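(* Let $\mathcal G$ be a network as in the context, $Y$ a subspace of $\mathbb C^{4E}$ and $R$ a dissipative linear operator on $Y$, and let $A=A_{Y,R}$. The semigroup $(e^{-tA})_{t\ge0}$ on $L^2(\mathcal G)$ extrapolates to a consistent family of semigroups on $L^p(\mathcal G)$ for every $1\le p\le\infty$, and there exist constants $c,\varepsilon>0$ such that $$\|e^{-tA}\|_{L^p(\mathcal G)}\le c\,t^{-\frac{|2-p|}{4p}}e^{\varepsilon t\frac{|2-p|}{p}},\quad t>0,$$ for every $1\le p<\infty$, as well as $$\|e^{-tA}\|_{L^\infty(\mathcal G)}\le c\,t^{-\frac14}e^{\varepsilon t},\quad t>0.$$
   Context: Let $\mathsf G=(\mathsf V,\mathsf E)$ be a finite connected graph without loops or multiple edges, $E=|\mathsf E|$. Fix an orientation; each edge $\mathsf e$ is identified with $[0,\ell_{\mathsf e}]$, $\ell_{\mathsf e}>0$, giving the network $\mathcal G$; $L^p(\mathcal G)=\bigoplus_{\mathsf e}L^p(0,\ell_{\mathsf e})$, $\widetilde H^4(\mathcal G)=\bigoplus_{\mathsf e}H^4(0,\ell_{\mathsf e})$. With $u(0)=(u_{\mathsf e}(0))_{\mathsf e}$, $u(\ell)=(u_{\mathsf e}(\ell_{\mathsf e}))_{\mathsf e}$ (similarly for derivatives), ${\bf u}^{0,1}=(u(0),u(\ell),-u'(0),u'(\ell))$, ${\bf u}^{3,2}=(-u'''(0),u'''(\ell),-u''(0),-u''(\ell))$. $A_{Y,R}$ is the edgewise fourth derivative on $L^2(\mathcal G)$ with domain $\{u\in\widetilde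 H^4(\mathcal G):{\bf u}^{0,1}\in Y,\ {\bf u}^{3,2}+R{\bf u}^{0,1}\in Y^\perp\}$; $-A_{Y,R}$ generates a semigroup on $L^2(\mathcal G)$. $R$ dissipative means $\mathrm{Re}(Ry,y)\le0$ for $y\in Y$. *)

theory Defs
  imports "HOL-Analysis.Analysis"
begin

text \<open>Functions on the network: edge index k (k < E) and position x in [0, l k].\<close>
type_synonym gfun = "nat \<Rightarrow> real \<Rightarrow> complex"

section \<open>Graph\<close>

definition simple_connected_graph ::
  "'v set \<Rightarrow> nat \<Rightarrow> (nat \<Rightarrow> 'v) \<Rightarrow> (nat \<Rightarrow> 'v) \<Rightarrow> bool" where
  "simple_connected_graph V E src tgt \<longleftrightarrow>
     finite V \<and> V \<noteq> {} \<and>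
     (\<forall>k<E. src k \<in> V \<and> tgt k \<in> V \<and> src k \<noteq> tgt k) \<and>
     (\<forall>i<E. \<forall>j<E. i \<noteq> j \<longrightarrow> {src i, tgt i} \<noteq> {src j, tgt j}) \<and>
     (\<forall>a\<in>V. \<forall>b\<in>V. (a, b) \<in> ({(src k, tgt k) | k. k < E} \<union> {(tgt k, src k) | k. k < E})\<^sup>*)"

section \<open>L^p spaces on the network (p :: ereal, p = \<infinity> allowed)\<close>

definition inLp :: "nat \<Rightarrow> (nat \<Rightarrow> real) \<Rightarrow> ereal \<Rightarrow> gfun \<Rightarrow> bool" where
  "inLp E l p u \<longleftrightarrow>
     (\<forall>k<E. u k \<in> borel_measurable (lebesgue_on {0..l k})) \<and>
     (if p = \<infinity> then (\<exists>M. \<forall>k<E. AE x in lebesgue_on {0..l k}. norm (u k x) \<le> M)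
      else (\<forall>k<E. integrable (lebesgue_on {0..l k}) (\<lambda>x. norm (u k x) powr real_of_ereal p)))"

definition Lpnorm :: "nat \<Rightarrow> (nat \<Rightarrow> real) \<Rightarrow> ereal \<Rightarrow> gfun \<Rightarrow> real" where
  "Lpnorm E l p u =
     (if p = \<infinity> then Inf {M. 0 \<le> M \<and> (\<forall>k<E. AE x in lebesgue_on {0..l k}. norm (u k x) \<le> M)}
      else (\<Sum>k<E. \<integral>x. norm (u k x) powr real_of_ereal p \<partial>(lebesgue_on {0..l k}))
              powr (1 / real_of_ereal p))"

text \<open>Equality almost everywhere on the network (equality in L^p).\<close>
definition aeq :: "nat \<Rightarrow> (nat \<Rightarrow> real) \<Rightarrow> gfun \<Rightarrow> gfun \<Rightarrow> bool" where
  "aeq E l u v \<longleftrightarrow> (\<forall>k<E. AE x in lebesgue_on {0..l k}. u k x = v k x)"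

definition gdiff :: "gfun \<Rightarrow> gfun \<Rightarrow> gfun" where
  "gdiff u v = (\<lambda>k x. u k x - v k x)"

text \<open>A semigroup of bounded linear operators on L^p(G); strongly continuous if p < \<infinity>.\<close>
definition Lp_semigroup :: "nat \<Rightarrow> (nat \<Rightarrow> real) \<Rightarrow> ereal \<Rightarrow> (real \<Rightarrow> gfun \<Rightarrow> gfun) \<Rightarrow> bool" where
  "Lp_semigroup E l p S \<longleftrightarrow>
     (\<forall>t\<ge>0. \<forall>u. inLp E l p u \<longrightarrow> inLp E l p (S t u)) \<and>
     (\<forall>t\<ge>0. \<forall>u v. inLp E l p u \<longrightarrow> inLp E l p v \<longrightarrow>
        aeq E l (S t (\<lambda>k x. u k x + v k x)) (\<lambda>k x. S t u k x + S t v k x)) \<and>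
     (\<forall>t\<ge>0. \<forall>u (c::complex). inLp E l p u \<longrightarrow>
        aeq E l (S t (\<lambda>k x. c * u k x)) (\<lambda>k x. c * S t u k x)) \<and>
     (\<forall>t\<ge>0. \<exists>M. \<forall>u. inLp E l p u \<longrightarrow> Lpnorm E l p (S t u) \<le> M * Lpnorm E l p u) \<and>
     (\<forall>u. inLp E l p u \<longrightarrow> aeq E l (S 0 u) u) \<and>
     (\<forall>s\<ge>0. \<forall>t\<ge>0. \<forall>u. inLp E l p u \<longrightarrow> aeq E l (S (s + t) u) (S s (S t u))) \<and>
     (p \<noteq> \<infinity> \<longrightarrow> (\<forall>u. inLp E l p u \<longrightarrow> (\<forall>t\<ge>0.
        ((\<lambda>s. Lpnorm E l p (gdiff (S s u) (S t u))) \<longlongrightarrow> 0) (at t within {0..}))))"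

section \<open>The operator A_{Y,R}\<close>

text \<open>H^4 representative on [0,l]: v is C^3 with derivatives d1,d2,d3, and d3 is
  absolutely continuous with derivative g \<in> L^2(0,l) (the fourth derivative).\<close>
definition H4_rep :: "real \<Rightarrow> (real \<Rightarrow> complex) \<Rightarrow> (real \<Rightarrow> complex) \<Rightarrow> (real \<Rightarrow> complex)
    \<Rightarrow> (real \<Rightarrow> complex) \<Rightarrow> (real \<Rightarrow> complex) \<Rightarrow> bool" where
  "H4_rep l v d1 d2 d3 g \<longleftrightarrow>
     (\<forall>x\<in>{0..l}. (v has_vector_derivative d1 x) (at x within {0..l}) \<and>
                 (d1 has_vector_derivative d2 x) (at x within {0..l}) \<and>
                 (d2 has_vector_derivative d3 x) (at x within {0..l})) \<and>
     g \<in> borel_measurable (lebesgue_on {0..l}) \<and>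
     integrable (lebesgue_on {0..l}) (\<lambda>x. (norm (g x))\<^sup>2) \<and>
     (\<forall>x\<in>{0..l}. d3 x = d3 0 + integral {0..x} g)"

text \<open>Vectors in C^{4E} are functions nat \<Rightarrow> complex vanishing at indices \<ge> 4E;
  block j (0..3) occupies indices j*E .. j*E+E-1.\<close>
definition cvec :: "nat \<Rightarrow> (nat \<Rightarrow> complex) set" where
  "cvec E = {y. \<forall>i\<ge>4 * E. y i = 0}"

definition blocks4 :: "nat \<Rightarrow> (nat \<Rightarrow> complex) \<Rightarrow> (nat \<Rightarrow> complex) \<Rightarrow> (nat \<Rightarrow> complex)
    \<Rightarrow> (nat \<Rightarrow> complex) \<Rightarrow> nat \<Rightarrow> complex" where
  "blocks4 E a b c d = (\<lambda>i. if i < E then a i else if i < 2 * E then b (i - E)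
     else if i < 3 * E then c (i - 2 * E) else if i < 4 * E then d (i - 3 * E) else 0)"

definition cinner :: "nat \<Rightarrow> (nat \<Rightarrow> complex) \<Rightarrow> (nat \<Rightarrow> complex) \<Rightarrow> complex" where
  "cinner E y z = (\<Sum>i<4 * E. y i * cnj (z i))"

definition csubspace :: "nat \<Rightarrow> (nat \<Rightarrow> complex) set \<Rightarrow> bool" where
  "csubspace E Y \<longleftrightarrow> Y \<subseteq> cvec E \<and> (\<lambda>i. 0) \<in> Y \<and>
     (\<forall>y\<in>Y. \<forall>z\<in>Y. (\<lambda>i. y i + z i) \<in> Y) \<and> (\<forall>c. \<forall>y\<in>Y. (\<lambda>i. c * y i) \<in> Y)"

definition corth :: "nat \<Rightarrow> (nat \<Rightarrow> complex) set \<Rightarrow> (nat \<Rightarrow> complex) set" where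
  "corth E Y = {z \<in> cvec E. \<forall>y\<in>Y. cinner E z y = 0}"

definition clinear_on :: "(nat \<Rightarrow> complex) set \<Rightarrow> ((nat \<Rightarrow> complex) \<Rightarrow> (nat \<Rightarrow> complex)) \<Rightarrow> bool" where
  "clinear_on Y R \<longleftrightarrow> (\<forall>y\<in>Y. R y \<in> Y) \<and>
     (\<forall>y\<in>Y. \<forall>z\<in>Y. R (\<lambda>i. y i + z i) = (\<lambda>i. R y i + R z i)) \<and>
     (\<forall>c. \<forall>y\<in>Y. R (\<lambda>i. c * y i) = (\<lambda>i. c * R y i))"

definition dissipative :: "nat \<Rightarrow> (nat \<Rightarrow> complex) set \<Rightarrow> ((nat \<Rightarrow> complex) \<Rightarrow> (nat \<Rightarrow> complex)) \<Rightarrow> bool" where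
  "dissipative E Y R \<longleftrightarrow> (\<forall>y\<in>Y. Re (cinner E (R y) y) \<le> 0)"

text \<open>A_rel E l Y R u f: u \<in> D(A_{Y,R}) and f = A_{Y,R} u (as elements of L^2).\<close>
definition A_rel :: "nat \<Rightarrow> (nat \<Rightarrow> real) \<Rightarrow> (nat \<Rightarrow> complex) set \<Rightarrow> ((nat \<Rightarrow> complex) \<Rightarrow> (nat \<Rightarrow> complex))
    \<Rightarrow> gfun \<Rightarrow> gfun \<Rightarrow> bool" where
  "A_rel E l Y R u f \<longleftrightarrow> inLp E l 2 u \<and>
     (\<exists>v d1 d2 d3.
        (\<forall>k<E. H4_rep (l k) (v k) (d1 k) (d2 k) (d3 k) (f k)) \<and> aeq E l u v \<and>
        (let u01 = blocks4 E (\<lambda>k. v k 0) (\<lambda>k. v k (l k)) (\<lambda>k. - d1 k 0) (\<lambda>k. d1 k (l k));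
             u32 = blocks4 E (\<lambda>k. - d3 k 0) (\<lambda>k. d3 k (l k)) (\<lambda>k. - d2 k 0) (\<lambda>k. - d2 k (l k))
         in u01 \<in> Y \<and> (\<lambda>i. u32 i + R u01 i) \<in> corth E Y))"

text \<open>T is the C0-semigroup on L^2(G) generated by -A_{Y,R}.\<close>
definition generated_by_minus_A :: "nat \<Rightarrow> (nat \<Rightarrow> real) \<Rightarrow> (nat \<Rightarrow> complex) set
    \<Rightarrow> ((nat \<Rightarrow> complex) \<Rightarrow> (nat \<Rightarrow> complex)) \<Rightarrow> (real \<Rightarrow> gfun \<Rightarrow> gfun) \<Rightarrow> bool" where
  "generated_by_minus_A E l Y R T \<longleftrightarrow> Lp_semigroup E l 2 T \<and>
     (\<forall>u f. inLp E l 2 u \<longrightarrow> inLp E l 2 f \<longrightarrow>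
        (((\<lambda>h. Lpnorm E l 2 (\<lambda>k x. (T h u k x - u k x) / complex_of_real h - f k x)) \<longlongrightarrow> 0) (at_right 0)
         \<longleftrightarrow> A_rel E l Y R u (\<lambda>k x. - f k x)))"

end

theory Submission
  imports Defs
begin

text \<open>
  Everything follows from a bound of \<open>e\<^sup>-\<^sup>t\<^sup>A\<close> on \<open>L\<^sup>p\<close> that is uniform in \<open>t > 0\<close> and
  \<open>1 \<le> p \<le> \<infinity>\<close>, since \<open>t\<^sup>-\<^sup>a e\<^sup>4\<^sup>a\<^sup>t \<ge> 1\<close> for \<open>a \<ge> 0\<close>. The uniform bound
  comes from a pointwise estimate with the kernel \<open>r\<^sup>-\<^sup>1 exp (- \<bar>\<phi> x - \<phi> y\<bar> / r)\<close>, where \<open>2 r\<^sup>4 = t\<close> for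
  small \<open>t\<close>, \<open>r\<close> is constant for large \<open>t\<close>, and \<open>\<phi>\<close> is the distance to the vertices smoothed at
  scale \<open>r\<close>. Decay in \<open>\<phi>\<close> alone suffices because each of its levels meets every edge in
  at most two points, and multiplication by a function of \<open>\<phi>\<close> respects the vertex conditions, however
  nonlocal, because \<open>\<phi>\<close> is constant with vanishing derivative at all vertices. The kernel estimate is
  Davies' method: the conjugated operator \<open>w A w\<^sup>-\<^sup>1\<close> with \<open>w = exp (\<plusminus> \<phi> / r)\<close> has, after a
  shift of order \<open>r\<^sup>-\<^sup>4\<close>, a coercive bounded form; an energy argument gives the smoothing from
  \<open>L\<^sup>2\<close> to \<open>L\<^sup>\<infinity>\<close>, and the resolvent replaces duality for the smoothing from \<open>L\<^sup>1\<close>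
  to \<open>L\<^sup>2\<close>.
\<close>

section \<open>Analysis on an interval\<close>

text \<open>\<open>T\<close> is known only as a strongly continuous family whose right difference
  quotients at 0 recover \<open>A\<close>; no adjoint semigroup, analyticity or resolvent is at
  hand. Hence energy estimates are inequalities for right derivatives along orbits of data in the
  domain of A^2, carried to L^2 by density. Such data exist for every \<open>Y\<close> and
  \<open>R\<close>, since functions vanishing to high order at all endpoints satisfy all vertex
  conditions. Scaling shapes the constants: at length r and time r^4 the shift contributes exp
  816951, independent of r, and so are the form constants. The term with \<open>R\<close> does not
  scale, which is why r \<le> 1 is imposed; the Sobolev inequalities need r to be at most every edge
  length. Weights of opposite sign give the decay of the kernel on both sides of a level. Its mass
  in either variable is bounded independently of r, so one Schur test yields all p. The kernel also
  bounds the semigroup from L^1 to L^infinity for t > 0, so the extension is one family for all p,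
  and strong continuity for finite p reduces to L^2 continuity on bounded functions.\<close>

lemma nonincreasing_if_right_derivative_nonpos:
  fixes \<phi> :: "real \<Rightarrow> real"
  assumes cont: "continuous_on {0..} \<phi>"
    and deriv: "\<And>s. 0 \<le> s \<Longrightarrow> \<exists>d\<le>0. (\<phi> has_real_derivative d) (at_right s)"
    and "0 \<le> t"
  shows "\<phi> t \<le> \<phi> 0"
proof -
  have "\<phi> t \<le> \<phi> 0 + \<epsilon> * t" if "\<epsilon> > 0" for \<epsilon>
  proof (rule ccontr)
    assume neg: "\<not> \<phi> t \<le> \<phi> 0 + \<epsilon> * t"
    define gap where "gap s = \<phi> s - \<phi> 0 - \<epsilon> * s" for s
    \<comment> \<open>The last time at which the bound with slack \<open>\<epsilon> * s\<close>
      holds: the slack makes the right derivative of \<open>gap\<close> strictly negative there, so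
      the bound persists a little longer. Only right derivatives are available because the generator
      is a one-sided limit.\<close>
    define A where "A = {0..t} \<inter> gap -` {..0}"
    have c: "continuous_on {0..t} gap"
      unfolding gap_def by (intro continuous_intros continuous_on_subset[OF cont]) auto
    have "closed A"
      unfolding A_def by (rule continuous_closed_preimage[OF c]) auto
    moreover have "A \<subseteq> {0..t}" by (auto simp: A_def)
    ultimately have "compact A"
      by (meson bounded_closed_interval bounded_subset compact_eq_bounded_closed)
    moreover have "0 \<in> A" using assms by (auto simp: A_def gap_def)
    ultimately obtain s where s: "s \<in> A" "\<forall>u\<in>A. u \<le> s"
      using compact_attains_sup by (metis empty_iff)
    have "gap s \<le> 0" "s \<le> t" using s(1) by (auto simp: A_def)
    moreover have "gap t > 0" using neg by (simp add: gap_def)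
    ultimately have "s < t" by (cases "s = t") auto
    have "0 \<le> s" using s by (auto simp: A_def)
    then obtain d where d: "d \<le> 0" "(\<phi> has_real_derivative d) (at_right s)"
      using deriv by blast
    have "(gap has_real_derivative d - \<epsilon>) (at_right s)"
      unfolding gap_def by (auto intro!: derivative_eq_intros d(2))
    from has_real_derivative_neg_dec_right[OF this] d that
    obtain e where e: "e > 0" "\<And>h. h > 0 \<Longrightarrow> h < e \<Longrightarrow> gap (s + h) < gap s"
      by auto
    define h where "h = min (e / 2) (t - s)"
    have "h > 0" "h < e" "s + h \<le> t"
      using e \<open>s < t\<close> by (auto simp: h_def)
    then have "gap (s + h) \<le> 0" using e(2)[of h] s by (auto simp: A_def)
    then have "s + h \<in> A" using \<open>h > 0\<close> \<open>0 \<le> s\<close> \<open>s + h \<le> t\<close> by (auto simp: A_def)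
    then show False using s(2) \<open>h > 0\<close> by force
  qed
  then have *: "\<phi> t - \<phi> 0 \<le> \<epsilon> * t" if "\<epsilon> > 0" for \<epsilon> using that by (simp add: algebra_simps)
  show ?thesis
  proof (cases "t = 0")
    case False
    then have "\<phi> t - \<phi> 0 \<le> e" if "e > 0" for e
      using *[of "e / t"] that \<open>0 \<le> t\<close> by simp
    then have "\<phi> t - \<phi> 0 \<le> 0" by (rule dense_ge)
    then show ?thesis by simp
  qed auto
qed

lemma exists_le_average:
  fixes g :: "real \<Rightarrow> real"
  assumes "continuous_on {a..b} g" "a < b"
  obtains p where "p \<in> {a..b}" "(b - a) * g p \<le> integral {a..b} g"
proof -
  obtain p where p: "p \<in> {a..b}" "\<forall>x\<in>{a..b}. g p \<le> g x"
    using continuous_attains_inf[of "{a..b}" g] assms by auto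
  have "integral {a..b} (\<lambda>x. g p) \<le> integral {a..b} g"
    using p assms by (intro integral_le integrable_continuous_real) auto
  with that[OF p(1)] assms show thesis by simp
qed

lemma integral_norm_le_sqrt:
  fixes f :: "real \<Rightarrow> 'a::euclidean_space"
  assumes "continuous_on {a..b} f" "a \<le> b"
  shows "integral {a..b} (\<lambda>x. norm (f x)) \<le> sqrt ((b - a) * integral {a..b} (\<lambda>x. (norm (f x))\<^sup>2))"
proof (cases "a = b")
  case False
  then have ab: "a < b" using assms by auto
  \<comment> \<open>Cauchy-Schwarz is read off from the nonnegativity of the variance of
    \<open>norm (f x)\<close> about its mean \<open>m\<close>.\<close>
  define m where "m = integral {a..b} (\<lambda>x. norm (f x)) / (b - a)"
  have i: "(\<lambda>x. norm (f x)) integrable_on {a..b}" "(\<lambda>x. (norm (f x))\<^sup>2) integrable_on {a..b}"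
    using assms by (auto intro!: integrable_continuous_real continuous_intros)
  have "0 \<le> integral {a..b} (\<lambda>x. (norm (f x) - m)\<^sup>2)"
    using assms by (intro integral_nonneg integrable_continuous_real continuous_intros) auto
  also have "(\<lambda>x. (norm (f x) - m)\<^sup>2) = (\<lambda>x. (norm (f x))\<^sup>2 - 2 * m * norm (f x) + m\<^sup>2)"
    by (auto simp: power2_eq_square algebra_simps)
  also have "integral {a..b} \<dots> = integral {a..b} (\<lambda>x. (norm (f x))\<^sup>2)
      - 2 * m * integral {a..b} (\<lambda>x. norm (f x)) + m\<^sup>2 * (b - a)"
    using i assms
    by (subst integral_add integral_diff;
        (intro integrable_diff integrable_on_mult_right integrable_const_ivl)?; simp add: integral_diff)+
  also have "integral {a..b} (\<lambda>x. norm (f x)) = m * (b - a)" using ab by (simp add: m_def)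
  finally have "m\<^sup>2 * (b - a) * (b - a) \<le> integral {a..b} (\<lambda>x. (norm (f x))\<^sup>2) * (b - a)"
    using ab by (intro mult_right_mono) (auto simp: power2_eq_square)
  then have "(m * (b - a))\<^sup>2 \<le> (b - a) * integral {a..b} (\<lambda>x. (norm (f x))\<^sup>2)"
    by (simp add: power2_eq_square algebra_simps)
  then show ?thesis using ab by (simp add: m_def real_le_rsqrt)
qed auto

section \<open>Interpolation between a function and its first two derivatives\<close>

locale C2_on_interval =
  fixes b :: real and y y1 y2 :: "real \<Rightarrow> 'a::euclidean_space"
  assumes y: "\<And>x. x \<in> {0..b} \<Longrightarrow> (y has_vector_derivative y1 x) (at x within {0..b})"
    and y1: "\<And>x. x \<in> {0..b} \<Longrightarrow> (y1 has_vector_derivative y2 x) (at x within {0..b})"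
    and cont_y2: "continuous_on {0..b} y2"
begin

lemma cont_y: "continuous_on {0..b} y"
  by (rule continuous_on_vector_derivative[OF y])

lemma cont_y1: "continuous_on {0..b} y1"
  by (rule continuous_on_vector_derivative[OF y1])

lemmas conts [continuous_intros] = cont_y cont_y1 cont_y2

abbreviation "I0 \<equiv> integral {0..b} (\<lambda>x. (norm (y x))\<^sup>2)"
abbreviation "I1 \<equiv> integral {0..b} (\<lambda>x. (norm (y1 x))\<^sup>2)"
abbreviation "I2 \<equiv> integral {0..b} (\<lambda>x. (norm (y2 x))\<^sup>2)"

lemma I_nonneg: "I0 \<ge> 0" "I1 \<ge> 0" "I2 \<ge> 0"
  by (auto intro!: integral_nonneg integrable_continuous_real continuous_intros)

lemma y1_increment_le:
  assumes "0 \<le> c" "c \<le> d" "d \<le> b"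
  shows "norm (y1 d - y1 c) \<le> sqrt ((d - c) * I2)"
proof -
  have sub: "{c..d} \<subseteq> {0..b}" using assms by auto
  have cont: "continuous_on {c..d} y2" using cont_y2 sub continuous_on_subset by blast
  have "(y2 has_integral (y1 d - y1 c)) {c..d}"
    using assms sub
    by (intro fundamental_theorem_of_calculus has_vector_derivative_within_subset[OF y1]) auto
  then have "norm (y1 d - y1 c) \<le> integral {c..d} (\<lambda>x. norm (y2 x))"
    using integral_norm_bound_integral[of y2 "{c..d}" "\<lambda>x. norm (y2 x)"] cont
    by (auto simp: integral_unique intro!: integrable_continuous_real continuous_intros)
  also have "\<dots> \<le> sqrt ((d - c) * integral {c..d} (\<lambda>x. (norm (y2 x))\<^sup>2))"
    by (rule integral_norm_le_sqrt) (use cont assms in auto)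
  also have "\<dots> \<le> sqrt ((d - c) * I2)"
    using sub assms cont
    by (intro real_sqrt_le_mono mult_left_mono integral_subset_le integrable_continuous_real
        continuous_intros) auto
  finally show ?thesis .
qed

lemma small_value:
  assumes "0 \<le> c" "c < d" "d \<le> b"
  obtains p where "p \<in> {c..d}" "(norm (y p))\<^sup>2 \<le> I0 / (d - c)"
proof -
  have sub: "{c..d} \<subseteq> {0..b}" using assms by auto
  have cont: "continuous_on {c..d} (\<lambda>x. (norm (y x))\<^sup>2)"
    by (intro continuous_intros continuous_on_subset[OF cont_y sub])
  obtain p where p: "p \<in> {c..d}" and "(d - c) * (norm (y p))\<^sup>2 \<le> integral {c..d} (\<lambda>x. (norm (y x))\<^sup>2)"
    by (rule exists_le_average[OF cont \<open>c < d\<close>])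
  note this(2)
  also have "integral {c..d} (\<lambda>x. (norm (y x))\<^sup>2) \<le> I0"
    using sub
    by (intro integral_subset_le integrable_continuous_real[OF cont] integrable_continuous_real
        continuous_intros) auto
  finally show thesis using that p assms by (simp add: field_simps)
qed

text \<open>On a window of length \<open>s\<close> containing \<open>x\<close> the derivative varies
  by at most \<open>J = sqrt (s * I2)\<close>, while averaging produces points \<open>p\<close>,
  \<open>q\<close> in its outer thirds with values of size \<open>L = sqrt (3 * I0 / s)\<close>. The
  difference quotient between them bounds \<open>y1 x\<close> by \<open>6 * L / s + J\<close>, and
  moving from \<open>p\<close> to \<open>x\<close> bounds \<open>y x\<close> by
  \<open>7 * L + 2 * s * J\<close>. Squaring gives 216 = 2 * 36 * 3 and 294 = 2 * 49 * 3.\<close>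

lemma sup_bounds:
  assumes s: "0 < s" "s \<le> b" and x: "x \<in> {0..b}"
  shows "(norm (y1 x))\<^sup>2 \<le> 216 / s ^ 3 * I0 + 2 * s * I2"
    and "(norm (y x))\<^sup>2 \<le> 294 / s * I0 + 8 * s ^ 3 * I2"
proof -
  \<comment> \<open>The window \<open>{a..a + s}\<close> is pushed left where needed to stay inside
    \<open>{0..b}\<close>.\<close>
  define a where "a = min x (b - s)"
  have a: "0 \<le> a" "a + s \<le> b" "a \<le> x" "x \<le> a + s"
    using s x by (auto simp: a_def)
  define J where "J = sqrt (s * I2)"
  have incr: "norm (y1 u - y1 v) \<le> J" if "u \<in> {a..a+s}" "v \<in> {a..a+s}" for u v
  proof -
    have *: "norm (y1 u - y1 v) \<le> J" if "v \<le> u" "u \<in> {a..a+s}" "v \<in> {a..a+s}" for u v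
    proof -
      have "norm (y1 u - y1 v) \<le> sqrt ((u - v) * I2)"
        by (rule y1_increment_le) (use that a in auto)
      also have "\<dots> \<le> J" unfolding J_def
        by (intro real_sqrt_le_mono mult_right_mono I_nonneg) (use that in auto)
      finally show ?thesis .
    qed
    show ?thesis using *[of u v] *[of v u] that by (cases "v \<le> u") (auto simp: norm_minus_commute)
  qed
  have lin: "norm (y q - y p - (q - p) *\<^sub>R y1 x) \<le> J * norm (q - p)"
    if "p \<in> {a..a+s}" "q \<in> {a..a+s}" for p q
  proof -
    have "norm ((y q - q *\<^sub>R y1 x) - (y p - p *\<^sub>R y1 x)) \<le> J * norm (q - p)"
    proof (rule differentiable_bound[of "{a..a+s}" _ "\<lambda>\<sigma> h. h *\<^sub>R (y1 \<sigma> - y1 x)"])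
      fix \<sigma> assume \<sigma>: "\<sigma> \<in> {a..a+s}"
      have "(y has_vector_derivative y1 \<sigma>) (at \<sigma> within {a..a+s})"
        by (rule has_vector_derivative_within_subset[OF y]) (use a \<sigma> in auto)
      then have "((\<lambda>\<sigma>. y \<sigma> - \<sigma> *\<^sub>R y1 x) has_vector_derivative (y1 \<sigma> - y1 x)) (at \<sigma> within {a..a+s})"
        by (auto intro!: derivative_eq_intros)
      then show "((\<lambda>\<sigma>. y \<sigma> - \<sigma> *\<^sub>R y1 x) has_derivative (\<lambda>h. h *\<^sub>R (y1 \<sigma> - y1 x))) (at \<sigma> within {a..a+s})"
        by (simp add: has_vector_derivative_def)
      show "onorm (\<lambda>h. h *\<^sub>R (y1 \<sigma> - y1 x)) \<le> J"
        by (rule onorm_le) (use incr[OF \<sigma>, of x] a in \<open>auto intro!: mult_left_mono simp: mult.commute[of J]\<close>)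
    qed (use that in auto)
    then show ?thesis by (simp add: algebra_simps)
  qed
  obtain p where p: "p \<in> {a..a+s/3}" "(norm (y p))\<^sup>2 \<le> I0 / (s/3)"
    by (rule small_value[of a "a+s/3"]) (use s a in auto)
  obtain q where q: "q \<in> {a + 2 * s / 3..a+s}" "(norm (y q))\<^sup>2 \<le> I0 / (s/3)"
    by (rule small_value[of "a + 2 * s / 3" "a+s"]) (use s a in auto)
  have mem: "p \<in> {a..a+s}" "q \<in> {a..a+s}" "x \<in> {a..a+s}" using p q s a by auto
  define L where "L = sqrt (3 * I0 / s)"
  have L: "norm (y p) \<le> L" "norm (y q) \<le> L"
    using p(2) q(2) by (auto simp: L_def intro!: real_le_rsqrt simp: field_simps)
  have L0: "0 \<le> L" "0 \<le> J" "L\<^sup>2 = 3 * I0 / s" "J\<^sup>2 = s * I2"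
    using I_nonneg s by (auto simp: L_def J_def)
  have qp: "q - p \<ge> s / 3" using p(1) q(1) by auto
  have "(q - p) * norm (y1 x) = norm ((y q - y p) - (y q - y p - (q - p) *\<^sub>R y1 x))"
    using qp s by simp
  also have "\<dots> \<le> (L + L) + J * (q - p)"
    using norm_triangle_ineq4[of "y q - y p" "y q - y p - (q - p) *\<^sub>R y1 x"]
      norm_triangle_ineq4[of "y q" "y p"] lin[OF mem(1,2)] L qp s
    by simp
  finally have "norm (y1 x) \<le> 2 * L / (q - p) + J"
    using qp s by (simp add: field_simps)
  also have "\<dots> \<le> 2 * L / (s / 3) + J"
    using qp s L0 by (intro add_mono divide_left_mono) auto
  finally have n1: "norm (y1 x) \<le> 6 * L / s + J" using s by (simp add: field_simps)
  have "(norm (y1 x))\<^sup>2 \<le> (6 * L / s + J)\<^sup>2" using n1 by (simp add: power_mono)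
  also have "\<dots> \<le> 2 * (6 * L / s)\<^sup>2 + 2 * J\<^sup>2"
    using sum_squares_bound[of "6 * L / s" J] by (simp add: power2_sum)
  also have "\<dots> = 72 * (3 * I0 / s) / s\<^sup>2 + 2 * (s * I2)"
    unfolding L0(3,4)[symmetric] by (simp add: power_divide power_mult_distrib)
  also have "\<dots> = 216 / s ^ 3 * I0 + 2 * s * I2"
    using s by (simp add: power3_eq_cube power2_eq_square)
  finally show b1: "(norm (y1 x))\<^sup>2 \<le> 216 / s ^ 3 * I0 + 2 * s * I2" .
  have "norm (x - p) \<le> s" using mem by (auto simp: abs_le_iff)
  have "norm (y x) = norm (y p + (x - p) *\<^sub>R y1 x + (y x - y p - (x - p) *\<^sub>R y1 x))"
    by simp
  also have "\<dots> \<le> L + s * norm (y1 x) + J * s"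
    using L lin[OF mem(1,3)] \<open>norm (x - p) \<le> s\<close> L0
    by (intro order.trans[OF norm_triangle_ineq] add_mono order.trans[OF lin[OF mem(1,3)]] mult_left_mono)
      (auto intro!: mult_right_mono)
  finally have "norm (y x) \<le> L + s * norm (y1 x) + J * s" .
  then have "norm (y x) \<le> 7 * L + 2 * s * J"
    using mult_left_mono[OF n1, of s] s by (simp add: algebra_simps)
  then have "(norm (y x))\<^sup>2 \<le> (7 * L + 2 * s * J)\<^sup>2" by (simp add: power_mono)
  also have "\<dots> \<le> 2 * (7 * L)\<^sup>2 + 2 * (2 * s * J)\<^sup>2"
    using sum_squares_bound[of "7 * L" "2 * s * J"] by (simp add: power2_sum)
  also have "\<dots> = 98 * (3 * I0 / s) + 8 * s\<^sup>2 * (s * I2)"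
    unfolding L0(3,4)[symmetric] by (simp add: power_divide power_mult_distrib)
  also have "\<dots> = 294 / s * I0 + 8 * s ^ 3 * I2"
    using s by (simp add: power3_eq_cube power2_eq_square)
  finally show "(norm (y x))\<^sup>2 \<le> 294 / s * I0 + 8 * s ^ 3 * I2" .
qed

text \<open>Integration by parts: \<open>I1\<close> consists of boundary values of
  \<open>inner y y1\<close> minus the integral of \<open>inner y2 y\<close>. The integral is handled
  by Young's inequality with weight, the boundary values by \<open>sup_bounds\<close>. Each endpoint
  contributes 255 = (294 + 216) / 2 and 5 = (8 + 2) / 2, the integral 1 / 2 each; 521 and 11 round
  the totals up.\<close>

lemma I1_le:
  assumes s: "0 < s" "s \<le> b"
  shows "I1 \<le> 521 / s\<^sup>2 * I0 + 11 * s\<^sup>2 * I2"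
proof -
  have b: "0 \<le> b" using s by simp
  have fact: "((\<lambda>x. inner (y2 x) (y x)) has_integral
      inner (y b) (y1 b) - inner (y 0) (y1 0) - I1) {0..b}"
  proof (rule integration_by_parts_interior[OF bounded_bilinear_inner b cont_y1 cont_y])
    fix x assume x: "x \<in> {0<..<b}"
    then have "x \<in> {0..b}" "at x within {0..b} = at x" by (auto simp: at_within_Icc_at)
    then show "(y has_vector_derivative y1 x) (at x)" "(y1 has_vector_derivative y2 x) (at x)"
      using y[of x] y1[of x] by auto
  next
    show "((\<lambda>x. inner (y1 x) (y1 x)) has_integral inner (y1 b) (y b) - inner (y1 0) (y 0)
        - (inner (y b) (y1 b) - inner (y 0) (y1 0) - I1)) {0..b}"
      by (auto simp: power2_norm_eq_inner[symmetric] inner_commute intro!: integrable_integral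
          integrable_continuous_real continuous_intros)
  qed
  define p where "p = 1 / s\<^sup>2"
  have ps: "p > 0" "p * s\<^sup>2 = 1" using s by (auto simp: p_def)
  have yng: "2 * \<bar>inner u v\<bar> \<le> p * (norm u)\<^sup>2 + s\<^sup>2 * (norm v)\<^sup>2" for u v :: 'a
  proof -
    have "2 * \<bar>inner u v\<bar> \<le> 2 * (norm u / s) * (s * norm v)"
      using Cauchy_Schwarz_ineq2[of u v] s by simp
    also have "\<dots> \<le> (norm u / s)\<^sup>2 + (s * norm v)\<^sup>2" by (rule sum_squares_bound)
    finally show ?thesis by (simp add: p_def power_divide power_mult_distrib)
  qed
  have "\<bar>integral {0..b} (\<lambda>x. inner (y2 x) (y x))\<bar>
      \<le> integral {0..b} (\<lambda>x. p / 2 * (norm (y x))\<^sup>2 + s\<^sup>2 / 2 * (norm (y2 x))\<^sup>2)"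
    unfolding real_norm_def[symmetric]
    by (rule integral_norm_bound_integral)
      (use yng[of "y2 _" "y _"] yng[of "y _" "y2 _"] in \<open>auto intro!: integrable_continuous_real continuous_intros simp: field_simps inner_commute\<close>)
  also have "\<dots> = p / 2 * I0 + s\<^sup>2 / 2 * I2"
    by (subst integral_add)
      (auto intro!: integrable_continuous_real continuous_intros)
  finally have 1: "\<bar>inner (y b) (y1 b) - inner (y 0) (y1 0) - I1\<bar> \<le> p / 2 * I0 + s\<^sup>2 / 2 * I2"
    using integral_unique[OF fact] by simp
  have 2: "\<bar>inner (y x) (y1 x)\<bar> \<le> 255 * p * I0 + 5 * s\<^sup>2 * I2" if "x \<in> {0..b}" for x
  proof -
    have "2 * \<bar>inner (y x) (y1 x)\<bar> \<le> 2 * (norm (y x)) * (norm (y1 x))"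
      using Cauchy_Schwarz_ineq2[of "y x" "y1 x"] by simp
    also have "\<dots> = 2 * (norm (y x) / sqrt s) * (sqrt s * norm (y1 x))" using s by simp
    also have "\<dots> \<le> (norm (y x) / sqrt s)\<^sup>2 + (sqrt s * norm (y1 x))\<^sup>2" by (rule sum_squares_bound)
    also have "\<dots> = (norm (y x))\<^sup>2 / s + s * (norm (y1 x))\<^sup>2"
      using s by (simp add: power_divide power_mult_distrib)
    also have "\<dots> \<le> (294 / s * I0 + 8 * s ^ 3 * I2) / s + s * (216 / s ^ 3 * I0 + 2 * s * I2)"
      using sup_bounds[OF s that] s by (intro add_mono divide_right_mono mult_left_mono) auto
    also have "\<dots> = 2 * (255 * p * I0 + 5 * s\<^sup>2 * I2)"
      using s by (simp add: p_def power2_eq_square power3_eq_cube field_simps)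
    finally show ?thesis by simp
  qed
  have "I1 \<le> \<bar>inner (y b) (y1 b)\<bar> + \<bar>inner (y 0) (y1 0)\<bar> + (p / 2 * I0 + s\<^sup>2 / 2 * I2)"
    using 1 by linarith
  also have "\<dots> \<le> 521 * (p * I0) + 11 * (s\<^sup>2 * I2)"
  proof -
    have "0 \<le> p * I0" "0 \<le> s\<^sup>2 * I2" using ps I_nonneg by auto
    then show ?thesis using 2[of b] 2[of 0] b by (simp add: mult.assoc)
  qed
  finally show ?thesis by (simp add: p_def)
qed

end

section \<open>Integration by parts against an indefinite integral\<close>

lemma bilinear_inner: "bilinear (inner :: 'a::real_inner \<Rightarrow> 'a \<Rightarrow> real)"
  by (auto simp: bilinear_def intro!: linearI simp: inner_add_left inner_add_right)

text \<open>The defect of the identity has increments bounded by \<open>\<bar>y - x\<bar>\<close> times the increment of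
  the continuous function \<open>\<integral>\<bar>g\<bar>\<close>, so its derivative vanishes everywhere.\<close>
lemma integration_by_parts_indefinite_integral:
  fixes g G \<theta> \<theta>' :: "real \<Rightarrow> 'a::euclidean_space"
  assumes g: "g absolutely_integrable_on {0..b}"
    and G: "\<And>x. x \<in> {0..b} \<Longrightarrow> G x = G 0 + integral {0..x} g"
    and \<theta>: "\<And>x. x \<in> {0..b} \<Longrightarrow> (\<theta> has_vector_derivative \<theta>' x) (at x within {0..b})"
    and cont: "continuous_on {0..b} \<theta>'" and b: "0 \<le> b"
  shows "((\<lambda>x. inner (g x) (\<theta> x)) has_integral
    inner (G b) (\<theta> b) - inner (G 0) (\<theta> 0) - integral {0..b} (\<lambda>x. inner (G x) (\<theta>' x))) {0..b}"
proof -
  have gi: "g integrable_on {0..b}" "(\<lambda>x. norm (g x)) integrable_on {0..b}"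
    using g by (auto simp: absolutely_integrable_on_def)
  have sub: "h integrable_on {c..d}" if "h integrable_on {0..b}" "0 \<le> c" "d \<le> b" for h
    :: "real \<Rightarrow> 'c::euclidean_space" and c d
    using that by (meson atLeastatMost_subset_iff integrable_on_subinterval)
  have cont_G: "continuous_on {0..b} G"
  proof -
    have "continuous_on {0..b} (\<lambda>x. G 0 + integral {0..x} g)"
      by (intro continuous_intros indefinite_integral_continuous_1 gi)
    then show ?thesis using G by (metis (no_types, lifting) continuous_on_cong)
  qed
  have cont_\<theta>: "continuous_on {0..b} \<theta>"
    by (rule continuous_on_vector_derivative[OF \<theta>])
  have i1: "(\<lambda>x. inner (g x) (\<theta> x)) integrable_on {0..b}"
  proof -
    have "(\<lambda>x. inner (\<theta> x) (g x)) absolutely_integrable_on {0..b}"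
      by (rule absolutely_integrable_bounded_measurable_product[OF bilinear_inner])
        (auto intro!: g compact_imp_bounded compact_continuous_image cont_\<theta>
          continuous_imp_measurable_on_sets_lebesgue)
    then show ?thesis by (simp add: absolutely_integrable_on_def inner_commute)
  qed
  have i2: "(\<lambda>x. inner (G x) (\<theta>' x)) integrable_on {0..b}"
    by (intro integrable_continuous_real continuous_intros cont_G cont)
  obtain L where L: "\<And>x. x \<in> {0..b} \<Longrightarrow> norm (\<theta>' x) \<le> L" "0 \<le> L"
  proof -
    have "bounded (\<theta>' ` {0..b})" by (intro compact_imp_bounded compact_continuous_image cont) auto
    then obtain L where "\<And>x. x \<in> {0..b} \<Longrightarrow> norm (\<theta>' x) \<le> L" unfolding bounded_iff by blast
    moreover from this[of 0] b have "0 \<le> L" by (intro order_trans[OF norm_ge_zero]) auto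
    ultimately show thesis using that by blast
  qed
  define H where "H x = integral {0..x} (\<lambda>x. norm (g x))" for x
  define F where "F x = integral {0..x} (\<lambda>x. inner (g x) (\<theta> x)) - inner (G x) (\<theta> x)
      + integral {0..x} (\<lambda>x. inner (G x) (\<theta>' x))" for x
  have cont_H: "continuous_on {0..b} H"
    unfolding H_def by (intro indefinite_integral_continuous_1 gi)
  have incr: "\<bar>F d - F c\<bar> \<le> 2 * L * (d - c) * (H d - H c)" if cd: "0 \<le> c" "c \<le> d" "d \<le> b" for c d
  proof -
    have split: "integral {0..d} h - integral {0..c} h = integral {c..d} h"
      if "h integrable_on {0..b}" for h :: "real \<Rightarrow> 'c::euclidean_space"
      using Henstock_Kurzweil_Integration.integral_combine[of 0 c d h] cd sub[OF that] by (simp add: algebra_simps)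
    have Gd: "G s - G c = integral {c..s} g" if "s \<in> {c..d}" for s
    proof -
      have "integral {0..s} g - integral {0..c} g = integral {c..s} g"
        using Henstock_Kurzweil_Integration.integral_combine[of 0 c s g] cd that sub[OF gi(1)]
        by (simp add: algebra_simps)
      moreover have "G s = G 0 + integral {0..s} g" "G c = G 0 + integral {0..c} g"
        using G[of s] G[of c] cd that by auto
      ultimately show ?thesis by simp
    qed
    have Gle: "norm (G s - G c) \<le> H d - H c" if "s \<in> {c..d}" for s
    proof -
      have "norm (G s - G c) \<le> integral {c..s} (\<lambda>x. norm (g x))"
        unfolding Gd[OF that] by (rule integral_norm_bound_integral)
          (use that cd sub[OF gi(1), of c s] sub[OF gi(2), of c s] in auto)
      also have "\<dots> \<le> integral {c..d} (\<lambda>x. norm (g x))"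
        using that cd sub[OF gi(2), of c s] sub[OF gi(2), of c d] by (intro integral_subset_le) auto
      finally show ?thesis using split[OF gi(2)] by (simp add: H_def)
    qed
    have \<theta>le: "norm (\<theta> s - \<theta> d) \<le> L * (d - c)" if "s \<in> {c..d}" for s
    proof -
      have "norm (\<theta> s - \<theta> d) \<le> L * norm (s - d)"
        by (rule differentiable_bound[of "{0..b}" _ "\<lambda>x h. h *\<^sub>R \<theta>' x"])
          (use \<theta> L that cd in \<open>auto simp: has_vector_derivative_def intro!: onorm_le mult_left_mono simp: mult.commute[of L]\<close>)
      also have "\<dots> \<le> L * (d - c)" using that L by (intro mult_left_mono) auto
      finally show ?thesis .
    qed
    have j1: "(\<lambda>x. inner (g x) (\<theta> x)) integrable_on {c..d}" "(\<lambda>x. inner (g x) (\<theta> d)) integrable_on {c..d}"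
      "(\<lambda>x. inner (G x) (\<theta>' x)) integrable_on {c..d}" "(\<lambda>x. inner (G c) (\<theta>' x)) integrable_on {c..d}"
      "\<theta>' integrable_on {c..d}" "g integrable_on {c..d}"
      using cd sub[OF i1, of c d] sub[OF i2, of c d] sub[OF gi(1), of c d]
        sub[OF integrable_continuous_real[OF cont], of c d]
        integrable_linear[OF _ bounded_linear_inner_left, of g "{c..d}" "\<theta> d"]
        integrable_linear[OF _ bounded_linear_inner_right, of \<theta>' "{c..d}" "G c"]
      by (auto simp: o_def)
    have th: "\<theta> d - \<theta> c = integral {c..d} \<theta>'"
      by (rule integral_unique[symmetric], rule fundamental_theorem_of_calculus)
        (use cd in \<open>auto intro!: has_vector_derivative_within_subset[OF \<theta>]\<close>)
    have "F d - F c = integral {c..d} (\<lambda>x. inner (g x) (\<theta> x)) - (inner (G d) (\<theta> d) - inner (G c) (\<theta> c))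
       + integral {c..d} (\<lambda>x. inner (G x) (\<theta>' x))"
      using split[OF i1] split[OF i2] by (simp add: F_def)
    also have "inner (G d) (\<theta> d) - inner (G c) (\<theta> c) = inner (G d - G c) (\<theta> d) + inner (G c) (\<theta> d - \<theta> c)"
      by (simp add: algebra_simps)
    also have "\<dots> = integral {c..d} (\<lambda>x. inner (g x) (\<theta> d)) + integral {c..d} (\<lambda>x. inner (G c) (\<theta>' x))"
      using Gd[of d] cd integral_linear[OF j1(6) bounded_linear_inner_left, of "\<theta> d"]
        integral_linear[OF j1(5) bounded_linear_inner_right, of "G c"]
      by (simp add: th o_def)
    \<comment> \<open>Two remainders of equal size: \<open>\<theta>\<close> varies by at most
      \<open>L * (d - c)\<close> against \<open>norm g\<close>, and \<open>G\<close> by at most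
      \<open>H d - H c\<close> against \<open>\<theta>'\<close>. This is the factor 2 in
      \<open>incr\<close>.\<close>
    finally have "F d - F c = integral {c..d} (\<lambda>x. inner (g x) (\<theta> x - \<theta> d))
        + integral {c..d} (\<lambda>x. inner (G x - G c) (\<theta>' x))"
      using j1 by (simp add: inner_diff_right inner_diff_left integral_diff)
    moreover have "\<bar>integral {c..d} (\<lambda>x. inner (g x) (\<theta> x - \<theta> d))\<bar> \<le> integral {c..d} (\<lambda>x. norm (g x) * (L * (d - c)))"
      unfolding real_norm_def[symmetric]
    proof (rule integral_norm_bound_integral)
      show "(\<lambda>x. inner (g x) (\<theta> x - \<theta> d)) integrable_on {c..d}"
        using j1 by (simp add: inner_diff_right integrable_diff)
      show "(\<lambda>x. norm (g x) * (L * (d - c))) integrable_on {c..d}"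
        using cd by (intro integrable_on_mult_left sub[OF gi(2)]) auto
      show "norm (inner (g x) (\<theta> x - \<theta> d)) \<le> norm (g x) * (L * (d - c))" if "x \<in> {c..d}" for x
        using \<theta>le[OF that] Cauchy_Schwarz_ineq2[of "g x" "\<theta> x - \<theta> d"]
        using mult_left_mono[OF \<theta>le[OF that] norm_ge_zero[of "g x"]] by simp
    qed
    moreover have "integral {c..d} (\<lambda>x. norm (g x) * (L * (d - c))) = (H d - H c) * (L * (d - c))"
      using split[OF gi(2)] by (simp add: H_def)
    moreover have "\<bar>integral {c..d} (\<lambda>x. inner (G x - G c) (\<theta>' x))\<bar> \<le> integral {c..d} (\<lambda>x. (H d - H c) * L)"
      unfolding real_norm_def[symmetric]
    proof (rule integral_norm_bound_integral)
      show "(\<lambda>x. inner (G x - G c) (\<theta>' x)) integrable_on {c..d}"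
        using j1 by (simp add: inner_diff_left integrable_diff)
      show "norm (inner (G x - G c) (\<theta>' x)) \<le> (H d - H c) * L" if "x \<in> {c..d}" for x
      proof -
        have "norm (inner (G x - G c) (\<theta>' x)) \<le> norm (G x - G c) * norm (\<theta>' x)"
          by (simp add: Cauchy_Schwarz_ineq2)
        also have "\<dots> \<le> (H d - H c) * L"
          using Gle[OF that] L(1)[of x] that cd order_trans[OF norm_ge_zero Gle[OF that]]
          by (intro mult_mono) auto
        finally show ?thesis .
      qed
    qed auto
    ultimately show ?thesis using cd by (simp add: algebra_simps)
  qed
  have incr': "\<bar>F d - F c\<bar> \<le> 2 * L * \<bar>d - c\<bar> * \<bar>H d - H c\<bar>" if "c \<in> {0..b}" "d \<in> {0..b}" for c d
  proof -
    have *: "\<bar>F d - F c\<bar> \<le> 2 * L * \<bar>d - c\<bar> * \<bar>H d - H c\<bar>" if "c \<in> {0..b}" "d \<in> {0..b}" "c \<le> d" for c d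
    proof -
      have "\<bar>F d - F c\<bar> \<le> 2 * L * (d - c) * (H d - H c)" using incr that by auto
      also have "\<dots> \<le> 2 * L * \<bar>d - c\<bar> * \<bar>H d - H c\<bar>"
        using that L mult_left_mono[OF abs_ge_self[of "H d - H c"], of "2 * L * (d - c)"] by simp
      finally show ?thesis .
    qed
    show ?thesis using *[of c d] *[of d c] that by (cases "c \<le> d") (auto simp: abs_minus_commute)
  qed
  have "(F has_vector_derivative 0) (at x within {0..b})" if x: "x \<in> {0..b}" for x
    unfolding has_vector_derivative_def has_derivative_within
  proof (intro conjI)
    show "((\<lambda>z. (1 / norm (z - x)) *\<^sub>R (F z - (F x + (z - x) *\<^sub>R 0))) \<longlongrightarrow> 0) (at x within {0..b})"
    proof (rule Lim_null_comparison[where g="\<lambda>z. 2 * L * \<bar>H z - H x\<bar>"])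
      have "(H \<longlongrightarrow> H x) (at x within {0..b})" using cont_H x by (auto simp: continuous_on_def)
      then show "((\<lambda>z. 2 * L * \<bar>H z - H x\<bar>) \<longlongrightarrow> 0) (at x within {0..b})"
        by (intro tendsto_eq_intros | force)+
      show "\<forall>\<^sub>F z in at x within {0..b}. norm ((1 / norm (z - x)) *\<^sub>R (F z - (F x + (z - x) *\<^sub>R 0))) \<le> 2 * L * \<bar>H z - H x\<bar>"
        unfolding eventually_at_filter
        by (rule always_eventually) (use incr'[OF x] in \<open>auto simp: field_simps\<close>)
    qed
  qed (simp add: bounded_linear_zero)
  then have "F b = F 0"
    using has_vector_derivative_zero_constant[of "{0..b}" F] b
    by (metis atLeastAtMost_iff convex_real_interval(5) order_refl)
  then have "integral {0..b} (\<lambda>x. inner (g x) (\<theta> x)) = inner (G b) (\<theta> b) - inner (G 0) (\<theta> 0)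
      - integral {0..b} (\<lambda>x. inner (G x) (\<theta>' x))"
    by (simp add: F_def)
  then show ?thesis using i1 by (simp add: has_integral_integral)
qed

section \<open>Square integrable functions and the generator\<close>

lemma complex_inner_mult: "inner (of_real a * z) w = a * inner z w" "inner z (of_real a * w) = a * inner z w"
  for z w :: complex
  by (simp_all add: inner_complex_def algebra_simps)

definition scaled :: "(nat \<Rightarrow> real \<Rightarrow> real) \<Rightarrow> gfun \<Rightarrow> gfun" where
  "scaled w u = (\<lambda>k x. of_real (w k x) * u k x)"

section \<open>The Hilbert space L^2 on the network\<close>

locale network =
  fixes E :: nat and l :: "nat \<Rightarrow> real"
  assumes lpos: "\<And>k. k < E \<Longrightarrow> 0 < l k"
begin

abbreviation edge :: "nat \<Rightarrow> real measure" where
  "edge k \<equiv> lebesgue_on {0..l k}"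

definition L2 :: "gfun \<Rightarrow> bool" where
  "L2 u \<longleftrightarrow> inLp E l 2 u"

abbreviation ae_eq :: "gfun \<Rightarrow> gfun \<Rightarrow> bool" (infix "\<simeq>" 50) where
  "u \<simeq> v \<equiv> aeq E l u v"

text \<open>The real part of the complex inner product: only real parts of the form enter the energy
  identities, and \<open>inner\<close> on complex numbers supplies them directly.\<close>

definition ip :: "gfun \<Rightarrow> gfun \<Rightarrow> real" where
  "ip u v = (\<Sum>k<E. \<integral>x. inner (u k x) (v k x) \<partial>edge k)"

definition n2 :: "gfun \<Rightarrow> real" where
  "n2 u = sqrt (ip u u)"

definition n1 :: "gfun \<Rightarrow> real" where
  "n1 u = (\<Sum>k<E. \<integral>x. norm (u k x) \<partial>edge k)"

definition total_length :: real where
  "total_length = (\<Sum>k<E. l k)"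

lemma total_length_nonneg: "0 \<le> total_length"
  unfolding total_length_def by (rule sum_nonneg) (use lpos in force)

lemma finite_measure_edge: "finite_measure (edge k)"
  by (rule finite_measure_lebesgue_on) auto

lemma measure_edge: "k < E \<Longrightarrow> measure (edge k) (space (edge k)) = l k"
  using lpos[of k] by (simp add: measure_restrict_space)

lemma integrable_const_edge: "integrable (edge k) (\<lambda>x. c::'a::{banach,second_countable_topology})"
  using finite_measure.integrable_const[OF finite_measure_edge] .

lemma integral_const_edge: "k < E \<Longrightarrow> (\<integral>x. (c::real) \<partial>edge k) = l k * c"
  using measure_edge[of k] by simp

lemma L2_iff: "L2 u \<longleftrightarrow> (\<forall>k<E. u k \<in> borel_measurable (edge k) \<and>
    integrable (edge k) (\<lambda>x. (norm (u k x))\<^sup>2))"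
  unfolding L2_def inLp_def by auto

lemma L2_measurable: "L2 u \<Longrightarrow> k < E \<Longrightarrow> u k \<in> borel_measurable (edge k)"
  by (simp add: L2_iff)

lemma L2_inner_integrable:
  assumes "L2 u" "L2 v" "k < E"
  shows "integrable (edge k) (\<lambda>x. inner (u k x) (v k x))"
proof (rule Bochner_Integration.integrable_bound)
  show "integrable (edge k) (\<lambda>x. (norm (u k x))\<^sup>2 + (norm (v k x))\<^sup>2)"
    using assms by (auto simp: L2_iff)
  show "(\<lambda>x. inner (u k x) (v k x)) \<in> borel_measurable (edge k)"
    using L2_measurable[OF assms(1,3)] L2_measurable[OF assms(2,3)] by measurable
  have "\<bar>inner a b\<bar> \<le> (norm a)\<^sup>2 + (norm b)\<^sup>2" for a b :: complex
  proof -
    have "2 * \<bar>inner a b\<bar> \<le> 2 * norm a * norm b" using Cauchy_Schwarz_ineq2[of a b] by simp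
    also have "\<dots> \<le> (norm a)\<^sup>2 + (norm b)\<^sup>2" by (rule sum_squares_bound)
    finally show ?thesis by (smt (verit) zero_le_power2)
  qed
  then show "AE x in edge k. norm (inner (u k x) (v k x)) \<le> norm ((norm (u k x))\<^sup>2 + (norm (v k x))\<^sup>2)"
    by (auto intro!: AE_I2)
qed

lemma L2_add:
  assumes "L2 u" "L2 v"
  shows "L2 (\<lambda>k x. u k x + v k x)"
  unfolding L2_iff
proof (intro allI impI conjI)
  fix k assume k: "k < E"
  show "(\<lambda>x. u k x + v k x) \<in> borel_measurable (edge k)"
    using L2_measurable[OF assms(1) k] L2_measurable[OF assms(2) k] by measurable
  have "integrable (edge k) (\<lambda>x. (norm (u k x))\<^sup>2 + (norm (v k x))\<^sup>2 + 2 * inner (u k x) (v k x))"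
    using assms L2_inner_integrable[OF assms k] k by (auto simp: L2_iff)
  then show "integrable (edge k) (\<lambda>x. (norm (u k x + v k x))\<^sup>2)"
    by (simp add: power2_norm_eq_inner inner_add_left inner_add_right inner_commute algebra_simps)
qed

lemma L2_mult:
  assumes "L2 u" and w: "\<And>k. k < E \<Longrightarrow> w k \<in> borel_measurable (edge k)"
    and M: "\<And>k x. k < E \<Longrightarrow> x \<in> {0..l k} \<Longrightarrow> norm (w k x) \<le> M"
  shows "L2 (\<lambda>k x. w k x * u k x :: complex)"
  unfolding L2_iff
proof (intro allI impI conjI)
  fix k assume k: "k < E"
  show m: "(\<lambda>x. w k x * u k x) \<in> borel_measurable (edge k)"
    using L2_measurable[OF assms(1) k] w[OF k] by measurable
  show "integrable (edge k) (\<lambda>x. (norm (w k x * u k x))\<^sup>2)"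
  proof (rule Bochner_Integration.integrable_bound)
    show "integrable (edge k) (\<lambda>x. M\<^sup>2 * (norm (u k x))\<^sup>2)" using assms k by (simp add: L2_iff)
    show "AE x in edge k. norm ((norm (w k x * u k x))\<^sup>2) \<le> norm (M\<^sup>2 * (norm (u k x))\<^sup>2)"
      using M[OF k] by (intro AE_I2) (auto simp: norm_mult power_mult_distrib power_mono intro!: mult_right_mono)
  qed (use m in measurable)
qed

lemma L2_scale: "L2 u \<Longrightarrow> L2 (\<lambda>k x. c * u k x)"
  by (rule L2_mult[where M = "norm c"]) auto

lemma L2_minus: "L2 u \<Longrightarrow> L2 (\<lambda>k x. - u k x)"
  using L2_scale[of u "-1"] by simp

lemma L2_diff: "L2 u \<Longrightarrow> L2 v \<Longrightarrow> L2 (\<lambda>k x. u k x - v k x)"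
  using L2_add[OF _ L2_minus, of u v] by simp

lemma L2_divide: "L2 u \<Longrightarrow> L2 (\<lambda>k x. u k x / c)"
  using L2_scale[of u "1 / c"] by simp

lemma L2_zero: "L2 (\<lambda>k x. 0)"
  by (simp add: L2_iff)

lemmas L2_intros = L2_add L2_scale L2_minus L2_diff L2_divide L2_zero

lemma ip_add_left: "L2 u \<Longrightarrow> L2 v \<Longrightarrow> L2 z \<Longrightarrow> ip (\<lambda>k x. u k x + v k x) z = ip u z + ip v z"
  unfolding ip_def sum.distrib[symmetric]
  by (intro sum.cong refl) (simp add: inner_add_left L2_inner_integrable)

lemma ip_commute: "ip u v = ip v u"
  by (simp add: ip_def inner_commute)

lemma ip_scale_left: "ip (\<lambda>k x. of_real c * u k x) v = c * ip u v"
  unfolding ip_def sum_distrib_left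
  by (intro sum.cong refl) (simp add: complex_inner_mult)

lemma ip_minus_left: "ip (\<lambda>k x. - u k x) v = - ip u v"
  using ip_scale_left[of "-1" u v] by simp

lemma ip_diff_left: "L2 u \<Longrightarrow> L2 v \<Longrightarrow> L2 z \<Longrightarrow> ip (\<lambda>k x. u k x - v k x) z = ip u z - ip v z"
  using ip_add_left[of u "\<lambda>k x. - v k x" z] by (simp add: L2_minus ip_minus_left)

lemma ip_add_right: "L2 u \<Longrightarrow> L2 v \<Longrightarrow> L2 z \<Longrightarrow> ip z (\<lambda>k x. u k x + v k x) = ip z u + ip z v"
  using ip_add_left by (simp add: ip_commute)

lemma ip_diff_right: "L2 u \<Longrightarrow> L2 v \<Longrightarrow> L2 z \<Longrightarrow> ip z (\<lambda>k x. u k x - v k x) = ip z u - ip z v"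
  using ip_diff_left by (simp add: ip_commute)

lemma ip_scale_right: "ip v (\<lambda>k x. of_real c * u k x) = c * ip v u"
  using ip_scale_left by (simp add: ip_commute)

lemma ip_nonneg: "0 \<le> ip u u"
  unfolding ip_def by (intro sum_nonneg integral_nonneg_AE) simp

lemma n2_nonneg: "0 \<le> n2 u"
  by (simp add: n2_def ip_nonneg)

lemma n2_squared: "(n2 u)\<^sup>2 = ip u u"
  by (simp add: n2_def ip_nonneg)

lemma Cauchy_Schwarz_ip:
  assumes "L2 u" "L2 v"
  shows "\<bar>ip u v\<bar> \<le> n2 u * n2 v"
proof -
  have *: "0 \<le> ip u u + s\<^sup>2 * ip v v - 2 * s * ip u v" for s
  proof -
    have "0 \<le> ip (\<lambda>k x. u k x - of_real s * v k x) (\<lambda>k x. u k x - of_real s * v k x)"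
      by (rule ip_nonneg)
    also have "\<dots> = ip u u + s\<^sup>2 * ip v v - 2 * s * ip u v"
      using assms ip_commute[of v u]
      by (simp add: ip_diff_left ip_diff_right L2_intros ip_scale_left ip_scale_right power2_eq_square algebra_simps)
    finally show ?thesis .
  qed
  have "(ip u v)\<^sup>2 \<le> ip u u * ip v v"
  proof (cases "ip v v = 0")
    case True
    have "ip u v = 0"
    proof (rule ccontr)
      assume "ip u v \<noteq> 0"
      \<comment> \<open>For \<open>ip v v = 0\<close> the quadratic is linear in \<open>s\<close>;
        this \<open>s\<close> gives it the negative value \<open>- ip u u - 2\<close>.\<close>
      then show False using *[of "(ip u u + 1) / ip u v"] True ip_nonneg[of u] by simp
    qed
    then show ?thesis using ip_nonneg by simp
  next
    case False
    then have pos: "ip v v > 0" using ip_nonneg[of v] by simp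
    have "0 \<le> ip u u - (ip u v)\<^sup>2 / ip v v"
      using *[of "ip u v / ip v v"] False by (simp add: power2_eq_square)
    then show ?thesis using pos by (simp add: field_simps)
  qed
  then have "sqrt ((ip u v)\<^sup>2) \<le> sqrt (ip u u * ip v v)" by (rule real_sqrt_le_mono)
  then show ?thesis by (simp add: n2_def real_sqrt_mult)
qed

lemma n2_add_squared:
  assumes "L2 u" "L2 v"
  shows "(n2 (\<lambda>k x. u k x + v k x))\<^sup>2 = (n2 u)\<^sup>2 + (n2 v)\<^sup>2 + 2 * ip u v"
  using assms ip_commute[of v u]
  by (simp add: n2_squared ip_add_left ip_add_right L2_add)

lemma n2_triangle:
  assumes "L2 u" "L2 v"
  shows "n2 (\<lambda>k x. u k x + v k x) \<le> n2 u + n2 v"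
proof (rule power2_le_imp_le)
  have "(n2 u)\<^sup>2 + (n2 v)\<^sup>2 + 2 * ip u v \<le> (n2 u + n2 v)\<^sup>2"
    using Cauchy_Schwarz_ip[OF assms] by (simp add: power2_sum)
  then show "(n2 (\<lambda>k x. u k x + v k x))\<^sup>2 \<le> (n2 u + n2 v)\<^sup>2"
    by (simp add: n2_add_squared assms)
qed (simp add: n2_nonneg)

lemma n2_scale: "n2 (\<lambda>k x. c * u k x) = norm c * n2 u"
proof -
  have "ip (\<lambda>k x. c * u k x) (\<lambda>k x. c * u k x) = (norm c)\<^sup>2 * ip u u"
    unfolding ip_def sum_distrib_left
    by (intro sum.cong refl) (simp add: power2_norm_eq_inner[symmetric] norm_mult power_mult_distrib)
  then show ?thesis by (simp add: n2_def real_sqrt_mult)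
qed

lemma n2_minus: "n2 (\<lambda>k x. - u k x) = n2 u"
  using n2_scale[of "-1" u] by simp

lemma n2_minus_commute: "n2 (\<lambda>k x. u k x - v k x) = n2 (\<lambda>k x. v k x - u k x)"
  using n2_minus[of "\<lambda>k x. v k x - u k x"] by simp

lemma n2_triangle_diff: "L2 u \<Longrightarrow> L2 v \<Longrightarrow> n2 (\<lambda>k x. u k x - v k x) \<le> n2 u + n2 v"
  using n2_triangle[OF _ L2_minus, of u v] by (simp add: n2_minus)

lemma n2_reverse_triangle:
  assumes "L2 u" "L2 v"
  shows "\<bar>n2 u - n2 v\<bar> \<le> n2 (\<lambda>k x. u k x - v k x)"
  using n2_triangle[OF L2_diff[OF assms] assms(2)]
    n2_triangle[OF L2_diff[OF assms(2,1)] assms(1)] n2_minus_commute[of u v]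
  by simp

lemma n2_zero [simp]: "n2 (\<lambda>k x. 0) = 0"
  by (simp add: n2_def ip_def)

lemma Lpnorm_2: "Lpnorm E l 2 u = n2 u"
  by (simp add: Lpnorm_def n2_def ip_def powr_half_sqrt power2_norm_eq_inner[symmetric]
      integral_nonneg_AE sum_nonneg)

lemma ip_cong: "u \<simeq> u' \<Longrightarrow> v \<simeq> v' \<Longrightarrow> L2 u \<Longrightarrow> L2 v \<Longrightarrow> L2 u' \<Longrightarrow> L2 v' \<Longrightarrow> ip u v = ip u' v'"
  unfolding ip_def aeq_def
proof (intro sum.cong refl integral_cong_AE)
  fix k assume "\<forall>k<E. AE x in edge k. u k x = u' k x" "\<forall>k<E. AE x in edge k. v k x = v' k x" "k \<in> {..<E}"
  then have "AE x in edge k. u k x = u' k x" "AE x in edge k. v k x = v' k x" by auto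
  then show "AE x in edge k. inner (u k x) (v k x) = inner (u' k x) (v' k x)" by eventually_elim simp
qed (use L2_inner_integrable in \<open>auto dest!: borel_measurable_integrable\<close>)

lemma n2_cong: "u \<simeq> v \<Longrightarrow> L2 u \<Longrightarrow> L2 v \<Longrightarrow> n2 u = n2 v"
  by (simp add: n2_def ip_cong[of u v u v])

lemma aeq_refl [simp]: "u \<simeq> u"
  by (simp add: aeq_def)

lemma aeq_sym: "u \<simeq> v \<Longrightarrow> v \<simeq> u"
  unfolding aeq_def by (auto elim!: eventually_mono)

lemma aeq_trans [trans]: "u \<simeq> v \<Longrightarrow> v \<simeq> z \<Longrightarrow> u \<simeq> z"
  unfolding aeq_def
proof (intro allI impI)
  fix k assume "\<forall>k<E. AE x in edge k. u k x = v k x" "\<forall>k<E. AE x in edge k. v k x = z k x" "k < E"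
  then have "AE x in edge k. u k x = v k x" "AE x in edge k. v k x = z k x" by auto
  then show "AE x in edge k. u k x = z k x" by eventually_elim simp
qed

text \<open>\<open>T\<close> acts on functions while its laws hold almost everywhere, so algebraic
  manipulations of orbits are pointwise operations \<open>F\<close> transported along
  \<open>\<simeq>\<close>.\<close>

lemma aeq_lift:
  assumes "u \<simeq> v"
  shows "(\<lambda>k x. F k x (u k x)) \<simeq> (\<lambda>k x. F k x (v k x))"
  using assms unfolding aeq_def by (auto elim!: eventually_mono)

lemma aeq_lift2:
  assumes "u \<simeq> v" "u' \<simeq> v'"
  shows "(\<lambda>k x. F k x (u k x) (u' k x)) \<simeq> (\<lambda>k x. F k x (v k x) (v' k x))"
  unfolding aeq_def
proof (intro allI impI)
  fix k assume k: "k < E"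
  with assms have "AE x in edge k. u k x = v k x" "AE x in edge k. u' k x = v' k x"
    by (auto simp: aeq_def)
  then show "AE x in edge k. F k x (u k x) (u' k x) = F k x (v k x) (v' k x)"
    by eventually_elim simp
qed

definition admissible :: "(nat \<Rightarrow> real \<Rightarrow> real) \<Rightarrow> bool" where
  "admissible w \<longleftrightarrow> (\<forall>k<E. w k \<in> borel_measurable (edge k)) \<and>
     (\<exists>M. \<forall>k<E. \<forall>x\<in>{0..l k}. \<bar>w k x\<bar> \<le> M)"

lemma L2_scaled: "admissible w \<Longrightarrow> L2 u \<Longrightarrow> L2 (scaled w u)"
  unfolding admissible_def scaled_def
proof (elim conjE exE)
  fix M assume "L2 u" "\<forall>k<E. w k \<in> borel_measurable (edge k)" "\<forall>k<E. \<forall>x\<in>{0..l k}. \<bar>w k x\<bar> \<le> M"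
  then show "L2 (\<lambda>k x. of_real (w k x) * u k x)" by (intro L2_mult[where M = M]) auto
qed

lemma n2_scaled_le:
  assumes "admissible w" "L2 u" and M: "\<And>k x. k < E \<Longrightarrow> x \<in> {0..l k} \<Longrightarrow> \<bar>w k x\<bar> \<le> M" "0 \<le> M"
  shows "n2 (scaled w u) \<le> M * n2 u"
proof (rule power2_le_imp_le)
  have "(n2 (scaled w u))\<^sup>2 \<le> (\<Sum>k<E. \<integral>x. M\<^sup>2 * inner (u k x) (u k x) \<partial>edge k)"
    unfolding n2_squared ip_def
  proof (intro sum_mono integral_mono_AE AE_I2)
    fix k x assume k: "k \<in> {..<E}" and x: "x \<in> space (edge k)"
    have "(w k x)\<^sup>2 \<le> M\<^sup>2" using M(1)[of k x] k x by (intro abs_le_square_iff[THEN iffD1]) auto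
    then show "inner (scaled w u k x) (scaled w u k x) \<le> M\<^sup>2 * inner (u k x) (u k x)"
      by (simp add: scaled_def complex_inner_mult power2_eq_square mult.assoc[symmetric] mult_right_mono)
  qed (use L2_inner_integrable L2_scaled assms in auto)
  then show "(n2 (scaled w u))\<^sup>2 \<le> (M * n2 u)\<^sup>2"
    by (simp add: power_mult_distrib n2_squared ip_def sum_distrib_left)
qed (use M n2_nonneg in auto)

lemma admissible_bound:
  assumes "admissible w"
  obtains M where "0 < M" "\<And>u. L2 u \<Longrightarrow> n2 (scaled w u) \<le> M * n2 u"
proof -
  obtain M where M: "\<forall>k<E. \<forall>x\<in>{0..l k}. \<bar>w k x\<bar> \<le> M" using assms by (auto simp: admissible_def)
  show thesis
    by (rule that[of "max 1 M"]) (use n2_scaled_le[OF assms, of _ "max 1 M"] M in \<open>auto simp: le_max_iff_disj\<close>)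
qed

lemma scaled_diff: "scaled w (\<lambda>k x. u k x - v k x) = (\<lambda>k x. scaled w u k x - scaled w v k x)"
  by (auto simp: scaled_def algebra_simps)

lemma scaled_1: "scaled (\<lambda>k x. 1) u = u"
  by (simp add: scaled_def)

lemma admissible_1: "admissible (\<lambda>k x. 1)"
  by (auto simp: admissible_def)

lemma aeq_scaled: "u \<simeq> v \<Longrightarrow> scaled w u \<simeq> scaled w v"
  unfolding scaled_def by (rule aeq_lift)

end

section \<open>The given semigroup and its generator\<close>

locale network_semigroup = network +
  fixes Y :: "(nat \<Rightarrow> complex) set" and R :: "(nat \<Rightarrow> complex) \<Rightarrow> (nat \<Rightarrow> complex)"
    and T :: "real \<Rightarrow> gfun \<Rightarrow> gfun"
  assumes Y: "csubspace E Y"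
    and R_lin: "clinear_on Y R"
    and R_diss: "dissipative E Y R"
    and T: "generated_by_minus_A E l Y R T"
begin

lemma T_semigroup: "Lp_semigroup E l 2 T"
  using T by (simp add: generated_by_minus_A_def)

lemma T_L2: "0 \<le> t \<Longrightarrow> L2 u \<Longrightarrow> L2 (T t u)"
  and T_add: "0 \<le> t \<Longrightarrow> L2 u \<Longrightarrow> L2 v \<Longrightarrow> T t (\<lambda>k x. u k x + v k x) \<simeq> (\<lambda>k x. T t u k x + T t v k x)"
  and T_scale: "0 \<le> t \<Longrightarrow> L2 u \<Longrightarrow> T t (\<lambda>k x. c * u k x) \<simeq> (\<lambda>k x. c * T t u k x)"
  and T_0: "L2 u \<Longrightarrow> T 0 u \<simeq> u"
  and T_plus: "0 \<le> s \<Longrightarrow> 0 \<le> t \<Longrightarrow> L2 u \<Longrightarrow> T (s + t) u \<simeq> T s (T t u)"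
  using T_semigroup unfolding Lp_semigroup_def L2_def by simp_all

lemma T_bounded:
  assumes "0 \<le> t"
  obtains M where "0 < M" "\<And>u. L2 u \<Longrightarrow> n2 (T t u) \<le> M * n2 u"
proof -
  obtain M where M: "\<And>u. L2 u \<Longrightarrow> n2 (T t u) \<le> M * n2 u"
    using T_semigroup assms unfolding Lp_semigroup_def Lpnorm_2 L2_def by meson
  have "n2 (T t u) \<le> max 1 M * n2 u" if "L2 u" for u
    by (rule order.trans[OF M[OF that]]) (auto intro!: mult_right_mono n2_nonneg)
  then show thesis using that[of "max 1 M"] by simp
qed

lemma T_continuous:
  "L2 u \<Longrightarrow> 0 \<le> t \<Longrightarrow> ((\<lambda>s. n2 (\<lambda>k x. T s u k x - T t u k x)) \<longlongrightarrow> 0) (at t within {0..})"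
  using T_semigroup unfolding Lp_semigroup_def gdiff_def Lpnorm_2 L2_def by simp

lemma T_diff:
  assumes "0 \<le> t" "L2 u" "L2 v"
  shows "T t (\<lambda>k x. u k x - v k x) \<simeq> (\<lambda>k x. T t u k x - T t v k x)"
proof -
  have "T t (\<lambda>k x. u k x + (- 1) * v k x) \<simeq> (\<lambda>k x. T t u k x + T t (\<lambda>k x. (- 1) * v k x) k x)"
    by (rule T_add) (use assms L2_scale[of v "-1"] in auto)
  also have "\<dots> \<simeq> (\<lambda>k x. T t u k x + (-1) * T t v k x)"
    by (rule aeq_lift2[of _ _ _ _ "\<lambda>k x. (+)"]) (use assms T_scale[of t v "-1"] in auto)
  finally show ?thesis by simp
qed

lemma n2_T_diff:
  assumes "0 \<le> t" "L2 u" "L2 v"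
  shows "n2 (\<lambda>k x. T t u k x - T t v k x) = n2 (T t (\<lambda>k x. u k x - v k x))"
  using n2_cong[OF T_diff[OF assms]] assms by (simp add: L2_intros T_L2)

text \<open>The relation \<open>a = A u\<close>. The generator is \<open>- A\<close>, hence the plus
  sign before \<open>a\<close>; it is a relation because \<open>a\<close> is determined only almost
  everywhere.\<close>

definition gen :: "gfun \<Rightarrow> gfun \<Rightarrow> bool" where
  "gen u a \<longleftrightarrow> L2 u \<and> L2 a \<and>
     ((\<lambda>h. n2 (\<lambda>k x. (T h u k x - u k x) / of_real h + a k x)) \<longlongrightarrow> 0) (at_right 0)"

lemma A_rel_L2:
  assumes "A_rel E l Y R u a"
  shows "L2 u" "L2 a"
proof -
  show "L2 u" using assms by (simp add: A_rel_def L2_def)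
  obtain v d1 d2 d3 where "\<forall>k<E. H4_rep (l k) (v k) (d1 k) (d2 k) (d3 k) (a k)"
    using assms unfolding A_rel_def by blast
  then show "L2 a" unfolding L2_iff H4_rep_def by blast
qed

text \<open>\<open>A_rel\<close> already forces square integrability of both arguments, so the
  equivalence assumed for \<open>T\<close> can be stated without side conditions.\<close>

lemma A_rel_iff_gen: "A_rel E l Y R u a \<longleftrightarrow> gen u a"
proof -
  have "(((\<lambda>h. n2 (\<lambda>k x. (T h u k x - u k x) / of_real h + a k x)) \<longlongrightarrow> 0) (at_right 0)
      \<longleftrightarrow> A_rel E l Y R u a)" if "L2 u" "L2 a"
  proof -
    have "((\<lambda>h. n2 (\<lambda>k x. (T h u k x - u k x) / of_real h - (- a k x))) \<longlongrightarrow> 0) (at_right 0)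
      \<longleftrightarrow> A_rel E l Y R u (\<lambda>k x. - (- a k x))"
      using T that(1) L2_minus[OF that(2)] unfolding generated_by_minus_A_def Lpnorm_2 L2_def by blast
    then show ?thesis by simp
  qed
  then show ?thesis unfolding gen_def using A_rel_L2 by blast
qed

lemma gen_L2: "gen u a \<Longrightarrow> L2 u" "gen u a \<Longrightarrow> L2 a"
  by (auto simp: gen_def)

text \<open>Closure properties of the generator are read off from its description by difference quotients.\<close>

lemma gen_bounded_image:
  assumes u: "gen u a" "L2 u'" "L2 a'" and M: "\<And>h. 0 < h \<Longrightarrow>
    n2 (\<lambda>k x. (T h u' k x - u' k x) / of_real h + a' k x)
      \<le> M * n2 (\<lambda>k x. (T h u k x - u k x) / of_real h + a k x)"
  shows "gen u' a'"
  unfolding gen_def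
proof (intro conjI u(2,3))
  have "((\<lambda>h. M * n2 (\<lambda>k x. (T h u k x - u k x) / of_real h + a k x)) \<longlongrightarrow> M * 0) (at_right 0)"
    using u(1) by (intro tendsto_mult_left) (auto simp: gen_def)
  then have lim: "((\<lambda>h. M * n2 (\<lambda>k x. (T h u k x - u k x) / of_real h + a k x)) \<longlongrightarrow> 0) (at_right 0)" by simp
  show "((\<lambda>h. n2 (\<lambda>k x. (T h u' k x - u' k x) / of_real h + a' k x)) \<longlongrightarrow> 0) (at_right 0)"
    by (rule Lim_null_comparison[where g="\<lambda>h. M * n2 (\<lambda>k x. (T h u k x - u k x) / of_real h + a k x)"])
      (use M n2_nonneg lim in \<open>auto simp: eventually_at_filter\<close>)
qed

lemma gen_scale:
  assumes "gen u a"
  shows "gen (\<lambda>k x. c * u k x) (\<lambda>k x. c * a k x)"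
proof (rule gen_bounded_image[OF assms])
  note L = gen_L2[OF assms]
  fix h :: real assume h: "0 < h"
  have "(\<lambda>k x. (T h (\<lambda>k x. c * u k x) k x - c * u k x) / of_real h + c * a k x) \<simeq>
    (\<lambda>k x. (c * T h u k x - c * u k x) / of_real h + c * a k x)"
    using h L by (intro aeq_lift[where F="\<lambda>k x z. (z - c * u k x) / of_real h + c * a k x"] T_scale) auto
  then have "n2 (\<lambda>k x. (T h (\<lambda>k x. c * u k x) k x - c * u k x) / of_real h + c * a k x)
    = n2 (\<lambda>k x. (c * T h u k x - c * u k x) / of_real h + c * a k x)"
    by (rule n2_cong) (use h L in \<open>auto intro!: L2_intros T_L2\<close>)
  also have "(\<lambda>k x. (c * T h u k x - c * u k x) / of_real h + c * a k x)
     = (\<lambda>k x. c * ((T h u k x - u k x) / of_real h + a k x))" by (simp add: algebra_simps diff_divide_distrib)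
  finally show "n2 (\<lambda>k x. (T h (\<lambda>k x. c * u k x) k x - c * u k x) / of_real h + c * a k x)
     \<le> norm c * n2 (\<lambda>k x. (T h u k x - u k x) / of_real h + a k x)"
    by (simp only: n2_scale order_refl)
qed (use gen_L2[OF assms] in \<open>auto intro: L2_intros\<close>)

lemma gen_add:
  assumes "gen u a" "gen v b"
  shows "gen (\<lambda>k x. u k x + v k x) (\<lambda>k x. a k x + b k x)"
  unfolding gen_def
proof (intro conjI)
  note L = gen_L2[OF assms(1)] gen_L2[OF assms(2)]
  show "L2 (\<lambda>k x. u k x + v k x)" "L2 (\<lambda>k x. a k x + b k x)" using L by (auto intro: L2_intros)
  let ?q = "\<lambda>h u a k x. (T h u k x - u k x) / of_real h + a k x"
  have "((\<lambda>h. n2 (?q h u a) + n2 (?q h v b)) \<longlongrightarrow> 0 + 0) (at_right 0)"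
    using assms by (intro tendsto_add) (auto simp: gen_def)
  moreover have "norm (n2 (?q h (\<lambda>k x. u k x + v k x) (\<lambda>k x. a k x + b k x))) \<le> n2 (?q h u a) + n2 (?q h v b)"
    if "0 < h" for h
  proof -
    have "?q h (\<lambda>k x. u k x + v k x) (\<lambda>k x. a k x + b k x) \<simeq>
      (\<lambda>k x. (T h u k x + T h v k x - (u k x + v k x)) / of_real h + (a k x + b k x))"
      using that L by (intro aeq_lift[where F="\<lambda>k x z. (z - (u k x + v k x)) / of_real h + (a k x + b k x)"] T_add) auto
    then have "n2 (?q h (\<lambda>k x. u k x + v k x) (\<lambda>k x. a k x + b k x)) =
      n2 (\<lambda>k x. (T h u k x + T h v k x - (u k x + v k x)) / of_real h + (a k x + b k x))"
      by (rule n2_cong) (use that L in \<open>auto intro!: L2_intros T_L2\<close>)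
    also have "(\<lambda>k x. (T h u k x + T h v k x - (u k x + v k x)) / of_real h + (a k x + b k x)) =
      (\<lambda>k x. ?q h u a k x + ?q h v b k x)"
      by (simp add: algebra_simps diff_divide_distrib add_divide_distrib)
    also have "n2 \<dots> \<le> n2 (?q h u a) + n2 (?q h v b)"
      by (rule n2_triangle) (use that L in \<open>auto intro!: L2_intros T_L2\<close>)
    finally show ?thesis using n2_nonneg by simp
  qed
  ultimately show "((\<lambda>h. n2 (?q h (\<lambda>k x. u k x + v k x) (\<lambda>k x. a k x + b k x))) \<longlongrightarrow> 0) (at_right 0)"
    by - (rule Lim_null_comparison[where g="\<lambda>h. n2 (?q h u a) + n2 (?q h v b)"], auto simp: eventually_at_filter)
qed

text \<open>\<open>T h\<close> and \<open>T t\<close> commute almost everywhere, both products being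
  \<open>T (t + h)\<close>; so the difference quotient of \<open>T t u\<close> is \<open>T t\<close>
  applied to that of \<open>u\<close>, and \<open>T t\<close> is bounded.\<close>

lemma gen_T:
  assumes "gen u a" "0 \<le> t"
  shows "gen (T t u) (T t a)"
proof -
  note L = gen_L2[OF assms(1)]
  obtain M where M: "0 < M" "\<And>u. L2 u \<Longrightarrow> n2 (T t u) \<le> M * n2 u" using T_bounded assms by blast
  show ?thesis
  proof (rule gen_bounded_image[OF assms(1)])
    fix h :: real assume h: "0 < h"
    let ?q = "\<lambda>k x. (T h u k x - u k x) / of_real h + a k x"
    have "T h (T t u) \<simeq> T (h + t) u" using h assms L by (intro aeq_sym[OF T_plus]) auto
    also have "\<dots> \<simeq> T t (T h u)" using h assms L T_plus[of t h u] by (simp add: add.commute)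
    finally have 1: "T h (T t u) \<simeq> T t (T h u)" .
    have "(\<lambda>k x. (T h (T t u) k x - T t u k x) / of_real h + T t a k x) \<simeq>
       (\<lambda>k x. (T t (T h u) k x - T t u k x) / of_real h + T t a k x)"
      by (rule aeq_lift[OF 1, where F="\<lambda>k x z. (z - T t u k x) / of_real h + T t a k x"])
    also have "\<dots> \<simeq> (\<lambda>k x. T t (\<lambda>k x. T h u k x - u k x) k x / of_real h + T t a k x)"
      by (rule aeq_sym, rule aeq_lift[OF T_diff, where F="\<lambda>k x z. z / of_real h + T t a k x"])
        (use h assms L T_L2 in auto)
    also have "\<dots> = (\<lambda>k x. 1 / of_real h * T t (\<lambda>k x. T h u k x - u k x) k x + T t a k x)" by simp
    also have "\<dots> \<simeq> (\<lambda>k x. T t (\<lambda>k x. 1 / of_real h * (T h u k x - u k x)) k x + T t a k x)"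
      by (rule aeq_sym, rule aeq_lift[OF T_scale, where F="\<lambda>k x z. z + T t a k x"])
        (use h assms L T_L2 in \<open>auto intro!: L2_intros\<close>)
    also have "\<dots> \<simeq> T t (\<lambda>k x. 1 / of_real h * (T h u k x - u k x) + a k x)"
      by (rule aeq_sym, rule T_add) (use h assms L T_L2 in \<open>auto intro!: L2_intros\<close>)
    also have "\<dots> = T t ?q" by simp
    finally have "n2 (\<lambda>k x. (T h (T t u) k x - T t u k x) / of_real h + T t a k x) = n2 (T t ?q)"
      by (rule n2_cong) (use h assms L in \<open>auto intro!: L2_intros T_L2\<close>)
    also have "\<dots> \<le> M * n2 ?q" by (rule M) (use h L in \<open>auto intro!: L2_intros T_L2\<close>)
    finally show "n2 (\<lambda>k x. (T h (T t u) k x - T t u k x) / of_real h + T t a k x) \<le> M * n2 ?q" .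
  qed (use L assms in \<open>auto intro: T_L2\<close>)
qed

lemma n2_scaled_T_continuous:
  assumes "L2 u" "admissible w"
  shows "continuous_on {0..} (\<lambda>t. n2 (scaled w (T t u)))"
  unfolding continuous_on_def
proof
  fix t :: real assume "t \<in> {0..}"
  then have t: "0 \<le> t" by simp
  obtain M where M: "0 < M" "\<And>u. L2 u \<Longrightarrow> n2 (scaled w u) \<le> M * n2 u"
    using admissible_bound[OF assms(2)] by blast
  have lim: "((\<lambda>s. M * n2 (\<lambda>k x. T s u k x - T t u k x)) \<longlongrightarrow> 0) (at t within {0..})"
    using tendsto_mult_left[OF T_continuous[OF assms(1) t], of M] by simp
  have le: "norm (n2 (scaled w (T s u)) - n2 (scaled w (T t u))) \<le> M * n2 (\<lambda>k x. T s u k x - T t u k x)"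
    if "0 \<le> s" for s
  proof -
    have "\<bar>n2 (scaled w (T s u)) - n2 (scaled w (T t u))\<bar>
        \<le> n2 (\<lambda>k x. scaled w (T s u) k x - scaled w (T t u) k x)"
      by (rule n2_reverse_triangle) (use assms t that in \<open>auto intro!: L2_scaled T_L2\<close>)
    also have "\<dots> \<le> M * n2 (\<lambda>k x. T s u k x - T t u k x)"
      unfolding scaled_diff[symmetric] by (rule M) (use assms t that in \<open>auto intro!: L2_diff T_L2\<close>)
    finally show ?thesis by simp
  qed
  have "((\<lambda>s. n2 (scaled w (T s u)) - n2 (scaled w (T t u))) \<longlongrightarrow> 0) (at t within {0..})"
  proof (rule Lim_null_comparison[OF _ lim])
    have "\<forall>\<^sub>F s in at t within {0..}. 0 \<le> s" by (simp add: eventually_at_filter)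
    then show "\<forall>\<^sub>F s in at t within {0..}. norm (n2 (scaled w (T s u)) - n2 (scaled w (T t u)))
        \<le> M * n2 (\<lambda>k x. T s u k x - T t u k x)"
      by (rule eventually_mono) (rule le)
  qed
  then show "((\<lambda>s. n2 (scaled w (T s u))) \<longlongrightarrow> n2 (scaled w (T t u))) (at t within {0..})"
    by (rule Lim_null[THEN iffD2])
qed

text \<open>With \<open>v = T t u\<close> and \<open>b = T t a\<close> the defining limit reads
  \<open>T h v = v + h * (q h - b)\<close>, where \<open>q h\<close> tends to 0 in L^2. Expanding
  the square leaves the remainder \<open>e h\<close>, which vanishes with \<open>h\<close>.\<close>

lemma n2_scaled_T_right_derivative:
  assumes u: "gen u a" and w: "admissible w" and t: "0 \<le> t"
  shows "((\<lambda>s. (n2 (scaled w (T s u)))\<^sup>2) has_real_derivative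
    - 2 * ip (scaled w (T t a)) (scaled w (T t u))) (at_right t)"
proof -
  define v b where "v = T t u" and "b = T t a"
  have vb: "gen v b" unfolding v_def b_def by (rule gen_T[OF u t])
  note L = gen_L2[OF vb] gen_L2[OF u]
  define q where "q h = (\<lambda>k x. (T h v k x - v k x) / of_real h + b k x)" for h
  have q: "((\<lambda>h. n2 (q h)) \<longlongrightarrow> 0) (at_right 0)" using vb by (simp add: gen_def q_def)
  have qL: "L2 (q h)" if "0 < h" for h unfolding q_def using that L by (intro L2_intros T_L2) auto
  obtain M where M: "0 < M" "\<And>u. L2 u \<Longrightarrow> n2 (scaled w u) \<le> M * n2 u"
    using admissible_bound[OF w] by blast
  note Lw = L2_scaled[OF w]
  define e where "e h = 2 * ip (scaled w (q h)) (scaled w v)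
      + h * (n2 (scaled w (\<lambda>k x. q h k x - b k x)))\<^sup>2" for h
  have e: "(e \<longlongrightarrow> 0) (at_right 0)"
  proof (rule Lim_null_comparison)
    show "((\<lambda>h. 2 * (M * n2 (q h) * n2 (scaled w v)) + h * (M * (n2 (q h) + n2 b))\<^sup>2) \<longlongrightarrow> 0) (at_right 0)"
      by (rule tendsto_eq_intros q tendsto_ident_at refl)+ simp
    have "norm (e h) \<le> 2 * (M * n2 (q h) * n2 (scaled w v)) + h * (M * (n2 (q h) + n2 b))\<^sup>2" if h: "0 < h" for h
    proof -
      have "\<bar>ip (scaled w (q h)) (scaled w v)\<bar> \<le> n2 (scaled w (q h)) * n2 (scaled w v)"
        by (intro Cauchy_Schwarz_ip Lw qL h L)
      also have "\<dots> \<le> M * n2 (q h) * n2 (scaled w v)"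
        by (intro mult_right_mono M qL h n2_nonneg)
      finally have 1: "\<bar>ip (scaled w (q h)) (scaled w v)\<bar> \<le> M * n2 (q h) * n2 (scaled w v)" .
      have "n2 (scaled w (\<lambda>k x. q h k x - b k x)) \<le> M * n2 (\<lambda>k x. q h k x - b k x)"
        by (intro M L2_diff qL h L)
      also have "\<dots> \<le> M * (n2 (q h) + n2 b)"
        using M(1) by (intro mult_left_mono n2_triangle_diff qL h L) auto
      finally have "(n2 (scaled w (\<lambda>k x. q h k x - b k x)))\<^sup>2 \<le> (M * (n2 (q h) + n2 b))\<^sup>2"
        by (intro power_mono n2_nonneg)
      then have "\<bar>h * (n2 (scaled w (\<lambda>k x. q h k x - b k x)))\<^sup>2\<bar> \<le> h * (M * (n2 (q h) + n2 b))\<^sup>2"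
        using h by (simp add: abs_mult)
      with 1 show ?thesis unfolding e_def by simp
    qed
    then show "\<forall>\<^sub>F h in at_right 0. norm (e h) \<le> 2 * (M * n2 (q h) * n2 (scaled w v)) + h * (M * (n2 (q h) + n2 b))\<^sup>2"
      by (simp add: eventually_at_filter)
  qed
  have quot: "((n2 (scaled w (T (t + h) u)))\<^sup>2 - (n2 (scaled w (T t u)))\<^sup>2) / h
      = - 2 * ip (scaled w b) (scaled w v) + e h" if h: "0 < h" for h
  proof -
    have 1: "n2 (scaled w (T (t + h) u)) = n2 (scaled w (T h v))"
      using T_plus[of h t u] h t L
      by (intro n2_cong aeq_scaled Lw T_L2) (auto simp: add.commute v_def)
    have "T h v = (\<lambda>k x. v k x + of_real h * (q h k x - b k x))"
      using h by (simp add: q_def)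
    then have "scaled w (T h v) = (\<lambda>k x. scaled w v k x + of_real h * scaled w (\<lambda>k x. q h k x - b k x) k x)"
      by (simp add: scaled_def algebra_simps)
    then have 2: "(n2 (scaled w (T h v)))\<^sup>2 = (n2 (scaled w v))\<^sup>2
       + h\<^sup>2 * (n2 (scaled w (\<lambda>k x. q h k x - b k x)))\<^sup>2 + 2 * (h * ip (scaled w v) (scaled w (\<lambda>k x. q h k x - b k x)))"
      using h by (simp add: n2_add_squared L2_intros Lw qL L n2_scale power_mult_distrib ip_scale_right)
    have 3: "ip (scaled w v) (scaled w (\<lambda>k x. q h k x - b k x)) = ip (scaled w (q h)) (scaled w v) - ip (scaled w b) (scaled w v)"
      unfolding scaled_diff using h by (subst ip_diff_right) (auto intro: Lw qL L simp: ip_commute)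
    show ?thesis using h unfolding 1 2 3 v_def[symmetric] by (simp add: e_def field_simps power2_eq_square)
  qed
  have "((\<lambda>h. - 2 * ip (scaled w b) (scaled w v) + e h) \<longlongrightarrow> - 2 * ip (scaled w b) (scaled w v)) (at_right 0)"
    using tendsto_add[OF tendsto_const[of "- 2 * ip (scaled w b) (scaled w v)"] e] by simp
  then have "((\<lambda>h. ((n2 (scaled w (T (t + h) u)))\<^sup>2 - (n2 (scaled w (T t u)))\<^sup>2) / h) \<longlongrightarrow>
      - 2 * ip (scaled w b) (scaled w v)) (at_right 0)"
    by (rule Lim_transform_eventually) (auto simp: eventually_at_filter quot)
  then have "((\<lambda>s. ((n2 (scaled w (T s u)))\<^sup>2 - (n2 (scaled w (T t u)))\<^sup>2) / (s - t)) \<longlongrightarrow>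
      - 2 * ip (scaled w b) (scaled w v)) (at_right t)"
    by (subst at_right_to_0) (simp add: filterlim_filtermap add.commute)
  then show ?thesis by (simp add: has_field_derivative_iff b_def v_def)
qed

end

section \<open>The weighted form\<close>

definition cnorm :: "nat \<Rightarrow> (nat \<Rightarrow> complex) \<Rightarrow> real" where
  "cnorm E y = (\<Sum>i<4 * E. norm (y i))"

lemma cnorm_nonneg: "0 \<le> cnorm E y"
  by (simp add: cnorm_def sum_nonneg)

lemma cnorm_triangle: "cnorm E (\<lambda>i. y i + z i) \<le> cnorm E y + cnorm E z"
  unfolding cnorm_def sum.distrib[symmetric] by (intro sum_mono norm_triangle_ineq)

lemma cnorm_scale: "cnorm E (\<lambda>i. c * y i) = norm c * cnorm E y"
  by (simp add: cnorm_def norm_mult sum_distrib_left)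

lemma norm_le_cnorm: "i < 4 * E \<Longrightarrow> norm (y i) \<le> cnorm E y"
  unfolding cnorm_def by (rule member_le_sum) auto

lemma norm_cinner_le: "norm (cinner E y z) \<le> cnorm E y * cnorm E z"
proof -
  have "norm (cinner E y z) \<le> (\<Sum>i<4 * E. norm (y i) * norm (z i))"
    unfolding cinner_def by (rule order.trans[OF norm_sum]) (simp add: norm_mult)
  also have "\<dots> \<le> (\<Sum>i<4 * E. norm (y i) * cnorm E z)"
    by (intro sum_mono mult_left_mono norm_le_cnorm) auto
  finally show ?thesis by (simp add: cnorm_def sum_distrib_right)
qed

text \<open>Induction on the index \<open>n\<close> from which all vectors of \<open>Z\<close>
  vanish. If some vector is nonzero in its last admissible entry, normalise it to \<open>e\<close>
  with \<open>e n = 1\<close> and subtract \<open>z n * e\<close>; the result lies in the subspace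
  \<open>Z'\<close> with one coordinate fewer. As \<open>R\<close> is constrained on
  \<open>Y\<close> only, the reduction has to stay inside \<open>Y\<close>.\<close>

lemma clinear_on_bounded:
  assumes Y: "csubspace E Y" and R: "clinear_on Y R"
  obtains K where "0 < K" "\<And>y. y \<in> Y \<Longrightarrow> cnorm E (R y) \<le> K * cnorm E y"
proof -
  have R0: "cnorm E (R (\<lambda>i. 0)) = 0"
  proof -
    have "(\<lambda>i. 0) \<in> Y" using Y by (simp add: csubspace_def)
    with R have "R (\<lambda>i. 0 * (\<lambda>i. 0) i) = (\<lambda>i. 0 * R (\<lambda>i. 0) i)" unfolding clinear_on_def by meson
    then show ?thesis by (simp add: cnorm_def)
  qed
  have *: "\<exists>K\<ge>0. \<forall>y\<in>Z. cnorm E (R y) \<le> K * cnorm E y"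
    if "csubspace E Z" "Z \<subseteq> Y" "\<forall>z\<in>Z. \<forall>i\<ge>n. z i = 0" for n Z
    using that
  proof (induction n arbitrary: Z)
    case 0
    then have "y = (\<lambda>i. 0)" if "y \<in> Z" for y using that by (auto simp: fun_eq_iff)
    then show ?case using R0 by (intro exI[of _ 0]) auto
  next
    case (Suc n)
    have add: "(\<lambda>i. y i + z i) \<in> Z" if "y \<in> Z" "z \<in> Z" for y z
      using Suc.prems(1) that by (auto simp: csubspace_def)
    have scale: "(\<lambda>i. c * y i) \<in> Z" if "y \<in> Z" for y c
      using Suc.prems(1) that by (auto simp: csubspace_def)
    show ?case
    proof (cases "\<forall>z\<in>Z. z n = 0")
      case True
      have "\<forall>z\<in>Z. \<forall>i\<ge>n. z i = 0"
        using True Suc.prems(3) by (metis Suc_leI le_neq_implies_less)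
      then show ?thesis using Suc.IH[of Z] Suc.prems by blast
    next
      case False
      then obtain e0 where e0: "e0 \<in> Z" "e0 n \<noteq> 0" by blast
      define e where "e = (\<lambda>i. 1 / e0 n * e0 i)"
      have e: "e \<in> Z" "e n = 1" unfolding e_def using scale[OF e0(1), of "1 / e0 n"] e0 by auto
      have n: "n < 4 * E"
        using Suc.prems(1) e0 by (force simp: csubspace_def cvec_def not_le[symmetric])
      define Z' where "Z' = {z \<in> Z. z n = 0}"
      have "Z' \<subseteq> Y" using Suc.prems(2) by (auto simp: Z'_def)
      have "csubspace E Z'"
        using Suc.prems(1) by (auto simp: csubspace_def Z'_def)
      moreover have "\<forall>z\<in>Z'. \<forall>i\<ge>n. z i = 0"
        using Suc.prems(3) by (metis (mono_tags, lifting) Suc_leI Z'_def le_neq_implies_less mem_Collect_eq)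
      ultimately obtain K where K: "K \<ge> 0" "\<And>y. y \<in> Z' \<Longrightarrow> cnorm E (R y) \<le> K * cnorm E y"
        using Suc.IH[OF _ \<open>Z' \<subseteq> Y\<close>] by meson
      have "cnorm E (R z) \<le> (K * (1 + cnorm E e) + cnorm E (R e)) * cnorm E z" if z: "z \<in> Z" for z
      proof -
        define z' where "z' = (\<lambda>i. z i + (- z n) * e i)"
        have "z' \<in> Z" unfolding z'_def by (intro add scale z e)
        then have z': "z' \<in> Z'" by (simp add: Z'_def) (simp add: z'_def e)
        have inY: "z' \<in> Y" "e \<in> Y" "(\<lambda>i. z n * e i) \<in> Y"
          using Suc.prems(2) \<open>z' \<in> Z\<close> e scale by auto
        have "z = (\<lambda>i. z' i + z n * e i)" by (simp add: z'_def)
        then have "R z = R (\<lambda>i. z' i + z n * e i)" by simp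
        also have "\<dots> = (\<lambda>i. R z' i + R (\<lambda>i. z n * e i) i)"
          using R inY unfolding clinear_on_def by meson
        also have "R (\<lambda>i. z n * e i) = (\<lambda>i. z n * R e i)"
          using R inY unfolding clinear_on_def by meson
        finally have "cnorm E (R z) \<le> cnorm E (R z') + norm (z n) * cnorm E (R e)"
          using cnorm_triangle[of E "R z'" "\<lambda>i. z n * R e i"] by (simp add: cnorm_scale)
        also have "\<dots> \<le> K * cnorm E z' + cnorm E z * cnorm E (R e)"
          by (intro add_mono K z' mult_right_mono norm_le_cnorm n cnorm_nonneg)
        also have "K * cnorm E z' \<le> K * (cnorm E z + cnorm E z * cnorm E e)"
        proof (rule mult_left_mono[OF _ K(1)])
          have "cnorm E z' \<le> cnorm E z + norm (z n) * cnorm E e"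
            unfolding z'_def using cnorm_triangle[of E z "\<lambda>i. - z n * e i"] by (simp only: cnorm_scale norm_minus_cancel)
          also have "norm (z n) * cnorm E e \<le> cnorm E z * cnorm E e"
            by (intro mult_right_mono norm_le_cnorm n cnorm_nonneg)
          finally show "cnorm E z' \<le> cnorm E z + cnorm E z * cnorm E e" by simp
        qed
        finally show ?thesis by (simp add: algebra_simps)
      qed
      moreover have "0 \<le> K * (1 + cnorm E e) + cnorm E (R e)"
        using K cnorm_nonneg by simp
      ultimately show ?thesis by blast
    qed
  qed
  obtain K where "K \<ge> 0" "\<And>y. y \<in> Y \<Longrightarrow> cnorm E (R y) \<le> K * cnorm E y"
    using *[OF Y order_refl, of "4 * E"] Y by (auto simp: csubspace_def cvec_def subset_iff)
  then have "0 < K + 1" "cnorm E (R y) \<le> (K + 1) * cnorm E y" if "y \<in> Y" for y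
    using that cnorm_nonneg[of E y] by (auto simp: algebra_simps intro: order_trans add_increasing2)
  then show thesis using that[of "K + 1"] \<open>K \<ge> 0\<close> by simp
qed

lemma sum_four_blocks:
  fixes f :: "nat \<Rightarrow> 'a::comm_monoid_add"
  shows "(\<Sum>i<4 * E. f i) = (\<Sum>k<E. f k + f (E + k) + f (2 * E + k) + f (3 * E + k))"
proof -
  have *: "(\<Sum>i<m + n. f i) = (\<Sum>i<m. f i) + (\<Sum>i<n. f (m + i))" for m n
    by (induction n) (simp_all add: add.assoc)
  have "4 * E = E + E + E + E" "2 * E = E + E" "3 * E = E + E + E" by simp_all
  then show ?thesis by (simp only: * sum.distrib)
qed

lemma blocks4_simps:
  assumes "k < E"
  shows "blocks4 E a b c d k = a k" "blocks4 E a b c d (E + k) = b k"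
    "blocks4 E a b c d (2 * E + k) = c k" "blocks4 E a b c d (3 * E + k) = d k"
  using assms by (auto simp: blocks4_def)

lemma cinner_blocks4:
  "cinner E (blocks4 E a b c d) (blocks4 E a' b' c' d') =
    (\<Sum>k<E. a k * cnj (a' k) + b k * cnj (b' k) + c k * cnj (c' k) + d k * cnj (d' k))"
  unfolding cinner_def sum_four_blocks by (intro sum.cong refl) (simp add: blocks4_simps)

lemma cnorm_blocks4:
  "cnorm E (blocks4 E a b c d) = (\<Sum>k<E. norm (a k) + norm (b k) + norm (c k) + norm (d k))"
  unfolding cnorm_def sum_four_blocks by (intro sum.cong refl) (simp add: blocks4_simps)

text \<open>The optimal choice is s = q / p; the increment \<open>e\<close> keeps it defined and
  positive when \<open>p\<close> or \<open>q\<close> is 0. This turns bounds that can be summed over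
  edges into a product of global norms.\<close>

lemma le_mult_if_le_weighted_mean:
  fixes a p q :: real
  assumes "0 \<le> p" "0 \<le> q" and le: "\<And>s. 0 < s \<Longrightarrow> 2 * a \<le> s * p\<^sup>2 + q\<^sup>2 / s"
  shows "a \<le> p * q"
proof -
  have *: "a \<le> (p + e) * (q + e)" if "0 < e" for e
  proof -
    define s where "s = (q + e) / (p + e)"
    have pe: "0 < p + e" "0 < q + e" using that assms by auto
    have "2 * a \<le> s * p\<^sup>2 + q\<^sup>2 / s" using pe by (intro le) (simp add: s_def)
    also have "\<dots> \<le> s * (p + e)\<^sup>2 + (q + e)\<^sup>2 / s"
      using pe assms that by (intro add_mono mult_left_mono divide_right_mono power_mono) (auto simp: s_def)
    also have "s * (p + e)\<^sup>2 = (p + e) * (q + e)" using pe by (simp add: s_def power2_eq_square)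
    also have "(q + e)\<^sup>2 / s = (p + e) * (q + e)" using pe by (simp add: s_def power2_eq_square)
    finally show ?thesis by simp
  qed
  have "((\<lambda>e. (p + e) * (q + e)) \<longlongrightarrow> (p + 0) * (q + 0)) (at_right 0)"
    by (intro tendsto_intros)
  then have "a \<le> (p + 0) * (q + 0)"
    by (rule tendsto_lowerbound) (use * in \<open>auto simp: eventually_at_filter\<close>)
  then show ?thesis by simp
qed

text \<open>\<open>wd0\<close>, \<open>wd1\<close> and \<open>wd2\<close> are
  \<open>exp \<psi> * v\<close> and its first two derivatives, expressed through the derivatives of
  \<open>v\<close> and \<open>\<psi>\<close>.\<close>

definition wd0 :: "(real \<Rightarrow> real) \<Rightarrow> (real \<Rightarrow> complex) \<Rightarrow> real \<Rightarrow> complex" where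
  "wd0 \<psi> v x = exp (\<psi> x) *\<^sub>R v x"

definition wd1 where
  "wd1 \<psi> \<psi>1 v d1 x = exp (\<psi> x) *\<^sub>R (d1 x + \<psi>1 x *\<^sub>R v x)"

definition wd2 where
  "wd2 \<psi> \<psi>1 \<psi>2 v d1 d2 x = exp (\<psi> x) *\<^sub>R (d2 x + (2 * \<psi>1 x) *\<^sub>R d1 x + ((\<psi>1 x)\<^sup>2 + \<psi>2 x) *\<^sub>R v x)"
  for v d1 d2 :: "real \<Rightarrow> complex"

lemma C2_exp_scaled:
  assumes "C2_on_interval b v d1 d2"
    and \<psi>: "\<And>x. x \<in> {0..b} \<Longrightarrow> (\<psi> has_real_derivative \<psi>1 x) (at x within {0..b})"
      "\<And>x. x \<in> {0..b} \<Longrightarrow> (\<psi>1 has_real_derivative \<psi>2 x) (at x within {0..b})"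
      "continuous_on {0..b} \<psi>2"
  shows "C2_on_interval b (wd0 \<psi> v) (wd1 \<psi> \<psi>1 v d1) (wd2 \<psi> \<psi>1 \<psi>2 v d1 d2)"
proof -
  interpret C2_on_interval b v d1 d2 by fact
  have exp\<psi>: "((\<lambda>x. exp (\<psi> x)) has_real_derivative exp (\<psi> x) * \<psi>1 x) (at x within {0..b})"
    if "x \<in> {0..b}" for x using DERIV_chain2[OF DERIV_exp \<psi>(1)[OF that]] by simp
  have cont: "continuous_on {0..b} \<psi>" "continuous_on {0..b} \<psi>1"
    using DERIV_continuous_on[OF \<psi>(1)] DERIV_continuous_on[OF \<psi>(2)] by auto
  show ?thesis
  proof
    fix x assume x: "x \<in> {0..b}"
    show "(wd0 \<psi> v has_vector_derivative wd1 \<psi> \<psi>1 v d1 x) (at x within {0..b})"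
      unfolding wd0_def[abs_def] wd1_def
      by (rule has_vector_derivative_eq_rhs, rule has_vector_derivative_scaleR, rule exp\<psi>[OF x], rule y[OF x])
        (simp add: scaleR_add_right)
    show "(wd1 \<psi> \<psi>1 v d1 has_vector_derivative wd2 \<psi> \<psi>1 \<psi>2 v d1 d2 x) (at x within {0..b})"
      unfolding wd1_def[abs_def] wd2_def
      by (rule has_vector_derivative_eq_rhs, rule has_vector_derivative_scaleR, rule exp\<psi>[OF x],
          rule has_vector_derivative_add, rule y1[OF x], rule has_vector_derivative_scaleR, rule \<psi>(2)[OF x], rule y[OF x])
        (simp add: complex_eq_iff power2_eq_square algebra_simps)
  qed (auto simp: wd2_def[abs_def] intro!: continuous_intros cont \<psi>)
qed

text \<open>The form of \<open>e\<^sup>\<psi> \<partial>\<^sup>4 e\<^sup>-\<^sup>\<psi>\<close> on one edge: both second derivatives are conjugated by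
  the weight.\<close>
definition wform :: "real \<Rightarrow> (real \<Rightarrow> real) \<Rightarrow> (real \<Rightarrow> real) \<Rightarrow> (real \<Rightarrow> complex) \<Rightarrow> (real \<Rightarrow> complex) \<Rightarrow>
    (real \<Rightarrow> complex) \<Rightarrow> (real \<Rightarrow> complex) \<Rightarrow> (real \<Rightarrow> complex) \<Rightarrow> (real \<Rightarrow> complex) \<Rightarrow> real" where
  "wform b \<psi>1 \<psi>2 y y1 y2 z z1 z2 = integral {0..b} (\<lambda>x.
     inner (y2 x - (2 * \<psi>1 x) *\<^sub>R y1 x + ((\<psi>1 x)\<^sup>2 - \<psi>2 x) *\<^sub>R y x)
       (z2 x + (2 * \<psi>1 x) *\<^sub>R z1 x + ((\<psi>1 x)\<^sup>2 + \<psi>2 x) *\<^sub>R z x))"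

text \<open>On the left stands the integrand of \<open>A\<close> tested against
  \<open>exp (2 * \<psi>) * z\<close>. One factor \<open>exp \<psi>\<close> goes to each side: the
  first vector on the right is \<open>exp \<psi> * d2\<close>, the second is
  \<open>exp (- \<psi>)\<close> times the second derivative of the test function, both rewritten
  through the weighted functions.\<close>

lemma inner_wd2:
  "inner (d2 x) (wd2 (\<lambda>x. 2 * \<psi> x) (\<lambda>x. 2 * \<psi>1 x) (\<lambda>x. 2 * \<psi>2 x) z e1 e2 x) =
     inner (wd2 \<psi> \<psi>1 \<psi>2 v d1 d2 x - (2 * \<psi>1 x) *\<^sub>R wd1 \<psi> \<psi>1 v d1 x + ((\<psi>1 x)\<^sup>2 - \<psi>2 x) *\<^sub>R wd0 \<psi> v x)
       (wd2 \<psi> \<psi>1 \<psi>2 z e1 e2 x + (2 * \<psi>1 x) *\<^sub>R wd1 \<psi> \<psi>1 z e1 x + ((\<psi>1 x)\<^sup>2 + \<psi>2 x) *\<^sub>R wd0 \<psi> z x)"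
proof -
  have "exp (2 * \<psi> x) = exp (\<psi> x) * exp (\<psi> x)" by (simp add: mult_exp_exp)
  moreover have "wd2 \<psi> \<psi>1 \<psi>2 v d1 d2 x - (2 * \<psi>1 x) *\<^sub>R wd1 \<psi> \<psi>1 v d1 x + ((\<psi>1 x)\<^sup>2 - \<psi>2 x) *\<^sub>R wd0 \<psi> v x
      = exp (\<psi> x) *\<^sub>R d2 x"
    by (simp add: wd0_def wd1_def wd2_def complex_eq_iff power2_eq_square algebra_simps)
  moreover have "wd2 \<psi> \<psi>1 \<psi>2 z e1 e2 x + (2 * \<psi>1 x) *\<^sub>R wd1 \<psi> \<psi>1 z e1 x + ((\<psi>1 x)\<^sup>2 + \<psi>2 x) *\<^sub>R wd0 \<psi> z x
      = exp (\<psi> x) *\<^sub>R (e2 x + (4 * \<psi>1 x) *\<^sub>R e1 x + (4 * (\<psi>1 x)\<^sup>2 + 2 * \<psi>2 x) *\<^sub>R z x)"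
    by (simp add: wd0_def wd1_def wd2_def complex_eq_iff power2_eq_square algebra_simps)
  ultimately show ?thesis by (simp add: wd2_def power_mult_distrib)
qed

lemma absolutely_integrable_on_iff_integrable:
  fixes f :: "'a::euclidean_space \<Rightarrow> 'b::euclidean_space"
  assumes "S \<in> sets lebesgue"
  shows "f absolutely_integrable_on S \<longleftrightarrow> integrable (lebesgue_on S) f"
  using assms by (simp add: set_integrable_def integrable_restrict_space)

lemma H4_rep_C2:
  assumes "H4_rep b v d1 d2 d3 g"
  shows "C2_on_interval b v d1 d2"
proof
  have d2: "(d2 has_vector_derivative d3 x) (at x within {0..b})" if "x \<in> {0..b}" for x
    using assms that unfolding H4_rep_def by blast
  show "continuous_on {0..b} d2"
    by (rule continuous_on_vector_derivative[OF d2])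
qed (use assms in \<open>unfold H4_rep_def, blast+\<close>)

lemma square_integrable_imp_integrable:
  fixes g :: "real \<Rightarrow> complex"
  assumes "g \<in> borel_measurable (lebesgue_on {a..b})"
    "integrable (lebesgue_on {a..b}) (\<lambda>x. (norm (g x))\<^sup>2)"
  shows "integrable (lebesgue_on {a..b}) g"
proof (rule Bochner_Integration.integrable_bound)
  show "integrable (lebesgue_on {a..b}) (\<lambda>x. 1 + (norm (g x))\<^sup>2)"
    using assms finite_measure.integrable_const[OF finite_measure_lebesgue_on, of "{a..b}" "1::real"] by simp
  have "t \<le> 1 + t\<^sup>2" for t :: real
    using sum_squares_bound[of t 1] zero_le_power2[of t] by (smt (verit) one_power2)
  then show "AE x in lebesgue_on {a..b}. norm (g x) \<le> norm (1 + (norm (g x))\<^sup>2)" by (auto intro!: AE_I2)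
qed fact

text \<open>Two integrations by parts; the first needs the version for indefinite integrals, because
  \<open>d3\<close> is only absolutely continuous.\<close>

lemma H4_rep_Green:
  assumes H: "H4_rep b v d1 d2 d3 g" and b: "0 < b" and \<theta>: "C2_on_interval b \<theta> \<theta>1 \<theta>2"
  shows "(\<integral>x. inner (g x) (\<theta> x) \<partial>lebesgue_on {0..b}) =
    inner (d3 b) (\<theta> b) - inner (d3 0) (\<theta> 0) - inner (d2 b) (\<theta>1 b) + inner (d2 0) (\<theta>1 0)
      + integral {0..b} (\<lambda>x. inner (d2 x) (\<theta>2 x))"
proof -
  interpret \<theta>: C2_on_interval b \<theta> \<theta>1 \<theta>2 by fact
  have gm: "g \<in> borel_measurable (lebesgue_on {0..b})" "integrable (lebesgue_on {0..b}) (\<lambda>x. (norm (g x))\<^sup>2)"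
    and d3: "\<And>x. x \<in> {0..b} \<Longrightarrow> d3 x = d3 0 + integral {0..x} g"
    using H unfolding H4_rep_def by blast+
  have d2: "(d2 has_vector_derivative d3 x) (at x within {0..b})" if "x \<in> {0..b}" for x
    using H that unfolding H4_rep_def by blast
  have cont_d2: "continuous_on {0..b} d2"
    by (rule continuous_on_vector_derivative[OF d2])
  have gi: "g absolutely_integrable_on {0..b}"
    using square_integrable_imp_integrable[OF gm] by (simp add: absolutely_integrable_on_iff_integrable)
  have "((\<lambda>x. inner (g x) (\<theta> x)) has_integral
    inner (d3 b) (\<theta> b) - inner (d3 0) (\<theta> 0) - integral {0..b} (\<lambda>x. inner (d3 x) (\<theta>1 x))) {0..b}"
    by (rule integration_by_parts_indefinite_integral[OF gi d3 \<theta>.y \<theta>.cont_y1 less_imp_le[OF b]])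
  moreover have "((\<lambda>x. inner (d3 x) (\<theta>1 x)) has_integral
     inner (d2 b) (\<theta>1 b) - inner (d2 0) (\<theta>1 0) - integral {0..b} (\<lambda>x. inner (d2 x) (\<theta>2 x))) {0..b}"
  proof (rule integration_by_parts_interior[OF bounded_bilinear_inner _ cont_d2 \<theta>.cont_y1])
    fix x assume x: "x \<in> {0<..<b}"
    then have "x \<in> {0..b}" "at x within {0..b} = at x" by (auto simp: at_within_Icc_at)
    then show "(d2 has_vector_derivative d3 x) (at x)" "(\<theta>1 has_vector_derivative \<theta>2 x) (at x)"
      using d2[of x] \<theta>.y1[of x] by auto
  next
    show "((\<lambda>x. inner (d2 x) (\<theta>2 x)) has_integral inner (d2 b) (\<theta>1 b) - inner (d2 0) (\<theta>1 0) -
      (inner (d2 b) (\<theta>1 b) - inner (d2 0) (\<theta>1 0) - integral {0..b} (\<lambda>x. inner (d2 x) (\<theta>2 x)))) {0..b}"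
      by (auto intro!: integrable_integral integrable_continuous_real continuous_intros cont_d2 \<theta>.cont_y2)
  qed (use b in auto)
  ultimately have "integral {0..b} (\<lambda>x. inner (g x) (\<theta> x)) =
    inner (d3 b) (\<theta> b) - inner (d3 0) (\<theta> 0) - inner (d2 b) (\<theta>1 b) + inner (d2 0) (\<theta>1 0)
      + integral {0..b} (\<lambda>x. inner (d2 x) (\<theta>2 x))"
    by (simp add: integral_unique)
  moreover have "(\<lambda>x. inner (\<theta> x) (g x)) absolutely_integrable_on {0..b}"
    by (rule absolutely_integrable_bounded_measurable_product[OF bilinear_inner])
      (auto intro!: gi compact_imp_bounded compact_continuous_image \<theta>.cont_y
        continuous_imp_measurable_on_sets_lebesgue)
  then have "integrable (lebesgue_on {0..b}) (\<lambda>x. inner (g x) (\<theta> x))"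
    by (simp add: absolutely_integrable_on_iff_integrable inner_commute)
  ultimately show ?thesis by (simp add: lebesgue_integral_eq_integral)
qed

text \<open>A weight varying on the length scale \<open>r\<close>: each derivative of
  \<open>\<psi>\<close> costs \<open>1 / r\<close>, so all terms created by conjugation are
  comparable to \<open>energy\<close>. The condition \<open>r \<le> b\<close> admits
  \<open>s = r\<close> in the interpolation inequalities.\<close>

locale weighted_edge =
  fixes b r :: real and \<psi>1 \<psi>2 :: "real \<Rightarrow> real"
  assumes r: "0 < r" "r \<le> b"
    and \<psi>_bounds: "\<And>x. x \<in> {0..b} \<Longrightarrow> \<bar>\<psi>1 x\<bar> \<le> 1 / r" "\<And>x. x \<in> {0..b} \<Longrightarrow> \<bar>\<psi>2 x\<bar> \<le> 2 / r\<^sup>2"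
    and \<psi>_cont: "continuous_on {0..b} \<psi>1" "continuous_on {0..b} \<psi>2"
begin

definition energy :: "(real \<Rightarrow> complex) \<Rightarrow> (real \<Rightarrow> complex) \<Rightarrow> real" where
  "energy y y2 = integral {0..b} (\<lambda>x. (norm (y2 x))\<^sup>2) + integral {0..b} (\<lambda>x. (norm (y x))\<^sup>2) / r ^ 4"

lemma energy_bounds:
  assumes "C2_on_interval b y y1 y2"
  shows "0 \<le> energy y y2"
    and "integral {0..b} (\<lambda>x. (norm (y x))\<^sup>2) \<le> r ^ 4 * energy y y2"
    and "integral {0..b} (\<lambda>x. (norm (y1 x))\<^sup>2) \<le> 521 * r\<^sup>2 * energy y y2"
    and "x \<in> {0..b} \<Longrightarrow> (norm (y x))\<^sup>2 \<le> 294 * r ^ 3 * energy y y2"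
    and "x \<in> {0..b} \<Longrightarrow> (norm (y1 x))\<^sup>2 \<le> 216 * r * energy y y2"
proof -
  interpret C2_on_interval b y y1 y2 by fact
  define P where "P = I0 / r ^ 4"
  have P: "0 \<le> P" "0 \<le> I2" "I0 = r ^ 4 * P" "energy y y2 = I2 + P"
    using I_nonneg r by (auto simp: P_def energy_def)
  show "0 \<le> energy y y2" using P by simp
  show "I0 \<le> r ^ 4 * energy y y2" using P r by simp
  have "I1 \<le> 521 / r\<^sup>2 * I0 + 11 * r\<^sup>2 * I2" by (rule I1_le[OF r])
  also have "\<dots> = r\<^sup>2 * (521 * P + 11 * I2)" unfolding P(3) using r by (simp add: eval_nat_numeral algebra_simps)
  also have "\<dots> \<le> r\<^sup>2 * (521 * energy y y2)" using P by (intro mult_left_mono) auto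
  finally show "I1 \<le> 521 * r\<^sup>2 * energy y y2" by simp
  assume x: "x \<in> {0..b}"
  have "(norm (y x))\<^sup>2 \<le> 294 / r * I0 + 8 * r ^ 3 * I2" by (rule sup_bounds[OF r x])
  also have "\<dots> = r ^ 3 * (294 * P + 8 * I2)" unfolding P(3) using r by (simp add: eval_nat_numeral algebra_simps)
  also have "\<dots> \<le> r ^ 3 * (294 * energy y y2)" using P r by (intro mult_left_mono) auto
  finally show "(norm (y x))\<^sup>2 \<le> 294 * r ^ 3 * energy y y2" by simp
  have "(norm (y1 x))\<^sup>2 \<le> 216 / r ^ 3 * I0 + 2 * r * I2" by (rule sup_bounds[OF r x])
  also have "\<dots> = r * (216 * P + 2 * I2)" unfolding P(3) using r by (simp add: eval_nat_numeral algebra_simps)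
  also have "\<dots> \<le> r * (216 * energy y y2)" using P r by (intro mult_left_mono) auto
  finally show "(norm (y1 x))\<^sup>2 \<le> 216 * r * energy y y2" by simp
qed

lemma coefficient_bounds:
  assumes "x \<in> {0..b}"
  shows "(\<psi>1 x)\<^sup>2 \<le> 1 / r\<^sup>2" "\<bar>(\<psi>1 x)\<^sup>2 - \<psi>2 x\<bar> \<le> 3 / r\<^sup>2" "\<bar>(\<psi>1 x)\<^sup>2 + \<psi>2 x\<bar> \<le> 3 / r\<^sup>2"
    "2 * \<bar>\<psi>1 x\<bar> \<le> 2 / r"
proof -
  have "(\<bar>\<psi>1 x\<bar>)\<^sup>2 \<le> (1 / r)\<^sup>2" using \<psi>_bounds(1)[OF assms] by (intro power_mono) auto
  then show 1: "(\<psi>1 x)\<^sup>2 \<le> 1 / r\<^sup>2" by (simp add: power_divide)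
  have "3 / r\<^sup>2 = 1 / r\<^sup>2 + 2 / r\<^sup>2" by simp
  then show "\<bar>(\<psi>1 x)\<^sup>2 - \<psi>2 x\<bar> \<le> 3 / r\<^sup>2" "\<bar>(\<psi>1 x)\<^sup>2 + \<psi>2 x\<bar> \<le> 3 / r\<^sup>2"
    using 1 \<psi>_bounds(2)[OF assms] zero_le_power2[of "\<psi>1 x"] by linarith+
  show "2 * \<bar>\<psi>1 x\<bar> \<le> 2 / r" using \<psi>_bounds(1)[OF assms] by simp
qed

text \<open>The square of a sum of three terms is at most three times the sum of the squares; the
  terms then contribute 3, 12 * 521 and 27 energies, in total 6282.\<close>

lemma conjugated_second_derivative_bound:
  assumes C2: "C2_on_interval b y y1 y2"
    and \<alpha>: "\<And>x. x \<in> {0..b} \<Longrightarrow> \<bar>\<alpha> x\<bar> \<le> 2 / r" "continuous_on {0..b} \<alpha>"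
    and \<beta>: "\<And>x. x \<in> {0..b} \<Longrightarrow> \<bar>\<beta> x\<bar> \<le> 3 / r\<^sup>2" "continuous_on {0..b} \<beta>"
  shows "integral {0..b} (\<lambda>x. (norm (y2 x + \<alpha> x *\<^sub>R y1 x + \<beta> x *\<^sub>R y x))\<^sup>2) \<le> 6282 * energy y y2"
proof -
  interpret C2_on_interval b y y1 y2 by fact
  have "integral {0..b} (\<lambda>x. (norm (y2 x + \<alpha> x *\<^sub>R y1 x + \<beta> x *\<^sub>R y x))\<^sup>2)
     \<le> integral {0..b} (\<lambda>x. 3 * (norm (y2 x))\<^sup>2 + 12 / r\<^sup>2 * (norm (y1 x))\<^sup>2 + 27 / r ^ 4 * (norm (y x))\<^sup>2)"
  proof (rule integral_le)
    fix x assume x: "x \<in> {0..b}"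
    have "norm (y2 x + \<alpha> x *\<^sub>R y1 x + \<beta> x *\<^sub>R y x) \<le> norm (y2 x) + 2 / r * norm (y1 x) + 3 / r\<^sup>2 * norm (y x)"
      using mult_right_mono[OF \<alpha>(1)[OF x], of "norm (y1 x)"] mult_right_mono[OF \<beta>(1)[OF x], of "norm (y x)"]
      by (intro order.trans[OF norm_triangle_ineq] add_mono) auto
    then have "(norm (y2 x + \<alpha> x *\<^sub>R y1 x + \<beta> x *\<^sub>R y x))\<^sup>2 \<le> (norm (y2 x) + 2 / r * norm (y1 x) + 3 / r\<^sup>2 * norm (y x))\<^sup>2"
      by (intro power_mono) auto
    also have "\<dots> \<le> 3 * ((norm (y2 x))\<^sup>2 + (2 / r * norm (y1 x))\<^sup>2 + (3 / r\<^sup>2 * norm (y x))\<^sup>2)"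
    proof -
      have "(p + q + s)\<^sup>2 \<le> 3 * (p\<^sup>2 + q\<^sup>2 + s\<^sup>2)" for p q s :: real
        using sum_squares_bound[of p q] sum_squares_bound[of p s] sum_squares_bound[of q s]
        by (simp add: power2_eq_square algebra_simps)
      then show ?thesis .
    qed
    also have "\<dots> = 3 * (norm (y2 x))\<^sup>2 + 12 / r\<^sup>2 * (norm (y1 x))\<^sup>2 + 27 / r ^ 4 * (norm (y x))\<^sup>2"
      by (simp add: power_mult_distrib power_divide)
    finally show "(norm (y2 x + \<alpha> x *\<^sub>R y1 x + \<beta> x *\<^sub>R y x))\<^sup>2 \<le> \<dots>" .
  qed (use r in \<open>auto intro!: integrable_continuous_real continuous_intros \<alpha> \<beta>\<close>)
  also have "\<dots> = 3 * I2 + 12 / r\<^sup>2 * I1 + 27 / r ^ 4 * I0"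
    using r by (simp add: integral_add integrable_continuous_real continuous_intros)
  also have "\<dots> \<le> 3 * energy y y2 + 12 / r\<^sup>2 * (521 * r\<^sup>2 * energy y y2) + 27 / r ^ 4 * (r ^ 4 * energy y y2)"
    using energy_bounds[OF C2] r I_nonneg
    by (intro add_mono mult_left_mono) (auto simp: energy_def)
  also have "\<dots> = 6282 * energy y y2" using r by simp
  finally show ?thesis .
qed

lemma wform_bound:
  assumes y: "C2_on_interval b y y1 y2" and z: "C2_on_interval b z z1 z2" and s: "0 < s"
  shows "2 * \<bar>wform b \<psi>1 \<psi>2 y y1 y2 z z1 z2\<bar> \<le> s * (6282 * energy y y2) + (6282 * energy z z2) / s"
proof -
  interpret y: C2_on_interval b y y1 y2 by fact
  interpret z: C2_on_interval b z z1 z2 by fact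
  define A where "A x = y2 x + (- 2 * \<psi>1 x) *\<^sub>R y1 x + ((\<psi>1 x)\<^sup>2 - \<psi>2 x) *\<^sub>R y x" for x
  define B where "B x = z2 x + (2 * \<psi>1 x) *\<^sub>R z1 x + ((\<psi>1 x)\<^sup>2 + \<psi>2 x) *\<^sub>R z x" for x
  have cont: "continuous_on {0..b} A" "continuous_on {0..b} B"
    unfolding A_def B_def by (intro continuous_intros y.conts z.conts \<psi>_cont)+
  have "integral {0..b} (\<lambda>x. (norm (A x))\<^sup>2) \<le> 6282 * energy y y2"
    unfolding A_def
    by (rule conjugated_second_derivative_bound[OF y])
      (use coefficient_bounds in \<open>auto intro!: continuous_intros \<psi>_cont simp: abs_mult\<close>)
  moreover have "integral {0..b} (\<lambda>x. (norm (B x))\<^sup>2) \<le> 6282 * energy z z2"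
    unfolding B_def
    by (rule conjugated_second_derivative_bound[OF z])
      (use coefficient_bounds in \<open>auto intro!: continuous_intros \<psi>_cont simp: abs_mult\<close>)
  moreover have "\<bar>integral {0..b} (\<lambda>x. inner (A x) (B x))\<bar>
     \<le> integral {0..b} (\<lambda>x. s / 2 * (norm (A x))\<^sup>2 + 1 / (2 * s) * (norm (B x))\<^sup>2)"
    unfolding real_norm_def[symmetric]
  proof (rule integral_norm_bound_integral)
    fix x
    have "2 * \<bar>inner (A x) (B x)\<bar> \<le> 2 * (sqrt s * norm (A x)) * (norm (B x) / sqrt s)"
      using Cauchy_Schwarz_ineq2[of "A x" "B x"] s by simp
    also have "\<dots> \<le> (sqrt s * norm (A x))\<^sup>2 + (norm (B x) / sqrt s)\<^sup>2" by (rule sum_squares_bound)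
    finally show "norm (inner (A x) (B x)) \<le> s / 2 * (norm (A x))\<^sup>2 + 1 / (2 * s) * (norm (B x))\<^sup>2"
      using s by (simp add: power_mult_distrib power_divide)
  qed (use s in \<open>auto intro!: integrable_continuous_real continuous_intros cont\<close>)
  moreover have "integral {0..b} (\<lambda>x. s / 2 * (norm (A x))\<^sup>2 + 1 / (2 * s) * (norm (B x))\<^sup>2)
      = s / 2 * integral {0..b} (\<lambda>x. (norm (A x))\<^sup>2) + 1 / (2 * s) * integral {0..b} (\<lambda>x. (norm (B x))\<^sup>2)"
    using s by (simp add: integral_add integrable_continuous_real continuous_intros cont)
  moreover have "wform b \<psi>1 \<psi>2 y y1 y2 z z1 z2 = integral {0..b} (\<lambda>x. inner (A x) (B x))"
    by (simp add: wform_def A_def B_def)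
  ultimately have "\<bar>wform b \<psi>1 \<psi>2 y y1 y2 z z1 z2\<bar> \<le> s / 2 * (6282 * energy y y2) + 1 / (2 * s) * (6282 * energy z z2)"
    using s by (smt (verit) mult_left_mono zero_le_divide_1_iff divide_nonneg_nonneg)
  then show ?thesis using s by (simp add: field_simps)
qed

text \<open>The constant is \<open>816951 = 8 * 521 * 14\<^sup>2 + 22 + 1\<close>: the first derivative is interpolated at the scale
  \<open>r / 14\<close>, so that it costs at most half of the second derivative.\<close>
lemma wform_coercive:
  assumes y: "C2_on_interval b y y1 y2"
  shows "energy y y2 / 4 \<le> wform b \<psi>1 \<psi>2 y y1 y2 y y1 y2 + 816951 / r ^ 4 * integral {0..b} (\<lambda>x. (norm (y x))\<^sup>2)"
proof -
  interpret C2_on_interval b y y1 y2 by fact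
  have "integral {0..b} (\<lambda>x. 3 / 4 * (norm (y2 x))\<^sup>2 - 8 / r\<^sup>2 * (norm (y1 x))\<^sup>2 - 22 / r ^ 4 * (norm (y x))\<^sup>2)
      \<le> wform b \<psi>1 \<psi>2 y y1 y2 y y1 y2"
    unfolding wform_def
  proof (rule integral_le)
    fix x assume x: "x \<in> {0..b}"
    define p where "p = (2 * \<psi>1 x) *\<^sub>R y1 x"
    define a where "a = norm (y2 x)"
    define q where "q = norm (y x) / r\<^sup>2"
    define q1 where "q1 = norm (y1 x) / r"
    \<comment> \<open>The two conjugated second derivatives are \<open>y2 - A\<close> and
      \<open>y2 + B\<close>. In their product \<open>y2\<close> meets only \<open>B - A\<close>,
      from which \<open>y1\<close> cancels; first derivatives survive only in
      \<open>inner A B\<close>. Hence 8 = 2 * 4 and 22 = 2 * 9 + 4, the last 4 from Young's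
      inequality for the term with \<open>B - A\<close>.\<close>
    define A where "A = p - ((\<psi>1 x)\<^sup>2 - \<psi>2 x) *\<^sub>R y x"
    define B where "B = p + ((\<psi>1 x)\<^sup>2 + \<psi>2 x) *\<^sub>R y x"
    have q: "0 \<le> q" "0 \<le> q1" "0 \<le> a" using r by (auto simp: q_def q1_def a_def)
    note cb = coefficient_bounds[OF x]
    have np: "norm p \<le> 2 * q1"
      using mult_right_mono[OF \<psi>_bounds(1)[OF x], of "norm (y1 x)"] by (simp add: p_def q1_def abs_mult)
    have nA: "norm A \<le> 2 * q1 + 3 * q"
      unfolding A_def using np mult_right_mono[OF cb(2), of "norm (y x)"]
      by (intro order.trans[OF norm_triangle_ineq4]) (simp add: q_def)
    have nB: "norm B \<le> 2 * q1 + 3 * q"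
      unfolding B_def using np mult_right_mono[OF cb(3), of "norm (y x)"]
      by (intro order.trans[OF norm_triangle_ineq]) (simp add: q_def)
    have AB: "\<bar>inner A B\<bar> \<le> (2 * q1 + 3 * q) * (2 * q1 + 3 * q)"
      using Cauchy_Schwarz_ineq2[of A B] mult_mono[OF nA nB] q by (simp del: mult_mono)
    have BA: "B - A = (2 * (\<psi>1 x)\<^sup>2) *\<^sub>R y x" by (simp add: A_def B_def algebra_simps scaleR_2[symmetric])
    have "norm (B - A) \<le> 2 * q"
      using mult_right_mono[OF cb(1), of "norm (y x)"] by (simp add: BA q_def)
    then have yBA: "\<bar>inner (y2 x) (B - A)\<bar> \<le> a * (2 * q)"
      using Cauchy_Schwarz_ineq2[of "y2 x" "B - A"] mult_left_mono[of "norm (B - A)" "2 * q" a] q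
      by (simp add: a_def)
    have "3 / 4 * a\<^sup>2 - 8 * q1\<^sup>2 - 22 * q\<^sup>2 \<le> a\<^sup>2 - a * (2 * q) - (2 * q1 + 3 * q) * (2 * q1 + 3 * q)"
      using sum_squares_bound[of "a / 2" "2 * q"] sum_squares_bound[of "2 * q1" "3 * q"]
      by (simp add: power2_eq_square algebra_simps)
    also have "\<dots> \<le> inner (y2 x) (y2 x) + inner (y2 x) (B - A) - inner A B"
      using AB yBA by (simp add: a_def power2_norm_eq_inner)
    also have "\<dots> = inner (y2 x - A) (y2 x + B)" by (simp add: algebra_simps inner_commute)
    also have "y2 x - A = y2 x - (2 * \<psi>1 x) *\<^sub>R y1 x + ((\<psi>1 x)\<^sup>2 - \<psi>2 x) *\<^sub>R y x" by (simp add: A_def p_def)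
    also have "y2 x + B = y2 x + (2 * \<psi>1 x) *\<^sub>R y1 x + ((\<psi>1 x)\<^sup>2 + \<psi>2 x) *\<^sub>R y x" by (simp add: B_def p_def)
    finally show "3 / 4 * (norm (y2 x))\<^sup>2 - 8 / r\<^sup>2 * (norm (y1 x))\<^sup>2 - 22 / r ^ 4 * (norm (y x))\<^sup>2 \<le>
      inner (y2 x - (2 * \<psi>1 x) *\<^sub>R y1 x + ((\<psi>1 x)\<^sup>2 - \<psi>2 x) *\<^sub>R y x)
       (y2 x + (2 * \<psi>1 x) *\<^sub>R y1 x + ((\<psi>1 x)\<^sup>2 + \<psi>2 x) *\<^sub>R y x)"
      by (simp add: a_def q1_def q_def power_divide)
  qed (use r in \<open>auto intro!: integrable_continuous_real continuous_intros \<psi>_cont\<close>)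
  moreover have "integral {0..b} (\<lambda>x. 3 / 4 * (norm (y2 x))\<^sup>2 - 8 / r\<^sup>2 * (norm (y1 x))\<^sup>2 - 22 / r ^ 4 * (norm (y x))\<^sup>2)
      = 3 / 4 * I2 - 8 * (I1 / r\<^sup>2) - 22 * (I0 / r ^ 4)"
    using r by (simp add: integral_diff integrable_continuous_real continuous_intros)
  moreover have "8 * (I1 / r\<^sup>2) \<le> 1 / 2 * I2 + 816928 * (I0 / r ^ 4)"
  proof -
    have "I1 \<le> 521 / (r / 14)\<^sup>2 * I0 + 11 * (r / 14)\<^sup>2 * I2" by (rule I1_le) (use r in auto)
    then have "8 / r\<^sup>2 * I1 \<le> 8 / r\<^sup>2 * (521 / (r / 14)\<^sup>2 * I0 + 11 * (r / 14)\<^sup>2 * I2)"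
      by (rule mult_left_mono) simp
    also have "\<dots> = 816928 / r ^ 4 * I0 + 88 / 196 * I2"
      using r by (simp add: power_divide field_simps eval_nat_numeral)
    also have "\<dots> \<le> 816928 / r ^ 4 * I0 + 1 / 2 * I2" using I_nonneg by simp
    finally show ?thesis by simp
  qed
  moreover have "0 \<le> I0 / r ^ 4" using I_nonneg by simp
  ultimately have "1 / 4 * I2 + 1 / 4 * (I0 / r ^ 4)
      \<le> wform b \<psi>1 \<psi>2 y y1 y2 y y1 y2 + 816951 * (I0 / r ^ 4)"
    by linarith
  then show ?thesis by (simp add: energy_def)
qed

end

section \<open>Weights and elliptic estimates\<close>

definition sabs :: "real \<Rightarrow> real \<Rightarrow> real" where
  "sabs r x = sqrt (r\<^sup>2 + x\<^sup>2)"

lemma sabs_bounds: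
  assumes "0 < r"
  shows "0 < sabs r x" "r \<le> sabs r x" "\<bar>x\<bar> \<le> sabs r x" "sabs r x \<le> \<bar>x\<bar> + r"
proof -
  show "r \<le> sabs r x" "\<bar>x\<bar> \<le> sabs r x" using assms by (auto simp: sabs_def intro!: real_le_rsqrt)
  then show "0 < sabs r x" using assms by linarith
  show "sabs r x \<le> \<bar>x\<bar> + r"
    unfolding sabs_def by (rule real_le_lsqrt) (use assms in \<open>auto simp: power2_sum\<close>)
qed

lemma sabs_squared: "(sabs r x)\<^sup>2 = r\<^sup>2 + x\<^sup>2"
  by (simp add: sabs_def)

lemma sabs_deriv:
  assumes "0 < r"
  shows "(sabs r has_real_derivative x / sabs r x) (at x within S)"
proof -
  have "0 < r\<^sup>2 + x\<^sup>2" using assms by (simp add: add_pos_nonneg)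
  then show ?thesis unfolding sabs_def[abs_def]
    by (auto intro!: derivative_eq_intros simp: field_simps)
qed

lemma sabs_deriv2:
  assumes "0 < r"
  shows "((\<lambda>x. x / sabs r x) has_real_derivative r\<^sup>2 / (sabs r x) ^ 3) (at x within S)"
proof -
  have pos: "0 < sabs r x" by (rule sabs_bounds[OF assms])
  have "((\<lambda>x. x / sabs r x) has_real_derivative (1 * sabs r x - x * (x / sabs r x)) / (sabs r x * sabs r x)) (at x within S)"
    by (rule DERIV_divide[OF DERIV_ident sabs_deriv[OF assms]]) (use pos in simp)
  also have "(1 * sabs r x - x * (x / sabs r x)) / (sabs r x * sabs r x) = ((sabs r x)\<^sup>2 - x\<^sup>2) / (sabs r x) ^ 3"
    using pos by (simp add: field_simps eval_nat_numeral)
  finally show ?thesis by (simp add: sabs_squared)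
qed

lemma sabs_deriv_bounds:
  assumes "0 < r"
  shows "\<bar>x / sabs r x\<bar> \<le> 1" "0 \<le> r\<^sup>2 / (sabs r x) ^ 3" "r\<^sup>2 / (sabs r x) ^ 3 \<le> 1 / r"
proof -
  note b = sabs_bounds[OF assms, of x]
  show "\<bar>x / sabs r x\<bar> \<le> 1" using b by simp
  show "0 \<le> r\<^sup>2 / (sabs r x) ^ 3" using b by simp
  have "r ^ 3 \<le> (sabs r x) ^ 3" using b assms by (intro power_mono) auto
  then have "r\<^sup>2 * r \<le> (sabs r x) ^ 3" by (simp add: eval_nat_numeral)
  then show "r\<^sup>2 / (sabs r x) ^ 3 \<le> 1 / r" using b assms by (simp add: field_simps)
qed

text \<open>Distance to the endpoints of \<open>[0, L]\<close>, smoothed at scale \<open>r\<close> both at the midpoint (by the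
  inner \<open>sabs\<close>) and at the endpoints (by the outer one), where its derivative vanishes.\<close>
definition bump :: "real \<Rightarrow> real \<Rightarrow> real \<Rightarrow> real" where
  "bump r L x = sabs r (L / 2) - sabs r (x - L / 2)"

definition enddist :: "real \<Rightarrow> real \<Rightarrow> real \<Rightarrow> real" where
  "enddist r L x = sabs r (bump r L x)"

definition bump1 :: "real \<Rightarrow> real \<Rightarrow> real \<Rightarrow> real" where
  "bump1 r L x = - ((x - L / 2) / sabs r (x - L / 2))"

definition bump2 :: "real \<Rightarrow> real \<Rightarrow> real \<Rightarrow> real" where
  "bump2 r L x = - (r\<^sup>2 / (sabs r (x - L / 2)) ^ 3)"

definition enddist1 :: "real \<Rightarrow> real \<Rightarrow> real \<Rightarrow> real" where
  "enddist1 r L x = bump r L x / sabs r (bump r L x) * bump1 r L x"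

definition enddist2 :: "real \<Rightarrow> real \<Rightarrow> real \<Rightarrow> real" where
  "enddist2 r L x = r\<^sup>2 / (sabs r (bump r L x)) ^ 3 * (bump1 r L x)\<^sup>2
     + bump r L x / sabs r (bump r L x) * bump2 r L x"

lemma bump_deriv:
  assumes "0 < r"
  shows "(bump r L has_real_derivative bump1 r L x) (at x within S)"
    "(bump1 r L has_real_derivative bump2 r L x) (at x within S)"
proof -
  have lin: "((\<lambda>x. x - L / 2) has_real_derivative 1) (at x within S)"
    by (auto intro!: derivative_eq_intros)
  note 1 = DERIV_chain2[OF sabs_deriv[OF assms, where S=UNIV] lin]
  note 2 = DERIV_chain2[OF sabs_deriv2[OF assms, where S=UNIV] lin]
  show "(bump r L has_real_derivative bump1 r L x) (at x within S)"
    unfolding bump_def[abs_def] bump1_def by (rule DERIV_cong[OF DERIV_diff[OF DERIV_const 1]]) simp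
  show "(bump1 r L has_real_derivative bump2 r L x) (at x within S)"
    unfolding bump1_def[abs_def] bump2_def by (rule DERIV_cong[OF DERIV_minus[OF 2]]) simp
qed

lemma enddist_deriv:
  assumes "0 < r"
  shows "(enddist r L has_real_derivative enddist1 r L x) (at x within S)"
    "(enddist1 r L has_real_derivative enddist2 r L x) (at x within S)"
proof -
  note b = bump_deriv[OF assms, of L x S]
  note 1 = DERIV_chain2[OF sabs_deriv[OF assms, where S=UNIV] b(1)]
  note 2 = DERIV_chain2[OF sabs_deriv2[OF assms, where S=UNIV] b(1)]
  show "(enddist r L has_real_derivative enddist1 r L x) (at x within S)"
    unfolding enddist_def[abs_def] enddist1_def by (rule 1)
  show "(enddist1 r L has_real_derivative enddist2 r L x) (at x within S)"
    unfolding enddist1_def[abs_def] enddist2_def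
    by (rule DERIV_cong[OF DERIV_mult[OF 2 b(2)]]) (simp add: power2_eq_square ac_simps)
qed

lemma enddist_deriv_bounds:
  assumes "0 < r"
  shows "\<bar>enddist1 r L x\<bar> \<le> 1" "\<bar>enddist2 r L x\<bar> \<le> 2 / r"
proof -
  note 1 = sabs_deriv_bounds[OF assms, of "bump r L x"] and 2 = sabs_deriv_bounds[OF assms, of "x - L / 2"]
  have b1: "\<bar>bump1 r L x\<bar> \<le> 1" and b2: "\<bar>bump2 r L x\<bar> \<le> 1 / r"
    using 2 by (auto simp: bump1_def bump2_def)
  show "\<bar>enddist1 r L x\<bar> \<le> 1"
    unfolding enddist1_def abs_mult using mult_mono[OF 1(1) b1] by simp
  have "(bump1 r L x)\<^sup>2 \<le> 1" using b1 by (simp add: abs_square_le_1)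
  then have "\<bar>r\<^sup>2 / (sabs r (bump r L x)) ^ 3 * (bump1 r L x)\<^sup>2\<bar> \<le> 1 / r * 1"
    unfolding abs_mult using 1 assms by (intro mult_mono) auto
  moreover have "\<bar>bump r L x / sabs r (bump r L x) * bump2 r L x\<bar> \<le> 1 * (1 / r)"
    unfolding abs_mult using 1 b2 by (intro mult_mono) auto
  moreover have "2 / r = 1 / r * 1 + 1 * (1 / r)" by simp
  ultimately show "\<bar>enddist2 r L x\<bar> \<le> 2 / r" unfolding enddist2_def by linarith
qed

lemma enddist_ends:
  "0 < r \<Longrightarrow> enddist r L 0 = r" "0 < r \<Longrightarrow> enddist r L L = r" "enddist1 r L 0 = 0" "enddist1 r L L = 0"
  by (simp_all add: enddist_def enddist1_def bump_def) (simp_all add: sabs_def power2_eq_square)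

text \<open>The two inner \<open>sabs\<close> err by amounts in \<open>[0, r]\<close> that enter
  with opposite signs, so \<open>bump\<close> is off by at most \<open>r\<close>. The outer
  \<open>sabs\<close> adds at most \<open>r\<close>, as \<open>bump\<close> is nonnegative on the
  edge.\<close>

lemma enddist_approx:
  assumes "0 < r" "x \<in> {0..L}"
  shows "\<bar>enddist r L x - min x (L - x)\<bar> \<le> 2 * r"
proof -
  have m: "min x (L - x) = L / 2 - \<bar>x - L / 2\<bar>" by (auto simp: min_def abs_if field_simps)
  note b = sabs_bounds[OF assms(1)]
  have "\<bar>x - L / 2\<bar> \<le> \<bar>L / 2\<bar>" using assms(2) by (auto simp: abs_if field_simps)
  then have "sabs r (x - L / 2) \<le> sabs r (L / 2)"
    unfolding sabs_def by (intro real_sqrt_le_mono add_left_mono abs_le_square_iff[THEN iffD1])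
  then have "0 \<le> bump r L x" by (simp add: bump_def)
  then have "bump r L x \<le> enddist r L x" "enddist r L x \<le> bump r L x + r"
    using b[of "bump r L x"] by (auto simp: enddist_def)
  moreover have "\<bar>bump r L x - (L / 2 - \<bar>x - L / 2\<bar>)\<bar> \<le> r"
    using b[of "L / 2"] b[of "x - L / 2"] assms by (auto simp: bump_def abs_le_iff)
  ultimately show ?thesis unfolding m using assms(1) by (simp add: abs_le_iff)
qed

lemma enddist_cont: "0 < r \<Longrightarrow> continuous_on S (enddist r L)"
  by (rule DERIV_continuous_on[OF enddist_deriv(1)])

lemma enddist_bounds: 
  assumes "0 < r" "x \<in> {0..L}"
  shows "0 \<le> enddist r L x" "enddist r L x \<le> L + 2 * r"
  using enddist_approx[OF assms] sabs_bounds[OF assms(1), of "bump r L x"] assms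
  by (auto simp: enddist_def min_def abs_le_iff split: if_splits)

lemma enddist2_cont:
  assumes "0 < r"
  shows "continuous_on S (enddist2 r L)"
proof -
  have c: "continuous_on S (\<lambda>x. sabs r (f x))" if "continuous_on S f" for f :: "real \<Rightarrow> real" and S
    unfolding sabs_def by (intro continuous_intros that)
  have nz: "sabs r x \<noteq> 0" for x using sabs_bounds(1)[OF assms, of x] by simp
  show ?thesis unfolding enddist2_def bump2_def bump1_def bump_def
    using nz by (intro continuous_intros c) auto
qed

context network
begin

text \<open>The value \<open>c\<close> is shared by all endpoints of all edges and the derivatives
  vanish there: multiplication by \<open>exp \<psi>\<close> then acts on the vector of boundary
  values as the scalar \<open>exp c\<close>, which preserves every subspace
  \<open>Y\<close>.\<close>

definition weight where
  "weight r \<psi> \<psi>1 \<psi>2 c \<longleftrightarrow> (\<forall>k<E.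
     (\<forall>x\<in>{0..l k}. (\<psi> k has_real_derivative \<psi>1 k x) (at x within {0..l k}) \<and>
       (\<psi>1 k has_real_derivative \<psi>2 k x) (at x within {0..l k}) \<and>
       \<bar>\<psi>1 k x\<bar> \<le> 1 / r \<and> \<bar>\<psi>2 k x\<bar> \<le> 2 / r\<^sup>2) \<and> continuous_on {0..l k} (\<psi>2 k) \<and>
     \<psi>1 k 0 = 0 \<and> \<psi>1 k (l k) = 0 \<and> \<psi> k 0 = c \<and> \<psi> k (l k) = c)"
  for \<psi> \<psi>1 \<psi>2 :: "nat \<Rightarrow> real \<Rightarrow> real"

lemma weight_zero: "0 < r \<Longrightarrow> weight r (\<lambda>k x. 0) (\<lambda>k x. 0) (\<lambda>k x. 0) 0"
  by (auto simp: weight_def)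

text \<open>The sign \<open>\<sigma>\<close> selects growth or decay away from the vertices. As
  \<open>enddist\<close> equals \<open>r\<close> at every endpoint, the common value is
  \<open>\<sigma>\<close> itself.\<close>

lemma weight_enddist:
  assumes "0 < r" "\<bar>\<sigma>\<bar> = 1"
  shows "weight r (\<lambda>k x. \<sigma> * enddist r (l k) x / r) (\<lambda>k x. \<sigma> * enddist1 r (l k) x / r)
    (\<lambda>k x. \<sigma> * enddist2 r (l k) x / r) \<sigma>"
  unfolding weight_def
proof (intro allI impI ballI conjI)
  fix k x assume "k < E" and x: "x \<in> {0..l k}"
  note d = enddist_deriv[OF assms(1), of "l k" x "{0..l k}"]
  show "((\<lambda>x. \<sigma> * enddist r (l k) x / r) has_real_derivative \<sigma> * enddist1 r (l k) x / r) (at x within {0..l k})"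
    "((\<lambda>x. \<sigma> * enddist1 r (l k) x / r) has_real_derivative \<sigma> * enddist2 r (l k) x / r) (at x within {0..l k})"
    by (auto intro!: DERIV_cdivide DERIV_cmult d)
  show "\<bar>\<sigma> * enddist1 r (l k) x / r\<bar> \<le> 1 / r" "\<bar>\<sigma> * enddist2 r (l k) x / r\<bar> \<le> 2 / r\<^sup>2"
    using enddist_deriv_bounds[OF assms(1), of "l k" x] assms
      divide_right_mono[OF enddist_deriv_bounds(2)[OF assms(1), of "l k" x], of r]
    by (auto simp: abs_mult power2_eq_square divide_right_mono)
qed (use assms in \<open>auto simp: enddist_ends intro!: continuous_intros enddist2_cont\<close>)

lemma weightD:
  assumes "weight r \<psi> \<psi>1 \<psi>2 c" "k < E"
  shows "\<And>x. x \<in> {0..l k} \<Longrightarrow> (\<psi> k has_real_derivative \<psi>1 k x) (at x within {0..l k})"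
    "\<And>x. x \<in> {0..l k} \<Longrightarrow> (\<psi>1 k has_real_derivative \<psi>2 k x) (at x within {0..l k})"
    "\<And>x. x \<in> {0..l k} \<Longrightarrow> \<bar>\<psi>1 k x\<bar> \<le> 1 / r"
    "\<And>x. x \<in> {0..l k} \<Longrightarrow> \<bar>\<psi>2 k x\<bar> \<le> 2 / r\<^sup>2"
    "continuous_on {0..l k} (\<psi>2 k)"
    "\<psi>1 k 0 = 0" "\<psi>1 k (l k) = 0" "\<psi> k 0 = c" "\<psi> k (l k) = c"
  using assms unfolding weight_def by auto

lemma weight_C2:
  assumes "weight r \<psi> \<psi>1 \<psi>2 c" "k < E" "C2_on_interval (l k) v d1 d2"
  shows "C2_on_interval (l k) (wd0 (\<psi> k) v) (wd1 (\<psi> k) (\<psi>1 k) v d1) (wd2 (\<psi> k) (\<psi>1 k) (\<psi>2 k) v d1 d2)"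
  using C2_exp_scaled[OF assms(3) weightD(1,2,5)[OF assms(1,2)]] .

lemma weight_edge:
  assumes "weight r \<psi> \<psi>1 \<psi>2 c" "k < E" "0 < r" "r \<le> l k"
  shows "weighted_edge (l k) r (\<psi>1 k) (\<psi>2 k)"
  using weightD[OF assms(1,2)] assms(3,4) DERIV_continuous_on[of "{0..l k}" "\<psi>1 k" "\<psi>2 k"]
  by unfold_locales auto

lemma weight_cont:
  assumes "weight r \<psi> \<psi>1 \<psi>2 c" "k < E"
  shows "continuous_on {0..l k} (\<psi> k)"
  using DERIV_continuous_on weightD(1)[OF assms] by blast

lemma admissible_continuous:
  assumes "\<And>k. k < E \<Longrightarrow> continuous_on {0..l k} (w k)"
  shows "admissible w"
  unfolding admissible_def
proof (intro conjI allI impI)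
  fix k assume "k < E"
  then show "w k \<in> borel_measurable (edge k)"
    using assms by (intro continuous_imp_measurable_on_sets_lebesgue) auto
next
  have "\<exists>M. \<forall>x\<in>{0..l k}. \<bar>w k x\<bar> \<le> M" if "k < E" for k
  proof -
    have "bounded (w k ` {0..l k})" using assms[OF that] by (intro compact_imp_bounded compact_continuous_image) auto
    then show ?thesis by (simp add: bounded_iff)
  qed
  then obtain M where M: "\<And>k. k < E \<Longrightarrow> \<forall>x\<in>{0..l k}. \<bar>w k x\<bar> \<le> M k" by metis
  then have "\<forall>k<E. \<forall>x\<in>{0..l k}. \<bar>w k x\<bar> \<le> (\<Sum>k<E. \<bar>M k\<bar>)"
  proof (intro allI impI ballI)
    fix k x assume k: "k < E" and x: "x \<in> {0..l k}"
    have "\<bar>w k x\<bar> \<le> \<bar>M k\<bar>" using M[OF k] x by fastforce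
    also have "\<dots> \<le> (\<Sum>k<E. \<bar>M k\<bar>)" using k by (intro member_le_sum) auto
    finally show "\<bar>w k x\<bar> \<le> (\<Sum>k<E. \<bar>M k\<bar>)" .
  qed
  then show "\<exists>M. \<forall>k<E. \<forall>x\<in>{0..l k}. \<bar>w k x\<bar> \<le> M" by blast
qed

lemma weight_admissible:
  assumes "weight r \<psi> \<psi>1 \<psi>2 c"
  shows "admissible (\<lambda>k x. exp (\<psi> k x))"
  by (rule admissible_continuous) (intro continuous_intros weight_cont[OF assms])

end

section \<open>Green's formula with weights\<close>

context network_semigroup
begin

definition trace01 :: "gfun \<Rightarrow> gfun \<Rightarrow> nat \<Rightarrow> complex" where
  "trace01 v d1 = blocks4 E (\<lambda>k. v k 0) (\<lambda>k. v k (l k)) (\<lambda>k. - d1 k 0) (\<lambda>k. d1 k (l k))"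

definition trace32 :: "gfun \<Rightarrow> gfun \<Rightarrow> nat \<Rightarrow> complex" where
  "trace32 d2 d3 = blocks4 E (\<lambda>k. - d3 k 0) (\<lambda>k. d3 k (l k)) (\<lambda>k. - d2 k 0) (\<lambda>k. - d2 k (l k))"

definition is_rep where
  "is_rep u a v d1 d2 d3 \<longleftrightarrow>
     (\<forall>k<E. H4_rep (l k) (v k) (d1 k) (d2 k) (d3 k) (a k)) \<and> u \<simeq> v \<and>
     trace01 v d1 \<in> Y \<and> (\<lambda>i. trace32 d2 d3 i + R (trace01 v d1) i) \<in> corth E Y"

lemma gen_iff_is_rep: "gen u a \<longleftrightarrow> L2 u \<and> (\<exists>v d1 d2 d3. is_rep u a v d1 d2 d3)"
  unfolding A_rel_iff_gen[symmetric] A_rel_def is_rep_def trace01_def trace32_def Let_def L2_def ..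

lemma L2_continuous:
  assumes "\<And>k. k < E \<Longrightarrow> continuous_on {0..l k} (v k)"
  shows "L2 v"
  unfolding L2_iff
proof (intro allI impI conjI)
  fix k assume k: "k < E"
  show "v k \<in> borel_measurable (edge k)"
    using assms k by (intro continuous_imp_measurable_on_sets_lebesgue) auto
  show "integrable (edge k) (\<lambda>x. (norm (v k x))\<^sup>2)"
    using assms k by (intro continuous_imp_integrable_real continuous_intros) auto
qed

lemma is_rep_C2: "is_rep u a v d1 d2 d3 \<Longrightarrow> k < E \<Longrightarrow> C2_on_interval (l k) (v k) (d1 k) (d2 k)"
  unfolding is_rep_def using H4_rep_C2 by blast

lemma is_rep_L2: "is_rep u a v d1 d2 d3 \<Longrightarrow> L2 v"
  using C2_on_interval.cont_y is_rep_C2 by (intro L2_continuous) blast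

lemma ip_weighted_rep:
  assumes rep: "is_rep u a v d1 d2 d3" and u: "L2 u" and w: "weight r \<psi> \<psi>1 \<psi>2 c"
  shows "ip (scaled (\<lambda>k x. exp (\<psi> k x)) u) (scaled (\<lambda>k x. exp (\<psi> k x)) u)
    = (\<Sum>k<E. integral {0..l k} (\<lambda>x. (norm (wd0 (\<psi> k) (v k) x))\<^sup>2))"
proof -
  note adm = weight_admissible[OF w]
  have "u \<simeq> v" using rep by (simp add: is_rep_def)
  then have "ip (scaled (\<lambda>k x. exp (\<psi> k x)) u) (scaled (\<lambda>k x. exp (\<psi> k x)) u) =
     ip (scaled (\<lambda>k x. exp (\<psi> k x)) v) (scaled (\<lambda>k x. exp (\<psi> k x)) v)"
    by (intro ip_cong aeq_scaled L2_scaled adm u is_rep_L2[OF rep])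
  also have "\<dots> = (\<Sum>k<E. integral {0..l k} (\<lambda>x. (norm (wd0 (\<psi> k) (v k) x))\<^sup>2))"
    unfolding ip_def
  proof (intro sum.cong refl)
    fix k assume "k \<in> {..<E}"
    then have k: "k < E" by simp
    interpret y: C2_on_interval "l k" "wd0 (\<psi> k) (v k)" "wd1 (\<psi> k) (\<psi>1 k) (v k) (d1 k)"
      "wd2 (\<psi> k) (\<psi>1 k) (\<psi>2 k) (v k) (d1 k) (d2 k)"
      by (rule weight_C2[OF w k is_rep_C2[OF rep k]])
    have "(\<lambda>x. inner (scaled (\<lambda>k x. exp (\<psi> k x)) v k x) (scaled (\<lambda>k x. exp (\<psi> k x)) v k x))
       = (\<lambda>x. (norm (wd0 (\<psi> k) (v k) x))\<^sup>2)"
      by (auto simp: scaled_def wd0_def power2_norm_eq_inner[symmetric] norm_mult)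
    moreover have "(\<integral>x. (norm (wd0 (\<psi> k) (v k) x))\<^sup>2 \<partial>edge k)
        = integral {0..l k} (\<lambda>x. (norm (wd0 (\<psi> k) (v k) x))\<^sup>2)"
      by (intro lebesgue_integral_eq_integral continuous_imp_integrable_real continuous_intros y.cont_y) auto
    ultimately show "(\<integral>x. inner (scaled (\<lambda>k x. exp (\<psi> k x)) v k x) (scaled (\<lambda>k x. exp (\<psi> k x)) v k x) \<partial>edge k)
       = integral {0..l k} (\<lambda>x. (norm (wd0 (\<psi> k) (v k) x))\<^sup>2)" by simp
  qed
  finally show ?thesis .
qed

text \<open>\<open>A u\<close> is tested against \<open>exp (2 * \<psi>) * z\<close>. The boundary
  values of this test function are \<open>exp (2 * c)\<close> times those of \<open>\<zeta>\<close>,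
  so they lie in \<open>Y\<close>; orthogonality of \<open>trace32 + R trace01\<close> to
  \<open>Y\<close> then replaces all boundary terms by a single one with \<open>R\<close>.\<close>

lemma Green_weighted:
  assumes u: "is_rep u a v d1 d2 d3" "L2 a" and z: "is_rep z a' \<zeta> e1 e2 e3" "L2 z"
    and w: "weight r \<psi> \<psi>1 \<psi>2 c"
  shows "ip (scaled (\<lambda>k x. exp (\<psi> k x)) a) (scaled (\<lambda>k x. exp (\<psi> k x)) z) =
    (\<Sum>k<E. wform (l k) (\<psi>1 k) (\<psi>2 k)
        (wd0 (\<psi> k) (v k)) (wd1 (\<psi> k) (\<psi>1 k) (v k) (d1 k)) (wd2 (\<psi> k) (\<psi>1 k) (\<psi>2 k) (v k) (d1 k) (d2 k))
        (wd0 (\<psi> k) (\<zeta> k)) (wd1 (\<psi> k) (\<psi>1 k) (\<zeta> k) (e1 k)) (wd2 (\<psi> k) (\<psi>1 k) (\<psi>2 k) (\<zeta> k) (e1 k) (e2 k)))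
    - exp (2 * c) * Re (cinner E (R (trace01 v d1)) (trace01 \<zeta> e1))"
proof -
  note adm = weight_admissible[OF w]
  have "z \<simeq> \<zeta>" using z by (simp add: is_rep_def)
  then have "ip (scaled (\<lambda>k x. exp (\<psi> k x)) a) (scaled (\<lambda>k x. exp (\<psi> k x)) z) =
     ip (scaled (\<lambda>k x. exp (\<psi> k x)) a) (scaled (\<lambda>k x. exp (\<psi> k x)) \<zeta>)"
    by (intro ip_cong aeq_scaled L2_scaled adm u z aeq_refl is_rep_L2[OF z(1)])
  also have "\<dots> = (\<Sum>k<E. wform (l k) (\<psi>1 k) (\<psi>2 k)
        (wd0 (\<psi> k) (v k)) (wd1 (\<psi> k) (\<psi>1 k) (v k) (d1 k)) (wd2 (\<psi> k) (\<psi>1 k) (\<psi>2 k) (v k) (d1 k) (d2 k))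
        (wd0 (\<psi> k) (\<zeta> k)) (wd1 (\<psi> k) (\<psi>1 k) (\<zeta> k) (e1 k)) (wd2 (\<psi> k) (\<psi>1 k) (\<psi>2 k) (\<zeta> k) (e1 k) (e2 k))
      + exp (2 * c) * (inner (d3 k (l k)) (\<zeta> k (l k)) - inner (d3 k 0) (\<zeta> k 0)
          - inner (d2 k (l k)) (e1 k (l k)) + inner (d2 k 0) (e1 k 0)))"
    unfolding ip_def
  proof (intro sum.cong refl)
    fix k assume "k \<in> {..<E}"
    then have k: "k < E" by simp
    have lk: "0 < l k" by (rule lpos[OF k])
    let ?\<theta> = "wd0 (\<lambda>x. 2 * \<psi> k x) (\<zeta> k)" and ?\<theta>1 = "wd1 (\<lambda>x. 2 * \<psi> k x) (\<lambda>x. 2 * \<psi>1 k x) (\<zeta> k) (e1 k)"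
      and ?\<theta>2 = "wd2 (\<lambda>x. 2 * \<psi> k x) (\<lambda>x. 2 * \<psi>1 k x) (\<lambda>x. 2 * \<psi>2 k x) (\<zeta> k) (e1 k) (e2 k)"
    have C2: "C2_on_interval (l k) ?\<theta> ?\<theta>1 ?\<theta>2"
      by (rule C2_exp_scaled[OF is_rep_C2[OF z(1) k]])
        (auto intro!: derivative_eq_intros continuous_intros weightD[OF w k])
    have H: "H4_rep (l k) (v k) (d1 k) (d2 k) (d3 k) (a k)" using u(1) k unfolding is_rep_def by blast
    have "(\<lambda>x. inner (scaled (\<lambda>k x. exp (\<psi> k x)) a k x) (scaled (\<lambda>k x. exp (\<psi> k x)) \<zeta> k x))
       = (\<lambda>x. inner (a k x) (?\<theta> x))"
    proof
      fix x
      have "exp (2 * \<psi> k x) = exp (\<psi> k x) * exp (\<psi> k x)" by (simp add: mult_exp_exp)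
      then show "inner (scaled (\<lambda>k x. exp (\<psi> k x)) a k x) (scaled (\<lambda>k x. exp (\<psi> k x)) \<zeta> k x) = inner (a k x) (?\<theta> x)"
        by (simp only: scaled_def wd0_def complex_inner_mult inner_scaleR_right mult.assoc)
    qed
    then have "(\<integral>x. inner (scaled (\<lambda>k x. exp (\<psi> k x)) a k x) (scaled (\<lambda>k x. exp (\<psi> k x)) \<zeta> k x) \<partial>edge k)
       = (\<integral>x. inner (a k x) (?\<theta> x) \<partial>edge k)" by (rule arg_cong)
    also have "\<dots> = inner (d3 k (l k)) (?\<theta> (l k)) - inner (d3 k 0) (?\<theta> 0) - inner (d2 k (l k)) (?\<theta>1 (l k))
        + inner (d2 k 0) (?\<theta>1 0) + integral {0..l k} (\<lambda>x. inner (d2 k x) (?\<theta>2 x))"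
      by (rule H4_rep_Green[OF H lk C2])
    also have "integral {0..l k} (\<lambda>x. inner (d2 k x) (?\<theta>2 x)) = wform (l k) (\<psi>1 k) (\<psi>2 k)
        (wd0 (\<psi> k) (v k)) (wd1 (\<psi> k) (\<psi>1 k) (v k) (d1 k)) (wd2 (\<psi> k) (\<psi>1 k) (\<psi>2 k) (v k) (d1 k) (d2 k))
        (wd0 (\<psi> k) (\<zeta> k)) (wd1 (\<psi> k) (\<psi>1 k) (\<zeta> k) (e1 k)) (wd2 (\<psi> k) (\<psi>1 k) (\<psi>2 k) (\<zeta> k) (e1 k) (e2 k))"
      unfolding wform_def inner_wd2[of "d2 k" _ "\<psi> k" "\<psi>1 k" "\<psi>2 k" "\<zeta> k" "e1 k" "e2 k" "v k" "d1 k"] ..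
    finally show "(\<integral>x. inner (scaled (\<lambda>k x. exp (\<psi> k x)) a k x) (scaled (\<lambda>k x. exp (\<psi> k x)) \<zeta> k x) \<partial>edge k) =
      wform (l k) (\<psi>1 k) (\<psi>2 k)
        (wd0 (\<psi> k) (v k)) (wd1 (\<psi> k) (\<psi>1 k) (v k) (d1 k)) (wd2 (\<psi> k) (\<psi>1 k) (\<psi>2 k) (v k) (d1 k) (d2 k))
        (wd0 (\<psi> k) (\<zeta> k)) (wd1 (\<psi> k) (\<psi>1 k) (\<zeta> k) (e1 k)) (wd2 (\<psi> k) (\<psi>1 k) (\<psi>2 k) (\<zeta> k) (e1 k) (e2 k))
      + exp (2 * c) * (inner (d3 k (l k)) (\<zeta> k (l k)) - inner (d3 k 0) (\<zeta> k 0)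
          - inner (d2 k (l k)) (e1 k (l k)) + inner (d2 k 0) (e1 k 0))"
      by (simp add: wd0_def wd1_def weightD(6-9)[OF w k] algebra_simps)
  qed
  also have "\<dots> = (\<Sum>k<E. wform (l k) (\<psi>1 k) (\<psi>2 k)
        (wd0 (\<psi> k) (v k)) (wd1 (\<psi> k) (\<psi>1 k) (v k) (d1 k)) (wd2 (\<psi> k) (\<psi>1 k) (\<psi>2 k) (v k) (d1 k) (d2 k))
        (wd0 (\<psi> k) (\<zeta> k)) (wd1 (\<psi> k) (\<psi>1 k) (\<zeta> k) (e1 k)) (wd2 (\<psi> k) (\<psi>1 k) (\<psi>2 k) (\<zeta> k) (e1 k) (e2 k)))
      + exp (2 * c) * (\<Sum>k<E. inner (d3 k (l k)) (\<zeta> k (l k)) - inner (d3 k 0) (\<zeta> k 0)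
          - inner (d2 k (l k)) (e1 k (l k)) + inner (d2 k 0) (e1 k 0))"
    by (subst sum.distrib) (simp only: sum_distrib_left)
  also have "(\<Sum>k<E. inner (d3 k (l k)) (\<zeta> k (l k)) - inner (d3 k 0) (\<zeta> k 0)
          - inner (d2 k (l k)) (e1 k (l k)) + inner (d2 k 0) (e1 k 0))
      = Re (cinner E (trace32 d2 d3) (trace01 \<zeta> e1))"
    unfolding trace32_def trace01_def cinner_blocks4 Re_sum
    by (intro sum.cong refl) (simp add: inner_complex_def)
  also have "\<dots> = - Re (cinner E (R (trace01 v d1)) (trace01 \<zeta> e1))"
  proof -
    have "(\<lambda>i. trace32 d2 d3 i + R (trace01 v d1) i) \<in> corth E Y" "trace01 \<zeta> e1 \<in> Y"
      using u(1) z(1) unfolding is_rep_def by blast+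
    then have "cinner E (\<lambda>i. trace32 d2 d3 i + R (trace01 v d1) i) (trace01 \<zeta> e1) = 0"
      by (simp add: corth_def)
    then have "cinner E (trace32 d2 d3) (trace01 \<zeta> e1) + cinner E (R (trace01 v d1)) (trace01 \<zeta> e1) = 0"
      by (simp add: cinner_def sum.distrib distrib_right)
    then have "Re (cinner E (trace32 d2 d3) (trace01 \<zeta> e1)) + Re (cinner E (R (trace01 v d1)) (trace01 \<zeta> e1)) = 0"
      by (metis plus_complex.sel(1) zero_complex.sel(1))
    then show ?thesis by simp
  qed
  finally show ?thesis by simp
qed

text \<open>With weight zero the form is the squared norm of the second derivative, and
  dissipativity gives the term with \<open>R\<close> the right sign.\<close>

lemma gen_accretive:
  assumes "gen u a"
  shows "0 \<le> ip a u"
proof -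
  obtain v d1 d2 d3 where rep: "is_rep u a v d1 d2 d3" using assms gen_iff_is_rep by blast
  have "0 \<le> wform (l k) (\<lambda>x. 0) (\<lambda>x. 0) y y1 y2 y y1 y2" if "k < E" "continuous_on {0..l k} y2" for k y y1 y2
    unfolding wform_def using that by (auto intro!: integral_nonneg integrable_continuous_real continuous_intros)
  moreover have "continuous_on {0..l k} (wd2 (\<lambda>x. 0) (\<lambda>x. 0) (\<lambda>x. 0) (v k) (d1 k) (d2 k))" if "k < E" for k
    using C2_on_interval.cont_y2[OF is_rep_C2[OF rep that]] by (simp add: wd2_def[abs_def])
  moreover have "0 \<le> - Re (cinner E (R (trace01 v d1)) (trace01 v d1))"
    using R_diss rep by (auto simp: dissipative_def is_rep_def)
  moreover have "scaled (\<lambda>k x. exp 0) z = z" for z by (simp add: scaled_def)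
  moreover note Green_weighted[OF rep gen_L2(2)[OF assms] rep gen_L2(1)[OF assms] weight_zero[OF zero_less_one]]
  ultimately show ?thesis
    by (simp only: mult_zero_right exp_zero mult_1 diff_conv_add_uminus)
      (intro add_nonneg_nonneg sum_nonneg, auto)
qed

end

text \<open>What the energy method needs from the weighted operator. \<open>N u a\<close> plays the
  role of the form norm: up to constants, the L^2 norm of the second derivative of the weighted
  function plus \<open>1 / r\<^sup>2\<close> times that of the function. The powers
  \<open>r\<^sup>2\<close> and \<open>r * sqrt r\<close> are then those of Sobolev scaling, and 18^2
  = 324 exceeds the interpolation constant 294. \<open>N\<close> also takes \<open>a\<close>, since
  a smooth representative is attached to the pair.\<close>

locale weighted_semigroup = network_semigroup +
  fixes w :: "nat \<Rightarrow> real \<Rightarrow> real" and N :: "gfun \<Rightarrow> gfun \<Rightarrow> real" and r M :: real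
  assumes admissible_w: "admissible w" and r: "0 < r" and M: "0 < M"
    and N_nonneg: "gen u a \<Longrightarrow> 0 \<le> N u a"
    and n2_le_N: "gen u a \<Longrightarrow> n2 (scaled w u) \<le> r\<^sup>2 * N u a"
    and sup_le_N: "gen u a \<Longrightarrow> k < E \<Longrightarrow>
      AE x in edge k. norm (scaled w u k x) \<le> 18 * (r * sqrt r) * N u a"
    and coercive: "gen u a \<Longrightarrow> (N u a)\<^sup>2 / 4 \<le>
      ip (scaled w (\<lambda>k x. a k x + of_real (816951 / r ^ 4) * u k x)) (scaled w u)"
    and form_bounded: "gen u a \<Longrightarrow> gen z b \<Longrightarrow>
      \<bar>ip (scaled w (\<lambda>k x. a k x + of_real (816951 / r ^ 4) * u k x)) (scaled w z)\<bar> \<le> M * N u a * N z b"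

context network_semigroup
begin

text \<open>\<open>M\<close> is fixed before \<open>r\<close> and the weight, and this uniformity
  makes all later constants free of scale. Coercivity uses only the sign of the term with
  \<open>R\<close>; boundedness uses its size, where \<open>r \<le> 1\<close> makes up for the
  missing scaling.\<close>

lemma weighted_semigroup_exists:
  obtains M where "\<And>r \<psi> \<psi>1 \<psi>2 c. 0 < r \<Longrightarrow> r \<le> 1 \<Longrightarrow> \<forall>k<E. r \<le> l k \<Longrightarrow> weight r \<psi> \<psi>1 \<psi>2 c \<Longrightarrow>
    \<exists>N. weighted_semigroup E l Y R T (\<lambda>k x. exp (\<psi> k x)) N r M"
proof -
  obtain K where K: "0 < K" "\<And>y. y \<in> Y \<Longrightarrow> cnorm E (R y) \<le> K * cnorm E y"
    using clinear_on_bounded[OF Y R_lin] by blast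
  \<comment> \<open>Form, boundary term and shift in turn; 72 = 4 * 18 for four boundary values per
    edge, each at most \<open>18 * NN\<close>.\<close>
  define M where "M = 6282 + K * (72 * E)\<^sup>2 + 816951"
  have M: "0 < M" using K by (simp add: M_def add_pos_nonneg)
  show thesis
  proof (rule that)
    fix r \<psi> \<psi>1 \<psi>2 c
    assume r: "0 < r" "r \<le> 1" and rl: "\<forall>k<E. r \<le> l k" and w: "weight r \<psi> \<psi>1 \<psi>2 c"
    define W where "W = scaled (\<lambda>k x. exp (\<psi> k x))"
    note adm = weight_admissible[OF w]
    have LW: "L2 u \<Longrightarrow> L2 (W u)" for u unfolding W_def by (rule L2_scaled[OF adm])
    define Y0 where "Y0 v k = wd0 (\<psi> k) (v k)" for v :: gfun and k
    define Y1 where "Y1 v d1 k = wd1 (\<psi> k) (\<psi>1 k) (v k) (d1 k)" for v d1 :: gfun and k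
    define Y2 where "Y2 v d1 d2 k = wd2 (\<psi> k) (\<psi>1 k) (\<psi>2 k) (v k) (d1 k) (d2 k)" for v d1 d2 :: gfun and k
    define en where "en v d1 d2 k = weighted_edge.energy (l k) r (Y0 v k) (Y2 v d1 d2 k)" for v d1 d2 k
    define NN where "NN v d1 d2 = sqrt (\<Sum>k<E. en v d1 d2 k)" for v d1 d2
    define F where "F v d1 d2 \<zeta> e1 e2 k = wform (l k) (\<psi>1 k) (\<psi>2 k) (Y0 v k) (Y1 v d1 k) (Y2 v d1 d2 k)
       (Y0 \<zeta> k) (Y1 \<zeta> e1 k) (Y2 \<zeta> e1 e2 k)" for v d1 d2 \<zeta> e1 e2 k
    have we: "weighted_edge (l k) r (\<psi>1 k) (\<psi>2 k)" if "k < E" for k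
      by (rule weight_edge[OF w that r(1) rl[rule_format, OF that]])
    have C2: "C2_on_interval (l k) (Y0 v k) (Y1 v d1 k) (Y2 v d1 d2 k)" if "is_rep u a v d1 d2 d3" "k < E" for u a v d1 d2 d3 k
      unfolding Y0_def Y1_def Y2_def by (rule weight_C2[OF w that(2) is_rep_C2[OF that]])
    note eb = weighted_edge.energy_bounds[OF we C2, folded en_def]
    have NN: "0 \<le> NN v d1 d2" "(NN v d1 d2)\<^sup>2 = (\<Sum>k<E. en v d1 d2 k)" "\<And>k. k < E \<Longrightarrow> en v d1 d2 k \<le> (NN v d1 d2)\<^sup>2"
      if rep: "is_rep u a v d1 d2 d3" for u a v d1 d2 d3
    proof -
      have e0: "0 \<le> en v d1 d2 k" if "k < E" for k using eb(1)[OF that rep that] .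
      then show "0 \<le> NN v d1 d2" "(NN v d1 d2)\<^sup>2 = (\<Sum>k<E. en v d1 d2 k)"
        by (auto simp: NN_def intro!: sum_nonneg)
      then show "en v d1 d2 k \<le> (NN v d1 d2)\<^sup>2" if "k < E" for k
        using that e0 by (auto intro!: member_le_sum)
    qed
    have sup0: "norm (Y0 v k x) \<le> 18 * (r * sqrt r) * NN v d1 d2"
      and sup1: "norm (Y1 v d1 k x) \<le> 18 * NN v d1 d2"
      if rep: "is_rep u a v d1 d2 d3" and k: "k < E" and x: "x \<in> {0..l k}" for u a v d1 d2 d3 k x
    proof -
      have "(norm (Y0 v k x))\<^sup>2 \<le> 294 * r ^ 3 * en v d1 d2 k" using eb(4)[OF k rep k x] .
      also have "\<dots> \<le> 324 * r ^ 3 * (NN v d1 d2)\<^sup>2"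
        using NN(3)[OF rep k] eb(1)[OF k rep k] r by (intro mult_mono) auto
      also have "\<dots> = (18 * (r * sqrt r) * NN v d1 d2)\<^sup>2"
        using r by (simp add: power_mult_distrib eval_nat_numeral)
      finally show "norm (Y0 v k x) \<le> 18 * (r * sqrt r) * NN v d1 d2"
        by (rule power2_le_imp_le) (use NN(1)[OF rep] r in auto)
      have "(norm (Y1 v d1 k x))\<^sup>2 \<le> 216 * r * en v d1 d2 k" using eb(5)[OF k rep k x] .
      also have "\<dots> \<le> 324 * (NN v d1 d2)\<^sup>2"
        using NN(3)[OF rep k] eb(1)[OF k rep k] r by (intro mult_mono) auto
      also have "\<dots> = (18 * NN v d1 d2)\<^sup>2" by (simp add: power_mult_distrib)
      finally show "norm (Y1 v d1 k x) \<le> 18 * NN v d1 d2"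
        by (rule power2_le_imp_le) (use NN(1)[OF rep] in auto)
    qed
    \<comment> \<open>Since \<open>\<psi>1\<close> vanishes at the endpoints, the weighted values
      and derivatives there are exactly \<open>exp c\<close> times the unweighted ones.\<close>
    have trace: "exp c * cnorm E (trace01 v d1) \<le> 72 * E * NN v d1 d2" if rep: "is_rep u a v d1 d2 d3" for u a v d1 d2 d3
    proof -
      have "18 * (r * sqrt r) * NN v d1 d2 \<le> 18 * 1 * NN v d1 d2"
        using r NN(1)[OF rep] by (intro mult_mono mult_left_le_one_le mult_le_one) auto
      then have s0: "norm (Y0 v k x) \<le> 18 * NN v d1 d2" if "k < E" "x \<in> {0..l k}" for k x
        using sup0[OF rep that] by simp
      have "exp c * cnorm E (trace01 v d1) = (\<Sum>k<E. norm (Y0 v k 0) + norm (Y0 v k (l k)) + norm (Y1 v d1 k 0) + norm (Y1 v d1 k (l k)))"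
        unfolding trace01_def cnorm_blocks4 sum_distrib_left Y0_def Y1_def wd0_def wd1_def
        by (intro sum.cong refl) (simp add: weightD(6-9)[OF w] algebra_simps)
      also have "\<dots> \<le> (\<Sum>k<E. 72 * NN v d1 d2)"
      proof (rule sum_mono)
        fix k assume "k \<in> {..<E}"
        then have k: "k < E" by simp
        then have "0 \<in> {0..l k}" "l k \<in> {0..l k}" using lpos[OF k] by auto
        then show "norm (Y0 v k 0) + norm (Y0 v k (l k)) + norm (Y1 v d1 k 0) + norm (Y1 v d1 k (l k)) \<le> 72 * NN v d1 d2"
          using s0[OF k, of 0] s0[OF k, of "l k"] sup1[OF rep k, of 0] sup1[OF rep k, of "l k"] by simp
      qed
      finally show ?thesis by simp
    qed
    have green: "ip (W a) (W z) = (\<Sum>k<E. F v d1 d2 \<zeta> e1 e2 k) - exp (2 * c) * Re (cinner E (R (trace01 v d1)) (trace01 \<zeta> e1))"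
      if "is_rep u a v d1 d2 d3" "L2 a" "is_rep z a' \<zeta> e1 e2 e3" "L2 z" for u a v d1 d2 d3 z a' \<zeta> e1 e2 e3
      unfolding W_def F_def Y0_def Y1_def Y2_def by (rule Green_weighted[OF that w])
    have ipW: "ip (W u) (W u) = (\<Sum>k<E. integral {0..l k} (\<lambda>x. (norm (Y0 v k x))\<^sup>2))"
      if "is_rep u a v d1 d2 d3" "L2 u" for u a v d1 d2 d3
      unfolding W_def Y0_def by (rule ip_weighted_rep[OF that w])
    have n2W: "n2 (W u) \<le> r\<^sup>2 * NN v d1 d2" if rep: "is_rep u a v d1 d2 d3" and u: "L2 u" for u a v d1 d2 d3
    proof (rule power2_le_imp_le)
      have "(n2 (W u))\<^sup>2 \<le> (\<Sum>k<E. r ^ 4 * en v d1 d2 k)"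
        unfolding n2_squared ipW[OF that] by (intro sum_mono eb(2)[OF _ rep]) auto
      also have "\<dots> = (r\<^sup>2 * NN v d1 d2)\<^sup>2"
        by (simp add: sum_distrib_left[symmetric] NN(2)[OF rep] power_mult_distrib)
      finally show "(n2 (W u))\<^sup>2 \<le> (r\<^sup>2 * NN v d1 d2)\<^sup>2" .
    qed (use NN(1)[OF rep] in simp)
    have expand: "ip (W (\<lambda>k x. a k x + of_real s * u k x)) (W z) = ip (W a) (W z) + s * ip (W u) (W z)"
      if "L2 a" "L2 u" "L2 z" for a u z s
    proof -
      have "W (\<lambda>k x. a k x + of_real s * u k x) = (\<lambda>k x. W a k x + of_real s * W u k x)"
        by (simp add: W_def scaled_def algebra_simps)
      then show ?thesis using that by (simp add: ip_add_left ip_scale_left LW L2_scale)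
    qed
    have coerc: "(NN v d1 d2)\<^sup>2 / 4 \<le> ip (W (\<lambda>k x. a k x + of_real (816951 / r ^ 4) * u k x)) (W u)"
      if rep: "is_rep u a v d1 d2 d3" and L: "L2 u" "L2 a" for u a v d1 d2 d3
    proof -
      have "Re (cinner E (R (trace01 v d1)) (trace01 v d1)) \<le> 0"
        using R_diss rep by (auto simp: dissipative_def is_rep_def)
      then have "0 \<le> - (exp (2 * c) * Re (cinner E (R (trace01 v d1)) (trace01 v d1)))"
        by (simp add: mult_le_0_iff)
      moreover have "(NN v d1 d2)\<^sup>2 / 4 \<le> (\<Sum>k<E. F v d1 d2 v d1 d2 k + 816951 / r ^ 4 * integral {0..l k} (\<lambda>x. (norm (Y0 v k x))\<^sup>2))"
        unfolding NN(2)[OF rep] sum_divide_distrib en_def F_def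
        by (intro sum_mono weighted_edge.wform_coercive[OF we C2[OF rep]]) auto
      moreover have "ip (W (\<lambda>k x. a k x + of_real (816951 / r ^ 4) * u k x)) (W u) =
        (\<Sum>k<E. F v d1 d2 v d1 d2 k) - exp (2 * c) * Re (cinner E (R (trace01 v d1)) (trace01 v d1))
        + 816951 / r ^ 4 * (\<Sum>k<E. integral {0..l k} (\<lambda>x. (norm (Y0 v k x))\<^sup>2))"
        by (simp only: expand[OF L(2,1,1)] green[OF rep L(2) rep L(1)] ipW[OF rep L(1)])
      ultimately show ?thesis by (simp only: sum.distrib sum_distrib_left[symmetric])
    qed
    have bound: "\<bar>ip (W (\<lambda>k x. a k x + of_real (816951 / r ^ 4) * u k x)) (W z)\<bar> \<le> M * NN v d1 d2 * NN \<zeta> e1 e2"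
      if rep: "is_rep u a v d1 d2 d3" and L: "L2 u" "L2 a" and rep': "is_rep z a' \<zeta> e1 e2 e3" and z: "L2 z"
      for u a v d1 d2 d3 z a' \<zeta> e1 e2 e3
    proof -
      define P Q where "P = NN v d1 d2" and "Q = NN \<zeta> e1 e2"
      have PQ: "0 \<le> P" "0 \<le> Q" using NN(1)[OF rep] NN(1)[OF rep'] by (auto simp: P_def Q_def)
      have "\<bar>\<Sum>k<E. F v d1 d2 \<zeta> e1 e2 k\<bar> \<le> (sqrt 6282 * P) * (sqrt 6282 * Q)"
      proof (rule le_mult_if_le_weighted_mean)
        fix s :: real assume s: "0 < s"
        have "2 * \<bar>\<Sum>k<E. F v d1 d2 \<zeta> e1 e2 k\<bar> \<le> (\<Sum>k<E. 2 * \<bar>F v d1 d2 \<zeta> e1 e2 k\<bar>)"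
          unfolding sum_distrib_left[symmetric] by (intro mult_left_mono sum_abs) auto
        also have "\<dots> \<le> (\<Sum>k<E. s * (6282 * en v d1 d2 k) + (6282 * en \<zeta> e1 e2 k) / s)"
          unfolding en_def F_def
          by (intro sum_mono weighted_edge.wform_bound[OF we C2[OF rep] C2[OF rep'] s]) auto
        also have "\<dots> = s * (sqrt 6282 * P)\<^sup>2 + (sqrt 6282 * Q)\<^sup>2 / s"
          by (simp add: power_mult_distrib P_def Q_def NN(2)[OF rep] NN(2)[OF rep'] sum.distrib
              sum_distrib_left[symmetric] sum_divide_distrib[symmetric])
        finally show "2 * \<bar>\<Sum>k<E. F v d1 d2 \<zeta> e1 e2 k\<bar> \<le> s * (sqrt 6282 * P)\<^sup>2 + (sqrt 6282 * Q)\<^sup>2 / s" .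
      qed (use PQ in auto)
      also have "\<dots> = 6282 * P * Q" by simp
      finally have 1: "\<bar>\<Sum>k<E. F v d1 d2 \<zeta> e1 e2 k\<bar> \<le> 6282 * P * Q" .
      have "\<bar>exp (2 * c) * Re (cinner E (R (trace01 v d1)) (trace01 \<zeta> e1))\<bar> \<le>
         exp (2 * c) * (cnorm E (R (trace01 v d1)) * cnorm E (trace01 \<zeta> e1))"
        unfolding abs_mult abs_exp_cancel
        by (intro mult_left_mono order.trans[OF abs_Re_le_cmod norm_cinner_le]) auto
      also have "\<dots> \<le> exp (2 * c) * (K * cnorm E (trace01 v d1) * cnorm E (trace01 \<zeta> e1))"
        using rep by (intro mult_left_mono mult_right_mono K cnorm_nonneg) (auto simp: is_rep_def)
      also have "\<dots> = K * ((exp c * cnorm E (trace01 v d1)) * (exp c * cnorm E (trace01 \<zeta> e1)))"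
        by (simp add: mult_exp_exp[symmetric] algebra_simps flip: mult_2) (simp add: mult_exp_exp mult_2 algebra_simps)
      also have "\<dots> \<le> K * ((72 * E * P) * (72 * E * Q))"
        unfolding P_def Q_def using K(1) cnorm_nonneg NN(1)[OF rep]
        by (intro mult_left_mono[OF mult_mono[OF trace[OF rep] trace[OF rep']]]) auto
      finally have 2: "\<bar>exp (2 * c) * Re (cinner E (R (trace01 v d1)) (trace01 \<zeta> e1))\<bar> \<le> K * (72 * E)\<^sup>2 * P * Q"
        by (simp add: power2_eq_square algebra_simps)
      have "\<bar>816951 / r ^ 4 * ip (W u) (W z)\<bar> \<le> 816951 / r ^ 4 * (n2 (W u) * n2 (W z))"
        unfolding abs_mult by (intro mult_mono Cauchy_Schwarz_ip LW L z) auto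
      also have "\<dots> \<le> 816951 / r ^ 4 * ((r\<^sup>2 * P) * (r\<^sup>2 * Q))"
        unfolding P_def Q_def using n2W[OF rep L(1)] n2W[OF rep' z] n2_nonneg NN(1)[OF rep]
        by (intro mult_left_mono mult_mono) auto
      also have "\<dots> = 816951 * P * Q" using r by (simp add: eval_nat_numeral)
      finally have 3: "\<bar>816951 / r ^ 4 * ip (W u) (W z)\<bar> \<le> 816951 * P * Q" .
      have "ip (W (\<lambda>k x. a k x + of_real (816951 / r ^ 4) * u k x)) (W z) =
         (\<Sum>k<E. F v d1 d2 \<zeta> e1 e2 k) - exp (2 * c) * Re (cinner E (R (trace01 v d1)) (trace01 \<zeta> e1))
         + 816951 / r ^ 4 * ip (W u) (W z)"
        by (simp only: expand[OF L(2,1) z] green[OF rep L(2) rep' z])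
      then have "\<bar>ip (W (\<lambda>k x. a k x + of_real (816951 / r ^ 4) * u k x)) (W z)\<bar>
         \<le> 6282 * P * Q + K * (72 * E)\<^sup>2 * P * Q + 816951 * P * Q"
        using 1 2 3 by linarith
      then show ?thesis by (simp add: M_def P_def Q_def algebra_simps)
    qed
    \<comment> \<open>\<open>N\<close> must be a function of the pair, so one representative is
      fixed by choice; the estimates above hold for every representative.\<close>
    define choice where "choice u a = (SOME (v, d1, d2, d3). is_rep u a v d1 d2 d3)" for u a
    define N where "N u a = (case choice u a of (v, d1, d2, d3) \<Rightarrow> NN v d1 d2)" for u a
    have choice: "\<exists>v d1 d2 d3. is_rep u a v d1 d2 d3 \<and> N u a = NN v d1 d2" if "gen u a" for u a
    proof -
      obtain v d1 d2 d3 where "is_rep u a v d1 d2 d3" using \<open>gen u a\<close> gen_iff_is_rep by blast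
      then have "case (v, d1, d2, d3) of (v, d1, d2, d3) \<Rightarrow> is_rep u a v d1 d2 d3" by simp
      then have "case choice u a of (v, d1, d2, d3) \<Rightarrow> is_rep u a v d1 d2 d3"
        unfolding choice_def by (rule someI)
      then show ?thesis unfolding N_def by (cases "choice u a") auto
    qed
    have "weighted_semigroup E l Y R T (\<lambda>k x. exp (\<psi> k x)) N r M"
    proof (unfold_locales, unfold W_def[symmetric])
      fix u a k assume g: "gen u a"
      then obtain v d1 d2 d3 where rep: "is_rep u a v d1 d2 d3" and N: "N u a = NN v d1 d2" using choice by blast
      note L = gen_L2[OF g]
      show "0 \<le> N u a" unfolding N by (rule NN(1)[OF rep])
      show "n2 (W u) \<le> r\<^sup>2 * N u a" unfolding N by (rule n2W[OF rep L(1)])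
      show "(N u a)\<^sup>2 / 4 \<le> ip (W (\<lambda>k x. a k x + of_real (816951 / r ^ 4) * u k x)) (W u)"
        unfolding N by (rule coerc[OF rep L])
      assume k: "k < E"
      have "u \<simeq> v" using rep by (simp add: is_rep_def)
      then have "AE x in edge k. u k x = v k x" using k by (simp add: aeq_def)
      moreover have "AE x in edge k. x \<in> {0..l k}" by (rule AE_I2) simp
      ultimately show "AE x in edge k. norm (W u k x) \<le> 18 * (r * sqrt r) * N u a"
      proof eventually_elim
        case (elim x)
        then show ?case
          using sup0[OF rep k, of x] by (simp add: N W_def scaled_def Y0_def wd0_def norm_mult)
      qed
    next
      fix u a z b assume g: "gen u a" "gen z b"
      obtain v d1 d2 d3 where rep: "is_rep u a v d1 d2 d3" and N: "N u a = NN v d1 d2" using choice[OF g(1)] by blast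
      obtain \<zeta> e1 e2 e3 where rep': "is_rep z b \<zeta> e1 e2 e3" and N': "N z b = NN \<zeta> e1 e2" using choice[OF g(2)] by blast
      show "\<bar>ip (W (\<lambda>k x. a k x + of_real (816951 / r ^ 4) * u k x)) (W z)\<bar> \<le> M * N u a * N z b"
        unfolding N N' by (rule bound[OF rep gen_L2[OF g(1)] rep' gen_L2(1)[OF g(2)]])
    qed (rule adm r(1) M)+
    then show "\<exists>N. weighted_semigroup E l Y R T (\<lambda>k x. exp (\<psi> k x)) N r M" by (rule exI[of _ N])
  qed
qed

end

section \<open>Density of the domain\<close>

lemma power_dvd_pderiv:
  fixes p q :: "'a::field_char_0 poly"
  assumes "q ^ Suc n dvd p"
  shows "q ^ n dvd pderiv p"
proof -
  obtain s where "p = q ^ Suc n * s" using assms by (elim dvdE)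
  then have "pderiv p = q ^ n * (q * pderiv s + smult (of_nat (Suc n)) (pderiv q * s))"
    by (simp add: pderiv_mult pderiv_power_Suc algebra_simps del: power_Suc) (simp add: algebra_simps)
  then show ?thesis by simp
qed

lemma power_dvd_pderiv_iterate:
  fixes p q :: "'a::field_char_0 poly"
  assumes "q ^ (n + m) dvd p"
  shows "q ^ n dvd (pderiv ^^ m) p"
  using assms
proof (induction m arbitrary: n)
  case (Suc m)
  then have "q ^ Suc n dvd (pderiv ^^ m) p" using Suc.IH[of "Suc n"] by simp
  then show ?case using power_dvd_pderiv[of q n] by simp
qed simp

text \<open>Divisibility by a power of \<open>x * (x - L)\<close> encodes the order of vanishing at
  both ends of an edge.\<close>

definition edge_poly :: "real \<Rightarrow> complex poly" where
  "edge_poly L = [:0, 1:] * [:- of_real L, 1:]"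

lemma poly_edge_poly: "poly (edge_poly L) (of_real x) = of_real (x * (x - L))"
  by (simp add: edge_poly_def algebra_simps)

lemma poly_eq_0_at_ends:
  assumes "edge_poly L dvd p"
  shows "poly p 0 = 0" "poly p (of_real L) = 0"
  using assms poly_edge_poly[of L 0] poly_edge_poly[of L L] by (auto elim!: dvdE)

lemma poly_real_has_vector_derivative:
  "((\<lambda>x. poly p (of_real x :: complex)) has_vector_derivative poly (pderiv p) (of_real x)) (at x within S)"
  by (rule has_vector_derivative_real_field) (rule poly_DERIV)

lemma poly_real_continuous: "continuous_on S (\<lambda>x. poly p (of_real x :: complex))"
  by (intro continuous_intros)

lemma H4_rep_poly:
  assumes "0 \<le> L"
  shows "H4_rep L (\<lambda>x. poly p (of_real x)) (\<lambda>x. poly (pderiv p) (of_real x))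
    (\<lambda>x. poly ((pderiv ^^ 2) p) (of_real x)) (\<lambda>x. poly ((pderiv ^^ 3) p) (of_real x))
    (\<lambda>x. poly ((pderiv ^^ 4) p) (of_real x))"
  unfolding H4_rep_def
proof (intro conjI ballI)
  show "(\<lambda>x. poly ((pderiv ^^ 4) p) (of_real x :: complex)) \<in> borel_measurable (lebesgue_on {0..L})"
    by (intro continuous_imp_measurable_on_sets_lebesgue poly_real_continuous) auto
  show "integrable (lebesgue_on {0..L}) (\<lambda>x. (cmod (poly ((pderiv ^^ 4) p) (of_real x)))\<^sup>2)"
    by (intro continuous_imp_integrable_real continuous_intros)
  fix x assume x: "x \<in> {0..L}"
  have "((\<lambda>x. poly ((pderiv ^^ 4) p) (of_real x :: complex)) has_integral
      poly ((pderiv ^^ 3) p) (of_real x) - poly ((pderiv ^^ 3) p) (of_real 0)) {0..x}"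
    using x poly_real_has_vector_derivative[of "(pderiv ^^ 3) p"]
    by (intro fundamental_theorem_of_calculus) (auto simp: eval_nat_numeral)
  then show "poly ((pderiv ^^ 3) p) (complex_of_real x) = poly ((pderiv ^^ 3) p) (complex_of_real 0)
      + integral {0..x} (\<lambda>x. poly ((pderiv ^^ 4) p) (of_real x))"
    by (simp add: integral_unique)
qed (use poly_real_has_vector_derivative[of p] poly_real_has_vector_derivative[of "pderiv p"]
      poly_real_has_vector_derivative[of "(pderiv ^^ 2) p"] in \<open>auto simp: eval_nat_numeral\<close>)

lemma L2_dominated_convergence:
  fixes f :: "real \<Rightarrow> complex"
  assumes m: "f \<in> borel_measurable M" "\<And>n. s n \<in> borel_measurable M"
    and lim: "AE x in M. (\<lambda>n. s n x) \<longlonglongrightarrow> f x"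
    and bd: "\<And>n. AE x in M. norm (s n x) \<le> w x" and w: "integrable M (\<lambda>x. (w x)\<^sup>2)"
  shows "(\<lambda>n. \<integral>x. (norm (f x - s n x))\<^sup>2 \<partial>M) \<longlonglongrightarrow> 0"
proof -
  have "(\<lambda>n. \<integral>x. (norm (f x - s n x))\<^sup>2 \<partial>M) \<longlonglongrightarrow> (\<integral>x. 0 \<partial>M)"
  proof (rule integral_dominated_convergence[where w = "\<lambda>x. 4 * (w x)\<^sup>2"])
    show "AE x in M. (\<lambda>n. (norm (f x - s n x))\<^sup>2) \<longlonglongrightarrow> 0"
      using lim
    proof eventually_elim
      case (elim x)
      then have "(\<lambda>n. (norm (f x - s n x))\<^sup>2) \<longlonglongrightarrow> (norm (f x - f x))\<^sup>2" by (intro tendsto_intros)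
      then show ?case by simp
    qed
    have "AE x in M. \<forall>n. norm (s n x) \<le> w x" using bd by (simp add: AE_all_countable)
    then show "AE x in M. norm ((norm (f x - s n x))\<^sup>2) \<le> 4 * (w x)\<^sup>2" for n
      using lim
    proof eventually_elim
      case (elim x)
      then have "norm (f x) \<le> w x" by (intro tendsto_upperbound[OF tendsto_norm]) (auto intro!: always_eventually)
      moreover have "norm (s n x) \<le> w x" using elim by simp
      ultimately have "norm (f x - s n x) \<le> 2 * w x" using norm_triangle_ineq4[of "f x" "s n x"] by simp
      then have "(norm (f x - s n x))\<^sup>2 \<le> (2 * w x)\<^sup>2" by (intro power_mono) auto
      then show ?case by (simp add: power_mult_distrib)
    qed
  qed (use m w in auto)
  then show ?thesis by simp
qed

lemma complex_polynomial_approximation: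
  fixes f :: "real \<Rightarrow> complex"
  assumes "continuous_on {a..b} f" "0 < e"
  obtains p where "\<And>x. x \<in> {a..b} \<Longrightarrow> norm (f x - poly p (of_real x)) < e"
proof -
  obtain g where g: "polynomial_function g" "\<And>x. x \<in> {a..b} \<Longrightarrow> norm (f x - g x) < e"
    using Stone_Weierstrass_polynomial_function[of "{a..b}" f e] assms by auto
  have "real_polynomial_function (Re \<circ> g)" "real_polynomial_function (Im \<circ> g)"
    using g(1) bounded_linear_Re bounded_linear_Im unfolding polynomial_function_def by blast+
  then obtain c n d m where cd: "Re \<circ> g = (\<lambda>x. \<Sum>i\<le>n. c i * x ^ i)" "Im \<circ> g = (\<lambda>x. \<Sum>i\<le>m. d i * x ^ i)"
    unfolding real_polynomial_function_iff_sum by blast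
  define p where "p = (\<Sum>i\<le>n. monom (complex_of_real (c i)) i) + [:\<i>:] * (\<Sum>i\<le>m. monom (complex_of_real (d i)) i)"
  have "poly p (of_real x) = g x" for x
  proof -
    have "Re (g x) = (\<Sum>i\<le>n. c i * x ^ i)" "Im (g x) = (\<Sum>i\<le>m. d i * x ^ i)"
      using cd[THEN fun_cong, of x] by auto
    then have "g x = of_real (\<Sum>i\<le>n. c i * x ^ i) + \<i> * of_real (\<Sum>i\<le>m. d i * x ^ i)"
      by (simp add: complex_eq_iff)
    then show ?thesis by (simp add: p_def poly_sum poly_monom)
  qed
  then show thesis using g(2) that by metis
qed

text \<open>The polynomials are multiplied by \<open>1 - (1 - \<beta>) ^ n\<close> where \<open>\<beta>\<close> is a polynomial with values in
  \<open>(0, 1]\<close> inside the interval that vanishes to high order at the endpoints.\<close>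
lemma bounded_L2_approximation:
  fixes f :: "real \<Rightarrow> complex"
  assumes L: "0 < L" and f: "f \<in> borel_measurable (lebesgue_on {0..L})"
    and B: "\<And>x. x \<in> {0..L} \<Longrightarrow> norm (f x) \<le> B"
  obtains p where "\<And>n. edge_poly L ^ 8 dvd p n"
    "(\<lambda>n. \<integral>x. (norm (f x - poly (p n) (of_real x)))\<^sup>2 \<partial>lebesgue_on {0..L}) \<longlonglongrightarrow> 0"
proof -
  have "f measurable_on {0..L}" using f by (simp add: measurable_on_iff_borel_measurable)
  then obtain N g where N: "negligible N" and g: "\<And>n. continuous_on UNIV (g n)"
    and lim: "\<And>x. x \<notin> N \<Longrightarrow> (\<lambda>n. g n x) \<longlonglongrightarrow> (if x \<in> {0..L} then f x else 0)"
    unfolding measurable_on_def by blast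
  define C where "C = max 1 B"
  have C: "1 \<le> C" "\<And>x. x \<in> {0..L} \<Longrightarrow> norm (f x) \<le> C"
    using B unfolding C_def by (force simp: le_max_iff_disj)+
  \<comment> \<open>Radial retraction onto the disc of radius \<open>C\<close>: the continuous
    approximants of a measurable function come without a bound, and clipping supplies one without
    moving the limit.\<close>
  define cl :: "complex \<Rightarrow> complex" where "cl z = (C / max C (norm z)) *\<^sub>R z" for z
  have cl: "norm (cl z) \<le> C" for z
  proof -
    have "norm (cl z) = C * (norm z / max C (norm z))" using C(1) by (simp add: cl_def)
    also have "\<dots> \<le> C * 1" using C(1) by (intro mult_left_mono) (auto simp: divide_le_eq_1)
    finally show ?thesis by simp
  qed
  have cl_id: "cl z = z" if "norm z \<le> C" for z using that C(1) by (simp add: cl_def max_def)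
  have cl_cont: "continuous_on S cl" for S
    unfolding cl_def using C(1) by (intro continuous_intros) (auto simp: max_def)
  have "\<exists>p. \<forall>x\<in>{0..L}. norm (cl (g n x) - poly p (of_real x)) < 1 / real (Suc n)" for n
  proof -
    have "continuous_on {0..L} (\<lambda>x. cl (g n x))"
      by (rule continuous_on_compose2[OF cl_cont[of UNIV] continuous_on_subset[OF g]]) auto
    from complex_polynomial_approximation[OF this, of "1 / real (Suc n)"] show ?thesis by (metis zero_less_divide_1_iff of_nat_0_less_iff zero_less_Suc)
  qed
  then obtain p where p: "\<And>n x. x \<in> {0..L} \<Longrightarrow> norm (cl (g n x) - poly (p n) (of_real x)) < 1 / real (Suc n)"
    by metis
  \<comment> \<open>The normalisation makes \<open>4 * x * (L - x) / L\<^sup>2\<close> take values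
    in \<open>[0, 1]\<close> on the edge; the even power 8 removes the sign of
    \<open>x * (x - L)\<close>.\<close>
  define \<beta> where "\<beta> = smult ((4 / (of_real L)\<^sup>2) ^ 8) (edge_poly L ^ 8)"
  define q where "q n = (1 - (1 - \<beta>) ^ n) * p n" for n
  define b where "b x = (4 * x * (L - x) / L\<^sup>2) ^ 8" for x
  have \<beta>: "poly \<beta> (of_real x) = of_real (b x)" for x
  proof -
    have "x * (x - L) = - (x * (L - x))" by (simp add: algebra_simps)
    then show ?thesis by (simp add: \<beta>_def b_def poly_edge_poly power_divide power_mult_distrib)
  qed
  have b01: "0 \<le> b x" "b x \<le> 1" if "x \<in> {0..L}" for x
  proof -
    have "0 \<le> 4 * x * (L - x) / L\<^sup>2" using that by simp
    moreover have "4 * x * (L - x) / L\<^sup>2 \<le> 1"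
      using L zero_le_power2[of "L - 2 * x"] by (simp add: divide_le_eq_1 power2_eq_square algebra_simps)
    ultimately show "0 \<le> b x" "b x \<le> 1" by (auto simp: b_def power_le_one)
  qed
  have q: "poly (q n) (of_real x) = of_real (1 - (1 - b x) ^ n) * poly (p n) (of_real x)" for n x
    by (simp add: q_def \<beta>)
  show thesis
  proof (rule that[of q])
    fix n
    have "\<beta> dvd 1 - (1 - \<beta>) ^ n"
    proof (induction n)
      case (Suc n)
      have "1 - (1 - \<beta>) ^ Suc n = (1 - (1 - \<beta>) ^ n) + \<beta> * (1 - \<beta>) ^ n" by (simp add: algebra_simps)
      then show ?case using Suc by (metis dvd_add dvd_triv_left)
    qed simp
    moreover have "edge_poly L ^ 8 dvd \<beta>" unfolding \<beta>_def by (rule dvd_smult) simp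
    ultimately show "edge_poly L ^ 8 dvd q n" unfolding q_def by (meson dvd_mult2 dvd_trans)
  next
    show "(\<lambda>n. \<integral>x. (norm (f x - poly (q n) (of_real x)))\<^sup>2 \<partial>lebesgue_on {0..L}) \<longlonglongrightarrow> 0"
    proof (rule L2_dominated_convergence[OF f])
      show "(\<lambda>x. poly (q n) (complex_of_real x)) \<in> borel_measurable (lebesgue_on {0..L})" for n
        by (intro continuous_imp_measurable_on_sets_lebesgue poly_real_continuous) auto
      show "AE x in lebesgue_on {0..L}. norm (poly (q n) (complex_of_real x)) \<le> C + 1" for n
      proof (rule AE_I2)
        fix x assume "x \<in> space (lebesgue_on {0..L})"
        then have x: "x \<in> {0..L}" by simp
        have "norm (poly (p n) (of_real x)) \<le> norm (cl (g n x)) + norm (cl (g n x) - poly (p n) (of_real x))"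
          by (metis norm_triangle_sub norm_minus_commute add.commute)
        also have "\<dots> \<le> C + 1 / real (Suc n)" using p[OF x, of n] cl by (intro add_mono) auto
        also have "\<dots> \<le> C + 1" by simp
        finally have 1: "norm (poly (p n) (of_real x)) \<le> C + 1" .
        have "\<bar>1 - (1 - b x) ^ n\<bar> \<le> 1" using b01[OF x] by (auto simp: abs_le_iff power_le_one)
        then have "\<bar>1 - (1 - b x) ^ n\<bar> * norm (poly (p n) (of_real x)) \<le> 1 * (C + 1)"
          using 1 by (intro mult_mono) auto
        then show "norm (poly (q n) (complex_of_real x)) \<le> C + 1" by (simp only: q norm_mult norm_of_real mult_1)
      qed
      show "integrable (lebesgue_on {0..L}) (\<lambda>x. (C + 1)\<^sup>2)"
        using finite_measure.integrable_const[OF finite_measure_lebesgue_on, of "{0..L}"] by simp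
      have "N \<union> {0, L} \<in> null_sets lebesgue"
        using N by (auto simp: negligible_iff_null_sets[symmetric])
      then have "AE x in lebesgue. x \<notin> N \<union> {0, L}" by (rule AE_not_in)
      then have "AE x in lebesgue_on {0..L}. x \<notin> N \<union> {0, L} \<and> x \<in> {0..L}"
        by (subst AE_restrict_space_iff) auto
      then show "AE x in lebesgue_on {0..L}. (\<lambda>n. poly (q n) (complex_of_real x)) \<longlonglongrightarrow> f x"
      proof eventually_elim
        case (elim x)
        then have x: "x \<in> {0..L}" "x \<notin> N" "0 < x" "x < L" by auto
        have "(\<lambda>n. g n x) \<longlonglongrightarrow> f x" using lim[OF x(2)] x(1) by simp
        moreover have "isCont cl (f x)" using cl_cont[of UNIV] by (simp add: continuous_on_eq_continuous_at)
        ultimately have "(\<lambda>n. cl (g n x)) \<longlonglongrightarrow> cl (f x)" by (rule isCont_tendsto_compose[rotated])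
        then have 1: "(\<lambda>n. cl (g n x)) \<longlonglongrightarrow> f x" using cl_id C(2)[OF x(1)] by simp
        have "(\<lambda>n. cl (g n x) - poly (p n) (of_real x)) \<longlonglongrightarrow> 0"
        proof (rule Lim_null_comparison)
          show "\<forall>\<^sub>F n in sequentially. norm (cl (g n x) - poly (p n) (of_real x)) \<le> inverse (real (Suc n))"
            using p[OF x(1)] by (auto intro!: always_eventually less_imp_le simp: inverse_eq_divide)
        qed (rule LIMSEQ_inverse_real_of_nat)
        from tendsto_diff[OF 1 this] have 2: "(\<lambda>n. poly (p n) (of_real x)) \<longlonglongrightarrow> f x" by simp
        have "0 < b x" using x L by (simp add: b_def)
        then have "norm (1 - b x) < 1" using b01[OF x(1)] by (simp add: abs_less_iff)
        then have "(\<lambda>n. (1 - b x) ^ n) \<longlonglongrightarrow> 0" by (rule LIMSEQ_power_zero)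
        from tendsto_mult[OF tendsto_of_real[OF tendsto_diff[OF tendsto_const[of 1] this]] 2]
        show ?case by (simp add: q)
      qed
    qed
  qed
qed

text \<open>Truncation reduces to bounded functions. Each of the two squared errors is kept below
  \<open>e / 4\<close>, as squaring their sum doubles both.\<close>

lemma L2_approximation:
  fixes f :: "real \<Rightarrow> complex"
  assumes L: "0 < L" and f: "f \<in> borel_measurable (lebesgue_on {0..L})"
    "integrable (lebesgue_on {0..L}) (\<lambda>x. (norm (f x))\<^sup>2)" and e: "0 < e"
  obtains p where "edge_poly L ^ 8 dvd p"
    "(\<integral>x. (norm (f x - poly p (of_real x)))\<^sup>2 \<partial>lebesgue_on {0..L}) < e"
proof -
  let ?M = "lebesgue_on {0..L}"
  define t where "t n x = (if norm (f x) \<le> real n then f x else 0)" for n x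
  have tm: "t n \<in> borel_measurable ?M" for n unfolding t_def using f(1) by measurable
  have "(\<lambda>n. \<integral>x. (norm (f x - t n x))\<^sup>2 \<partial>?M) \<longlonglongrightarrow> 0"
  proof (rule L2_dominated_convergence[OF f(1) tm])
    show "AE x in ?M. (\<lambda>n. t n x) \<longlonglongrightarrow> f x"
    proof (rule AE_I2, rule tendsto_eventually)
      fix x
      obtain n0 where "norm (f x) \<le> real n0" using real_arch_simple by blast
      then show "\<forall>\<^sub>F n in sequentially. t n x = f x"
        unfolding eventually_sequentially t_def by (intro exI[of _ n0]) auto
    qed
    show "AE x in ?M. norm (t n x) \<le> norm (f x)" for n by (auto simp: t_def)
  qed fact
  then obtain n where n: "(\<integral>x. (norm (f x - t n x))\<^sup>2 \<partial>?M) < e / 4"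
    using order_tendstoD(2)[of _ 0 sequentially "e / 4"] e eventually_happens'[OF sequentially_bot] by fastforce
  obtain p where p: "\<And>m. edge_poly L ^ 8 dvd p m"
    "(\<lambda>m. \<integral>x. (norm (t n x - poly (p m) (of_real x)))\<^sup>2 \<partial>?M) \<longlonglongrightarrow> 0"
    by (rule bounded_L2_approximation[OF L tm[of n], where B = "real n"]) (auto simp: t_def)
  have "\<forall>\<^sub>F m in sequentially. (\<integral>x. (norm (t n x - poly (p m) (of_real x)))\<^sup>2 \<partial>?M) < e / 4"
    using p(2) e by (intro order_tendstoD) auto
  then obtain m where m: "(\<integral>x. (norm (t n x - poly (p m) (of_real x)))\<^sup>2 \<partial>?M) < e / 4"
    using eventually_happens'[OF sequentially_bot] by blast
  have pm: "(\<lambda>x. poly (p m) (of_real x :: complex)) \<in> borel_measurable ?M"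
    by (intro continuous_imp_measurable_on_sets_lebesgue poly_real_continuous) auto
  have ip: "integrable ?M (\<lambda>x. (norm (poly (p m) (of_real x :: complex)))\<^sup>2)"
    by (intro continuous_imp_integrable_real continuous_intros)
  have sq: "(norm (a + b))\<^sup>2 \<le> 2 * (norm a)\<^sup>2 + 2 * (norm b)\<^sup>2" for a b :: complex
  proof -
    have "(norm (a + b))\<^sup>2 \<le> (norm a + norm b)\<^sup>2" by (intro power_mono norm_triangle_ineq) auto
    also have "\<dots> \<le> 2 * (norm a)\<^sup>2 + 2 * (norm b)\<^sup>2"
      using sum_squares_bound[of "norm a" "norm b"] by (simp add: power2_sum)
    finally show ?thesis .
  qed
  have it: "integrable ?M (\<lambda>x. (norm (t n x))\<^sup>2)"
  proof (rule Bochner_Integration.integrable_bound[OF f(2)])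
    show "(\<lambda>x. (norm (t n x))\<^sup>2) \<in> borel_measurable ?M" using tm[of n] by measurable
  qed (simp add: t_def)
  have sqi: "integrable ?M (\<lambda>x. (norm (g x - h x))\<^sup>2)"
    if "g \<in> borel_measurable ?M" "h \<in> borel_measurable ?M"
      "integrable ?M (\<lambda>x. (norm (g x))\<^sup>2)" "integrable ?M (\<lambda>x. (norm (h x))\<^sup>2)" for g h :: "real \<Rightarrow> complex"
  proof (rule Bochner_Integration.integrable_bound)
    show "integrable ?M (\<lambda>x. 2 * (norm (g x))\<^sup>2 + 2 * (norm (h x))\<^sup>2)" using that by auto
    show "(\<lambda>x. (norm (g x - h x))\<^sup>2) \<in> borel_measurable ?M" using that(1,2) by measurable
    show "AE x in ?M. norm ((norm (g x - h x))\<^sup>2) \<le> norm (2 * (norm (g x))\<^sup>2 + 2 * (norm (h x))\<^sup>2)"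
      using sq[of "g _" "- h _"] by (auto intro!: AE_I2)
  qed
  have "(\<integral>x. (norm (f x - poly (p m) (of_real x)))\<^sup>2 \<partial>?M) \<le>
     (\<integral>x. 2 * (norm (f x - t n x))\<^sup>2 + 2 * (norm (t n x - poly (p m) (of_real x)))\<^sup>2 \<partial>?M)"
  proof (intro integral_mono_AE AE_I2)
    show "(norm (f x - poly (p m) (of_real x)))\<^sup>2 \<le> 2 * (norm (f x - t n x))\<^sup>2 + 2 * (norm (t n x - poly (p m) (of_real x)))\<^sup>2" for x
      using sq[of "f x - t n x" "t n x - poly (p m) (of_real x)"] by simp
  qed (intro Bochner_Integration.integrable_add integrable_mult_right sqi f tm pm ip it)+
  also have "\<dots> = 2 * (\<integral>x. (norm (f x - t n x))\<^sup>2 \<partial>?M) + 2 * (\<integral>x. (norm (t n x - poly (p m) (of_real x)))\<^sup>2 \<partial>?M)"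
    by (subst Bochner_Integration.integral_add) (auto intro!: sqi f tm pm ip it)
  also have "\<dots> < e" using n m by simp
  finally show thesis using that p(1) by blast
qed

section \<open>Approximation in L^2 by the domain of A^2\<close>

context network_semigroup
begin

text \<open>A fourth-order zero at both ends kills all derivatives up to the third, so both boundary
  vectors are 0 and the vertex conditions hold for any \<open>Y\<close> and any linear
  \<open>R\<close>.\<close>

lemma gen_poly:
  assumes P: "\<And>k. k < E \<Longrightarrow> edge_poly (l k) ^ 4 dvd P k"
  shows "gen (\<lambda>k x. poly (P k) (of_real x)) (\<lambda>k x. poly ((pderiv ^^ 4) (P k)) (of_real x))"
proof -
  let ?d = "\<lambda>i k x. poly ((pderiv ^^ i) (P k)) (complex_of_real x)"
  have zero: "?d i k 0 = 0" "?d i k (l k) = 0" if "k < E" "i < 4" for i k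
  proof -
    have "edge_poly (l k) ^ (1 + i) dvd P k" 
      by (rule dvd_trans[OF le_imp_power_dvd P]) (use that in auto)
    then have "edge_poly (l k) dvd (pderiv ^^ i) (P k)" using power_dvd_pderiv_iterate[of _ 1] by simp
    then show "?d i k 0 = 0" "?d i k (l k) = 0" using poly_eq_0_at_ends by auto
  qed
  have Y0: "(\<lambda>i. 0) \<in> Y" using Y by (simp add: csubspace_def)
  have "R (\<lambda>i. 0 * (\<lambda>i. 0) i) = (\<lambda>i. 0 * R (\<lambda>i. 0) i)" using R_lin Y0 unfolding clinear_on_def by meson
  then have R0: "R (\<lambda>i. 0) = (\<lambda>i. 0)" by simp
  have t01: "trace01 (?d 0) (?d 1) = (\<lambda>i. 0)" unfolding trace01_def blocks4_def using zero[of _ 0] zero[of _ 1] by (auto simp: fun_eq_iff)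
  have t32: "trace32 (?d 2) (?d 3) = (\<lambda>i. 0)" unfolding trace32_def blocks4_def using zero[of _ 2] zero[of _ 3] by (auto simp: fun_eq_iff)
  have "is_rep (?d 0) (?d 4) (?d 0) (?d 1) (?d 2) (?d 3)"
    unfolding is_rep_def t01 t32 R0
    using H4_rep_poly[OF less_imp_le[OF lpos]] Y0 by (auto simp: corth_def cvec_def cinner_def)
  moreover have "L2 (?d 0)" by (intro L2_continuous poly_real_continuous)
  ultimately have "gen (?d 0) (?d 4)" using gen_iff_is_rep by blast
  then show ?thesis by simp
qed

text \<open>Vanishing to order 8 leaves order 4 after four derivatives, so the approximants lie in
  the domain of A^2, as the smoothing estimates require.\<close>

lemma gen_dense:
  assumes "L2 f" "0 < \<epsilon>"
  obtains g a b where "gen g a" "gen a b" "n2 (\<lambda>k x. f k x - g k x) < \<epsilon>"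
proof -
  \<comment> \<open>The summand 1 makes \<open>real E * e\<close> strictly smaller than the square
    of \<open>\<epsilon>\<close> and covers \<open>E = 0\<close>.\<close>
  define e where "e = \<epsilon>\<^sup>2 / (real E + 1)"
  have e: "0 < e" using assms(2) by (simp add: e_def)
  have "\<exists>p. edge_poly (l k) ^ 8 dvd p \<and> (\<integral>x. (norm (f k x - poly p (of_real x)))\<^sup>2 \<partial>edge k) < e" if k: "k < E" for k
  proof -
    have f: "f k \<in> borel_measurable (edge k)" "integrable (edge k) (\<lambda>x. (norm (f k x))\<^sup>2)"
      using assms(1) k by (auto simp: L2_iff)
    show ?thesis by (rule L2_approximation[OF lpos[OF k] f e]) blast
  qed
  then obtain P where P: "\<And>k. k < E \<Longrightarrow> edge_poly (l k) ^ 8 dvd P k"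
    "\<And>k. k < E \<Longrightarrow> (\<integral>x. (norm (f k x - poly (P k) (of_real x)))\<^sup>2 \<partial>edge k) < e" by metis
  have g1: "gen (\<lambda>k x. poly (P k) (of_real x)) (\<lambda>k x. poly ((pderiv ^^ 4) (P k)) (of_real x))"
    by (rule gen_poly) (rule dvd_trans[OF le_imp_power_dvd P(1)], simp_all)
  have g2: "gen (\<lambda>k x. poly ((pderiv ^^ 4) (P k)) (of_real x)) (\<lambda>k x. poly ((pderiv ^^ 4) ((pderiv ^^ 4) (P k))) (of_real x))"
    by (rule gen_poly, rule power_dvd_pderiv_iterate) (simp add: P)
  have "(n2 (\<lambda>k x. f k x - poly (P k) (of_real x)))\<^sup>2 \<le> (\<Sum>k<E. e)"
    unfolding n2_squared ip_def by (intro sum_mono) (use P(2) in \<open>auto simp: power2_norm_eq_inner intro: less_imp_le\<close>)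
  also have "\<dots> < \<epsilon>\<^sup>2" using assms(2) by (simp add: e_def field_simps)
  finally have "n2 (\<lambda>k x. f k x - poly (P k) (of_real x)) < \<epsilon>" using assms(2) by (simp add: power_less_imp_less_base)
  then show thesis using that[OF g1 g2] by blast
qed

lemma gen_sequence:
  assumes "L2 f"
  obtains g a b where "\<And>n. gen (g n) (a n)" "\<And>n. gen (a n) (b n)"
    "(\<lambda>n. n2 (\<lambda>k x. f k x - g n k x)) \<longlonglongrightarrow> 0"
proof -
  have "\<exists>g a b. gen g a \<and> gen a b \<and> n2 (\<lambda>k x. f k x - g k x) < inverse (real (Suc n))" for n
    by (rule gen_dense[OF assms, of "inverse (real (Suc n))"]) (simp, blast)
  then obtain g a b where g: "\<And>n. gen (g n) (a n)" "\<And>n. gen (a n) (b n)"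
    "\<And>n. n2 (\<lambda>k x. f k x - g n k x) < inverse (real (Suc n))" by metis
  have "(\<lambda>n. n2 (\<lambda>k x. f k x - g n k x)) \<longlonglongrightarrow> 0"
    by (rule tendsto_sandwich[OF _ _ tendsto_const LIMSEQ_inverse_real_of_nat])
      (use g(3) in \<open>auto intro!: always_eventually simp: n2_nonneg less_imp_le simp del: of_nat_Suc\<close>)
  with g show thesis using that by blast
qed

lemma n2_tendsto:
  assumes "L2 f" "\<And>n. L2 (g n)" "(\<lambda>n. n2 (\<lambda>k x. f k x - g n k x)) \<longlonglongrightarrow> 0"
  shows "(\<lambda>n. n2 (g n)) \<longlonglongrightarrow> n2 f"
proof -
  have "(\<lambda>n. n2 f - n2 (g n)) \<longlonglongrightarrow> 0"
    by (rule Lim_null_comparison[OF _ assms(3)])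
      (use n2_reverse_triangle[OF assms(1,2)] in \<open>auto intro!: always_eventually\<close>)
  then have "(\<lambda>n. n2 f - (n2 f - n2 (g n))) \<longlonglongrightarrow> n2 f - 0" by (intro tendsto_intros)
  then show ?thesis by simp
qed

lemma T_tendsto:
  assumes "0 \<le> t" "L2 f" "\<And>n. L2 (g n)" "(\<lambda>n. n2 (\<lambda>k x. f k x - g n k x)) \<longlonglongrightarrow> 0"
  shows "(\<lambda>n. n2 (\<lambda>k x. T t f k x - T t (g n) k x)) \<longlonglongrightarrow> 0"
proof -
  obtain M where M: "0 < M" "\<And>u. L2 u \<Longrightarrow> n2 (T t u) \<le> M * n2 u" using T_bounded assms(1) by blast
  have lim: "(\<lambda>n. M * n2 (\<lambda>k x. f k x - g n k x)) \<longlonglongrightarrow> 0" using tendsto_mult_left[OF assms(4), of M] by simp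
  show ?thesis
    by (rule Lim_null_comparison[OF always_eventually lim])
      (use M assms in \<open>auto simp: n2_T_diff n2_nonneg L2_intros\<close>)
qed

lemma scaled_tendsto:
  assumes "admissible w" "L2 f" "\<And>n. L2 (g n)" "(\<lambda>n. n2 (\<lambda>k x. f k x - g n k x)) \<longlonglongrightarrow> 0"
  shows "(\<lambda>n. n2 (\<lambda>k x. scaled w f k x - scaled w (g n) k x)) \<longlonglongrightarrow> 0"
proof -
  obtain M where M: "0 < M" "\<And>u. L2 u \<Longrightarrow> n2 (scaled w u) \<le> M * n2 u" using admissible_bound assms(1) by blast
  have lim: "(\<lambda>n. M * n2 (\<lambda>k x. f k x - g n k x)) \<longlonglongrightarrow> 0" using tendsto_mult_left[OF assms(4), of M] by simp
  show ?thesis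
    by (rule Lim_null_comparison[OF always_eventually lim])
      (use M assms in \<open>auto simp: scaled_diff[symmetric] n2_nonneg L2_intros\<close>)
qed

text \<open>The semigroup axioms bound \<open>T t\<close> only for each \<open>t\<close> separately.
  Accretivity makes the norm nonincreasing along orbits in the domain, and density does the rest.
  The contraction controls the error in the approximate resolvent and bridges long times.\<close>

lemma T_contraction:
  assumes f: "L2 f" and t: "0 \<le> t"
  shows "n2 (T t f) \<le> n2 f"
proof -
  have *: "n2 (T t g) \<le> n2 g" if g: "gen g a" for g a
  proof -
    note L = gen_L2[OF g]
    have "(n2 (T t g))\<^sup>2 \<le> (n2 (T 0 g))\<^sup>2"
    proof (rule nonincreasing_if_right_derivative_nonpos[OF _ _ t])
      show "continuous_on {0..} (\<lambda>t. (n2 (T t g))\<^sup>2)"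
        using n2_scaled_T_continuous[OF L(1) admissible_1] by (intro continuous_intros) (simp add: scaled_1)
      fix s :: real assume s: "0 \<le> s"
      have "0 \<le> ip (T s a) (T s g)" by (rule gen_accretive[OF gen_T[OF g s]])
      then show "\<exists>d\<le>0. ((\<lambda>t. (n2 (T t g))\<^sup>2) has_real_derivative d) (at_right s)"
        using n2_scaled_T_right_derivative[OF g admissible_1 s]
        by (intro exI[of _ "- 2 * ip (T s a) (T s g)"]) (simp add: scaled_1)
    qed
    moreover have "n2 (T 0 g) = n2 g" by (rule n2_cong[OF T_0]) (use L in \<open>auto intro: T_L2\<close>)
    ultimately show ?thesis using n2_nonneg by (metis power2_le_imp_le)
  qed
  obtain g a b where g: "\<And>n. gen (g n) (a n)" "\<And>n. gen (a n) (b n)"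
    "(\<lambda>n. n2 (\<lambda>k x. f k x - g n k x)) \<longlonglongrightarrow> 0" using gen_sequence[OF f] by blast
  note L = gen_L2(1)[OF g(1)]
  show ?thesis
  proof (rule LIMSEQ_le)
    show "(\<lambda>n. n2 (T t (g n))) \<longlonglongrightarrow> n2 (T t f)"
      by (intro n2_tendsto T_tendsto T_L2 f t g L)
    show "(\<lambda>n. n2 (g n)) \<longlonglongrightarrow> n2 f" by (intro n2_tendsto f g L)
    show "\<exists>N. \<forall>n\<ge>N. n2 (T t (g n)) \<le> n2 (g n)" using *[OF g(1)] by blast
  qed
qed

end

section \<open>Energy estimates\<close>

context network
begin

lemma L2_norm_integrable:
  assumes "L2 u" "k < E"
  shows "integrable (edge k) (\<lambda>x. norm (u k x))"
  using square_integrable_imp_integrable[of "u k" 0 "l k"] assms by (simp add: L2_iff)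

lemma n1_nonneg: "0 \<le> n1 u"
  unfolding n1_def by (intro sum_nonneg integral_nonneg_AE) simp

lemma ip_le_n1:
  assumes "L2 u" "L2 v" and s: "\<And>k. k < E \<Longrightarrow> AE x in edge k. norm (v k x) \<le> s"
  shows "\<bar>ip u v\<bar> \<le> n1 u * s"
proof -
  have "\<bar>ip u v\<bar> \<le> (\<Sum>k<E. \<bar>\<integral>x. inner (u k x) (v k x) \<partial>edge k\<bar>)"
    unfolding ip_def by (rule sum_abs)
  also have "\<dots> \<le> (\<Sum>k<E. \<integral>x. norm (u k x) * s \<partial>edge k)"
  proof (rule sum_mono)
    fix k assume "k \<in> {..<E}"
    then have k: "k < E" by simp
    have "\<bar>\<integral>x. inner (u k x) (v k x) \<partial>edge k\<bar> \<le> (\<integral>x. \<bar>inner (u k x) (v k x)\<bar> \<partial>edge k)"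
      by (rule integral_abs_bound)
    also have "\<dots> \<le> (\<integral>x. norm (u k x) * s \<partial>edge k)"
    proof (rule integral_mono_AE)
      show "AE x in edge k. \<bar>inner (u k x) (v k x)\<bar> \<le> norm (u k x) * s"
        using s[OF k]
      proof eventually_elim
        case (elim x)
        then show ?case
          using Cauchy_Schwarz_ineq2[of "u k x" "v k x"] mult_left_mono[OF elim, of "norm (u k x)"] by simp
      qed
    qed (use L2_inner_integrable[OF assms(1,2) k] L2_norm_integrable[OF assms(1) k] in auto)
    finally show "\<bar>\<integral>x. inner (u k x) (v k x) \<partial>edge k\<bar> \<le> (\<integral>x. norm (u k x) * s \<partial>edge k)" .
  qed
  finally show ?thesis by (simp add: n1_def sum_distrib_right)
qed

end

context network_semigroup
begin

text \<open>The approximate solutions of \<open>(A + \<omega>) h = f\<close> are Riemann sums of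
  \<open>\<integral> e\<^sup>-\<^sup>\<omega>\<^sup>s T s f ds\<close> in Horner form, so that no vector-valued integration is needed.\<close>
lemma approximate_resolvent:
  assumes f: "gen f a" "gen a b" and \<omega>: "0 < \<omega>" and \<epsilon>: "0 < \<epsilon>"
  obtains h h1 h2 where "gen h h1" "gen h1 h2"
    "n2 (\<lambda>k x. (h1 k x + of_real \<omega> * h k x) - f k x) \<le> \<epsilon>"
proof -
  note L = gen_L2[OF f(1)] gen_L2[OF f(2)]
  define q where "q \<delta> = n2 (\<lambda>k x. (T \<delta> f k x - f k x) / of_real \<delta> + a k x)" for \<delta>
  have q: "(q \<longlongrightarrow> 0) (at_right 0)" using f(1) by (simp add: gen_def q_def[abs_def])
  \<comment> \<open>One Horner step: \<open>\<delta> * c\<close> plus the damped, propagated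
    previous sum. Run with \<open>f\<close>, \<open>a\<close>, \<open>b\<close> as \<open>c\<close>
    it yields \<open>h\<close>, A h and A^2 h, because \<open>A\<close> commutes with
    \<open>T\<close> on its domain.\<close>
  define step where "step \<delta> c z = (\<lambda>k x. of_real \<delta> * c k x + of_real (exp (- \<omega> * \<delta>)) * T \<delta> z k x)"
    for \<delta> and c z :: gfun
  have step_gen: "gen (step \<delta> c z) (step \<delta> c' z')" if "gen c c'" "gen z z'" "0 < \<delta>" for \<delta> c c' z z'
    unfolding step_def using that by (intro gen_add gen_scale gen_T) auto
  define h where "h \<delta> c m = (step \<delta> c ^^ m) (\<lambda>k x. 0)" for \<delta> c and m :: nat
  have h_Suc: "h \<delta> c (Suc m) = step \<delta> c (h \<delta> c m)" for \<delta> c m by (simp add: h_def)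
  have gen0: "gen (\<lambda>k x. 0) (\<lambda>k x. 0)" using gen_scale[OF f(1), of 0] by simp
  have h_gen: "gen (h \<delta> c m) (h \<delta> c' m)" if "gen c c'" "0 < \<delta>" for \<delta> c c' m
    by (induction m) (use gen0 step_gen that in \<open>auto simp: h_Suc h_def[of _ _ 0]\<close>)
  \<comment> \<open>\<open>\<rho>\<close> is the defect in the resolvent equation caused by one
    step. \<open>J\<close> is the defect after \<open>m\<close> steps, measured against the identity
    that the exact integral up to time \<open>\<delta> * m\<close> satisfies: (A + \<omega>) h = f
    minus the damped \<open>T (\<delta> * m) f\<close>.\<close>
  define \<rho> where "\<rho> \<delta> = n2 (\<lambda>k x. of_real \<delta> * (a k x + of_real \<omega> * f k x) - f k x + of_real (exp (- \<omega> * \<delta>)) * T \<delta> f k x)" for \<delta>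
  define J where "J \<delta> m = (\<lambda>k x. (h \<delta> a m k x + of_real \<omega> * h \<delta> f m k x) - f k x
      + of_real (exp (- \<omega> * (\<delta> * real m))) * T (\<delta> * real m) f k x)" for \<delta> m
  have J: "n2 (J \<delta> m) \<le> real m * \<rho> \<delta>" if \<delta>: "0 < \<delta>" for \<delta> m
  proof (induction m)
    case 0
    have "J \<delta> 0 \<simeq> (\<lambda>k x. - f k x + f k x)"
      unfolding J_def h_def using aeq_lift[OF T_0[OF L(1)], where F="\<lambda>k x z. - f k x + z"] by simp
    then have "n2 (J \<delta> 0) = n2 (\<lambda>k x. - f k x + f k x)"
      by (rule n2_cong) (use L in \<open>auto simp: J_def h_def intro!: L2_intros T_L2\<close>)
    then show ?case by simp
  next
    case (Suc m)
    define e where "e = complex_of_real (exp (- \<omega> * \<delta>))"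
    define em where "em = complex_of_real (exp (- \<omega> * (\<delta> * real m)))"
    have Lh: "L2 (h \<delta> f m)" "L2 (h \<delta> a m)" using h_gen[OF f(1) \<delta>] h_gen[OF f(2) \<delta>] gen_L2 by blast+
    have dm: "0 \<le> \<delta> * real m" using \<delta> by simp
    have LJ: "L2 (J \<delta> m)" unfolding J_def using Lh L dm by (intro L2_intros T_L2)
    have TJ: "T \<delta> (J \<delta> m) \<simeq> (\<lambda>k x. (T \<delta> (h \<delta> a m) k x + of_real \<omega> * T \<delta> (h \<delta> f m) k x) - T \<delta> f k x
        + em * T (\<delta> * real (Suc m)) f k x)"
    proof -
      have "T \<delta> (J \<delta> m) \<simeq> (\<lambda>k x. T \<delta> (\<lambda>k x. (h \<delta> a m k x + of_real \<omega> * h \<delta> f m k x) - f k x) k x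
         + T \<delta> (\<lambda>k x. em * T (\<delta> * real m) f k x) k x)"
        unfolding J_def em_def[symmetric] using \<delta> dm L Lh by (intro T_add L2_intros T_L2) auto
      also have "\<dots> \<simeq> (\<lambda>k x. (T \<delta> (\<lambda>k x. h \<delta> a m k x + of_real \<omega> * h \<delta> f m k x) k x - T \<delta> f k x)
         + em * T \<delta> (T (\<delta> * real m) f) k x)"
        using \<delta> dm L Lh
        by (intro aeq_lift2[where F="\<lambda>k x. (+)"] T_diff T_scale L2_intros T_L2) auto
      also have "\<dots> \<simeq> (\<lambda>k x. (T \<delta> (h \<delta> a m) k x + T \<delta> (\<lambda>k x. of_real \<omega> * h \<delta> f m k x) k x - T \<delta> f k x)
         + em * T (\<delta> + \<delta> * real m) f k x)"
        using \<delta> dm L Lh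
        by (intro aeq_lift2[where F="\<lambda>k x y z. (y - T \<delta> f k x) + em * z"] T_add aeq_sym[OF T_plus] L2_intros) auto
      also have "\<dots> \<simeq> (\<lambda>k x. (T \<delta> (h \<delta> a m) k x + of_real \<omega> * T \<delta> (h \<delta> f m) k x - T \<delta> f k x)
         + em * T (\<delta> + \<delta> * real m) f k x)"
        using \<delta> Lh
        by (intro aeq_lift[where F="\<lambda>k x y. (T \<delta> (h \<delta> a m) k x + y - T \<delta> f k x) + em * T (\<delta> + \<delta> * real m) f k x"] T_scale) auto
      finally show ?thesis by (simp add: algebra_simps)
    qed
    have ee: "complex_of_real (exp (- \<omega> * (\<delta> * real (Suc m)))) = e * em"
      by (simp add: e_def em_def flip: exp_add of_real_mult) (simp add: algebra_simps)
    have J1: "J \<delta> (Suc m) = (\<lambda>k x. (of_real \<delta> * (a k x + of_real \<omega> * f k x) - f k x + e * T \<delta> f k x)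
      + e * ((T \<delta> (h \<delta> a m) k x + of_real \<omega> * T \<delta> (h \<delta> f m) k x) - T \<delta> f k x
        + em * T (\<delta> * real (Suc m)) f k x))"
      unfolding J_def h_Suc step_def ee e_def[symmetric] by (simp add: algebra_simps)
    \<comment> \<open>The new defect is the defect of one step plus \<open>e * T \<delta>\<close>
      applied to the old one; as \<open>e * T \<delta>\<close> is a contraction, defects merely add
      up.\<close>
    have J2: "J \<delta> (Suc m) \<simeq> (\<lambda>k x. (of_real \<delta> * (a k x + of_real \<omega> * f k x) - f k x + e * T \<delta> f k x) + e * T \<delta> (J \<delta> m) k x)"
      unfolding J1
      by (rule aeq_lift[OF aeq_sym[OF TJ], where F="\<lambda>k x z. (of_real \<delta> * (a k x + of_real \<omega> * f k x) - f k x + e * T \<delta> f k x) + e * z"])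
    have "n2 (J \<delta> (Suc m)) = n2 (\<lambda>k x. (of_real \<delta> * (a k x + of_real \<omega> * f k x) - f k x + e * T \<delta> f k x) + e * T \<delta> (J \<delta> m) k x)"
    proof (rule n2_cong[OF J2])
      show "L2 (J \<delta> (Suc m))"
        unfolding J_def using h_gen[OF f(1) \<delta>, of "Suc m"] h_gen[OF f(2) \<delta>, of "Suc m"] gen_L2 L \<delta>
        by (intro L2_intros T_L2) (auto dest: gen_L2)
    qed (use L LJ \<delta> in \<open>auto intro!: L2_intros T_L2\<close>)
    also have "\<dots> \<le> \<rho> \<delta> + n2 (\<lambda>k x. e * T \<delta> (J \<delta> m) k x)"
      unfolding \<rho>_def e_def[symmetric] using L LJ \<delta> by (intro n2_triangle L2_intros T_L2) auto
    also have "n2 (\<lambda>k x. e * T \<delta> (J \<delta> m) k x) = exp (- \<omega> * \<delta>) * n2 (T \<delta> (J \<delta> m))"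
      by (simp add: n2_scale e_def)
    also have "\<dots> \<le> 1 * n2 (J \<delta> m)"
      using \<omega> \<delta> T_contraction[OF LJ] n2_nonneg by (intro mult_mono) auto
    finally show ?case using Suc.IH by (simp add: algebra_simps)
  qed
  \<comment> \<open>One step has defect o(\<delta>): the difference quotient enters through
    \<open>q \<delta>\<close>, the exponential through its second-order error. With the total time
    fixed, all steps together contribute o(1).\<close>
  have \<rho>: "\<rho> \<delta> \<le> \<delta> * (q \<delta> + \<delta> * (\<omega> * n2 a + \<omega>\<^sup>2 * n2 f))" if \<delta>: "0 < \<delta>" for \<delta>
  proof -
    define e where "e = exp (- \<omega> * \<delta>)"
    have x: "0 < \<omega> * \<delta>" using \<omega> \<delta> by simp
    have e: "0 < e" "e \<le> 1" "1 - e \<le> \<omega> * \<delta>" using x exp_ge_add_one_self[of "- \<omega> * \<delta>"] by (auto simp: e_def)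
    have "e \<le> 1 - \<omega> * \<delta> + (\<omega> * \<delta>)\<^sup>2"
    proof -
      have "1 \<le> (1 - \<omega> * \<delta> + (\<omega> * \<delta>)\<^sup>2) * (1 + \<omega> * \<delta>)"
      proof -
        have "(1 - z + z\<^sup>2) * (1 + z) = 1 + z ^ 3" for z :: real
          by (simp add: power2_eq_square power3_eq_cube algebra_simps)
        then show ?thesis using x by simp
      qed
      also have "\<dots> \<le> (1 - \<omega> * \<delta> + (\<omega> * \<delta>)\<^sup>2) * exp (\<omega> * \<delta>)"
      proof (rule mult_left_mono[OF exp_ge_add_one_self])
        show "0 \<le> 1 - \<omega> * \<delta> + (\<omega> * \<delta>)\<^sup>2" using sum_squares_bound[of "\<omega> * \<delta>" 1] x by simp
      qed
      finally have "exp (- (\<omega> * \<delta>)) * 1 \<le> exp (- (\<omega> * \<delta>)) * ((1 - \<omega> * \<delta> + (\<omega> * \<delta>)\<^sup>2) * exp (\<omega> * \<delta>))"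
        by (intro mult_left_mono) auto
      then show ?thesis by (simp add: e_def mult.left_commute[of "exp (- (\<omega> * \<delta>))"] flip: exp_add)
    qed
    then have e2: "\<bar>\<omega> * \<delta> - 1 + e\<bar> \<le> (\<omega> * \<delta>)\<^sup>2" using e by (simp add: abs_le_iff)
    let ?q = "\<lambda>k x. (T \<delta> f k x - f k x) / of_real \<delta> + a k x"
    have Lq: "L2 ?q" using L \<delta> by (intro L2_intros T_L2) auto
    have "(\<lambda>k x. of_real \<delta> * (a k x + of_real \<omega> * f k x) - f k x + of_real (exp (- \<omega> * \<delta>)) * T \<delta> f k x)
      = (\<lambda>k x. of_real (e * \<delta>) * ?q k x + (of_real (\<delta> * (1 - e)) * a k x + of_real (\<omega> * \<delta> - 1 + e) * f k x))"
      unfolding e_def[symmetric] using \<delta> by (simp add: fun_eq_iff field_simps)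
    then have "\<rho> \<delta> \<le> n2 (\<lambda>k x. of_real (e * \<delta>) * ?q k x) + n2 (\<lambda>k x. of_real (\<delta> * (1 - e)) * a k x + of_real (\<omega> * \<delta> - 1 + e) * f k x)"
      unfolding \<rho>_def by (simp only: n2_triangle[OF L2_scale[OF Lq] L2_add[OF L2_scale[OF L(2)] L2_scale[OF L(1)]]])
    also have "\<dots> \<le> n2 (\<lambda>k x. of_real (e * \<delta>) * ?q k x) + (n2 (\<lambda>k x. of_real (\<delta> * (1 - e)) * a k x) + n2 (\<lambda>k x. of_real (\<omega> * \<delta> - 1 + e) * f k x))"
      using L by (intro add_left_mono n2_triangle L2_scale)
    also have "\<dots> = (e * \<delta>) * q \<delta> + (\<delta> * (1 - e) * n2 a + \<bar>\<omega> * \<delta> - 1 + e\<bar> * n2 f)"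
      using e \<delta> by (simp only: n2_scale norm_of_real q_def) (simp add: abs_mult)
    also have "\<dots> \<le> (1 * \<delta>) * q \<delta> + (\<delta> * (\<omega> * \<delta>) * n2 a + (\<omega> * \<delta>)\<^sup>2 * n2 f)"
      using e e2 \<delta> n2_nonneg by (intro add_mono mult_right_mono mult_left_mono) (auto simp: q_def)
    finally show ?thesis by (simp add: power2_eq_square algebra_simps)
  qed
  \<comment> \<open>The time horizon is fixed first, so that the tail of the integral is small; only
    then is the step size refined.\<close>
  obtain \<tau> where \<tau>: "0 < \<tau>" "exp (- \<omega> * \<tau>) * n2 f \<le> \<epsilon> / 2"
  proof -
    define \<tau> where "\<tau> = (2 * n2 f / \<epsilon> + 1) / \<omega>"
    have \<tau>: "\<omega> * \<tau> = 2 * n2 f / \<epsilon> + 1" "0 < \<tau>"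
      using \<omega> \<epsilon> n2_nonneg[of f] by (auto simp: \<tau>_def intro!: divide_pos_pos add_nonneg_pos)
    have "2 * n2 f / \<epsilon> \<le> exp (\<omega> * \<tau>)" using exp_ge_add_one_self[of "\<omega> * \<tau>"] \<tau>(1) by linarith
    then have "exp (- \<omega> * \<tau>) * n2 f \<le> \<epsilon> / 2"
      using \<epsilon> by (simp add: exp_minus field_simps)
    then show thesis by (rule that[OF \<tau>(2)])
  qed
  have "((\<lambda>\<delta>. \<tau> * (q \<delta> + \<delta> * (\<omega> * n2 a + \<omega>\<^sup>2 * n2 f))) \<longlongrightarrow> \<tau> * (0 + 0 * (\<omega> * n2 a + \<omega>\<^sup>2 * n2 f))) (at_right 0)"
    by (intro tendsto_intros q)
  then have ev: "\<forall>\<^sub>F \<delta> in at_right 0. \<tau> * (q \<delta> + \<delta> * (\<omega> * n2 a + \<omega>\<^sup>2 * n2 f)) < \<epsilon> / 2"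
    using \<epsilon> by (intro order_tendstoD(2)) auto
  have "filterlim (\<lambda>m. \<tau> / real (Suc m)) (at_right 0) sequentially"
    using \<tau> by (intro tendsto_imp_filterlim_at_right LIMSEQ_Suc[OF lim_const_over_n]) auto
  from filterlim_compose[OF _ this, of "\<lambda>x. x"] eventually_compose_filterlim[OF ev this]
  obtain m where m: "\<tau> * (q (\<tau> / real (Suc m)) + \<tau> / real (Suc m) * (\<omega> * n2 a + \<omega>\<^sup>2 * n2 f)) < \<epsilon> / 2"
    using eventually_happens'[OF sequentially_bot] by blast
  define \<delta> where "\<delta> = \<tau> / real (Suc m)"
  have \<delta>: "0 < \<delta>" "\<delta> * real (Suc m) = \<tau>" using \<tau> by (auto simp: \<delta>_def)
  have "real (Suc m) * \<rho> \<delta> \<le> real (Suc m) * (\<delta> * (q \<delta> + \<delta> * (\<omega> * n2 a + \<omega>\<^sup>2 * n2 f)))"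
    by (intro mult_left_mono \<rho> \<delta>) simp
  also have "\<dots> = \<tau> * (q \<delta> + \<delta> * (\<omega> * n2 a + \<omega>\<^sup>2 * n2 f))" using \<delta>(2) by (simp add: mult.assoc[symmetric] mult.commute)
  also have "\<dots> < \<epsilon> / 2" using m by (simp add: \<delta>_def)
  finally have J2: "n2 (J \<delta> (Suc m)) \<le> \<epsilon> / 2" using J[OF \<delta>(1), of "Suc m"] by simp
  have g: "gen (h \<delta> f (Suc m)) (h \<delta> a (Suc m))" "gen (h \<delta> a (Suc m)) (h \<delta> b (Suc m))"
    by (intro h_gen f \<delta>)+
  note Lg = gen_L2[OF g(1)]
  have LJ: "L2 (J \<delta> (Suc m))" unfolding J_def \<delta>(2) using Lg L \<tau> by (intro L2_intros T_L2) auto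
  have "(\<lambda>k x. (h \<delta> a (Suc m) k x + of_real \<omega> * h \<delta> f (Suc m) k x) - f k x)
     = (\<lambda>k x. J \<delta> (Suc m) k x - of_real (exp (- \<omega> * \<tau>)) * T \<tau> f k x)"
    by (simp add: J_def \<delta>(2) del: of_nat_Suc)
  then have "n2 (\<lambda>k x. (h \<delta> a (Suc m) k x + of_real \<omega> * h \<delta> f (Suc m) k x) - f k x)
     \<le> n2 (J \<delta> (Suc m)) + n2 (\<lambda>k x. of_real (exp (- \<omega> * \<tau>)) * T \<tau> f k x)"
    using LJ L \<tau> by (simp only:) (intro n2_triangle_diff L2_scale T_L2, auto)
  also have "n2 (\<lambda>k x. of_real (exp (- \<omega> * \<tau>)) * T \<tau> f k x) = exp (- \<omega> * \<tau>) * n2 (T \<tau> f)"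
    by (simp only: n2_scale norm_of_real abs_exp_cancel)
  also have "\<dots> \<le> exp (- \<omega> * \<tau>) * n2 f" using T_contraction[OF L(1)] \<tau> by (intro mult_left_mono) auto
  finally show thesis using that[OF g] J2 \<tau>(2) by simp
qed

end

section \<open>Growth bounds and smoothing in weighted norms\<close>

context weighted_semigroup
begin

abbreviation "W \<equiv> scaled w"

definition \<omega> where "\<omega> = 816951 / r ^ 4"

definition shift :: "gfun \<Rightarrow> gfun \<Rightarrow> gfun" where
  "shift a u = (\<lambda>k x. a k x + of_real \<omega> * u k x)"

lemma LW: "L2 u \<Longrightarrow> L2 (W u)"
  by (rule L2_scaled[OF admissible_w])

lemma coercive': "gen u a \<Longrightarrow> (N u a)\<^sup>2 / 4 \<le> ip (W (shift a u)) (W u)"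
  and form_bounded': "gen u a \<Longrightarrow> gen z b \<Longrightarrow> \<bar>ip (W (shift a u)) (W z)\<bar> \<le> M * N u a * N z b"
  using coercive form_bounded unfolding shift_def \<omega>_def by blast+

lemma \<omega>_pos: "0 < \<omega>"
  using r by (simp add: \<omega>_def)

lemma gen_shift: "gen f a \<Longrightarrow> gen a b \<Longrightarrow> gen (shift a f) (shift b a)"
  unfolding shift_def by (intro gen_add gen_scale)

lemma shift_T:
  assumes "0 \<le> t" "L2 f" "L2 a"
  shows "T t (shift a f) \<simeq> shift (T t a) (T t f)"
proof -
  have "T t (shift a f) \<simeq> (\<lambda>k x. T t a k x + T t (\<lambda>k x. of_real \<omega> * f k x) k x)"
    unfolding shift_def using assms by (intro T_add L2_intros)
  also have "\<dots> \<simeq> shift (T t a) (T t f)"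
    unfolding shift_def using assms by (intro aeq_lift[where F="\<lambda>k x z. T t a k x + z"] T_scale)
  finally show ?thesis .
qed

definition damped :: "gfun \<Rightarrow> real \<Rightarrow> real" where
  "damped f t = exp (- 2 * \<omega> * t) * (n2 (W (T t f)))\<^sup>2"

lemma damped_continuous: "L2 f \<Longrightarrow> continuous_on {0..} (damped f)"
  unfolding damped_def[abs_def]
  by (intro continuous_intros n2_scaled_T_continuous admissible_w)

lemma damped_0: "L2 f \<Longrightarrow> damped f 0 = (n2 (W f))\<^sup>2"
  using n2_cong[OF aeq_scaled[OF T_0], of f w] by (simp add: damped_def LW T_L2)

lemma damped_derivative:
  assumes f: "gen f a" and t: "0 \<le> t"
  shows "(damped f has_real_derivative
    - 2 * exp (- 2 * \<omega> * t) * ip (W (shift (T t a) (T t f))) (W (T t f))) (at_right t)"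
proof -
  note L = gen_L2[OF f]
  have "((\<lambda>s. exp (- 2 * \<omega> * s)) has_real_derivative exp (- 2 * \<omega> * t) * (- 2 * \<omega>)) (at_right t)"
    by (auto intro!: derivative_eq_intros)
  from DERIV_mult[OF this n2_scaled_T_right_derivative[OF f admissible_w t]]
  have "(damped f has_real_derivative exp (- 2 * \<omega> * t) * (- 2 * \<omega>) * (n2 (W (T t f)))\<^sup>2
      + - 2 * ip (W (T t a)) (W (T t f)) * exp (- 2 * \<omega> * t)) (at_right t)"
    unfolding damped_def[abs_def] .
  moreover have "W (shift (T t a) (T t f)) = (\<lambda>k x. W (T t a) k x + of_real \<omega> * W (T t f) k x)"
    by (simp add: shift_def scaled_def algebra_simps)
  then have "ip (W (shift (T t a) (T t f))) (W (T t f)) = ip (W (T t a)) (W (T t f)) + \<omega> * (n2 (W (T t f)))\<^sup>2"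
    using L t by (simp add: ip_add_left ip_scale_left LW T_L2 L2_scale n2_squared)
  ultimately show ?thesis by (simp add: algebra_simps)
qed

lemma damped_le:
  assumes f: "gen f a" and t: "0 \<le> t"
  shows "damped f t \<le> (n2 (W f))\<^sup>2"
proof -
  note L = gen_L2[OF f]
  have "damped f t \<le> damped f 0"
  proof (rule nonincreasing_if_right_derivative_nonpos[OF damped_continuous[OF L(1)] _ t])
    fix s :: real assume s: "0 \<le> s"
    have "0 \<le> (N (T s f) (T s a))\<^sup>2 / 4" by simp
    also have "\<dots> \<le> ip (W (shift (T s a) (T s f))) (W (T s f))"
      by (rule coercive'[OF gen_T[OF f s]])
    finally show "\<exists>d\<le>0. (damped f has_real_derivative d) (at_right s)"
      using damped_derivative[OF f s] by (intro exI conjI) auto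
  qed
  then show ?thesis by (simp add: damped_0 L)
qed

lemma n2_W_T_le:
  assumes f: "gen f a" and t: "0 \<le> t"
  shows "n2 (W (T t f)) \<le> exp (\<omega> * t) * n2 (W f)"
proof (rule power2_le_imp_le)
  have "(n2 (W (T t f)))\<^sup>2 = exp (2 * \<omega> * t) * damped f t"
    by (simp add: damped_def flip: mult.assoc exp_add)
  also have "\<dots> \<le> exp (2 * \<omega> * t) * (n2 (W f))\<^sup>2" by (intro mult_left_mono damped_le[OF f t]) simp
  also have "\<dots> = (exp (\<omega> * t) * n2 (W f))\<^sup>2"
    by (simp add: power_mult_distrib exp_double[symmetric] mult.assoc)
  finally show "(n2 (W (T t f)))\<^sup>2 \<le> (exp (\<omega> * t) * n2 (W f))\<^sup>2" .
qed (simp add: n2_nonneg)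

text \<open>Smoothing without analyticity: for \<open>g = (A + \<omega>) f\<close>, the growth \<open>2 t \<parallel>g\<parallel>\<^sup>2 = 2 t \<langle>(A + \<omega>) f, g\<rangle>\<close> of
  \<open>t\<^sup>2 \<parallel>g\<parallel>\<^sup>2\<close> is absorbed by the dissipation of \<open>t\<^sup>2 \<parallel>g\<parallel>\<^sup>2 + 4 M\<^sup>2 \<parallel>f\<parallel>\<^sup>2\<close>.\<close>
lemma n2_W_T_shift_le:
  assumes f: "gen f a" "gen a b" and t: "0 < t"
  shows "n2 (W (T t (shift a f))) \<le> 2 * M / t * exp (\<omega> * t) * n2 (W f)"
proof -
  define g g1 where "g = shift a f" and "g1 = shift b a"
  have g: "gen g g1" unfolding g_def g1_def by (rule gen_shift[OF f])
  note L = gen_L2[OF f(1)] gen_L2[OF g]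
  define \<Phi> where "\<Phi> s = s\<^sup>2 * damped g s + 4 * M\<^sup>2 * damped f s" for s
  have "\<Phi> t \<le> \<Phi> 0"
  proof (rule nonincreasing_if_right_derivative_nonpos)
    show "continuous_on {0..} \<Phi>"
      unfolding \<Phi>_def[abs_def] using L by (intro continuous_intros damped_continuous)
    fix s :: real assume s: "0 \<le> s"
    define e where "e = exp (- 2 * \<omega> * s)"
    define Nf Ng where "Nf = N (T s f) (T s a)" and "Ng = N (T s g) (T s g1)"
    define Qf Qg where "Qf = ip (W (shift (T s a) (T s f))) (W (T s f))"
      and "Qg = ip (W (shift (T s g1) (T s g))) (W (T s g))"
    have Q: "Nf\<^sup>2 / 4 \<le> Qf" "Ng\<^sup>2 / 4 \<le> Qg"
      unfolding Nf_def Ng_def Qf_def Qg_def by (intro coercive' gen_T f g s)+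
    have "damped g s = e * ip (W (shift (T s a) (T s f))) (W (T s g))"
    proof -
      have "ip (W (T s g)) (W (T s g)) = ip (W (shift (T s a) (T s f))) (W (T s g))"
        using s L unfolding g_def
        by (intro ip_cong aeq_scaled shift_T LW T_L2) (auto simp: shift_def intro!: L2_intros T_L2)
      then show ?thesis by (simp add: damped_def e_def n2_squared)
    qed
    moreover have "ip (W (shift (T s a) (T s f))) (W (T s g)) \<le> M * Nf * Ng"
      using form_bounded'[OF gen_T[OF f(1) s] gen_T[OF g s]] by (simp add: Nf_def Ng_def)
    ultimately have dg: "damped g s \<le> e * (M * Nf * Ng)" by (simp add: e_def)
    have "((\<lambda>s. s\<^sup>2) has_real_derivative 2 * s) (at_right s)" by (auto intro!: derivative_eq_intros)
    from DERIV_add[OF DERIV_mult[OF this damped_derivative[OF g s]] DERIV_cmult[OF damped_derivative[OF f(1) s], of "4 * M\<^sup>2"]]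
    have "(\<Phi> has_real_derivative 2 * s * damped g s + - 2 * e * Qg * s\<^sup>2 + 4 * M\<^sup>2 * (- 2 * e * Qf)) (at_right s)"
      unfolding \<Phi>_def[abs_def] e_def Qf_def Qg_def .
    moreover have "2 * s * damped g s + - 2 * e * Qg * s\<^sup>2 + 4 * M\<^sup>2 * (- 2 * e * Qf) \<le> 0"
    proof -
      have e0: "0 \<le> e" by (simp add: e_def)
      have "2 * s * damped g s \<le> 2 * s * (e * (M * Nf * Ng))" using s dg by (intro mult_left_mono) auto
      moreover have "2 * e * s\<^sup>2 * (Ng\<^sup>2 / 4) \<le> 2 * e * s\<^sup>2 * Qg" using e0 Q by (intro mult_left_mono) auto
      moreover have "8 * M\<^sup>2 * e * (Nf\<^sup>2 / 4) \<le> 8 * M\<^sup>2 * e * Qf" using e0 Q by (intro mult_left_mono) auto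
      \<comment> \<open>The coefficient \<open>4 * M\<^sup>2\<close> of \<open>damped f\<close> in
        \<open>\<Phi>\<close> is chosen to complete this square: the growth is at most
        \<open>2 * s * e * M * Nf * Ng\<close>, the dissipation at least \<open>e * s\<^sup>2 *
        Ng\<^sup>2 / 2 + 2 * e * M\<^sup>2 * Nf\<^sup>2\<close>.\<close>
      moreover have "0 \<le> e * (s * Ng - 2 * M * Nf)\<^sup>2 / 2" using e0 by simp
      ultimately show ?thesis by (simp add: power2_eq_square algebra_simps)
    qed
    ultimately show "\<exists>d\<le>0. (\<Phi> has_real_derivative d) (at_right s)" by blast
  qed (use t in simp)
  moreover have "0 \<le> 4 * M\<^sup>2 * damped f t" by (simp add: damped_def)
  moreover have "\<Phi> 0 = 4 * M\<^sup>2 * (n2 (W f))\<^sup>2" using damped_0[OF L(1)] by (simp add: \<Phi>_def)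
  ultimately have "t\<^sup>2 * damped g t \<le> 4 * M\<^sup>2 * (n2 (W f))\<^sup>2"
    unfolding \<Phi>_def[of t] by linarith
  then have d: "damped g t \<le> 4 * M\<^sup>2 / t\<^sup>2 * (n2 (W f))\<^sup>2" using t by (simp add: field_simps)
  show ?thesis
  proof (rule power2_le_imp_le)
    have "(n2 (W (T t g)))\<^sup>2 = exp (2 * \<omega> * t) * damped g t"
      by (simp add: damped_def flip: mult.assoc exp_add)
    also have "\<dots> \<le> exp (2 * \<omega> * t) * (4 * M\<^sup>2 / t\<^sup>2 * (n2 (W f))\<^sup>2)" by (intro mult_left_mono d) simp
    also have "\<dots> = (2 * M / t * exp (\<omega> * t) * n2 (W f))\<^sup>2"
      by (simp add: power_mult_distrib power_divide exp_double[symmetric] mult.assoc)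
    finally show "(n2 (W (T t (shift a f))))\<^sup>2 \<le> (2 * M / t * exp (\<omega> * t) * n2 (W f))\<^sup>2"
      by (simp add: g_def)
  qed (use t M n2_nonneg in simp)
qed

text \<open>At time \<open>r ^ 4\<close> the shift gives \<open>\<omega> * t = 816951\<close>, so
  the growth factor does not depend on \<open>r\<close>. The root of \<open>8 * M\<close> combines
  the factor 1 / 4 of coercivity with the smoothing bound \<open>2 * M / t\<close>.\<close>

definition "smoothing_const = 18 * sqrt (8 * M) * exp 816951"

text \<open>Coercivity bounds \<open>Nf\<^sup>2 / 4\<close> by the pairing of (A + \<omega>) T f
  with T f, hence by smoothing times growth: \<open>Nf\<close> is of size
  \<open>n2 (W f) / r\<^sup>2\<close>. The pointwise bound multiplies this by
  \<open>r * sqrt r\<close>, leaving \<open>1 / sqrt r\<close>.\<close>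

lemma W_T_sup_le_n2_gen:
  assumes f: "gen f a" "gen a b" and k: "k < E"
  shows "AE x in edge k. norm (W (T (r ^ 4) f) k x) \<le> smoothing_const / sqrt r * n2 (W f)"
proof -
  define t where "t = r ^ 4"
  have t: "0 < t" "\<omega> * t = 816951" using r by (auto simp: t_def \<omega>_def)
  note L = gen_L2[OF f(1)]
  have gT: "gen (T t f) (T t a)" using t by (intro gen_T f) auto
  define Nf where "Nf = N (T t f) (T t a)"
  have Nf: "0 \<le> Nf" unfolding Nf_def by (rule N_nonneg[OF gT])
  have "Nf\<^sup>2 / 4 \<le> ip (W (shift (T t a) (T t f))) (W (T t f))"
    unfolding Nf_def by (rule coercive'[OF gT])
  also have "\<dots> = ip (W (T t (shift a f))) (W (T t f))"
    using t L by (intro ip_cong aeq_scaled aeq_sym[OF shift_T] LW T_L2 aeq_refl) (auto simp: shift_def intro!: L2_intros T_L2)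
  also have "\<dots> \<le> n2 (W (T t (shift a f))) * n2 (W (T t f))"
  proof -
    have "L2 (shift a f)" unfolding shift_def by (intro L2_intros L)
    then have "L2 (W (T t (shift a f)))" "L2 (W (T t f))" using t L by (auto intro!: LW T_L2)
    from Cauchy_Schwarz_ip[OF this] show ?thesis by simp
  qed
  also have "\<dots> \<le> (2 * M / t * exp (\<omega> * t) * n2 (W f)) * (exp (\<omega> * t) * n2 (W f))"
    using n2_W_T_shift_le[OF f t(1)] n2_W_T_le[OF f(1), of t] t M n2_nonneg by (intro mult_mono) auto
  finally have "Nf\<^sup>2 \<le> 8 * M / t * (exp 816951)\<^sup>2 * (n2 (W f))\<^sup>2"
    unfolding t(2) by (simp add: power2_eq_square algebra_simps)
  also have "\<dots> = (sqrt (8 * M) * exp 816951 / r\<^sup>2 * n2 (W f))\<^sup>2"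
    using M by (simp add: t_def power_mult_distrib power_divide)
  finally have "Nf \<le> sqrt (8 * M) * exp 816951 / r\<^sup>2 * n2 (W f)"
    by (rule power2_le_imp_le) (use M n2_nonneg in simp)
  then have "18 * (r * sqrt r) * Nf \<le> 18 * (r * sqrt r) * (sqrt (8 * M) * exp 816951 / r\<^sup>2 * n2 (W f))"
    using r by (intro mult_left_mono) auto
  also have "\<dots> = smoothing_const / sqrt r * n2 (W f)"
    using r by (simp add: smoothing_const_def field_simps power2_eq_square)
  finally have le: "18 * (r * sqrt r) * Nf \<le> smoothing_const / sqrt r * n2 (W f)" .
  have "AE x in edge k. norm (W (T t f) k x) \<le> 18 * (r * sqrt r) * Nf"
    unfolding Nf_def by (rule sup_le_N[OF gT k])
  then show ?thesis unfolding t_def[symmetric] by eventually_elim (use le in linarith)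
qed

text \<open>For \<open>h\<close> with (A + \<omega>) h close to \<open>f\<close>, coercivity pairs
  \<open>f\<close> in L^1 with the pointwise bound of \<open>h\<close>, so \<open>N h h1\<close> is
  at most \<open>72 * r * sqrt r * n1 (W f)\<close> up to the error, and \<open>n2 (W h)\<close>
  gains another \<open>r\<^sup>2\<close>. Smoothing of T (A + \<omega>) h then costs
  \<open>2 * M / r ^ 4\<close>; the constant is 2 * 72 = 144.\<close>

lemma n2_W_T_le_n1_gen:
  assumes f: "gen f a" "gen a b"
  shows "n2 (W (T (r ^ 4) f)) \<le> 144 * M * exp 816951 / sqrt r * n1 (W f)"
proof -
  define t where "t = r ^ 4"
  have t: "0 < t" "\<omega> * t = 816951" using r by (auto simp: t_def \<omega>_def)
  note L = gen_L2[OF f(1)]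
  obtain B where B: "0 < B" "\<And>u. L2 u \<Longrightarrow> n2 (W u) \<le> B * n2 u"
    using admissible_bound[OF admissible_w] by blast
  \<comment> \<open>Collects every contribution of the resolvent error \<open>\<epsilon>\<close>. It
    depends on \<open>r\<close> and, through \<open>B\<close>, on the weight, which is harmless
    because \<open>\<epsilon>\<close> is arbitrary.\<close>
  define C where "C = 8 * M / t * exp 816951 * r ^ 4 * B + B"
  have C: "0 < C" using M t r B by (simp add: C_def add_nonneg_pos)
  have *: "n2 (W (T t f)) \<le> 144 * M * exp 816951 / sqrt r * n1 (W f) + C * \<epsilon>" if \<epsilon>: "0 < \<epsilon>" for \<epsilon>
  proof -
    obtain h h1 h2 where h: "gen h h1" "gen h1 h2" and err: "n2 (\<lambda>k x. (h1 k x + of_real \<omega> * h k x) - f k x) \<le> \<epsilon>"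
      by (rule approximate_resolvent[OF f \<omega>_pos \<epsilon>])
    define g where "g = shift h1 h"
    note Lh = gen_L2[OF h(1)]
    have Lg: "L2 g" unfolding g_def shift_def using Lh by (intro L2_intros)
    define d where "d = (\<lambda>k x. g k x - f k x)"
    have Ld: "L2 d" unfolding d_def by (intro L2_intros Lg L)
    have nd: "n2 (W d) \<le> B * \<epsilon>"
      using B(2)[OF Ld] mult_left_mono[OF err less_imp_le[OF B(1)]] by (simp add: d_def g_def shift_def)
    define Nh where "Nh = N h h1"
    have Nh: "0 \<le> Nh" unfolding Nh_def by (rule N_nonneg[OF h(1)])
    have "Nh\<^sup>2 / 4 \<le> ip (W g) (W h)" unfolding Nh_def g_def by (rule coercive'[OF h(1)])
    also have "W g = (\<lambda>k x. W f k x + W d k x)" by (simp add: d_def scaled_def algebra_simps)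
    also have "ip \<dots> (W h) = ip (W f) (W h) + ip (W d) (W h)" by (intro ip_add_left LW L Ld Lh)
    also have "\<dots> \<le> n1 (W f) * (18 * (r * sqrt r) * Nh) + n2 (W d) * n2 (W h)"
      using ip_le_n1[OF LW[OF L(1)] LW[OF Lh(1)] sup_le_N[OF h(1)]] Cauchy_Schwarz_ip[OF LW[OF Ld] LW[OF Lh(1)]]
      by (simp add: Nh_def)
    also have "\<dots> \<le> n1 (W f) * (18 * (r * sqrt r) * Nh) + (B * \<epsilon>) * (r\<^sup>2 * Nh)"
      using nd n2_le_N[OF h(1)] n2_nonneg B \<epsilon> by (intro add_left_mono mult_mono) (auto simp: Nh_def)
    finally have "Nh * Nh \<le> 4 * (18 * (r * sqrt r) * n1 (W f) + B * \<epsilon> * r\<^sup>2) * Nh"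
      by (simp add: power2_eq_square algebra_simps)
    then have Nle: "Nh \<le> 4 * (18 * (r * sqrt r) * n1 (W f) + B * \<epsilon> * r\<^sup>2)"
      using Nh r B \<epsilon> n1_nonneg[of "W f"] by (cases "Nh = 0") auto
    have "n2 (W h) \<le> r\<^sup>2 * Nh" unfolding Nh_def by (rule n2_le_N[OF h(1)])
    also have "\<dots> \<le> r\<^sup>2 * (4 * (18 * (r * sqrt r) * n1 (W f) + B * \<epsilon> * r\<^sup>2))" by (intro mult_left_mono Nle) simp
    finally have nh: "n2 (W h) \<le> r\<^sup>2 * (4 * (18 * (r * sqrt r) * n1 (W f) + B * \<epsilon> * r\<^sup>2))" .
    have "T t f \<simeq> (\<lambda>k x. T t g k x - T t d k x)"
      using T_diff[of t g d] t Lg Ld by (simp add: d_def)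
    then have "n2 (W (T t f)) = n2 (W (\<lambda>k x. T t g k x - T t d k x))"
      by (intro n2_cong aeq_scaled LW) (use t L Lg Ld in \<open>auto intro!: T_L2 L2_intros\<close>)
    also have "\<dots> \<le> n2 (W (T t g)) + n2 (W (T t d))"
      unfolding scaled_diff using t Lg Ld by (intro n2_triangle_diff LW T_L2) auto
    also have "\<dots> \<le> 2 * M / t * exp 816951 * n2 (W h) + B * \<epsilon>"
    proof (rule add_mono)
      show "n2 (W (T t g)) \<le> 2 * M / t * exp 816951 * n2 (W h)"
        using n2_W_T_shift_le[OF h t(1)] unfolding g_def t(2) .
      have "n2 (W (T t d)) \<le> B * n2 (T t d)" using t Ld by (intro B T_L2) auto
      also have "\<dots> \<le> B * n2 d" using B t by (intro mult_left_mono T_contraction[OF Ld]) auto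
      also have "\<dots> \<le> B * \<epsilon>" using err B by (intro mult_left_mono) (auto simp: d_def g_def shift_def)
      finally show "n2 (W (T t d)) \<le> B * \<epsilon>" .
    qed
    also have "\<dots> \<le> 2 * M / t * exp 816951 * (r\<^sup>2 * (4 * (18 * (r * sqrt r) * n1 (W f) + B * \<epsilon> * r\<^sup>2))) + B * \<epsilon>"
      using t M by (intro add_right_mono mult_left_mono nh) auto
    also have "\<dots> = 144 * M * exp 816951 * (r\<^sup>2 * (r * sqrt r) / t) * n1 (W f) + C * \<epsilon>"
      by (simp add: C_def algebra_simps add_divide_distrib eval_nat_numeral)
    also have "r\<^sup>2 * (r * sqrt r) / t = 1 / sqrt r"
      using r by (simp add: t_def field_simps eval_nat_numeral)
    finally show ?thesis by simp
  qed
  have "n2 (W (T t f)) \<le> 144 * M * exp 816951 / sqrt r * n1 (W f) + \<epsilon>" if "0 < \<epsilon>" for \<epsilon>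
    using *[of "\<epsilon> / C"] that C by simp
  then show ?thesis unfolding t_def[symmetric] by (rule field_le_epsilon)
qed

end

section \<open>Kernel bound for short times\<close>

context network
begin

lemma edge_integral_le_n2:
  assumes "L2 u" "k < E"
  shows "(\<integral>x. (norm (u k x))\<^sup>2 \<partial>edge k) \<le> (n2 u)\<^sup>2"
  unfolding n2_squared ip_def power2_norm_eq_inner
  by (rule member_le_sum[of k "{..<E}" "\<lambda>k. \<integral>x. inner (u k x) (u k x) \<partial>edge k"])
    (use assms in \<open>auto intro!: integral_nonneg_AE\<close>)

text \<open>Pointwise bounds pass to L^2 limits without a subsequence: the integral of the squared
  excess of \<open>norm f\<close> over \<open>c\<close> is dominated by the errors, hence 0.\<close>

lemma AE_norm_le_limit:
  assumes L: "L2 f" "\<And>n. L2 (g n)" and lim: "(\<lambda>n. n2 (\<lambda>k x. f k x - g n k x)) \<longlonglongrightarrow> 0"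
    and s: "s \<longlonglongrightarrow> c" and k: "k < E" and g: "\<And>n. AE x in edge k. norm (g n k x) \<le> s n"
  shows "AE x in edge k. norm (f k x) \<le> c"
proof -
  define p where "p x = (max 0 (norm (f k x) - c))\<^sup>2" for x
  note mf = L2_measurable[OF L(1) k] and mg = L2_measurable[OF L(2) k]
  have pm: "p \<in> borel_measurable (edge k)" unfolding p_def using mf by measurable
  have d2: "integrable (edge k) (\<lambda>x. (norm (f k x - g n k x))\<^sup>2)" for n
    using L2_diff[OF L(1) L(2)[of n]] k unfolding L2_iff by blast
  have le: "AE x in edge k. p x \<le> 2 * (norm (f k x - g n k x))\<^sup>2 + 2 * (s n - c)\<^sup>2" for n
    using g[of n]
  proof eventually_elim
    case (elim x)
    have "norm (f k x) - c \<le> norm (f k x - g n k x) + \<bar>s n - c\<bar>"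
      using norm_triangle_ineq2[of "f k x" "g n k x"] elim by linarith
    then have "p x \<le> (norm (f k x - g n k x) + \<bar>s n - c\<bar>)\<^sup>2"
      unfolding p_def by (intro power_mono) auto
    also have "\<dots> \<le> 2 * (norm (f k x - g n k x))\<^sup>2 + 2 * (s n - c)\<^sup>2"
      using sum_squares_bound[of "norm (f k x - g n k x)" "\<bar>s n - c\<bar>"] by (simp add: power2_sum)
    finally show ?case .
  qed
  have bi: "integrable (edge k) (\<lambda>x. 2 * (norm (f k x - g n k x))\<^sup>2 + 2 * (s n - c)\<^sup>2)" for n
    using d2 integrable_const_edge by simp
  have pint: "integrable (edge k) p"
    by (rule Bochner_Integration.integrable_bound[OF bi[of 0] pm]) (use le[of 0] in eventually_elim, simp add: p_def)
  have "(\<integral>x. p x \<partial>edge k) \<le> 2 * (n2 (\<lambda>k x. f k x - g n k x))\<^sup>2 + 2 * (s n - c)\<^sup>2 * l k" for n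
  proof -
    have "(\<integral>x. p x \<partial>edge k) \<le> (\<integral>x. 2 * (norm (f k x - g n k x))\<^sup>2 + 2 * (s n - c)\<^sup>2 \<partial>edge k)"
      by (rule integral_mono_AE[OF pint bi le])
    also have "\<dots> = 2 * (\<integral>x. (norm (f k x - g n k x))\<^sup>2 \<partial>edge k) + l k * (2 * (s n - c)\<^sup>2)"
      using d2 integrable_const_edge integral_const_edge[OF k] by (subst Bochner_Integration.integral_add) auto
    also have "\<dots> \<le> 2 * (n2 (\<lambda>k x. f k x - g n k x))\<^sup>2 + l k * (2 * (s n - c)\<^sup>2)"
      using edge_integral_le_n2[OF L2_diff[OF L(1) L(2)[of n]] k] by simp
    finally show ?thesis by (simp add: mult.commute)
  qed
  moreover have "(\<lambda>n. 2 * (n2 (\<lambda>k x. f k x - g n k x))\<^sup>2 + 2 * (s n - c)\<^sup>2 * l k) \<longlonglongrightarrow> 2 * 0\<^sup>2 + 2 * (c - c)\<^sup>2 * l k"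
    by (intro tendsto_intros lim s)
  ultimately have "(\<integral>x. p x \<partial>edge k) \<le> 2 * 0\<^sup>2 + 2 * (c - c)\<^sup>2 * l k"
    by (intro tendsto_lowerbound[OF _ always_eventually]) auto
  moreover have "0 \<le> (\<integral>x. p x \<partial>edge k)" by (intro integral_nonneg_AE) (simp add: p_def)
  ultimately have "(\<integral>x. p x \<partial>edge k) = 0" by simp
  moreover have "(\<integral>x. p x \<partial>edge k) = 0 \<longleftrightarrow> (AE x in edge k. p x = 0)"
    by (rule integral_nonneg_eq_0_iff_AE[OF pint]) (simp add: p_def)
  ultimately have "AE x in edge k. p x = 0" by blast
  then show ?thesis by eventually_elim (simp add: p_def max_def split: if_splits)
qed

lemma n1_le_n2:
  assumes "L2 u"
  shows "n1 u \<le> n2 u * sqrt total_length"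
proof (rule le_mult_if_le_weighted_mean)
  fix s :: real assume s: "0 < s"
  have "2 * n1 u = (\<Sum>k<E. \<integral>x. 2 * norm (u k x) \<partial>edge k)" by (simp add: n1_def sum_distrib_left)
  also have "\<dots> \<le> (\<Sum>k<E. \<integral>x. s * inner (u k x) (u k x) + 1 / s \<partial>edge k)"
  proof (intro sum_mono integral_mono_AE AE_I2)
    fix k x
    have "2 * (sqrt s * norm (u k x)) * (1 / sqrt s) \<le> (sqrt s * norm (u k x))\<^sup>2 + (1 / sqrt s)\<^sup>2"
      by (rule sum_squares_bound)
    then show "2 * norm (u k x) \<le> s * inner (u k x) (u k x) + 1 / s"
      using s by (simp add: power_mult_distrib power_divide power2_norm_eq_inner)
  qed (use assms L2_norm_integrable L2_inner_integrable integrable_const_edge in auto)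
  also have "\<dots> = (\<Sum>k<E. s * (\<integral>x. inner (u k x) (u k x) \<partial>edge k) + l k * (1 / s))"
    by (intro sum.cong refl, subst Bochner_Integration.integral_add)
      (use assms L2_inner_integrable integrable_const_edge integral_const_edge in auto)
  also have "\<dots> = s * (n2 u)\<^sup>2 + (sqrt total_length)\<^sup>2 / s"
    using total_length_nonneg
    by (simp add: sum.distrib n2_squared ip_def sum_distrib_left total_length_def sum_divide_distrib)
  finally show "2 * n1 u \<le> s * (n2 u)\<^sup>2 + (sqrt total_length)\<^sup>2 / s" .
qed (simp_all add: n2_nonneg total_length_nonneg)

definition L1 :: "gfun \<Rightarrow> bool" where
  "L1 u \<longleftrightarrow> (\<forall>k<E. u k \<in> borel_measurable (edge k) \<and> integrable (edge k) (\<lambda>x. norm (u k x)))"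

lemma L2_imp_L1: "L2 u \<Longrightarrow> L1 u"
  by (simp add: L1_def L2_measurable L2_norm_integrable)

lemma L1_add:
  assumes "L1 u" "L1 v"
  shows "L1 (\<lambda>k x. u k x + v k x)"
  unfolding L1_def
proof (intro allI impI conjI)
  fix k assume "k < E"
  then have k: "u k \<in> borel_measurable (edge k)" "v k \<in> borel_measurable (edge k)"
    "integrable (edge k) (\<lambda>x. norm (u k x))" "integrable (edge k) (\<lambda>x. norm (v k x))"
    using assms by (auto simp: L1_def)
  show m: "(\<lambda>x. u k x + v k x) \<in> borel_measurable (edge k)" using k by measurable
  show "integrable (edge k) (\<lambda>x. norm (u k x + v k x))"
    by (rule Bochner_Integration.integrable_bound[of _ "\<lambda>x. norm (u k x) + norm (v k x)"])
      (use k m in \<open>auto intro!: AE_I2 norm_triangle_ineq\<close>)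
qed

lemma L1_scale: "L1 u \<Longrightarrow> L1 (\<lambda>k x. c * u k x)"
  by (auto simp: L1_def norm_mult)

lemma L1_diff: "L1 u \<Longrightarrow> L1 v \<Longrightarrow> L1 (\<lambda>k x. u k x - v k x)"
  using L1_add[OF _ L1_scale, of u v "- 1"] by simp

lemma n1_triangle:
  assumes "L1 u" "L1 v"
  shows "n1 u \<le> n1 v + n1 (\<lambda>k x. u k x - v k x)"
  unfolding n1_def sum.distrib[symmetric]
proof (rule sum_mono)
  fix k assume "k \<in> {..<E}"
  then have k: "k < E" by simp
  have i: "integrable (edge k) (\<lambda>x. norm (u k x))" "integrable (edge k) (\<lambda>x. norm (v k x))"
    "integrable (edge k) (\<lambda>x. norm (u k x - v k x))"
    using assms L1_diff[OF assms] k by (auto simp: L1_def)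
  have "(\<integral>x. norm (u k x) \<partial>edge k) \<le> (\<integral>x. norm (v k x) + norm (u k x - v k x) \<partial>edge k)"
    using i norm_triangle_sub by (intro integral_mono_AE AE_I2) auto
  then show "(\<integral>x. norm (u k x) \<partial>edge k) \<le> (\<integral>x. norm (v k x) \<partial>edge k) + (\<integral>x. norm (u k x - v k x) \<partial>edge k)"
    using i by simp
qed

lemma n1_tendsto:
  assumes L: "L2 f" "\<And>n. L2 (g n)" and lim: "(\<lambda>n. n2 (\<lambda>k x. f k x - g n k x)) \<longlonglongrightarrow> 0"
  shows "(\<lambda>n. n1 (g n)) \<longlonglongrightarrow> n1 f"
proof -
  have lim0: "(\<lambda>n. n2 (\<lambda>k x. f k x - g n k x) * sqrt total_length) \<longlonglongrightarrow> 0"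
    using tendsto_mult_right[OF lim, of "sqrt total_length"] by simp
  have "(\<lambda>n. n1 (g n) - n1 f) \<longlonglongrightarrow> 0"
  proof (rule Lim_null_comparison[OF always_eventually lim0], rule allI)
    fix n
    have "n1 f \<le> n1 (g n) + n2 (\<lambda>k x. f k x - g n k x) * sqrt total_length"
      by (rule order.trans[OF n1_triangle add_left_mono[OF n1_le_n2]]) (use L in \<open>auto intro: L2_diff L2_imp_L1\<close>)
    moreover have "n1 (g n) \<le> n1 f + n2 (\<lambda>k x. g n k x - f k x) * sqrt total_length"
      by (rule order.trans[OF n1_triangle add_left_mono[OF n1_le_n2]]) (use L in \<open>auto intro: L2_diff L2_imp_L1\<close>)
    ultimately show "norm (n1 (g n) - n1 f) \<le> n2 (\<lambda>k x. f k x - g n k x) * sqrt total_length"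
      using n2_minus_commute[of f "g n"] by (simp add: abs_le_iff)
  qed
  then show ?thesis by (simp add: Lim_null[of _ "n1 f"])
qed

text \<open>The kernel operator applied to \<open>norm u\<close>: one pointwise bound by it carries
  the L^p estimates for all p.\<close>

definition potential :: "real \<Rightarrow> gfun \<Rightarrow> nat \<Rightarrow> real \<Rightarrow> real" where
  "potential r u k x =
     (\<Sum>j<E. \<integral>y. exp (- \<bar>enddist r (l k) x - enddist r (l j) y\<bar> / r) * norm (u j y) \<partial>edge j) / r"

lemma enddist_measurable: "0 < r \<Longrightarrow> enddist r L \<in> borel_measurable (lebesgue_on {0..b})"
  by (intro continuous_imp_measurable_on_sets_lebesgue enddist_cont) auto

lemma edge_le_total: "k < E \<Longrightarrow> l k \<le> total_length"
  unfolding total_length_def by (rule member_le_sum) (use lpos in \<open>auto intro: less_imp_le\<close>)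

lemma scale_exists: obtains r0 where "0 < r0" "r0 \<le> 1" "\<And>k. k < E \<Longrightarrow> r0 \<le> l k"
  by (rule that[of "Min (insert 1 (l ` {..<E}))"]) (use lpos in auto)

end

context weighted_semigroup
begin

lemma W_T_sup_le_n2:
  assumes f: "L2 f" and k: "k < E"
  shows "AE x in edge k. norm (W (T (r ^ 4) f) k x) \<le> smoothing_const / sqrt r * n2 (W f)"
proof -
  obtain g a b where g: "\<And>n. gen (g n) (a n)" "\<And>n. gen (a n) (b n)"
    "(\<lambda>n. n2 (\<lambda>k x. f k x - g n k x)) \<longlonglongrightarrow> 0" using gen_sequence[OF f] by blast
  note L = gen_L2(1)[OF g(1)]
  have t: "0 \<le> r ^ 4" by simp
  show ?thesis
  proof (rule AE_norm_le_limit[where g = "\<lambda>n. W (T (r ^ 4) (g n))", OF _ _ _ _ k W_T_sup_le_n2_gen[OF g(1,2) k]])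
    show "(\<lambda>n. n2 (\<lambda>k x. W (T (r ^ 4) f) k x - W (T (r ^ 4) (g n)) k x)) \<longlonglongrightarrow> 0"
      by (intro scaled_tendsto T_tendsto admissible_w T_L2 f L t g)
    show "(\<lambda>n. smoothing_const / sqrt r * n2 (W (g n))) \<longlonglongrightarrow> smoothing_const / sqrt r * n2 (W f)"
      by (intro tendsto_mult_left n2_tendsto scaled_tendsto admissible_w LW f L g)
  qed (intro LW T_L2 f L t)+
qed

lemma n2_W_T_le_n1:
  assumes f: "L2 f"
  shows "n2 (W (T (r ^ 4) f)) \<le> 144 * M * exp 816951 / sqrt r * n1 (W f)"
proof -
  obtain g a b where g: "\<And>n. gen (g n) (a n)" "\<And>n. gen (a n) (b n)"
    "(\<lambda>n. n2 (\<lambda>k x. f k x - g n k x)) \<longlonglongrightarrow> 0" using gen_sequence[OF f] by blast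
  note L = gen_L2(1)[OF g(1)]
  have t: "0 \<le> r ^ 4" by simp
  show ?thesis
  proof (rule LIMSEQ_le)
    show "(\<lambda>n. n2 (W (T (r ^ 4) (g n)))) \<longlonglongrightarrow> n2 (W (T (r ^ 4) f))"
      by (intro n2_tendsto scaled_tendsto T_tendsto admissible_w LW T_L2 f L t g)
    show "(\<lambda>n. 144 * M * exp 816951 / sqrt r * n1 (W (g n))) \<longlonglongrightarrow> 144 * M * exp 816951 / sqrt r * n1 (W f)"
      by (intro tendsto_mult_left n1_tendsto scaled_tendsto admissible_w LW f L g)
    show "\<exists>N. \<forall>n\<ge>N. n2 (W (T (r ^ 4) (g n))) \<le> 144 * M * exp 816951 / sqrt r * n1 (W (g n))"
      using n2_W_T_le_n1_gen[OF g(1,2)] by blast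
  qed
qed

definition "kernel_const = smoothing_const * (144 * M * exp 816951)"

lemma kernel_const_pos: "0 < kernel_const"
  using M by (simp add: kernel_const_def smoothing_const_def)

text \<open>Time \<open>2 * r ^ 4\<close> is spent half on L^1 to L^2 and half on L^2 to L^infinity;
  each half costs \<open>1 / sqrt r\<close>.\<close>

lemma W_T_sup_le_n1:
  assumes f: "L2 f" and k: "k < E"
  shows "AE x in edge k. norm (W (T (2 * r ^ 4) f) k x) \<le> kernel_const / r * n1 (W f)"
proof -
  have t: "0 \<le> r ^ 4" by simp
  have "T (2 * r ^ 4) f \<simeq> T (r ^ 4) (T (r ^ 4) f)" using T_plus[OF t t f] by simp
  then have "W (T (2 * r ^ 4) f) \<simeq> W (T (r ^ 4) (T (r ^ 4) f))" by (rule aeq_scaled)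
  then have "AE x in edge k. W (T (2 * r ^ 4) f) k x = W (T (r ^ 4) (T (r ^ 4) f)) k x"
    using k by (simp add: aeq_def)
  moreover have "AE x in edge k. norm (W (T (r ^ 4) (T (r ^ 4) f)) k x) \<le> smoothing_const / sqrt r * n2 (W (T (r ^ 4) f))"
    by (intro W_T_sup_le_n2 T_L2 t f k)
  ultimately show ?thesis
  proof eventually_elim
    case (elim x)
    have "smoothing_const / sqrt r * n2 (W (T (r ^ 4) f)) \<le> smoothing_const / sqrt r * (144 * M * exp 816951 / sqrt r * n1 (W f))"
      using M r by (intro mult_left_mono n2_W_T_le_n1 f) (simp add: smoothing_const_def)
    also have "\<dots> = kernel_const / r * n1 (W f)" using r by (simp add: kernel_const_def)
    finally show ?case using elim by simp
  qed
qed

end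

context network_semigroup
begin

lemma weighted_kernel_bound:
  obtains C where "0 < C" "\<And>r \<sigma> f k. 0 < r \<Longrightarrow> r \<le> 1 \<Longrightarrow> (\<forall>k<E. r \<le> l k) \<Longrightarrow> \<bar>\<sigma>\<bar> = 1 \<Longrightarrow> L2 f \<Longrightarrow> k < E \<Longrightarrow>
    AE x in edge k. norm (T (2 * r ^ 4) f k x) \<le>
      C / r * (\<Sum>j<E. \<integral>y. exp (\<sigma> * (enddist r (l j) y - enddist r (l k) x) / r) * norm (f j y) \<partial>edge j)"
proof -
  obtain M where ws: "\<And>r \<psi> \<psi>1 \<psi>2 c. 0 < r \<Longrightarrow> r \<le> 1 \<Longrightarrow> \<forall>k<E. r \<le> l k \<Longrightarrow> weight r \<psi> \<psi>1 \<psi>2 c \<Longrightarrow>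
    \<exists>N. weighted_semigroup E l Y R T (\<lambda>k x. exp (\<psi> k x)) N r M"
    using weighted_semigroup_exists by blast
  obtain r0 where r0: "0 < r0" "r0 \<le> 1" "\<And>k. k < E \<Longrightarrow> r0 \<le> l k" using scale_exists by blast
  \<comment> \<open>The zero weight is instantiated to extract the positivity of
    \<open>M\<close>.\<close>
  then have "\<exists>N. weighted_semigroup E l Y R T (\<lambda>k x. exp 0) N r0 M" using ws[OF r0(1,2) _ weight_zero] by simp
  then have M: "0 < M" by (auto dest: weighted_semigroup.M)
  \<comment> \<open>\<open>kernel_const\<close> spelled out: it depends on \<open>M\<close> alone,
    so a single constant serves all \<open>r\<close> and both signs.\<close>
  define C where "C = 18 * sqrt (8 * M) * exp 816951 * (144 * M * exp 816951)"
  have "0 < C" using M by (simp add: C_def)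
  then show thesis
  proof (rule that)
    fix r \<sigma> f k assume r: "0 < r" "r \<le> 1" "\<forall>k<E. r \<le> l k" and \<sigma>: "\<bar>\<sigma>\<bar> = (1::real)" and f: "L2 f" and k: "k < E"
    obtain N where "weighted_semigroup E l Y R T (\<lambda>k x. exp (\<sigma> * enddist r (l k) x / r)) N r M"
      using ws[OF r weight_enddist[OF r(1) \<sigma>]] by blast
    then interpret weighted_semigroup E l Y R T "\<lambda>k x. exp (\<sigma> * enddist r (l k) x / r)" N r M .
    have KC: "kernel_const = C" by (simp add: kernel_const_def smoothing_const_def C_def)
    show "AE x in edge k. norm (T (2 * r ^ 4) f k x) \<le>
      C / r * (\<Sum>j<E. \<integral>y. exp (\<sigma> * (enddist r (l j) y - enddist r (l k) x) / r) * norm (f j y) \<partial>edge j)"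
      using W_T_sup_le_n1[OF f k]
    proof eventually_elim
      case (elim x)
      define e where "e = exp (- (\<sigma> * enddist r (l k) x / r))"
      have "norm (T (2 * r ^ 4) f k x) = e * norm (W (T (2 * r ^ 4) f) k x)"
        by (simp add: scaled_def norm_mult e_def flip: mult.assoc exp_add)
      also have "\<dots> \<le> e * (kernel_const / r * n1 (W f))" by (intro mult_left_mono elim) (simp add: e_def)
      also have "\<dots> = C / r * (e * n1 (W f))" by (simp add: KC)
      also have "e * n1 (W f) = (\<Sum>j<E. e * (\<integral>y. norm (W f j y) \<partial>edge j))"
        by (simp add: n1_def sum_distrib_left)
      also have "(\<Sum>j<E. e * (\<integral>y. norm (W f j y) \<partial>edge j))
          = (\<Sum>j<E. \<integral>y. exp (\<sigma> * (enddist r (l j) y - enddist r (l k) x) / r) * norm (f j y) \<partial>edge j)"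
      proof (intro sum.cong refl)
        fix j
        have "e * norm (W f j y) = exp (\<sigma> * (enddist r (l j) y - enddist r (l k) x) / r) * norm (f j y)" for y
          by (simp add: e_def scaled_def norm_mult flip: mult.assoc exp_add)
            (simp add: right_diff_distrib diff_divide_distrib)
        then show "e * (\<integral>y. norm (W f j y) \<partial>edge j)
            = (\<integral>y. exp (\<sigma> * (enddist r (l j) y - enddist r (l k) x) / r) * norm (f j y) \<partial>edge j)"
          by (simp flip: integral_mult_right_zero)
      qed
      finally show ?case .
    qed
  qed
qed

text \<open>Splitting \<open>f\<close> at a level of \<open>enddist\<close> and using the growing weight below and the decaying weight
  above that level turns the two weighted bounds into an exponentially decaying kernel.\<close>
lemma short_time_kernel_bound:
  obtains C where "0 < C" "\<And>r f k. 0 < r \<Longrightarrow> r \<le> 1 \<Longrightarrow> (\<forall>k<E. r \<le> l k) \<Longrightarrow> L2 f \<Longrightarrow> k < E \<Longrightarrow>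
    AE x in edge k. norm (T (2 * r ^ 4) f k x) \<le> C * potential r f k x"
proof -
  obtain C where C: "0 < C" "\<And>r \<sigma> f k. 0 < r \<Longrightarrow> r \<le> 1 \<Longrightarrow> (\<forall>k<E. r \<le> l k) \<Longrightarrow> \<bar>\<sigma>\<bar> = 1 \<Longrightarrow> L2 f \<Longrightarrow> k < E \<Longrightarrow>
    AE x in edge k. norm (T (2 * r ^ 4) f k x) \<le>
      C / r * (\<Sum>j<E. \<integral>y. exp (\<sigma> * (enddist r (l j) y - enddist r (l k) x) / r) * norm (f j y) \<partial>edge j)"
    using weighted_kernel_bound by blast
  have "0 < C * exp 2" using C(1) by simp
  then show thesis
  proof (rule that)
    fix r f k assume r: "0 < r" "r \<le> 1" "\<forall>k<E. r \<le> l k" and f: "L2 f" and k: "k < E"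
    define \<phi> where "\<phi> j y = enddist r (l j) y" for j y
    \<comment> \<open>The levels are multiples of \<open>r\<close>, hence countably many: the
      exceptional null sets of all splittings are united before the level is chosen depending on
      \<open>x\<close>.\<close>
    define low where "low i j y = (if \<phi> j y < real i * r then f j y else 0)" for i :: nat and j y
    define high where "high i j y = (if \<phi> j y < real i * r then 0 else f j y)" for i :: nat and j y
    have \<phi>m [measurable]: "\<phi> j \<in> borel_measurable (edge j)" for j
      unfolding \<phi>_def by (rule enddist_measurable[OF r(1)])
    have low_eq: "low i = (\<lambda>j y. (if \<phi> j y < real i * r then 1 else 0) * f j y)" for i
      by (auto simp: low_def fun_eq_iff)
    have high_eq: "high i = (\<lambda>j y. (if \<phi> j y < real i * r then 0 else 1) * f j y)" for i
      by (auto simp: high_def fun_eq_iff)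
    have step_measurable: "(\<lambda>y. if \<phi> j y < s then a else b) \<in> borel_measurable (edge j)" for j s and a b :: complex
      by (intro measurable_If measurable_const borel_measurable_less \<phi>m) simp_all
    have Llow: "L2 (low i)" for i
      unfolding low_eq by (rule L2_mult[OF f step_measurable, where M = 1]) auto
    have Lhigh: "L2 (high i)" for i
      unfolding high_eq by (rule L2_mult[OF f step_measurable, where M = 1]) auto
    have t: "0 \<le> 2 * r ^ 4" by simp
    have "AE x in edge k. \<forall>i. T (2 * r ^ 4) f k x = T (2 * r ^ 4) (low i) k x + T (2 * r ^ 4) (high i) k x"
      unfolding AE_all_countable
    proof
      fix i
      have "f = (\<lambda>j y. low i j y + high i j y)" by (auto simp: low_def high_def fun_eq_iff)
      then have "T (2 * r ^ 4) f \<simeq> (\<lambda>k x. T (2 * r ^ 4) (low i) k x + T (2 * r ^ 4) (high i) k x)"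
        using T_add[OF t Llow Lhigh, of i i] by simp
      then show "AE x in edge k. T (2 * r ^ 4) f k x = T (2 * r ^ 4) (low i) k x + T (2 * r ^ 4) (high i) k x"
        using k by (simp add: aeq_def)
    qed
    moreover have "AE x in edge k. \<forall>i. norm (T (2 * r ^ 4) (low i) k x) \<le>
        C / r * (\<Sum>j<E. \<integral>y. exp (1 * (\<phi> j y - \<phi> k x) / r) * norm (low i j y) \<partial>edge j)"
      unfolding AE_all_countable \<phi>_def using C(2)[OF r _ Llow k, of 1] by simp
    moreover have "AE x in edge k. \<forall>i. norm (T (2 * r ^ 4) (high i) k x) \<le>
        C / r * (\<Sum>j<E. \<integral>y. exp ((-1) * (\<phi> j y - \<phi> k x) / r) * norm (high i j y) \<partial>edge j)"
      unfolding AE_all_countable \<phi>_def using C(2)[OF r _ Lhigh k, of "-1"] by simp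
    moreover have "AE x in edge k. x \<in> {0..l k}" by (rule AE_I2) simp
    ultimately show "AE x in edge k. norm (T (2 * r ^ 4) f k x) \<le> C * exp 2 * potential r f k x"
    proof eventually_elim
      case (elim x)
      define i where "i = nat \<lfloor>\<phi> k x / r\<rfloor>"
      have \<phi>0: "0 \<le> \<phi> k x" using enddist_bounds(1)[OF r(1) elim(4)] by (simp add: \<phi>_def)
      have "real i = of_int \<lfloor>\<phi> k x / r\<rfloor>" using \<phi>0 r by (simp add: i_def)
      then have "real i \<le> \<phi> k x / r" "\<phi> k x / r < real i + 1" by linarith+
      then have i: "real i * r \<le> \<phi> k x" "\<phi> k x < real i * r + r" using r by (auto simp: field_simps)
      let ?K = "\<lambda>j y. exp (- \<bar>\<phi> k x - \<phi> j y\<bar> / r)"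
      have fi: "integrable (edge j) (\<lambda>y. h y * norm (u j y))"
        if "L2 u" "j < E" "h \<in> borel_measurable (edge j)" "\<And>y. y \<in> {0..l j} \<Longrightarrow> \<bar>h y\<bar> \<le> B"
        for u h B and j :: nat
      proof (rule Bochner_Integration.integrable_bound)
        show "integrable (edge j) (\<lambda>y. B * norm (u j y))" using L2_norm_integrable[OF that(1,2)] by simp
        show "(\<lambda>y. h y * norm (u j y)) \<in> borel_measurable (edge j)"
          using that(3) L2_measurable[OF that(1,2)] by measurable
        show "AE y in edge j. norm (h y * norm (u j y)) \<le> norm (B * norm (u j y))"
          using that(4) by (intro AE_I2) (force simp: abs_mult intro!: mult_right_mono)
      qed
      have Ki: "integrable (edge j) (\<lambda>y. ?K j y * norm (f j y))" if "j < E" for j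
        by (rule fi[OF f that, where B = 1]) (use \<phi>m[of j] r in \<open>measurable, auto\<close>)
      have le1: "exp ((\<phi> j y - \<phi> k x) / r) * norm (low i j y) \<le> ?K j y * norm (low i j y)" for j y
        using i(1) r by (cases "\<phi> j y < real i * r") (auto simp: low_def field_simps abs_if intro!: mult_right_mono)
      \<comment> \<open>Points of the high part may still lie below the level of \<open>x\<close>,
        but by less than \<open>r\<close>; there the weight exceeds the kernel by at most the factor
        \<open>exp 2\<close>.\<close>
      have le2: "exp (- (\<phi> j y - \<phi> k x) / r) * norm (high i j y) \<le> exp 2 * ?K j y * norm (high i j y)" for j y
      proof (cases "\<phi> j y < real i * r")
        case False
        then have "- (\<phi> j y - \<phi> k x) \<le> 2 * r - \<bar>\<phi> k x - \<phi> j y\<bar>" using i(2) r by (auto simp: abs_if)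
        then have "- (\<phi> j y - \<phi> k x) / r \<le> (2 * r - \<bar>\<phi> k x - \<phi> j y\<bar>) / r" using r by (intro divide_right_mono) auto
        then have "- (\<phi> j y - \<phi> k x) / r \<le> 2 + - \<bar>\<phi> k x - \<phi> j y\<bar> / r" using r by (simp add: diff_divide_distrib)
        then have "exp (- (\<phi> j y - \<phi> k x) / r) \<le> exp 2 * ?K j y" by (simp flip: exp_add)
        then show ?thesis by (intro mult_right_mono) auto
      qed (simp add: high_def)
      have bnd: "(\<integral>y. h y * norm (u j y) \<partial>edge j) \<le> c * (\<integral>y. ?K j y * norm (v j y) \<partial>edge j)"
        if "j < E" "L2 v" "0 \<le> c" "\<And>y. 0 \<le> h y" "\<And>y. h y * norm (u j y) \<le> c * ?K j y * norm (v j y)" for j h u v c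
      proof -
        have "(\<integral>y. h y * norm (u j y) \<partial>edge j) \<le> (\<integral>y. c * (?K j y * norm (v j y)) \<partial>edge j)"
        proof (rule integral_mono_AE')
          have "integrable (edge j) (\<lambda>y. ?K j y * norm (v j y))"
            by (rule fi[OF that(2,1), where B = 1]) (use \<phi>m[of j] r in \<open>measurable, auto\<close>)
          then show "integrable (edge j) (\<lambda>y. c * (?K j y * norm (v j y)))" by simp
        qed (use that in \<open>auto simp: mult.assoc\<close>)
        then show ?thesis by simp
      qed
      have "norm (T (2 * r ^ 4) f k x) \<le> norm (T (2 * r ^ 4) (low i) k x) + norm (T (2 * r ^ 4) (high i) k x)"
        by (simp only: elim(1)[rule_format, of i] norm_triangle_ineq)
      also have "\<dots> \<le> C / r * (\<Sum>j<E. \<integral>y. exp (1 * (\<phi> j y - \<phi> k x) / r) * norm (low i j y) \<partial>edge j)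
         + C / r * (\<Sum>j<E. \<integral>y. exp ((-1) * (\<phi> j y - \<phi> k x) / r) * norm (high i j y) \<partial>edge j)"
        by (intro add_mono elim(2,3)[rule_format])
      also have "\<dots> \<le> C / r * (\<Sum>j<E. exp 2 * (\<integral>y. ?K j y * norm (low i j y) \<partial>edge j))
         + C / r * (\<Sum>j<E. exp 2 * (\<integral>y. ?K j y * norm (high i j y) \<partial>edge j))"
      proof (intro add_mono mult_left_mono sum_mono)
        fix j assume "j \<in> {..<E}"
        then have j: "j < E" by simp
        show "(\<integral>y. exp (1 * (\<phi> j y - \<phi> k x) / r) * norm (low i j y) \<partial>edge j) \<le> exp 2 * (\<integral>y. ?K j y * norm (low i j y) \<partial>edge j)"
        proof (rule bnd[OF j Llow])
          fix y
          have "exp (1 * (\<phi> j y - \<phi> k x) / r) * norm (low i j y) \<le> 1 * (?K j y * norm (low i j y))" using le1 by simp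
          also have "\<dots> \<le> exp 2 * (?K j y * norm (low i j y))" by (intro mult_right_mono) auto
          finally show "exp (1 * (\<phi> j y - \<phi> k x) / r) * norm (low i j y) \<le> exp 2 * ?K j y * norm (low i j y)" by simp
        qed auto
        show "(\<integral>y. exp ((-1) * (\<phi> j y - \<phi> k x) / r) * norm (high i j y) \<partial>edge j) \<le> exp 2 * (\<integral>y. ?K j y * norm (high i j y) \<partial>edge j)"
          by (rule bnd[OF j Lhigh]) (use le2 in auto)
      qed (use C r in auto)
      also have "\<dots> = C * exp 2 * ((\<Sum>j<E. (\<integral>y. ?K j y * norm (low i j y) \<partial>edge j) + (\<integral>y. ?K j y * norm (high i j y) \<partial>edge j)) / r)"
        by (simp add: sum.distrib sum_distrib_left[symmetric] algebra_simps add_divide_distrib)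
      also have "(\<Sum>j<E. (\<integral>y. ?K j y * norm (low i j y) \<partial>edge j) + (\<integral>y. ?K j y * norm (high i j y) \<partial>edge j))
         = (\<Sum>j<E. \<integral>y. ?K j y * norm (f j y) \<partial>edge j)"
      proof (intro sum.cong refl)
        fix j assume "j \<in> {..<E}"
        then have j: "j < E" by simp
        have "integrable (edge j) (\<lambda>y. ?K j y * norm (low i j y))"
          by (rule fi[OF Llow j, where B = 1]) (use \<phi>m[of j] r in \<open>measurable, auto\<close>)
        moreover have "integrable (edge j) (\<lambda>y. ?K j y * norm (high i j y))"
          by (rule fi[OF Lhigh j, where B = 1]) (use \<phi>m[of j] r in \<open>measurable, auto\<close>)
        ultimately have "(\<integral>y. ?K j y * norm (low i j y) \<partial>edge j) + (\<integral>y. ?K j y * norm (high i j y) \<partial>edge j)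
           = (\<integral>y. ?K j y * norm (low i j y) + ?K j y * norm (high i j y) \<partial>edge j)" by simp
        also have "\<dots> = (\<integral>y. ?K j y * norm (f j y) \<partial>edge j)"
          by (intro Bochner_Integration.integral_cong refl) (auto simp: low_def high_def)
        finally show "(\<integral>y. ?K j y * norm (low i j y) \<partial>edge j) + (\<integral>y. ?K j y * norm (high i j y) \<partial>edge j)
           = (\<integral>y. ?K j y * norm (f j y) \<partial>edge j)" .
      qed
      finally show ?case by (simp add: potential_def \<phi>_def)
    qed
  qed
qed

end

section \<open>Schur test and the kernel bound for all times\<close>

text \<open>Trades the exponential for a rational bound with primitive arctan, whose integral is
  bounded independently of the interval.\<close>

lemma exp_minus_abs_le: "exp (- \<bar>s\<bar>) \<le> 2 * inverse (1 + s\<^sup>2)" for s :: real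
proof -
  have "(1 + s\<^sup>2) / 2 \<le> exp \<bar>s\<bar>"
    using exp_lower_Taylor_quadratic[of "\<bar>s\<bar>"] by (simp add: add_divide_distrib)
  then have "exp (- \<bar>s\<bar>) * ((1 + s\<^sup>2) / 2) \<le> exp (- \<bar>s\<bar>) * exp \<bar>s\<bar>" by (intro mult_left_mono) auto
  also have "\<dots> = 1" by (simp flip: exp_add)
  finally show ?thesis
    by (simp add: field_simps add_pos_nonneg)
qed

text \<open>The tangent to the convex function \<open>s powr p\<close> at 1, taken from Young's
  inequality with second factor 1.\<close>

lemma Bernoulli_powr: "p * s \<le> s powr p + (p - 1)" if "1 \<le> p" "0 \<le> s" for p s :: real
proof (cases "s = 0")
  case False
  then have "(s powr p) powr (1 / p) * 1 powr (1 - 1 / p) \<le> 1 / p * s powr p + (1 - 1 / p) * 1"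
    using that by (intro Youngs_inequality_0) auto
  then have "s \<le> 1 / p * s powr p + (1 - 1 / p)" using that False by (simp add: powr_powr)
  then have "p * s \<le> p * (1 / p * s powr p + (1 - 1 / p))" using that by (intro mult_left_mono) auto
  then show ?thesis using that by (simp add: algebra_simps)
qed (use that in simp)

section \<open>The kernel and its action on L^p\<close>

context network
begin

definition kern :: "real \<Rightarrow> nat \<Rightarrow> real \<Rightarrow> nat \<Rightarrow> real \<Rightarrow> real" where
  "kern r k x j y = exp (- \<bar>enddist r (l k) x - enddist r (l j) y\<bar> / r) / r"

text \<open>Per edge, the comparison factor \<open>2 * exp 2 / r\<close> meets two integrals of size
  \<open>r * pi\<close>; the summand 1 keeps the constant positive for \<open>E = 0\<close>.\<close>

definition kern_mass :: real where
  "kern_mass = 4 * pi * exp 2 * E + 1"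

lemma kern_mass_pos: "0 < kern_mass"
  by (simp add: kern_mass_def add_nonneg_pos)

lemma kern_nonneg: "0 < r \<Longrightarrow> 0 \<le> kern r k x j y"
  and kern_le: "0 < r \<Longrightarrow> kern r k x j y \<le> 1 / r"
  and kern_commute: "kern r k x j y = kern r j y k x"
  by (auto simp: kern_def abs_minus_commute divide_right_mono)

lemma kern_measurable: "0 < r \<Longrightarrow> kern r k x j \<in> borel_measurable (edge j)"
  unfolding kern_def using enddist_measurable[of r "l j" "l j"] by measurable

lemma kern_integrable: "0 < r \<Longrightarrow> integrable (edge j) (kern r k x j)"
  by (rule Bochner_Integration.integrable_bound[OF integrable_const_edge[where c = "1 / r"] kern_measurable])
    (auto simp: kern_nonneg kern_le)

text \<open>Replacing \<open>enddist\<close> by the exact distance to the endpoints costs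
  \<open>exp 2\<close>. The level \<open>a\<close> is then attained at \<open>a\<close> on the left
  half of the edge and at \<open>L - a\<close> on the right half, so two integrable bumps,
  \<open>f a\<close> and \<open>f (L - a)\<close>, dominate the kernel.\<close>

lemma kern_integral_le:
  assumes r: "0 < r"
  shows "(\<Sum>j<E. \<integral>y. kern r k x j y \<partial>edge j) \<le> kern_mass"
proof -
  define a where "a = enddist r (l k) x"
  have "(\<integral>y. kern r k x j y \<partial>edge j) \<le> 4 * pi * exp 2" if j: "j < E" for j
  proof -
    define L where "L = l j"
    have L: "0 \<le> L" using lpos[OF j] by (simp add: L_def)
    define F where "F c y = r * arctan ((y - c) / r)" for c y :: real
    define f where "f c y = inverse (1 + ((y - c) / r)\<^sup>2)" for c y :: real
    have pos: "0 < 1 + s\<^sup>2" for s :: real by (simp add: add_pos_nonneg)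
    have deriv: "(F c has_real_derivative f c y) (at y within S)" for c y S
      unfolding F_def[abs_def] f_def using r pos[of "(y - c) / r"]
      by (auto intro!: derivative_eq_intros)
    have cont: "continuous_on S (f c)" for S c
      unfolding f_def using pos r by (intro continuous_intros) (auto simp: add_nonneg_eq_0_iff)
    have fi: "integrable (edge j) (f c)" for c
      using continuous_imp_integrable_real[OF cont] by (simp add: L_def)
    have fint: "(\<integral>y. f c y \<partial>edge j) \<le> r * pi" for c
    proof -
      have "(f c has_integral F c L - F c 0) {0..L}"
        using deriv L by (intro fundamental_theorem_of_calculus) (auto simp: has_real_derivative_iff_has_vector_derivative)
      then have "(\<integral>y. f c y \<partial>edge j) = F c L - F c 0"
        using fi by (simp add: lebesgue_integral_eq_integral integral_unique L_def)
      also have "\<dots> = r * (arctan ((L - c) / r) - arctan ((0 - c) / r))" by (simp add: F_def algebra_simps)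
      also have "\<dots> \<le> r * (pi / 2 + pi / 2)"
        using arctan_ubound[of "(L - c) / r"] arctan_lbound[of "(0 - c) / r"] r by (intro mult_left_mono) auto
      finally show ?thesis by simp
    qed
    have "(\<integral>y. kern r k x j y \<partial>edge j) \<le> (\<integral>y. 2 * exp 2 / r * (f a y + f (L - a) y) \<partial>edge j)"
    proof (intro integral_mono_AE AE_I2 kern_integrable r)
      fix y assume "y \<in> space (edge j)"
      then have y: "y \<in> {0..L}" by (simp add: L_def)
      define d where "d = min y (L - y)"
      have "\<bar>enddist r L y - d\<bar> \<le> 2 * r" unfolding d_def by (rule enddist_approx[OF r y])
      then have "- \<bar>a - enddist r L y\<bar> \<le> 2 * r - \<bar>a - d\<bar>" by linarith
      then have "- \<bar>a - enddist r L y\<bar> / r \<le> 2 + - \<bar>(a - d) / r\<bar>"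
        using divide_right_mono[of "- \<bar>a - enddist r L y\<bar>" "2 * r - \<bar>a - d\<bar>" r] r
        by (simp add: diff_divide_distrib[of "2 * r"])
      then have "exp (- \<bar>a - enddist r L y\<bar> / r) \<le> exp 2 * exp (- \<bar>(a - d) / r\<bar>)" by (simp flip: exp_add)
      also have "\<dots> \<le> exp 2 * (2 * inverse (1 + ((a - d) / r)\<^sup>2))" by (intro mult_left_mono exp_minus_abs_le) simp
      also have "inverse (1 + ((a - d) / r)\<^sup>2) \<le> f a y + f (L - a) y"
      proof -
        have nn: "0 \<le> f c y" for c using pos[of "(y - c) / r"] by (simp add: f_def less_imp_le)
        show ?thesis
        proof (cases "y \<le> L - y")
          case True
          then have "inverse (1 + ((a - d) / r)\<^sup>2) = f a y" by (simp add: d_def f_def power_divide power2_commute)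
          then show ?thesis using nn by simp
        next
          case False
          then have "(a - d) / r = (y - (L - a)) / r" by (simp add: d_def)
          then have "inverse (1 + ((a - d) / r)\<^sup>2) = f (L - a) y" by (simp only: f_def)
          then show ?thesis using nn by simp
        qed
      qed
      finally have "exp (- \<bar>a - enddist r L y\<bar> / r) / r \<le> exp 2 * (2 * (f a y + f (L - a) y)) / r"
        using r by (intro divide_right_mono) auto
      then show "kern r k x j y \<le> 2 * exp 2 / r * (f a y + f (L - a) y)"
        by (simp add: kern_def a_def L_def algebra_simps add_divide_distrib)
    qed (use fi in simp)
    also have "\<dots> = 2 * exp 2 / r * ((\<integral>y. f a y \<partial>edge j) + (\<integral>y. f (L - a) y \<partial>edge j))"
      using fi by simp
    also have "\<dots> \<le> 2 * exp 2 / r * (r * pi + r * pi)"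
      using r by (intro mult_left_mono add_mono fint) auto
    also have "\<dots> = 4 * pi * exp 2" using r by simp
    finally show ?thesis .
  qed
  then have "(\<Sum>j<E. \<integral>y. kern r k x j y \<partial>edge j) \<le> (\<Sum>j<E. 4 * pi * exp 2)"
    by (intro sum_mono) auto
  then show ?thesis by (simp add: kern_mass_def mult.commute)
qed

lemma potential_eq: "potential r u k x = (\<Sum>j<E. \<integral>y. kern r k x j y * norm (u j y) \<partial>edge j)"
  unfolding potential_def kern_def sum_divide_distrib
  by (intro sum.cong refl) (simp flip: integral_divide_zero)

lemma kern_mult_integrable:
  fixes h :: "real \<Rightarrow> real"
  assumes r: "0 < r" and h: "integrable (edge j) h"
  shows "integrable (edge j) (\<lambda>y. kern r k x j y * h y)"
proof (rule Bochner_Integration.integrable_bound)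
  show "integrable (edge j) (\<lambda>y. 1 / r * h y)" using h by simp
  show "(\<lambda>y. kern r k x j y * h y) \<in> borel_measurable (edge j)"
    using kern_measurable[OF r, of k x j] borel_measurable_integrable[OF h] by measurable
  show "AE y in edge j. norm (kern r k x j y * h y) \<le> norm (1 / r * h y)"
    using kern_nonneg[OF r] kern_le[OF r] r
    by (intro AE_I2) (auto simp: abs_mult divide_inverse intro!: mult_right_mono)
qed

lemma potential_nonneg: "0 < r \<Longrightarrow> 0 \<le> potential r u k x"
  unfolding potential_eq by (intro sum_nonneg integral_nonneg_AE) (simp add: kern_nonneg)

lemma potential_le_n1:
  assumes r: "0 < r" and u: "L1 u"
  shows "potential r u k x \<le> n1 u / r"
  unfolding potential_eq n1_def sum_divide_distrib
proof (rule sum_mono)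
  fix j assume "j \<in> {..<E}"
  then have i: "integrable (edge j) (\<lambda>y. norm (u j y))" using u by (simp add: L1_def)
  have "(\<integral>y. kern r k x j y * norm (u j y) \<partial>edge j) \<le> (\<integral>y. 1 / r * norm (u j y) \<partial>edge j)"
    by (intro integral_mono_AE AE_I2 kern_mult_integrable r i mult_right_mono kern_le) (use i in auto)
  then show "(\<integral>y. kern r k x j y * norm (u j y) \<partial>edge j) \<le> (\<integral>y. norm (u j y) \<partial>edge j) / r" by simp
qed

lemma potential_triangle:
  assumes r: "0 < r" and u: "L1 u" "L1 v"
  shows "potential r u k x \<le> potential r v k x + potential r (\<lambda>k x. u k x - v k x) k x"
  unfolding potential_eq sum.distrib[symmetric]
proof (rule sum_mono)
  fix j assume "j \<in> {..<E}"
  then have j: "j < E" by simp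
  have i: "integrable (edge j) (\<lambda>x. norm (u j x))" "integrable (edge j) (\<lambda>x. norm (v j x))"
    "integrable (edge j) (\<lambda>x. norm (u j x - v j x))"
    using u L1_diff[OF u] j by (auto simp: L1_def)
  note ki = kern_mult_integrable[OF r i(1)] kern_mult_integrable[OF r i(2)] kern_mult_integrable[OF r i(3)]
  have "(\<integral>y. kern r k x j y * norm (u j y) \<partial>edge j)
      \<le> (\<integral>y. kern r k x j y * norm (v j y) + kern r k x j y * norm (u j y - v j y) \<partial>edge j)"
    using ki mult_left_mono[OF norm_triangle_sub[of "u j _" "v j _"] kern_nonneg[OF r, of k x j]]
    by (intro integral_mono_AE AE_I2) (auto simp: distrib_left)
  then show "(\<integral>y. kern r k x j y * norm (u j y) \<partial>edge j)
      \<le> (\<integral>y. kern r k x j y * norm (v j y) \<partial>edge j) + (\<integral>y. kern r k x j y * norm (u j y - v j y) \<partial>edge j)"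
    using ki by simp
qed

lemma potential_bounded:
  assumes r: "0 < r" and u: "L1 u" and B: "\<And>j. j < E \<Longrightarrow> AE y in edge j. norm (u j y) \<le> B" "0 \<le> B"
  shows "potential r u k x \<le> kern_mass * B"
proof -
  have "potential r u k x \<le> (\<Sum>j<E. \<integral>y. kern r k x j y * B \<partial>edge j)"
    unfolding potential_eq
  proof (intro sum_mono integral_mono_AE kern_mult_integrable r)
    fix j assume "j \<in> {..<E}"
    then have j: "j < E" by simp
    show "integrable (edge j) (\<lambda>x. norm (u j x))" using u j by (simp add: L1_def)
    show "integrable (edge j) (\<lambda>x. B)" by (rule integrable_const_edge)
    show "AE y in edge j. kern r k x j y * norm (u j y) \<le> kern r k x j y * B"
      using B(1)[OF j] by eventually_elim (intro mult_left_mono kern_nonneg r)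
  qed
  also have "\<dots> = (\<Sum>j<E. \<integral>y. kern r k x j y \<partial>edge j) * B" by (simp add: sum_distrib_right)
  also have "\<dots> \<le> kern_mass * B" by (intro mult_right_mono kern_integral_le r B)
  finally show ?thesis .
qed

text \<open>Jensen's inequality for a measure of mass at most \<open>kern_mass\<close>: the tangent
  to \<open>s powr p\<close> at \<open>\<mu> = P / kern_mass\<close> is integrated against the
  kernel, which takes the place of Hoelder's inequality.\<close>

lemma potential_powr_le:
  assumes r: "0 < r" and p: "1 \<le> p" and u: "L1 u"
    and up: "\<And>j. j < E \<Longrightarrow> integrable (edge j) (\<lambda>y. norm (u j y) powr p)"
  shows "potential r u k x powr p \<le>
    kern_mass powr (p - 1) * (\<Sum>j<E. \<integral>y. kern r k x j y * norm (u j y) powr p \<partial>edge j)" (is "_ \<le> _ * ?Q")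
proof (cases "potential r u k x = 0")
  case True
  have "0 \<le> ?Q" by (intro sum_nonneg integral_nonneg_AE) (simp add: kern_nonneg[OF r])
  then show ?thesis using True kern_mass_pos by simp
next
  case False
  define P where "P = potential r u k x"
  have P: "0 < P" using False potential_nonneg[OF r, of u k x] by (simp add: P_def)
  define \<mu> where "\<mu> = P / kern_mass"
  have \<mu>: "0 < \<mu>" using P kern_mass_pos by (simp add: \<mu>_def)
  have pt: "p * \<mu> powr (p - 1) * s \<le> s powr p + (p - 1) * \<mu> powr p" if "0 \<le> s" for s
  proof -
    have "\<mu> powr p * (p * (s / \<mu>)) \<le> \<mu> powr p * ((s / \<mu>) powr p + (p - 1))"
      using Bernoulli_powr[OF p, of "s / \<mu>"] that \<mu> by (intro mult_left_mono) auto
    moreover have "\<mu> powr p * (p * (s / \<mu>)) = p * \<mu> powr (p - 1) * s"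
      using \<mu> by (simp add: powr_diff)
    moreover have "\<mu> powr p * (s / \<mu>) powr p = s powr p" using \<mu> that by (simp add: powr_divide)
    ultimately show ?thesis by (simp add: algebra_simps)
  qed
  have "p * \<mu> powr (p - 1) * P = (\<Sum>j<E. \<integral>y. kern r k x j y * (p * \<mu> powr (p - 1) * norm (u j y)) \<partial>edge j)"
    unfolding P_def potential_eq sum_distrib_left by (intro sum.cong refl) (simp flip: integral_mult_right_zero add: ac_simps)
  also have "\<dots> \<le> (\<Sum>j<E. \<integral>y. kern r k x j y * (norm (u j y) powr p) + kern r k x j y * ((p - 1) * \<mu> powr p) \<partial>edge j)"
  proof (intro sum_mono integral_mono_AE AE_I2)
    fix j y assume "j \<in> {..<E}"
    then have j: "j < E" by simp
    have un: "integrable (edge j) (\<lambda>x. norm (u j x))" using u j by (simp add: L1_def)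
    show "integrable (edge j) (\<lambda>y. kern r k x j y * (p * \<mu> powr (p - 1) * norm (u j y)))"
      by (intro kern_mult_integrable r integrable_mult_right un)
    show "integrable (edge j) (\<lambda>y. kern r k x j y * (norm (u j y) powr p) + kern r k x j y * ((p - 1) * \<mu> powr p))"
      by (intro Bochner_Integration.integrable_add kern_mult_integrable r up j integrable_const_edge)
    show "kern r k x j y * (p * \<mu> powr (p - 1) * norm (u j y)) \<le> kern r k x j y * (norm (u j y) powr p) + kern r k x j y * ((p - 1) * \<mu> powr p)"
      unfolding distrib_left[symmetric] by (intro mult_left_mono pt kern_nonneg r) simp
  qed
  also have "\<dots> = ?Q + (\<Sum>j<E. \<integral>y. kern r k x j y \<partial>edge j) * ((p - 1) * \<mu> powr p)"
    unfolding sum_distrib_right sum.distrib[symmetric]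
    by (intro sum.cong refl, subst Bochner_Integration.integral_add)
      (auto intro!: kern_mult_integrable r up kern_integrable)
  also have "\<dots> \<le> ?Q + kern_mass * ((p - 1) * \<mu> powr p)"
    using p by (intro add_left_mono mult_right_mono kern_integral_le r) auto
  also have "kern_mass * ((p - 1) * \<mu> powr p) = (p - 1) * \<mu> powr (p - 1) * P"
    using \<mu> P kern_mass_pos by (simp add: powr_diff \<mu>_def)
  finally have "\<mu> powr (p - 1) * P \<le> ?Q" by (simp add: algebra_simps)
  then have "kern_mass powr (p - 1) * (\<mu> powr (p - 1) * P) \<le> kern_mass powr (p - 1) * ?Q" by (intro mult_left_mono) auto
  also have "kern_mass powr (p - 1) * (\<mu> powr (p - 1) * P) = P powr p"
    using P kern_mass_pos by (simp add: \<mu>_def powr_divide powr_diff)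
  finally show ?thesis by (simp add: P_def)
qed

lemma inLp_real: "inLp E l (ereal p) u \<longleftrightarrow> (\<forall>k<E. u k \<in> borel_measurable (edge k) \<and>
    integrable (edge k) (\<lambda>x. norm (u k x) powr p))"
  by (auto simp: inLp_def)

lemma Lpnorm_real: "Lpnorm E l (ereal p) u = (\<Sum>k<E. \<integral>x. norm (u k x) powr p \<partial>edge k) powr (1 / p)"
  by (simp add: Lpnorm_def)

text \<open>The symmetric kernel has bounded mass in either variable: one bound is used pointwise
  through \<open>potential_powr_le\<close>, the other after exchanging the integrals. The double
  integral is taken in \<open>ennreal\<close>, since integrability of \<open>norm v powr p\<close>
  is part of the conclusion.\<close>

lemma Schur_estimate:
  assumes r: "0 < r" and p: "1 \<le> p" and u: "L1 u" and up: "inLp E l (ereal p) u" and C: "0 \<le> C"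
    and v: "\<And>k. k < E \<Longrightarrow> v k \<in> borel_measurable (edge k)"
    and vu: "\<And>k. k < E \<Longrightarrow> AE x in edge k. norm (v k x) \<le> C * potential r u k x"
  shows "inLp E l (ereal p) v" "Lpnorm E l (ereal p) v \<le> C * kern_mass * Lpnorm E l (ereal p) u"
proof -
  define U where "U = (\<Sum>j<E. \<integral>y. norm (u j y) powr p \<partial>edge j)"
  define D where "D = C powr p * kern_mass powr (p - 1)"
  have D: "0 \<le> D" by (simp add: D_def)
  have um: "u j \<in> borel_measurable (edge j)" and ui: "integrable (edge j) (\<lambda>y. norm (u j y) powr p)" if "j < E" for j
    using up that by (auto simp: inLp_real)
  have U0: "0 \<le> U" unfolding U_def by (intro sum_nonneg integral_nonneg_AE) auto
  have dbl: "(\<integral>\<^sup>+x. ennreal (norm (v k x) powr p) \<partial>edge k)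
      \<le> ennreal D * (\<Sum>j<E. \<integral>\<^sup>+y. (\<integral>\<^sup>+x. ennreal (kern r k x j y) \<partial>edge k) * ennreal (norm (u j y) powr p) \<partial>edge j)"
    if k: "k < E" for k
  proof -
    have km: "(\<lambda>(x, y). ennreal (kern r k x j y * norm (u j y) powr p)) \<in> borel_measurable (edge k \<Otimes>\<^sub>M edge j)"
      if "j < E" for j
    proof -
      have [measurable]: "enddist r (l k) \<in> borel_measurable (edge k)" "enddist r (l j) \<in> borel_measurable (edge j)"
        "u j \<in> borel_measurable (edge j)"
        using enddist_measurable[OF r] um[OF that] by auto
      show ?thesis unfolding kern_def by measurable
    qed
    have "(\<integral>\<^sup>+x. ennreal (norm (v k x) powr p) \<partial>edge k)
       \<le> (\<integral>\<^sup>+x. ennreal D * (\<Sum>j<E. \<integral>\<^sup>+y. ennreal (kern r k x j y * norm (u j y) powr p) \<partial>edge j) \<partial>edge k)"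
    proof (rule nn_integral_mono_AE)
      show "AE x in edge k. ennreal (norm (v k x) powr p)
         \<le> ennreal D * (\<Sum>j<E. \<integral>\<^sup>+y. ennreal (kern r k x j y * norm (u j y) powr p) \<partial>edge j)"
        using vu[OF k]
      proof eventually_elim
        case (elim x)
        have "norm (v k x) powr p \<le> (C * potential r u k x) powr p" using elim p by (intro powr_mono2) auto
        also have "\<dots> = C powr p * potential r u k x powr p" using C potential_nonneg[OF r] by (simp add: powr_mult)
        also have "\<dots> \<le> C powr p * (kern_mass powr (p - 1) * (\<Sum>j<E. \<integral>y. kern r k x j y * norm (u j y) powr p \<partial>edge j))"
          by (intro mult_left_mono potential_powr_le r p u ui) auto
        also have "\<dots> = D * (\<Sum>j<E. \<integral>y. kern r k x j y * norm (u j y) powr p \<partial>edge j)" by (simp add: D_def)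
        finally have "ennreal (norm (v k x) powr p) \<le> ennreal (D * (\<Sum>j<E. \<integral>y. kern r k x j y * norm (u j y) powr p \<partial>edge j))"
          by (rule ennreal_leI)
        also have "\<dots> = ennreal D * (\<Sum>j<E. ennreal (\<integral>y. kern r k x j y * norm (u j y) powr p \<partial>edge j))"
          using kern_nonneg[OF r] D
          by (subst ennreal_mult) (auto intro!: sum_nonneg integral_nonneg_AE simp: sum_ennreal)
        also have "\<dots> = ennreal D * (\<Sum>j<E. \<integral>\<^sup>+y. ennreal (kern r k x j y * norm (u j y) powr p) \<partial>edge j)"
          by (intro arg_cong2[where f="(*)"] refl sum.cong nn_integral_eq_integral[symmetric] kern_mult_integrable r ui AE_I2)
            (auto simp: kern_nonneg[OF r])
        finally show ?case .
      qed
    qed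
    also have "\<dots> = ennreal D * (\<Sum>j<E. \<integral>\<^sup>+x. \<integral>\<^sup>+y. ennreal (kern r k x j y * norm (u j y) powr p) \<partial>edge j \<partial>edge k)"
    proof -
      have m: "(\<lambda>x. \<integral>\<^sup>+y. ennreal (kern r k x j y * norm (u j y) powr p) \<partial>edge j) \<in> borel_measurable (edge k)" if "j < E" for j
      proof -
        interpret finite_measure "edge j" by (rule finite_measure_edge)
        show ?thesis using km[OF that] by (rule borel_measurable_nn_integral)
      qed
      then have "(\<integral>\<^sup>+x. (\<Sum>j<E. \<integral>\<^sup>+y. ennreal (kern r k x j y * norm (u j y) powr p) \<partial>edge j) \<partial>edge k)
        = (\<Sum>j<E. \<integral>\<^sup>+x. \<integral>\<^sup>+y. ennreal (kern r k x j y * norm (u j y) powr p) \<partial>edge j \<partial>edge k)"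
        by (intro nn_integral_sum) auto
      then show ?thesis using m by (subst nn_integral_cmult) auto
    qed
    also have "(\<Sum>j<E. \<integral>\<^sup>+x. \<integral>\<^sup>+y. ennreal (kern r k x j y * norm (u j y) powr p) \<partial>edge j \<partial>edge k)
       = (\<Sum>j<E. \<integral>\<^sup>+y. (\<integral>\<^sup>+x. ennreal (kern r k x j y) \<partial>edge k) * ennreal (norm (u j y) powr p) \<partial>edge j)"
    proof (intro sum.cong refl)
      fix j assume "j \<in> {..<E}"
      then have j: "j < E" by simp
      interpret j: finite_measure "edge j" by (rule finite_measure_edge)
      interpret k: finite_measure "edge k" by (rule finite_measure_edge)
      interpret pair_sigma_finite "edge k" "edge j" ..
      have "(\<integral>\<^sup>+x. \<integral>\<^sup>+y. ennreal (kern r k x j y * norm (u j y) powr p) \<partial>edge j \<partial>edge k)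
         = (\<integral>\<^sup>+y. \<integral>\<^sup>+x. ennreal (kern r k x j y * norm (u j y) powr p) \<partial>edge k \<partial>edge j)"
        by (rule Fubini'[symmetric]) (rule km[OF j])
      also have "\<dots> = (\<integral>\<^sup>+y. (\<integral>\<^sup>+x. ennreal (kern r k x j y) \<partial>edge k) * ennreal (norm (u j y) powr p) \<partial>edge j)"
        using kern_measurable[OF r, of j _ k] kern_nonneg[OF r]
        by (intro nn_integral_cong) (simp add: ennreal_mult nn_integral_multc kern_commute[of r k _ j])
      finally show "(\<integral>\<^sup>+x. \<integral>\<^sup>+y. ennreal (kern r k x j y * norm (u j y) powr p) \<partial>edge j \<partial>edge k)
         = (\<integral>\<^sup>+y. (\<integral>\<^sup>+x. ennreal (kern r k x j y) \<partial>edge k) * ennreal (norm (u j y) powr p) \<partial>edge j)" .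
    qed
    finally show ?thesis .
  qed
  have "(\<Sum>k<E. \<integral>\<^sup>+x. ennreal (norm (v k x) powr p) \<partial>edge k)
     \<le> (\<Sum>k<E. ennreal D * (\<Sum>j<E. \<integral>\<^sup>+y. (\<integral>\<^sup>+x. ennreal (kern r k x j y) \<partial>edge k) * ennreal (norm (u j y) powr p) \<partial>edge j))"
    by (intro sum_mono dbl) auto
  also have "\<dots> = ennreal D * (\<Sum>j<E. \<Sum>k<E. \<integral>\<^sup>+y. (\<integral>\<^sup>+x. ennreal (kern r k x j y) \<partial>edge k) * ennreal (norm (u j y) powr p) \<partial>edge j)"
    unfolding sum_distrib_left[symmetric] by (subst sum.swap) simp
  also have "(\<Sum>j<E. \<Sum>k<E. \<integral>\<^sup>+y. (\<integral>\<^sup>+x. ennreal (kern r k x j y) \<partial>edge k) * ennreal (norm (u j y) powr p) \<partial>edge j)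
     \<le> (\<Sum>j<E. \<integral>\<^sup>+y. ennreal kern_mass * ennreal (norm (u j y) powr p) \<partial>edge j)"
  proof (rule sum_mono)
    fix j assume "j \<in> {..<E}"
    then have j: "j < E" by simp
    have kx: "(\<integral>\<^sup>+x. ennreal (kern r k x j y) \<partial>edge k) = ennreal (\<integral>x. kern r j y k x \<partial>edge k)" for k y
      unfolding kern_commute[of r k _ j]
      by (intro nn_integral_eq_integral kern_integrable r AE_I2 kern_nonneg)
    have km: "(\<lambda>y. (\<integral>\<^sup>+x. ennreal (kern r k x j y) \<partial>edge k)) \<in> borel_measurable (edge j)" for k
    proof -
      interpret finite_measure "edge k" by (rule finite_measure_edge)
      have [measurable]: "enddist r (l k) \<in> borel_measurable (edge k)" "enddist r (l j) \<in> borel_measurable (edge j)"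
        using enddist_measurable[OF r] by auto
      have "(\<lambda>(y, x). ennreal (kern r k x j y)) \<in> borel_measurable (edge j \<Otimes>\<^sub>M edge k)"
        unfolding kern_def by measurable
      then show ?thesis by (rule borel_measurable_nn_integral)
    qed
    have "(\<Sum>k<E. \<integral>\<^sup>+y. (\<integral>\<^sup>+x. ennreal (kern r k x j y) \<partial>edge k) * ennreal (norm (u j y) powr p) \<partial>edge j)
       = (\<integral>\<^sup>+y. (\<Sum>k<E. (\<integral>\<^sup>+x. ennreal (kern r k x j y) \<partial>edge k) * ennreal (norm (u j y) powr p)) \<partial>edge j)"
    proof (rule nn_integral_sum[symmetric], rule borel_measurable_times_ennreal[OF km])
      show "(\<lambda>y. ennreal (norm (u j y) powr p)) \<in> borel_measurable (edge j)" using um[OF j] by measurable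
    qed
    also have "\<dots> \<le> (\<integral>\<^sup>+y. ennreal kern_mass * ennreal (norm (u j y) powr p) \<partial>edge j)"
    proof (intro nn_integral_mono)
      fix y
      have "(\<Sum>k<E. (\<integral>\<^sup>+x. ennreal (kern r k x j y) \<partial>edge k)) = ennreal (\<Sum>k<E. \<integral>x. kern r j y k x \<partial>edge k)"
        unfolding kx by (intro sum_ennreal integral_nonneg_AE AE_I2 kern_nonneg r)
      also have "\<dots> \<le> ennreal kern_mass" by (intro ennreal_leI kern_integral_le r)
      finally show "(\<Sum>k<E. (\<integral>\<^sup>+x. ennreal (kern r k x j y) \<partial>edge k) * ennreal (norm (u j y) powr p))
         \<le> ennreal kern_mass * ennreal (norm (u j y) powr p)"
        unfolding sum_distrib_right[symmetric] by (rule mult_right_mono) simp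
    qed
    finally show "(\<Sum>k<E. \<integral>\<^sup>+y. (\<integral>\<^sup>+x. ennreal (kern r k x j y) \<partial>edge k) * ennreal (norm (u j y) powr p) \<partial>edge j)
       \<le> (\<integral>\<^sup>+y. ennreal kern_mass * ennreal (norm (u j y) powr p) \<partial>edge j)" .
  qed
  also have "(\<Sum>j<E. \<integral>\<^sup>+y. ennreal kern_mass * ennreal (norm (u j y) powr p) \<partial>edge j) = ennreal kern_mass * ennreal U"
  proof -
    have "(\<integral>\<^sup>+y. ennreal kern_mass * ennreal (norm (u j y) powr p) \<partial>edge j) = ennreal kern_mass * ennreal (\<integral>y. norm (u j y) powr p \<partial>edge j)"
      if "j < E" for j
      using um[OF that] ui[OF that] by (subst nn_integral_cmult) (auto simp: nn_integral_eq_integral)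
    then show ?thesis unfolding U_def by (simp add: sum_distrib_left[symmetric] integral_nonneg_AE)
  qed
  finally have tot: "(\<Sum>k<E. \<integral>\<^sup>+x. ennreal (norm (v k x) powr p) \<partial>edge k) \<le> ennreal (D * kern_mass * U)"
    using D kern_mass_pos U0 by (simp add: ennreal_mult mult.assoc mult_left_mono)
  have vi: "integrable (edge k) (\<lambda>x. norm (v k x) powr p)" if k: "k < E" for k
  proof (rule integrableI_bounded)
    show "(\<lambda>x. norm (v k x) powr p) \<in> borel_measurable (edge k)" using v[OF k] by measurable
    have "(\<integral>\<^sup>+x. ennreal (norm (v k x) powr p) \<partial>edge k) \<le> (\<Sum>k<E. \<integral>\<^sup>+x. ennreal (norm (v k x) powr p) \<partial>edge k)"
      using k by (intro member_le_sum) auto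
    also note tot
    finally show "(\<integral>\<^sup>+x. ennreal (norm (norm (v k x) powr p)) \<partial>edge k) < \<infinity>"
      by (simp add: le_less_trans)
  qed
  show "inLp E l (ereal p) v" using v vi by (simp add: inLp_real)
  have "ennreal (\<Sum>k<E. \<integral>x. norm (v k x) powr p \<partial>edge k) = (\<Sum>k<E. \<integral>\<^sup>+x. ennreal (norm (v k x) powr p) \<partial>edge k)"
  proof -
    have "(\<Sum>k<E. \<integral>\<^sup>+x. ennreal (norm (v k x) powr p) \<partial>edge k) = (\<Sum>k<E. ennreal (\<integral>x. norm (v k x) powr p \<partial>edge k))"
      by (intro sum.cong refl nn_integral_eq_integral vi) auto
    also have "\<dots> = ennreal (\<Sum>k<E. \<integral>x. norm (v k x) powr p \<partial>edge k)"
      by (intro sum_ennreal integral_nonneg_AE) auto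
    finally show ?thesis ..
  qed
  with tot have "ennreal (\<Sum>k<E. \<integral>x. norm (v k x) powr p \<partial>edge k) \<le> ennreal (D * kern_mass * U)" by simp
  then have "(\<Sum>k<E. \<integral>x. norm (v k x) powr p \<partial>edge k) \<le> D * kern_mass * U"
    by (rule ennreal_le_iff[THEN iffD1, rotated]) (use D kern_mass_pos U0 in auto)
  then have "Lpnorm E l (ereal p) v \<le> (D * kern_mass * U) powr (1 / p)"
    unfolding Lpnorm_real using p by (intro powr_mono2) (auto intro!: sum_nonneg integral_nonneg_AE)
  also have "D * kern_mass = (C * kern_mass) powr p"
    using C kern_mass_pos by (simp add: D_def powr_mult powr_diff)
  also have "((C * kern_mass) powr p * U) powr (1 / p) = C * kern_mass * Lpnorm E l (ereal p) u"
    using p C kern_mass_pos U0 by (simp add: powr_mult powr_powr Lpnorm_real U_def)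
  finally show "Lpnorm E l (ereal p) v \<le> C * kern_mass * Lpnorm E l (ereal p) u" .
qed

text \<open>The infimum is approached along a sequence, and countably many null sets suffice to see
  that it is itself an essential bound.\<close>

lemma Linf_AE:
  assumes "inLp E l \<infinity> u" "k < E"
  shows "AE x in edge k. norm (u k x) \<le> Lpnorm E l \<infinity> u"
proof -
  define S where "S = {M. 0 \<le> M \<and> (\<forall>k<E. AE x in edge k. norm (u k x) \<le> M)}"
  obtain M where M: "\<forall>k<E. AE x in edge k. norm (u k x) \<le> M" using assms by (auto simp: inLp_def)
  have "\<forall>k<E. AE x in edge k. norm (u k x) \<le> max 0 M"
    using M by (auto elim!: eventually_mono)
  then have ne: "max 0 M \<in> S" by (simp add: S_def)
  have bdd: "bdd_below S" by (auto simp: S_def intro: bdd_belowI[of _ 0])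
  have I: "Lpnorm E l \<infinity> u = Inf S" by (simp add: Lpnorm_def S_def)
  have "AE x in edge k. norm (u k x) < Inf S + inverse (real (Suc n))" for n
  proof -
    obtain m where m: "m \<in> S" "m < Inf S + inverse (real (Suc n))"
      using cInf_lessD[of S "Inf S + inverse (real (Suc n))"] ne by auto
    then have "AE x in edge k. norm (u k x) \<le> m" using assms(2) by (auto simp: S_def)
    then show ?thesis by eventually_elim (use m in simp)
  qed
  then have "AE x in edge k. \<forall>n. norm (u k x) < Inf S + inverse (real (Suc n))" by (simp add: AE_all_countable)
  then show ?thesis unfolding I
  proof eventually_elim
    case (elim x)
    have "(\<lambda>n. Inf S + inverse (real (Suc n))) \<longlonglongrightarrow> Inf S + 0"
      by (intro tendsto_intros LIMSEQ_inverse_real_of_nat)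
    then show ?case using elim by (intro tendsto_lowerbound) (auto intro!: always_eventually less_imp_le)
  qed
qed

lemma Linf_norm_nonneg: "inLp E l \<infinity> u \<Longrightarrow> 0 \<le> Lpnorm E l \<infinity> u"
proof -
  assume u: "inLp E l \<infinity> u"
  then obtain M where M: "\<forall>k<E. AE x in edge k. norm (u k x) \<le> M" by (auto simp: inLp_def)
  have "\<forall>k<E. AE x in edge k. norm (u k x) \<le> max 0 M" using M by (auto elim!: eventually_mono)
  then have "{M. 0 \<le> M \<and> (\<forall>k<E. AE x in edge k. norm (u k x) \<le> M)} \<noteq> {}" by (auto intro!: exI[of _ "max 0 M"])
  then show ?thesis unfolding Lpnorm_def by (auto intro!: cInf_greatest)
qed

lemma Linf_norm_le:
  assumes "0 \<le> M" "\<And>k. k < E \<Longrightarrow> AE x in edge k. norm (u k x) \<le> M"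
  shows "Lpnorm E l \<infinity> u \<le> M"
  unfolding Lpnorm_def using assms by (auto intro!: cInf_lower bdd_belowI[of _ 0])

end

section \<open>The kernel bound at all positive times\<close>

context network_semigroup
begin

text \<open>For long times \<open>r\<close> stays at \<open>r0\<close>: \<open>T t\<close> is split
  into smoothing, a contraction on L^2 and smoothing again, which bounds it from L^1 to L^infinity.
  As the total length is finite, the kernel at scale \<open>r0\<close> is at least
  \<open>1 / (H * r0)\<close>, so this bound is again of kernel type.\<close>

lemma kernel_bound:
  obtains C where "0 < C" "\<And>t. 0 < t \<Longrightarrow> \<exists>r>0. \<forall>f k. L2 f \<longrightarrow> k < E \<longrightarrow>
    (AE x in edge k. norm (T t f k x) \<le> C * potential r f k x)"
proof -
  obtain C1 where C1: "0 < C1" "\<And>r f k. 0 < r \<Longrightarrow> r \<le> 1 \<Longrightarrow> (\<forall>k<E. r \<le> l k) \<Longrightarrow> L2 f \<Longrightarrow> k < E \<Longrightarrow>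
    AE x in edge k. norm (T (2 * r ^ 4) f k x) \<le> C1 * potential r f k x"
    using short_time_kernel_bound by blast
  obtain r0 where r0: "0 < r0" "r0 \<le> 1" "\<And>k. k < E \<Longrightarrow> r0 \<le> l k" using scale_exists by blast
  obtain M where ws: "\<And>r \<psi> \<psi>1 \<psi>2 c. 0 < r \<Longrightarrow> r \<le> 1 \<Longrightarrow> \<forall>k<E. r \<le> l k \<Longrightarrow> weight r \<psi> \<psi>1 \<psi>2 c \<Longrightarrow>
    \<exists>N. weighted_semigroup E l Y R T (\<lambda>k x. exp (\<psi> k x)) N r M"
    using weighted_semigroup_exists by blast
  obtain N where "weighted_semigroup E l Y R T (\<lambda>k x. exp (1 * enddist r0 (l k) x / r0)) N r0 M"
    using ws[OF r0(1,2) _ weight_enddist[OF r0(1), of 1]] r0(3) by auto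
  then interpret weighted_semigroup E l Y R T "\<lambda>k x. exp (1 * enddist r0 (l k) x / r0)" N r0 M .
  \<comment> \<open>\<open>enddist\<close> lies between 0 and \<open>total_length + 2 * r0\<close>,
    so \<open>H\<close> bounds both the weight from above and the reciprocal of
    \<open>r0 * kern\<close>.\<close>
  define H where "H = exp ((total_length + 2 * r0) / r0)"
  have H: "0 < H" "1 \<le> H" using total_length_nonneg r0 by (auto simp: H_def)
  have ed: "0 \<le> enddist r0 (l k) x" "enddist r0 (l k) x \<le> total_length + 2 * r0" if "k < E" "x \<in> {0..l k}" for k x
    using enddist_bounds[OF r0(1) that(2)] edge_le_total[OF that(1)] by auto
  have w: "1 \<le> exp (1 * enddist r0 (l k) x / r0)" "exp (1 * enddist r0 (l k) x / r0) \<le> H" if "k < E" "x \<in> {0..l k}" for k x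
    using ed[OF that] r0 by (auto simp: H_def divide_right_mono)
  have W_upper: "n2 (W u) \<le> H * n2 u" if "L2 u" for u
    by (rule n2_scaled_le[OF admissible_w that]) (use w H in auto)
  have W_lower: "n2 u \<le> n2 (W u)" if "L2 u" for u
    unfolding n2_def ip_def
  proof (intro real_sqrt_le_mono sum_mono integral_mono_AE AE_I2)
    fix k x assume k: "k \<in> {..<E}" and x: "x \<in> space (edge k)"
    have "1 * 1 \<le> exp (1 * enddist r0 (l k) x / r0) * exp (1 * enddist r0 (l k) x / r0)"
      using w(1)[of k x] k x by (intro mult_mono) auto
    then have "1 * inner (u k x) (u k x) \<le> exp (1 * enddist r0 (l k) x / r0) * exp (1 * enddist r0 (l k) x / r0) * inner (u k x) (u k x)"
      by (intro mult_right_mono) auto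
    then show "inner (u k x) (u k x) \<le> inner (W u k x) (W u k x)"
      by (simp only: scaled_def complex_inner_mult mult_1 mult.assoc)
  qed (use that LW L2_inner_integrable in auto)
  have n1W: "n1 (W u) \<le> H * n1 u" if "L2 u" for u
    unfolding n1_def sum_distrib_left
  proof (rule sum_mono)
    fix k assume "k \<in> {..<E}"
    then have k: "k < E" by simp
    have "(\<integral>x. norm (W u k x) \<partial>edge k) \<le> (\<integral>x. H * norm (u k x) \<partial>edge k)"
      using L2_norm_integrable[OF LW[OF that] k] L2_norm_integrable[OF that k] w[OF k]
      by (intro integral_mono_AE AE_I2) (auto simp: scaled_def norm_mult intro!: mult_right_mono)
    then show "(\<integral>x. norm (W u k x) \<partial>edge k) \<le> H * (\<integral>x. norm (u k x) \<partial>edge k)" by simp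
  qed
  define C2 where "C2 = kernel_const * H\<^sup>2 * H"
  have C2: "0 < C2" using kernel_const_pos H by (simp add: C2_def)
  have long: "AE x in edge k. norm (T t f k x) \<le> C2 * potential r0 f k x" if t: "2 * r0 ^ 4 < t" and f: "L2 f" and k: "k < E" for t f k
  proof -
    define s where "s = t - 2 * r0 ^ 4"
    have s: "0 \<le> s" "t = r0 ^ 4 + (s + r0 ^ 4)" using t by (auto simp: s_def)
    define g where "g = T (s + r0 ^ 4) f"
    have r4: "0 \<le> r0 ^ 4" by simp
    have Lg: "L2 g" unfolding g_def using s r4 f by (intro T_L2) auto
    have "n2 g = n2 (T s (T (r0 ^ 4) f))"
      unfolding g_def using s r4 f by (intro n2_cong T_plus T_L2) auto
    also have "\<dots> \<le> n2 (T (r0 ^ 4) f)" by (intro T_contraction T_L2 f s r4)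
    also have "\<dots> \<le> n2 (W (T (r0 ^ 4) f))" by (intro W_lower T_L2 f r4)
    also have "\<dots> \<le> 144 * M * exp 816951 / sqrt r0 * n1 (W f)" by (rule n2_W_T_le_n1[OF f])
    also have "\<dots> \<le> 144 * M * exp 816951 / sqrt r0 * (H * n1 f)" using M r0 by (intro mult_left_mono n1W f) auto
    finally have ng: "n2 g \<le> 144 * M * exp 816951 / sqrt r0 * (H * n1 f)" .
    have "T t f \<simeq> T (r0 ^ 4) g" unfolding s(2) g_def using s r4 f by (intro T_plus) auto
    then have "AE x in edge k. T t f k x = T (r0 ^ 4) g k x" using k by (simp add: aeq_def)
    moreover have "AE x in edge k. norm (W (T (r0 ^ 4) g) k x) \<le> smoothing_const / sqrt r0 * n2 (W g)"
      by (rule W_T_sup_le_n2[OF Lg k])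
    moreover have "AE x in edge k. x \<in> {0..l k}" by (rule AE_I2) simp
    ultimately show ?thesis
    proof eventually_elim
      case (elim x)
      have "norm (T t f k x) = 1 * norm (T (r0 ^ 4) g k x)" using elim by simp
      also have "\<dots> \<le> exp (1 * enddist r0 (l k) x / r0) * norm (T (r0 ^ 4) g k x)"
        by (intro mult_right_mono w k elim) auto
      also have "\<dots> = norm (W (T (r0 ^ 4) g) k x)" by (simp add: scaled_def norm_mult)
      also have "\<dots> \<le> smoothing_const / sqrt r0 * n2 (W g)" by (rule elim)
      also have "\<dots> \<le> smoothing_const / sqrt r0 * (H * (144 * M * exp 816951 / sqrt r0 * (H * n1 f)))"
        using M r0 H order.trans[OF W_upper[OF Lg] mult_left_mono[OF ng]]
        by (intro mult_left_mono) (auto simp: smoothing_const_def)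
      also have "\<dots> = kernel_const * H\<^sup>2 * (n1 f / r0)"
        using r0 by (simp add: kernel_const_def power2_eq_square)
      also have "n1 f / r0 \<le> H * potential r0 f k x"
        unfolding n1_def potential_eq sum_divide_distrib sum_distrib_left
      proof (rule sum_mono)
        fix j assume "j \<in> {..<E}"
        then have j: "j < E" by simp
        have i: "integrable (edge j) (\<lambda>y. norm (f j y))" by (rule L2_norm_integrable[OF f j])
        have "(\<integral>y. 1 / r0 * norm (f j y) \<partial>edge j) \<le> (\<integral>y. H * (kern r0 k x j y * norm (f j y)) \<partial>edge j)"
        proof (intro integral_mono_AE AE_I2)
          fix y assume "y \<in> space (edge j)"
          then have y: "y \<in> {0..l j}" by simp
          have "\<bar>enddist r0 (l k) x - enddist r0 (l j) y\<bar> \<le> total_length + 2 * r0"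
            using ed[OF k elim(3)] ed[OF j y] by (simp add: abs_le_iff)
          then have "1 \<le> H * exp (- \<bar>enddist r0 (l k) x - enddist r0 (l j) y\<bar> / r0)"
            using r0 by (simp add: H_def diff_divide_distrib[symmetric] add_divide_distrib[symmetric] flip: exp_add)
          then have "1 / r0 \<le> H * kern r0 k x j y"
            using divide_right_mono[of 1 _ r0] r0 by (simp add: kern_def)
          then show "1 / r0 * norm (f j y) \<le> H * (kern r0 k x j y * norm (f j y))"
            using mult_right_mono[of "1 / r0" "H * kern r0 k x j y" "norm (f j y)"] by (simp add: mult.assoc)
        qed (use i kern_mult_integrable[OF r0(1) i] in auto)
        then show "(\<integral>y. norm (f j y) \<partial>edge j) / r0 \<le> H * (\<integral>y. kern r0 k x j y * norm (f j y) \<partial>edge j)" by simp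
      qed
      finally show ?case using kernel_const_pos H by (simp add: C2_def mult.assoc mult_left_mono)
    qed
  qed
  show thesis
  proof (rule that[of "max C1 C2"])
    show "0 < max C1 C2" using C1 by simp
    fix t :: real assume t: "0 < t"
    have up: "AE x in edge k. norm (T t f k x) \<le> max C1 C2 * potential r f k x"
      if "AE x in edge k. norm (T t f k x) \<le> C * potential r f k x" "C \<le> max C1 C2" "0 < r" for C r f k
      using that(1) by eventually_elim (meson mult_right_mono order.trans potential_nonneg that(2,3))
    show "\<exists>r>0. \<forall>f k. L2 f \<longrightarrow> k < E \<longrightarrow> (AE x in edge k. norm (T t f k x) \<le> max C1 C2 * potential r f k x)"
    proof (cases "2 * r0 ^ 4 < t")
      case True
      then show ?thesis using up[OF long[OF True] _ r0(1)] r0(1) by (intro exI[of _ r0]) auto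
    next
      case False
      define r where "r = root 4 (t / 2)"
      have r: "0 < r" "2 * r ^ 4 = t" using t by (auto simp: r_def)
      then have "r ^ 4 \<le> r0 ^ 4" using False by simp
      then have "r \<le> r0" using r0(1) power_less_imp_less_base[of r0 4 r] r(1) by (meson not_le power_strict_mono less_imp_le pos2 zero_less_numeral)
      then have "AE x in edge k. norm (T t f k x) \<le> C1 * potential r f k x" if "L2 f" "k < E" for f k
        using C1(2)[of r f k] r r0 that by fastforce
      then show ?thesis using up[of _ _ C1] r by (intro exI[of _ r]) auto
    qed
  qed
qed

end

section \<open>Extension to integrable functions\<close>

context network
begin

lemma inLp_imp_L1:
  assumes "1 \<le> p" "inLp E l p u"
  shows "L1 u"
  unfolding L1_def
proof (intro allI impI conjI)
  fix k assume k: "k < E"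
  show m: "u k \<in> borel_measurable (edge k)" using assms k by (simp add: inLp_def)
  show "integrable (edge k) (\<lambda>x. norm (u k x))"
  proof (cases p)
    case (real q)
    then have q: "1 \<le> q" using assms(1) by simp
    have "integrable (edge k) (\<lambda>x. 1 + norm (u k x) powr q)"
      using assms(2) k integrable_const_edge unfolding real inLp_real by auto
    then show ?thesis
    proof (rule Bochner_Integration.integrable_bound)
      have "t \<le> 1 + t powr q" if "0 \<le> t" for t
      proof (cases "t \<le> 1")
        case False
        then have "t powr 1 \<le> t powr q" using q by (intro powr_mono) auto
        then show ?thesis using False by simp
      qed (simp add: add_increasing2)
      then show "AE x in edge k. norm (norm (u k x)) \<le> norm (1 + norm (u k x) powr q)" by (auto intro!: AE_I2)
    qed (use m in measurable)
  next
    case PInf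
    then obtain M where "AE x in edge k. norm (u k x) \<le> M" using assms k by (auto simp: inLp_def)
    then have "AE x in edge k. norm (norm (u k x)) \<le> norm M" by (auto elim!: eventually_mono)
    then show ?thesis using m
      by (intro Bochner_Integration.integrable_bound[OF integrable_const_edge[where c = M]]) auto
  qed (use assms in simp)
qed

lemma AE_bounded_imp_L2:
  assumes "\<And>k. k < E \<Longrightarrow> v k \<in> borel_measurable (edge k)" "\<And>k. k < E \<Longrightarrow> AE x in edge k. norm (v k x) \<le> B"
  shows "L2 v"
  unfolding L2_iff
proof (intro allI impI conjI)
  fix k assume k: "k < E"
  show "v k \<in> borel_measurable (edge k)" by (rule assms(1)[OF k])
  have "AE x in edge k. norm ((norm (v k x))\<^sup>2) \<le> norm (B\<^sup>2)"
    using assms(2)[OF k] by eventually_elim (simp add: power_mono)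
  then show "integrable (edge k) (\<lambda>x. (norm (v k x))\<^sup>2)"
    using assms(1)[OF k] by (intro Bochner_Integration.integrable_bound[OF integrable_const_edge[where c = "B\<^sup>2"]]) auto
qed

definition trunc :: "nat \<Rightarrow> gfun \<Rightarrow> gfun" where
  "trunc n u = (\<lambda>k x. if norm (u k x) \<le> real n then u k x else 0)"

lemma trunc_measurable:
  assumes "u k \<in> borel_measurable (edge k)"
  shows "trunc n u k \<in> borel_measurable (edge k)"
proof -
  have "(\<lambda>x. norm (u k x)) \<in> borel_measurable (edge k)" using assms by measurable
  then have "{x \<in> space (edge k). norm (u k x) \<le> real n} \<in> sets (edge k)"
    by (intro borel_measurable_le) auto
  then show ?thesis unfolding trunc_def using assms by (intro measurable_If) auto
qed

lemma L2_trunc: "L1 u \<Longrightarrow> L2 (trunc n u)"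
  by (rule AE_bounded_imp_L2[where B = "real n"]) (auto simp: L1_def trunc_measurable, auto simp: trunc_def)

lemma trunc_tendsto:
  assumes p: "1 \<le> p" and u: "inLp E l (ereal p) u"
  shows "(\<lambda>n. \<Sum>k<E. \<integral>x. norm (u k x - trunc n u k x) powr p \<partial>edge k) \<longlonglongrightarrow> 0"
proof -
  have "(\<lambda>n. \<integral>x. norm (u k x - trunc n u k x) powr p \<partial>edge k) \<longlonglongrightarrow> (\<integral>x. 0 \<partial>edge k)" if k: "k < E" for k
  proof (rule integral_dominated_convergence[where w = "\<lambda>x. norm (u k x) powr p"])
    have m: "u k \<in> borel_measurable (edge k)" and i: "integrable (edge k) (\<lambda>x. norm (u k x) powr p)"
      using u k by (auto simp: inLp_real)
    show "integrable (edge k) (\<lambda>x. norm (u k x) powr p)" by (rule i)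
    show "(\<lambda>x. norm (u k x - trunc n u k x) powr p) \<in> borel_measurable (edge k)" for n
      using m trunc_measurable[of u k n, OF m] by measurable
    show "AE x in edge k. (\<lambda>n. norm (u k x - trunc n u k x) powr p) \<longlonglongrightarrow> 0"
    proof (rule AE_I2, rule tendsto_eventually)
      fix x
      obtain n0 where "norm (u k x) \<le> real n0" using real_arch_simple by blast
      then show "\<forall>\<^sub>F n in sequentially. norm (u k x - trunc n u k x) powr p = 0"
        unfolding eventually_sequentially trunc_def by (intro exI[of _ n0]) auto
    qed
    show "AE x in edge k. norm (norm (u k x - trunc n u k x) powr p) \<le> norm (u k x) powr p" for n
      by (auto simp: trunc_def)
  qed simp
  then have "(\<lambda>n. \<Sum>k<E. \<integral>x. norm (u k x - trunc n u k x) powr p \<partial>edge k) \<longlonglongrightarrow> (\<Sum>k<E. 0)"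
    by (intro tendsto_sum) simp
  then show ?thesis by simp
qed

lemma L1_iff_inLp: "L1 u \<longleftrightarrow> inLp E l (ereal 1) u"
  unfolding L1_def inLp_real by simp

lemma n1_trunc_tendsto:
  assumes "L1 u"
  shows "(\<lambda>n. n1 (\<lambda>k x. u k x - trunc n u k x)) \<longlonglongrightarrow> 0"
  using trunc_tendsto[of 1 u] assms by (simp add: L1_iff_inLp n1_def)

lemma n1_minus_commute: "n1 (\<lambda>k x. u k x - v k x) = n1 (\<lambda>k x. v k x - u k x)"
  by (simp add: n1_def norm_minus_commute)

lemma n1_diff_triangle:
  assumes "L1 u" "L1 v" "L1 z"
  shows "n1 (\<lambda>k x. u k x - z k x) \<le> n1 (\<lambda>k x. u k x - v k x) + n1 (\<lambda>k x. v k x - z k x)"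
  using n1_triangle[of "\<lambda>k x. u k x - z k x" "\<lambda>k x. u k x - v k x"] assms by (simp add: L1_diff)

lemma n1_scale: "n1 (\<lambda>k x. c * u k x) = norm c * n1 u"
  by (simp add: n1_def norm_mult sum_distrib_left)

lemma n1_le_of_AE:
  assumes "L1 u" and B: "\<And>k. k < E \<Longrightarrow> AE x in edge k. norm (u k x) \<le> B"
  shows "n1 u \<le> total_length * B"
  unfolding n1_def total_length_def sum_distrib_right
proof (rule sum_mono)
  fix k assume "k \<in> {..<E}"
  then have k: "k < E" by simp
  have "(\<integral>x. norm (u k x) \<partial>edge k) \<le> (\<integral>x. B \<partial>edge k)"
    using assms(1) k by (intro integral_mono_AE B integrable_const_edge) (auto simp: L1_def)
  then show "(\<integral>x. norm (u k x) \<partial>edge k) \<le> l k * B" by (simp only: integral_const_edge[OF k])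
qed

lemma Lpnorm_powr:
  assumes "1 \<le> p"
  shows "(Lpnorm E l (ereal p) u) powr p = (\<Sum>k<E. \<integral>x. norm (u k x) powr p \<partial>edge k)"
proof -
  have "0 \<le> (\<Sum>k<E. \<integral>x. norm (u k x) powr p \<partial>edge k)" by (intro sum_nonneg integral_nonneg_AE) auto
  then show ?thesis using assms by (simp add: Lpnorm_real powr_powr)
qed

lemma Lpnorm_nonneg: "0 \<le> Lpnorm E l (ereal p) u"
  by (simp add: Lpnorm_real)

text \<open>The crude constant \<open>2 powr p\<close> stands in for Minkowski's inequality; it is
  enough for membership and for limits equal to 0.\<close>

lemma inLp_add:
  assumes p: "1 \<le> p" and "inLp E l (ereal p) u" "inLp E l (ereal p) v"
  shows "inLp E l (ereal p) (\<lambda>k x. u k x + v k x)"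
    "(\<Sum>k<E. \<integral>x. norm (u k x + v k x) powr p \<partial>edge k) \<le>
      2 powr p * (\<Sum>k<E. \<integral>x. norm (u k x) powr p \<partial>edge k) + 2 powr p * (\<Sum>k<E. \<integral>x. norm (v k x) powr p \<partial>edge k)"
proof -
  have le: "norm (a + b) powr p \<le> 2 powr p * norm a powr p + 2 powr p * norm b powr p" for a b :: complex
  proof -
    have "norm (a + b) \<le> 2 * max (norm a) (norm b)" using norm_triangle_ineq[of a b] by linarith
    then have "norm (a + b) powr p \<le> (2 * max (norm a) (norm b)) powr p" using p by (intro powr_mono2) auto
    also have "\<dots> = 2 powr p * max (norm a) (norm b) powr p" by (simp add: powr_mult)
    also have "\<dots> \<le> 2 powr p * (norm a powr p + norm b powr p)" by (intro mult_left_mono) (auto simp: max_def)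
    finally show ?thesis by (simp add: distrib_left)
  qed
  have m: "u k \<in> borel_measurable (edge k)" "v k \<in> borel_measurable (edge k)"
    and i: "integrable (edge k) (\<lambda>x. norm (u k x) powr p)" "integrable (edge k) (\<lambda>x. norm (v k x) powr p)" if "k < E" for k
    using assms that by (auto simp: inLp_real)
  have iw: "integrable (edge k) (\<lambda>x. 2 powr p * norm (u k x) powr p + 2 powr p * norm (v k x) powr p)" if "k < E" for k
    using i[OF that] by auto
  have isum: "integrable (edge k) (\<lambda>x. norm (u k x + v k x) powr p)" if k: "k < E" for k
    by (rule Bochner_Integration.integrable_bound[OF iw[OF k]])
      (use m[OF k] le in \<open>measurable, auto intro!: AE_I2\<close>)
  then show "inLp E l (ereal p) (\<lambda>k x. u k x + v k x)" using m by (auto simp: inLp_real)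
  have "(\<Sum>k<E. \<integral>x. norm (u k x + v k x) powr p \<partial>edge k)
     \<le> (\<Sum>k<E. \<integral>x. 2 powr p * norm (u k x) powr p + 2 powr p * norm (v k x) powr p \<partial>edge k)"
    by (intro sum_mono integral_mono_AE AE_I2 isum iw le) auto
  also have "\<dots> = 2 powr p * (\<Sum>k<E. \<integral>x. norm (u k x) powr p \<partial>edge k) + 2 powr p * (\<Sum>k<E. \<integral>x. norm (v k x) powr p \<partial>edge k)"
    unfolding sum_distrib_left sum.distrib[symmetric]
    by (intro sum.cong refl, subst Bochner_Integration.integral_add) (use i in auto)
  finally show "(\<Sum>k<E. \<integral>x. norm (u k x + v k x) powr p \<partial>edge k) \<le>
      2 powr p * (\<Sum>k<E. \<integral>x. norm (u k x) powr p \<partial>edge k) + 2 powr p * (\<Sum>k<E. \<integral>x. norm (v k x) powr p \<partial>edge k)" .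
qed

lemma inLp_minus: "inLp E l (ereal p) u \<Longrightarrow> inLp E l (ereal p) (\<lambda>k x. - u k x)"
  by (auto simp: inLp_real)

lemma inLp_diff: "1 \<le> p \<Longrightarrow> inLp E l (ereal p) u \<Longrightarrow> inLp E l (ereal p) v \<Longrightarrow> inLp E l (ereal p) (\<lambda>k x. u k x - v k x)"
  using inLp_add(1)[OF _ _ inLp_minus, of p u v] by simp

lemma bounded_imp_inLp:
  assumes p: "1 \<le> p" and m: "\<And>k. k < E \<Longrightarrow> v k \<in> borel_measurable (edge k)"
    and B: "\<And>k. k < E \<Longrightarrow> AE x in edge k. norm (v k x) \<le> B"
  shows "inLp E l (ereal p) v"
  unfolding inLp_real
proof (intro allI impI conjI)
  fix k assume k: "k < E"
  show mk: "v k \<in> borel_measurable (edge k)" by (rule m[OF k])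
  have "AE x in edge k. norm (norm (v k x) powr p) \<le> norm (B powr p)"
    using B[OF k] by eventually_elim (use p in \<open>auto intro!: powr_mono2\<close>)
  then show "integrable (edge k) (\<lambda>x. norm (v k x) powr p)"
    using mk by (intro Bochner_Integration.integrable_bound[OF integrable_const_edge[where c = "B powr p"]]) auto
qed

text \<open>Values up to \<open>\<eta>\<close> are controlled by the finite length, the others in
  the manner of Chebyshev by the L^2 norm and the bound \<open>B\<close>. One argument covers
  exponents on both sides of 2.\<close>

lemma bounded_L2_small_imp_Lp_small:
  assumes p: "1 \<le> p" and m: "\<And>k. k < E \<Longrightarrow> v k \<in> borel_measurable (edge k)"
    and B: "\<And>k. k < E \<Longrightarrow> AE x in edge k. norm (v k x) \<le> B" and B0: "0 < B" and \<eta>: "0 < \<eta>"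
  shows "(\<Sum>k<E. \<integral>x. norm (v k x) powr p \<partial>edge k) \<le>
    total_length * \<eta> powr p + (B powr p / \<eta>\<^sup>2) * (n2 v)\<^sup>2"
proof -
  have L: "L2 v" by (rule AE_bounded_imp_L2[OF m B])
  have "(\<integral>x. norm (v k x) powr p \<partial>edge k) \<le> l k * \<eta> powr p + B powr p / \<eta>\<^sup>2 * (\<integral>x. inner (v k x) (v k x) \<partial>edge k)"
    if k: "k < E" for k
  proof -
    have i: "integrable (edge k) (\<lambda>x. \<eta> powr p + B powr p / \<eta>\<^sup>2 * inner (v k x) (v k x))"
      using L2_inner_integrable[OF L L k] integrable_const_edge by simp
    have "(\<integral>x. norm (v k x) powr p \<partial>edge k) \<le> (\<integral>x. \<eta> powr p + B powr p / \<eta>\<^sup>2 * inner (v k x) (v k x) \<partial>edge k)"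
    proof (rule integral_mono_AE[OF _ i])
      show "integrable (edge k) (\<lambda>x. norm (v k x) powr p)"
        using bounded_imp_inLp[OF p m B] k by (simp add: inLp_real)
      show "AE x in edge k. norm (v k x) powr p \<le> \<eta> powr p + B powr p / \<eta>\<^sup>2 * inner (v k x) (v k x)"
        using B[OF k]
      proof eventually_elim
        case (elim x)
        show ?case
        proof (cases "norm (v k x) \<le> \<eta>")
          case True
          then have "norm (v k x) powr p \<le> \<eta> powr p" using p by (intro powr_mono2) auto
          then show ?thesis by (simp add: add_increasing2)
        next
          case False
          then have "\<eta>\<^sup>2 \<le> (norm (v k x))\<^sup>2" using \<eta> by (intro power_mono) auto
          then have "1 \<le> (norm (v k x))\<^sup>2 / \<eta>\<^sup>2" using \<eta> by simp
          then have "B powr p * 1 \<le> B powr p * ((norm (v k x))\<^sup>2 / \<eta>\<^sup>2)" by (intro mult_left_mono) auto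
          moreover have "norm (v k x) powr p \<le> B powr p" using elim p by (intro powr_mono2) auto
          moreover have "B powr p * ((norm (v k x))\<^sup>2 / \<eta>\<^sup>2) = B powr p / \<eta>\<^sup>2 * inner (v k x) (v k x)"
            by (simp add: power2_norm_eq_inner)
          moreover have "0 \<le> \<eta> powr p" by simp
          ultimately show ?thesis by linarith
        qed
      qed
    qed
    also have "\<dots> = l k * \<eta> powr p + B powr p / \<eta>\<^sup>2 * (\<integral>x. inner (v k x) (v k x) \<partial>edge k)"
      using L2_inner_integrable[OF L L k] integrable_const_edge integral_const_edge[OF k]
      by (subst Bochner_Integration.integral_add) auto
    finally show ?thesis .
  qed
  then have "(\<Sum>k<E. \<integral>x. norm (v k x) powr p \<partial>edge k)
     \<le> (\<Sum>k<E. l k * \<eta> powr p + B powr p / \<eta>\<^sup>2 * (\<integral>x. inner (v k x) (v k x) \<partial>edge k))"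
    by (intro sum_mono) auto
  also have "\<dots> = total_length * \<eta> powr p + (B powr p / \<eta>\<^sup>2) * (n2 v)\<^sup>2"
    by (simp only: sum.distrib sum_distrib_left[symmetric] sum_distrib_right[symmetric] total_length_def n2_squared ip_def)
  finally show ?thesis .
qed

end

text \<open>\<open>scale t\<close> is the radius r attached to the time \<open>t\<close>. The
  extension rests on this kernel bound and the L^2 theory alone.\<close>

locale kernel_semigroup = network_semigroup +
  fixes C :: real and scale :: "real \<Rightarrow> real"
  assumes C: "0 < C" and scale: "0 < t \<Longrightarrow> 0 < scale t"
    and T_kernel: "0 < t \<Longrightarrow> L2 f \<Longrightarrow> k < E \<Longrightarrow>
      AE x in edge k. norm (T t f k x) \<le> C * potential (scale t) f k x"
begin

definition "sup_const t = C / scale t"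

lemma sup_const_pos: "0 < t \<Longrightarrow> 0 < sup_const t"
  using C scale by (simp add: sup_const_def)

lemma T_sup_le_n1:
  assumes "0 < t" "L2 f" "k < E"
  shows "AE x in edge k. norm (T t f k x) \<le> sup_const t * n1 f"
  using T_kernel[OF assms]
proof eventually_elim
  case (elim x)
  have "C * potential (scale t) f k x \<le> C * (n1 f / scale t)"
    using C by (intro mult_left_mono potential_le_n1 scale assms L2_imp_L1) auto
  then show ?case using elim by (simp add: sup_const_def)
qed

lemma T_diff_sup_le_n1:
  assumes t: "0 < t" and "L2 f" "L2 g" and k: "k < E"
  shows "AE x in edge k. norm (T t f k x - T t g k x) \<le> sup_const t * n1 (\<lambda>k x. f k x - g k x)"
proof -
  have "AE x in edge k. T t (\<lambda>k x. f k x - g k x) k x = T t f k x - T t g k x"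
    using T_diff[of t f g] assms by (simp add: aeq_def)
  moreover note T_sup_le_n1[OF t L2_diff[OF assms(2,3)] k]
  ultimately show ?thesis by eventually_elim simp
qed

text \<open>For \<open>t > 0\<close> the kernel bounds \<open>T t\<close> from L^1 to L^infinity, so
  L^2 functions \<open>g n\<close> approaching \<open>u\<close> in L^1 have uniformly convergent
  images. Explicit rates \<open>e n\<close> express this by countably many almost-everywhere
  bounds.\<close>

definition extends :: "real \<Rightarrow> gfun \<Rightarrow> gfun \<Rightarrow> bool" where
  "extends t u v \<longleftrightarrow> (\<forall>k<E. v k \<in> borel_measurable (edge k)) \<and>
     (\<exists>g e. (\<forall>n. L2 (g n)) \<and> (\<lambda>n. n1 (\<lambda>k x. u k x - g n k x)) \<longlonglongrightarrow> 0 \<and> e \<longlonglongrightarrow> 0 \<and>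
       (\<forall>n. \<forall>k<E. AE x in edge k. norm (v k x - T t (g n) k x) \<le> e n))"

lemma extendsE:
  assumes "extends t u v"
  obtains g e where "\<And>n. L2 (g n)" "(\<lambda>n. n1 (\<lambda>k x. u k x - g n k x)) \<longlonglongrightarrow> 0" "e \<longlonglongrightarrow> 0"
    "\<And>n k. k < E \<Longrightarrow> AE x in edge k. norm (v k x - T t (g n) k x) \<le> e n"
  using assms unfolding extends_def by blast

lemma extends_measurable: "extends t u v \<Longrightarrow> k < E \<Longrightarrow> v k \<in> borel_measurable (edge k)"
  by (simp add: extends_def)

lemma extends_L2: "0 \<le> t \<Longrightarrow> L2 u \<Longrightarrow> extends t u (T t u)"
  unfolding extends_def
  by (intro conjI exI[of _ "\<lambda>n. u"] exI[of _ "\<lambda>n. 0"])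
    (auto simp: n1_def L2_measurable T_L2)

lemma extends_unique:
  assumes t: "0 < t" and u: "L1 u" and "extends t u v" "extends t u v'"
  shows "v \<simeq> v'"
  unfolding aeq_def
proof (intro allI impI)
  fix k assume k: "k < E"
  obtain g e where g: "\<And>n. L2 (g n)" "(\<lambda>n. n1 (\<lambda>k x. u k x - g n k x)) \<longlonglongrightarrow> 0" "e \<longlonglongrightarrow> 0"
    "\<And>n k. k < E \<Longrightarrow> AE x in edge k. norm (v k x - T t (g n) k x) \<le> e n" using extendsE[OF assms(3)] by blast
  obtain g' e' where g': "\<And>n. L2 (g' n)" "(\<lambda>n. n1 (\<lambda>k x. u k x - g' n k x)) \<longlonglongrightarrow> 0" "e' \<longlonglongrightarrow> 0"
    "\<And>n k. k < E \<Longrightarrow> AE x in edge k. norm (v' k x - T t (g' n) k x) \<le> e' n" using extendsE[OF assms(4)] by blast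
  define d where "d n = e n + e' n + sup_const t * (n1 (\<lambda>k x. u k x - g n k x) + n1 (\<lambda>k x. u k x - g' n k x))" for n
  have "d \<longlonglongrightarrow> 0 + 0 + sup_const t * (0 + 0)" unfolding d_def by (intro tendsto_intros g g')
  then have d: "d \<longlonglongrightarrow> 0" by simp
  have "AE x in edge k. norm (v k x - v' k x) \<le> d n" for n
    using g(4)[OF k, of n] g'(4)[OF k, of n] T_diff_sup_le_n1[OF t g(1)[of n] g'(1)[of n] k]
  proof eventually_elim
    case (elim x)
    have "n1 (\<lambda>k x. g n k x - g' n k x) \<le> n1 (\<lambda>k x. u k x - g n k x) + n1 (\<lambda>k x. u k x - g' n k x)"
      using n1_diff_triangle[OF L2_imp_L1[OF g(1)] u L2_imp_L1[OF g'(1)], of n n] n1_minus_commute[of u "g n"] by simp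
    then have "sup_const t * n1 (\<lambda>k x. g n k x - g' n k x) \<le> sup_const t * (n1 (\<lambda>k x. u k x - g n k x) + n1 (\<lambda>k x. u k x - g' n k x))"
      using sup_const_pos[OF t] by (intro mult_left_mono) auto
    moreover have "norm (v k x - v' k x) \<le> norm (v k x - T t (g n) k x) + norm (T t (g n) k x - T t (g' n) k x) + norm (v' k x - T t (g' n) k x)"
      by (smt (verit) norm_minus_commute norm_triangle_ineq4 diff_diff_eq2 diff_add_cancel norm_diff_triangle_ineq add_diff_eq norm_triangle_sub)
    ultimately show ?case using elim by (simp add: d_def)
  qed
  then have "AE x in edge k. \<forall>n. norm (v k x - v' k x) \<le> d n" by (simp add: AE_all_countable)
  then show "AE x in edge k. v k x = v' k x"
  proof eventually_elim
    case (elim x)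
    then have "norm (v k x - v' k x) \<le> 0" by (intro tendsto_lowerbound[OF d]) (auto intro!: always_eventually)
    then show ?case by simp
  qed
qed

text \<open>Truncations of \<open>u\<close> lie in L^2; off a null set their images form Cauchy
  sequences with a common rate, and \<open>lim\<close> defines a measurable limit.\<close>

lemma extends_exists:
  assumes t: "0 < t" and u: "L1 u"
  obtains v where "extends t u v"
proof -
  define g where "g n = trunc n u" for n
  define a where "a n = n1 (\<lambda>k x. u k x - g n k x)" for n
  have g: "L2 (g n)" for n unfolding g_def by (rule L2_trunc[OF u])
  have a: "a \<longlonglongrightarrow> 0" unfolding a_def g_def by (rule n1_trunc_tendsto[OF u])
  define v where "v k x = lim (\<lambda>n. T t (g n) k x)" for k x
  have Tm: "T t (g n) k \<in> borel_measurable (edge k)" if "k < E" for n k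
    using L2_measurable[OF T_L2[OF less_imp_le[OF t] g] that] .
  have cauchy: "AE x in edge k. \<forall>n m. norm (T t (g n) k x - T t (g m) k x) \<le> sup_const t * (a n + a m)" if k: "k < E" for k
    unfolding AE_all_countable
  proof (intro allI)
    fix n m
    have "n1 (\<lambda>k x. g n k x - g m k x) \<le> a n + a m"
      using n1_diff_triangle[OF L2_imp_L1[OF g] u L2_imp_L1[OF g], of n m] n1_minus_commute[of u "g n"] by (simp add: a_def)
    then have le: "sup_const t * n1 (\<lambda>k x. g n k x - g m k x) \<le> sup_const t * (a n + a m)"
      using sup_const_pos[OF t] by (intro mult_left_mono) auto
    show "AE x in edge k. norm (T t (g n) k x - T t (g m) k x) \<le> sup_const t * (a n + a m)"
      using T_diff_sup_le_n1[OF t g g k, of n m] by eventually_elim (use le in linarith)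
  qed
  have lim: "AE x in edge k. (\<lambda>n. T t (g n) k x) \<longlonglongrightarrow> v k x" if k: "k < E" for k
    using cauchy[OF k]
  proof eventually_elim
    case (elim x)
    have "Cauchy (\<lambda>n. T t (g n) k x)"
    proof (rule metric_CauchyI)
      fix \<epsilon> :: real assume \<epsilon>: "0 < \<epsilon>"
      have "(\<lambda>n. sup_const t * a n) \<longlonglongrightarrow> 0" using tendsto_mult_left[OF a, of "sup_const t"] by simp
      then have "\<forall>\<^sub>F n in sequentially. sup_const t * a n < \<epsilon> / 2" using \<epsilon> by (intro order_tendstoD(2)) auto
      then obtain n0 where n0: "\<And>n. n \<ge> n0 \<Longrightarrow> sup_const t * a n < \<epsilon> / 2" by (auto simp: eventually_sequentially)
      have "dist (T t (g m) k x) (T t (g n) k x) < \<epsilon>" if "m \<ge> n0" "n \<ge> n0" for m n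
        using elim[rule_format, of m n] n0[OF that(1)] n0[OF that(2)] by (simp add: dist_norm distrib_left)
      then show "\<exists>M. \<forall>m\<ge>M. \<forall>n\<ge>M. dist (T t (g m) k x) (T t (g n) k x) < \<epsilon>" by blast
    qed
    then have "convergent (\<lambda>n. T t (g n) k x)" by (simp add: Cauchy_convergent_iff)
    then show ?case unfolding v_def by (simp add: convergent_LIMSEQ_iff)
  qed
  have "extends t u v"
    unfolding extends_def
  proof (intro conjI allI impI exI[of _ g] exI[of _ "\<lambda>n. sup_const t * a n"])
    fix k assume k: "k < E"
    show "v k \<in> borel_measurable (edge k)" unfolding v_def using Tm[OF k] by (intro borel_measurable_lim_metric)
    fix n
    show "AE x in edge k. norm (v k x - T t (g n) k x) \<le> sup_const t * a n"
      using cauchy[OF k] lim[OF k]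
    proof eventually_elim
      case (elim x)
      have "(\<lambda>m. norm (T t (g m) k x - T t (g n) k x)) \<longlonglongrightarrow> norm (v k x - T t (g n) k x)"
        by (intro tendsto_intros elim)
      moreover have "(\<lambda>m. sup_const t * (a m + a n)) \<longlonglongrightarrow> sup_const t * (0 + a n)" by (intro tendsto_intros a)
      ultimately have "norm (v k x - T t (g n) k x) \<le> sup_const t * (0 + a n)"
        using elim(1) by (intro LIMSEQ_le) auto
      then show ?case by simp
    qed
  qed (use g a tendsto_mult_left[OF a, of "sup_const t"] in \<open>auto simp: a_def[abs_def]\<close>)
  then show thesis by (rule that)
qed

text \<open>A change of \<open>u\<close> in L^1 changes its potential at every point by at most the
  L^1 distance divided by \<open>scale t\<close>, so the kernel bound survives the limit.\<close>

lemma extends_kernel: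
  assumes t: "0 < t" and u: "L1 u" and v: "extends t u v" and k: "k < E"
  shows "AE x in edge k. norm (v k x) \<le> C * potential (scale t) u k x"
proof -
  obtain g e where g: "\<And>n. L2 (g n)" "(\<lambda>n. n1 (\<lambda>k x. u k x - g n k x)) \<longlonglongrightarrow> 0" "e \<longlonglongrightarrow> 0"
    "\<And>n k. k < E \<Longrightarrow> AE x in edge k. norm (v k x - T t (g n) k x) \<le> e n" using extendsE[OF v] by blast
  define d where "d n = e n + sup_const t * n1 (\<lambda>k x. u k x - g n k x)" for n
  have "d \<longlonglongrightarrow> 0 + sup_const t * 0" unfolding d_def by (intro tendsto_intros g)
  then have d: "d \<longlonglongrightarrow> 0" by simp
  have "AE x in edge k. norm (v k x) \<le> C * potential (scale t) u k x + d n" for n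
    using g(4)[OF k, of n] T_kernel[OF t g(1)[of n] k]
  proof eventually_elim
    case (elim x)
    have "potential (scale t) (g n) k x \<le> potential (scale t) u k x + potential (scale t) (\<lambda>k x. g n k x - u k x) k x"
      by (intro potential_triangle scale t u L2_imp_L1 g)
    also have "\<dots> \<le> potential (scale t) u k x + n1 (\<lambda>k x. g n k x - u k x) / scale t"
      by (intro add_left_mono potential_le_n1 scale t L1_diff u L2_imp_L1 g)
    finally have "C * potential (scale t) (g n) k x \<le> C * (potential (scale t) u k x + n1 (\<lambda>k x. u k x - g n k x) / scale t)"
      using C n1_minus_commute[of u "g n"] by (intro mult_left_mono) auto
    then show ?case
      using elim norm_triangle_sub[of "v k x" "T t (g n) k x"] by (simp add: d_def sup_const_def distrib_left)
  qed
  then have "AE x in edge k. \<forall>n. norm (v k x) \<le> C * potential (scale t) u k x + d n" by (simp add: AE_all_countable)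
  then show ?thesis
  proof eventually_elim
    case (elim x)
    have "(\<lambda>n. C * potential (scale t) u k x + d n) \<longlonglongrightarrow> C * potential (scale t) u k x + 0" by (intro tendsto_intros d)
    then show ?case using elim by (intro tendsto_lowerbound) (auto intro!: always_eventually)
  qed
qed

lemma extends_bounded:
  assumes "0 < t" "L1 u" "extends t u v" "k < E"
  shows "AE x in edge k. norm (v k x) \<le> sup_const t * n1 u"
  using extends_kernel[OF assms]
proof eventually_elim
  case (elim x)
  have "C * potential (scale t) u k x \<le> C * (n1 u / scale t)"
    using C by (intro mult_left_mono potential_le_n1 scale assms) auto
  then show ?case using elim by (simp add: sup_const_def)
qed

lemma extends_imp_L2:
  assumes "0 < t" "L1 u" "extends t u v"
  shows "L2 v"
  using extends_measurable[OF assms(3)] extends_bounded[OF assms] by (rule AE_bounded_imp_L2)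

lemma extends_add:
  assumes t: "0 < t" and u: "L1 u" "L1 u'" and v: "extends t u v" "extends t u' v'"
  shows "extends t (\<lambda>k x. u k x + u' k x) (\<lambda>k x. v k x + v' k x)"
proof -
  obtain g e where g: "\<And>n. L2 (g n)" "(\<lambda>n. n1 (\<lambda>k x. u k x - g n k x)) \<longlonglongrightarrow> 0" "e \<longlonglongrightarrow> 0"
    "\<And>n k. k < E \<Longrightarrow> AE x in edge k. norm (v k x - T t (g n) k x) \<le> e n" using extendsE[OF v(1)] by blast
  obtain g' e' where g': "\<And>n. L2 (g' n)" "(\<lambda>n. n1 (\<lambda>k x. u' k x - g' n k x)) \<longlonglongrightarrow> 0" "e' \<longlonglongrightarrow> 0"
    "\<And>n k. k < E \<Longrightarrow> AE x in edge k. norm (v' k x - T t (g' n) k x) \<le> e' n" using extendsE[OF v(2)] by blast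
  show ?thesis
    unfolding extends_def
  proof (intro conjI allI impI exI[of _ "\<lambda>n k x. g n k x + g' n k x"] exI[of _ "\<lambda>n. e n + e' n"])
    show "(\<lambda>x. v k x + v' k x) \<in> borel_measurable (edge k)" if "k < E" for k
      using extends_measurable[OF v(1) that] extends_measurable[OF v(2) that] by measurable
    show "L2 (\<lambda>k x. g n k x + g' n k x)" for n by (intro L2_add g g')
    show "(\<lambda>n. e n + e' n) \<longlonglongrightarrow> 0" using tendsto_add[OF g(3) g'(3)] by simp
    show "(\<lambda>n. n1 (\<lambda>k x. u k x + u' k x - (g n k x + g' n k x))) \<longlonglongrightarrow> 0"
    proof (rule tendsto_sandwich[OF _ _ tendsto_const])
      show "(\<lambda>n. n1 (\<lambda>k x. u k x - g n k x) + n1 (\<lambda>k x. u' k x - g' n k x)) \<longlonglongrightarrow> 0"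
        using tendsto_add[OF g(2) g'(2)] by simp
      have "n1 (\<lambda>k x. u k x + u' k x - (g n k x + g' n k x)) \<le> n1 (\<lambda>k x. u k x - g n k x) + n1 (\<lambda>k x. u' k x - g' n k x)" for n
      proof -
        have L: "L1 (\<lambda>k x. u k x - g n k x)" "L1 (\<lambda>k x. u' k x - g' n k x)" by (intro L1_diff u L2_imp_L1 g g')+
        have "n1 (\<lambda>k x. (u k x - g n k x) + (u' k x - g' n k x)) \<le> n1 (\<lambda>k x. u k x - g n k x)
          + n1 (\<lambda>k x. ((u k x - g n k x) + (u' k x - g' n k x)) - (u k x - g n k x))"
          by (intro n1_triangle L1_add L)
        then show ?thesis by (simp add: algebra_simps)
      qed
      then show "\<forall>\<^sub>F n in sequentially. n1 (\<lambda>k x. u k x + u' k x - (g n k x + g' n k x)) \<le> n1 (\<lambda>k x. u k x - g n k x) + n1 (\<lambda>k x. u' k x - g' n k x)"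
        by simp
    qed (simp add: n1_nonneg)
    fix n k assume k: "k < E"
    have "AE x in edge k. T t (\<lambda>k x. g n k x + g' n k x) k x = T t (g n) k x + T t (g' n) k x"
      using T_add[OF less_imp_le[OF t] g(1)[of n] g'(1)[of n]] k by (simp add: aeq_def)
    with g(4)[OF k, of n] g'(4)[OF k, of n]
    show "AE x in edge k. norm (v k x + v' k x - T t (\<lambda>k x. g n k x + g' n k x) k x) \<le> e n + e' n"
    proof eventually_elim
      case (elim x)
      then show ?case using norm_diff_triangle_ineq[of "v k x" "v' k x" "T t (g n) k x" "T t (g' n) k x"] by simp
    qed
  qed
qed

lemma extends_scale:
  assumes t: "0 < t" and u: "L1 u" and v: "extends t u v"
  shows "extends t (\<lambda>k x. c * u k x) (\<lambda>k x. c * v k x)"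
proof -
  obtain g e where g: "\<And>n. L2 (g n)" "(\<lambda>n. n1 (\<lambda>k x. u k x - g n k x)) \<longlonglongrightarrow> 0" "e \<longlonglongrightarrow> 0"
    "\<And>n k. k < E \<Longrightarrow> AE x in edge k. norm (v k x - T t (g n) k x) \<le> e n" using extendsE[OF v] by blast
  show ?thesis
    unfolding extends_def
  proof (intro conjI allI impI exI[of _ "\<lambda>n k x. c * g n k x"] exI[of _ "\<lambda>n. norm c * e n"])
    show "(\<lambda>x. c * v k x) \<in> borel_measurable (edge k)" if "k < E" for k
      using extends_measurable[OF v that] by measurable
    show "L2 (\<lambda>k x. c * g n k x)" for n by (intro L2_scale g)
    show "(\<lambda>n. norm c * e n) \<longlonglongrightarrow> 0" using tendsto_mult_left[OF g(3), of "norm c"] by simp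
    have "(\<lambda>n. n1 (\<lambda>k x. c * (u k x - g n k x))) \<longlonglongrightarrow> 0"
      unfolding n1_scale using tendsto_mult_left[OF g(2), of "norm c"] by simp
    then show "(\<lambda>n. n1 (\<lambda>k x. c * u k x - c * g n k x)) \<longlonglongrightarrow> 0" by (simp add: right_diff_distrib)
    fix n k assume k: "k < E"
    have "AE x in edge k. T t (\<lambda>k x. c * g n k x) k x = c * T t (g n) k x"
      using T_scale[OF less_imp_le[OF t] g(1)[of n]] k by (simp add: aeq_def)
    with g(4)[OF k, of n]
    show "AE x in edge k. norm (c * v k x - T t (\<lambda>k x. c * g n k x) k x) \<le> norm c * e n"
      by eventually_elim (simp add: norm_mult mult_left_mono flip: right_diff_distrib)
  qed
qed

text \<open>After a positive time the extension is bounded, hence in L^2, so the second stretch of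
  time can use \<open>T s\<close> itself.\<close>

lemma extends_plus:
  assumes s: "0 < s" and t: "0 < t" and u: "L1 u" and v: "extends t u v"
  shows "extends (s + t) u (T s v)"
proof -
  obtain g e where g: "\<And>n. L2 (g n)" "(\<lambda>n. n1 (\<lambda>k x. u k x - g n k x)) \<longlonglongrightarrow> 0" "e \<longlonglongrightarrow> 0"
    "\<And>n k. k < E \<Longrightarrow> AE x in edge k. norm (v k x - T t (g n) k x) \<le> e n" using extendsE[OF v] by blast
  have Lv: "L2 v" by (rule extends_imp_L2[OF t u v])
  have LT: "L2 (T t (g n))" for n by (intro T_L2 g less_imp_le t)
  show ?thesis
    unfolding extends_def
  proof (intro conjI allI impI exI[of _ g] exI[of _ "\<lambda>n. sup_const s * (total_length * e n)"] g)
    show "T s v k \<in> borel_measurable (edge k)" if "k < E" for k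
      using L2_measurable[OF T_L2[OF less_imp_le[OF s] Lv] that] .
    have "(\<lambda>n. sup_const s * (total_length * e n)) \<longlonglongrightarrow> sup_const s * (total_length * 0)" by (intro tendsto_intros g)
    then show "(\<lambda>n. sup_const s * (total_length * e n)) \<longlonglongrightarrow> 0" by simp
    fix n k assume k: "k < E"
    have le: "sup_const s * n1 (\<lambda>k x. v k x - T t (g n) k x) \<le> sup_const s * (total_length * e n)"
      using sup_const_pos[OF s] by (intro mult_left_mono n1_le_of_AE L1_diff L2_imp_L1 Lv LT g) auto
    have "AE x in edge k. T (s + t) (g n) k x = T s (T t (g n)) k x"
      using T_plus[of s t "g n"] s t g k by (simp add: aeq_def)
    with T_diff_sup_le_n1[OF s Lv LT[of n] k]
    show "AE x in edge k. norm (T s v k x - T (s + t) (g n) k x) \<le> sup_const s * (total_length * e n)"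
      by eventually_elim (use le in simp)
  qed
qed

text \<open>One family for all exponents, so consistency is built in. Time 0 is set apart: uniform
  limits of L^2 functions stay in L^2, so at time 0 \<open>extends\<close> provides no value for
  other integrable functions.\<close>

definition S :: "real \<Rightarrow> gfun \<Rightarrow> gfun" where
  "S t u = (if t \<le> 0 then u else SOME v. extends t u v)"

lemma S_0: "S 0 u = u"
  by (simp add: S_def)

lemma S_extends: "0 < t \<Longrightarrow> L1 u \<Longrightarrow> extends t u (S t u)"
  using extends_exists[of t u] by (simp add: S_def) (metis someI)

lemma S_L2:
  assumes "0 \<le> t" "L2 u"
  shows "S t u \<simeq> T t u"
proof (cases "t = 0")
  case True
  then show ?thesis using T_0[OF assms(2)] by (simp add: S_0 aeq_sym)
next
  case False
  then have t: "0 < t" using assms by simp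
  show ?thesis using assms
    by (intro extends_unique[OF t L2_imp_L1 S_extends[OF t L2_imp_L1] extends_L2])
qed

lemma S_add:
  assumes "0 \<le> t" "L1 u" "L1 v"
  shows "S t (\<lambda>k x. u k x + v k x) \<simeq> (\<lambda>k x. S t u k x + S t v k x)"
proof (cases "t = 0")
  case False
  then have t: "0 < t" using assms by simp
  show ?thesis using assms
    by (intro extends_unique[OF t L1_add S_extends[OF t L1_add]] extends_add t S_extends)
qed (simp add: S_0)

lemma S_scale:
  assumes "0 \<le> t" "L1 u"
  shows "S t (\<lambda>k x. c * u k x) \<simeq> (\<lambda>k x. c * S t u k x)"
proof (cases "t = 0")
  case False
  then have t: "0 < t" using assms by simp
  show ?thesis using assms
    by (intro extends_unique[OF t L1_scale S_extends[OF t L1_scale]] extends_scale t S_extends)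
qed (simp add: S_0)

lemma S_plus:
  assumes "0 \<le> s" "0 \<le> t" "L1 u"
  shows "S (s + t) u \<simeq> S s (S t u)"
proof (cases "s = 0 \<or> t = 0")
  case True
  then show ?thesis by (auto simp: S_0)
next
  case False
  then have st: "0 < s" "0 < t" "0 < s + t" using assms by auto
  have e: "extends t u (S t u)" by (rule S_extends[OF st(2) assms(3)])
  have "S (s + t) u \<simeq> T s (S t u)"
    by (rule extends_unique[OF st(3) assms(3) S_extends[OF st(3) assms(3)] extends_plus[OF st(1,2) assms(3) e]])
  also have "T s (S t u) \<simeq> S s (S t u)"
    by (rule aeq_sym, rule S_L2) (use st extends_imp_L2[OF st(2) assms(3) e] in auto)
  finally show ?thesis .
qed

text \<open>The Schur test handles \<open>t > 0\<close>; the summand 1 accounts for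
  \<open>t = 0\<close>, where \<open>S\<close> is the identity.\<close>

lemma S_Lp:
  assumes p: "1 \<le> p" and t: "0 \<le> t" and u: "inLp E l (ereal p) u"
  shows "inLp E l (ereal p) (S t u)"
    and "Lpnorm E l (ereal p) (S t u) \<le> (1 + C * kern_mass) * Lpnorm E l (ereal p) u"
proof -
  have L1: "L1 u" by (rule inLp_imp_L1[OF _ u]) (use p in simp)
  have "inLp E l (ereal p) (S t u) \<and> Lpnorm E l (ereal p) (S t u) \<le> (1 + C * kern_mass) * Lpnorm E l (ereal p) u"
  proof (cases "t = 0")
    case True
    then show ?thesis using u C kern_mass_pos Lpnorm_nonneg[of p u] by (simp add: S_0 distrib_right)
  next
    case False
    then have t: "0 < t" using assms by simp
    note e = S_extends[OF t L1]
    note Schur = Schur_estimate[OF scale[OF t] p L1 u less_imp_le[OF C] extends_measurable[OF e] extends_kernel[OF t L1 e]]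
    show ?thesis using Schur Lpnorm_nonneg[of p u] by (simp add: distrib_right)
  qed
  then show "inLp E l (ereal p) (S t u)"
    and "Lpnorm E l (ereal p) (S t u) \<le> (1 + C * kern_mass) * Lpnorm E l (ereal p) u" by auto
qed

lemma S_Linf:
  assumes t: "0 \<le> t" and u: "inLp E l \<infinity> u"
  shows "inLp E l \<infinity> (S t u)"
    and "Lpnorm E l \<infinity> (S t u) \<le> (1 + C * kern_mass) * Lpnorm E l \<infinity> u"
proof -
  have L1: "L1 u" by (rule inLp_imp_L1[OF _ u]) simp
  have n0: "0 \<le> Lpnorm E l \<infinity> u" by (rule Linf_norm_nonneg[OF u])
  have "inLp E l \<infinity> (S t u) \<and> Lpnorm E l \<infinity> (S t u) \<le> (1 + C * kern_mass) * Lpnorm E l \<infinity> u"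
  proof (cases "t = 0")
    case True
    then show ?thesis using u C kern_mass_pos n0 by (simp add: S_0 distrib_right)
  next
    case False
    then have t: "0 < t" using assms by simp
    note e = S_extends[OF t L1]
    have b: "AE x in edge k. norm (S t u k x) \<le> C * kern_mass * Lpnorm E l \<infinity> u" if k: "k < E" for k
      using extends_kernel[OF t L1 e k]
    proof eventually_elim
      case (elim x)
      have "C * potential (scale t) u k x \<le> C * (kern_mass * Lpnorm E l \<infinity> u)"
        using C by (intro mult_left_mono potential_bounded scale t L1 Linf_AE u n0) auto
      then show ?case using elim by simp
    qed
    have "Lpnorm E l \<infinity> (S t u) \<le> C * kern_mass * Lpnorm E l \<infinity> u"
      by (rule Linf_norm_le[OF _ b]) (use C kern_mass_pos n0 in simp)
    moreover have "inLp E l \<infinity> (S t u)" using b extends_measurable[OF e] by (auto simp: inLp_def)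
    ultimately show ?thesis using n0 by (simp add: distrib_right)
  qed
  then show "inLp E l \<infinity> (S t u)"
    and "Lpnorm E l \<infinity> (S t u) \<le> (1 + C * kern_mass) * Lpnorm E l \<infinity> u" by auto
qed

end

section \<open>Strong continuity and the main theorem\<close>

text \<open>Holds because \<open>ln t \<le> t - 1 \<le> 4 * t\<close>. The factor 4 is the ratio of
  the two exponents |2 - p| / p and |2 - p| / (4 p) in the theorem.\<close>

lemma one_le_powr_exp:
  fixes t a :: real
  assumes "0 < t" "0 \<le> a"
  shows "1 \<le> t powr (- a) * exp (4 * a * t)"
proof -
  have "ln t \<le> 4 * t" using ln_le_minus_one[OF assms(1)] assms(1) by linarith
  then have "0 \<le> - a * ln t + 4 * a * t" using mult_left_mono[of "ln t" "4 * t" a] assms(2) by simp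
  then have "1 \<le> exp (- a * ln t + 4 * a * t)" by simp
  also have "\<dots> = t powr (- a) * exp (4 * a * t)" using assms(1) by (simp add: powr_def flip: exp_add)
  finally show ?thesis .
qed

section \<open>Strong continuity on L^p for finite p\<close>

context kernel_semigroup
begin

lemma S_measurable:
  assumes "0 \<le> t" "L1 u" "k < E"
  shows "S t u k \<in> borel_measurable (edge k)"
proof (cases "t = 0")
  case True
  then show ?thesis using assms by (simp add: S_0 L1_def)
next
  case False
  then show ?thesis using extends_measurable[OF S_extends, of t u k] assms by simp
qed

lemma S_Lp_powr:
  assumes p: "1 \<le> p" and t: "0 \<le> t" and u: "inLp E l (ereal p) u"
  shows "(\<Sum>k<E. \<integral>x. norm (S t u k x) powr p \<partial>edge k) \<le>
    (1 + C * kern_mass) powr p * (\<Sum>k<E. \<integral>x. norm (u k x) powr p \<partial>edge k)"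
proof -
  have K: "0 \<le> 1 + C * kern_mass" using C kern_mass_pos by simp
  have "(Lpnorm E l (ereal p) (S t u)) powr p \<le> ((1 + C * kern_mass) * Lpnorm E l (ereal p) u) powr p"
    using p by (intro powr_mono2 S_Lp t u Lpnorm_nonneg) auto
  also have "\<dots> = (1 + C * kern_mass) powr p * (Lpnorm E l (ereal p) u) powr p"
    using K Lpnorm_nonneg by (simp add: powr_mult)
  finally show ?thesis unfolding Lpnorm_powr[OF p] .
qed

text \<open>On bounded data \<open>S\<close> agrees with \<open>T\<close>, and all increments share
  one essential bound \<open>B\<close>; L^2 continuity therefore transfers to every finite exponent,
  once a threshold \<open>\<eta>\<close> has made the part with small values negligible.\<close>

lemma S_bounded_increment:
  assumes p: "1 \<le> p" and t: "0 \<le> t" and b: "inLp E l \<infinity> b" and \<epsilon>: "0 < \<epsilon>"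
  shows "\<forall>\<^sub>F s in at t within {0..}. (\<Sum>k<E. \<integral>x. norm (S s b k x - S t b k x) powr p \<partial>edge k) < \<epsilon>"
proof -
  define K where "K = 1 + C * kern_mass"
  have K: "0 < K" using C kern_mass_pos by (simp add: K_def add_pos_pos)
  define B where "B = 2 * K * Lpnorm E l \<infinity> b + 1"
  have B: "0 < B" using K Linf_norm_nonneg[OF b] by (simp add: B_def add_nonneg_pos)
  have L1: "L1 b" by (rule inLp_imp_L1[OF _ b]) simp
  have L: "L2 b"
    by (rule AE_bounded_imp_L2[where B = "Lpnorm E l \<infinity> b"]) (use L1 Linf_AE[OF b] in \<open>auto simp: L1_def\<close>)
  have m: "(\<lambda>x. S s b k x - S t b k x) \<in> borel_measurable (edge k)" if "0 \<le> s" "k < E" for s k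
    using S_measurable[OF that(1) L1 that(2)] S_measurable[OF t L1 that(2)] by measurable
  have bd: "AE x in edge k. norm (S s b k x - S t b k x) \<le> B" if "0 \<le> s" "k < E" for s k
    using Linf_AE[OF S_Linf(1)[OF that(1) b] that(2)] Linf_AE[OF S_Linf(1)[OF t b] that(2)]
  proof eventually_elim
    case (elim x)
    have "norm (S s b k x - S t b k x) \<le> norm (S s b k x) + norm (S t b k x)" by (rule norm_triangle_ineq4)
    also have "\<dots> \<le> K * Lpnorm E l \<infinity> b + K * Lpnorm E l \<infinity> b"
      using elim S_Linf(2)[OF that(1) b] S_Linf(2)[OF t b] unfolding K_def by (intro add_mono) auto
    finally show ?case by (simp add: B_def)
  qed
  have "((\<lambda>\<eta>. total_length * \<eta> powr p) \<longlongrightarrow> total_length * 0) (at_right 0)"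
    using p by (intro tendsto_mult_left tendsto_zero_powrI[where b = p] tendsto_const tendsto_ident_at)
      (auto simp: eventually_at_filter)
  then have "\<forall>\<^sub>F \<eta> in at_right 0. total_length * \<eta> powr p < \<epsilon> / 2"
    using \<epsilon> by (intro order_tendstoD(2)) auto
  then have "\<forall>\<^sub>F \<eta> in at_right 0. 0 < \<eta> \<and> total_length * \<eta> powr p < \<epsilon> / 2"
    using eventually_at_right_less[of "0::real"] by eventually_elim simp
  then obtain \<eta> where \<eta>: "0 < \<eta>" "total_length * \<eta> powr p < \<epsilon> / 2"
    using eventually_happens'[OF trivial_limit_at_right_real] by blast
  have "((\<lambda>s. (B powr p / \<eta>\<^sup>2) * (n2 (\<lambda>k x. T s b k x - T t b k x))\<^sup>2) \<longlongrightarrow> (B powr p / \<eta>\<^sup>2) * 0\<^sup>2) (at t within {0..})"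
    by (intro tendsto_intros T_continuous L t)
  then have "\<forall>\<^sub>F s in at t within {0..}. (B powr p / \<eta>\<^sup>2) * (n2 (\<lambda>k x. T s b k x - T t b k x))\<^sup>2 < \<epsilon> / 2"
    using \<epsilon> by (intro order_tendstoD(2)) auto
  moreover have "\<forall>\<^sub>F s in at t within {0..}. 0 \<le> s" by (simp add: eventually_at_filter)
  ultimately show ?thesis
  proof eventually_elim
    case (elim s)
    have "(\<lambda>k x. S s b k x - S t b k x) \<simeq> (\<lambda>k x. T s b k x - T t b k x)"
      by (rule aeq_lift2[where F = "\<lambda>k x. (-)"]) (use elim t L in \<open>auto intro: S_L2\<close>)
    then have eq: "n2 (\<lambda>k x. S s b k x - S t b k x) = n2 (\<lambda>k x. T s b k x - T t b k x)"
    proof (rule n2_cong)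
      show "L2 (\<lambda>k x. S s b k x - S t b k x)" by (rule AE_bounded_imp_L2[OF m bd]) (use elim in auto)
    qed (use elim t L in \<open>auto intro!: L2_diff T_L2\<close>)
    have le: "(\<Sum>k<E. \<integral>x. norm (S s b k x - S t b k x) powr p \<partial>edge k) \<le>
       total_length * \<eta> powr p + (B powr p / \<eta>\<^sup>2) * (n2 (\<lambda>k x. S s b k x - S t b k x))\<^sup>2"
      by (rule bounded_L2_small_imp_Lp_small[OF p m bd B \<eta>(1)]) (use elim in auto)
    show ?case using le[unfolded eq] elim(1) \<eta>(2) by linarith
  qed
qed

text \<open>\<open>u\<close> is a bounded truncation plus a part \<open>w\<close> that is small in
  L^p. The bound of \<open>S\<close> is uniform in time, so \<open>w\<close> stays small and only
  the bounded part has to be continuous.\<close>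

lemma S_continuous:
  assumes p: "1 \<le> p" and t: "0 \<le> t" and u: "inLp E l (ereal p) u"
  shows "((\<lambda>s. Lpnorm E l (ereal p) (gdiff (S s u) (S t u))) \<longlongrightarrow> 0) (at t within {0..})"
proof -
  define D where "D s = (\<Sum>k<E. \<integral>x. norm (S s u k x - S t u k x) powr p \<partial>edge k)" for s
  define K where "K = 1 + C * kern_mass"
  have L1: "L1 u" by (rule inLp_imp_L1[OF _ u]) (use p in simp)
  have D0: "0 \<le> D s" for s unfolding D_def by (intro sum_nonneg integral_nonneg_AE) auto
  have small: "\<forall>\<^sub>F s in at t within {0..}. D s < \<epsilon>" if \<epsilon>: "0 < \<epsilon>" for \<epsilon>
  proof -
    \<comment> \<open>Bounds the contribution of \<open>w\<close>: \<open>2 powr p\<close> for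
      splitting off the truncation, then \<open>2 powr p * K powr p\<close> for each of
      \<open>S s w\<close> and \<open>S t w\<close>.\<close>
    define c where "c = 2 powr p * (2 powr p * (K powr p) + 2 powr p * (K powr p))"
    have "(\<lambda>n. c * (\<Sum>k<E. \<integral>x. norm (u k x - trunc n u k x) powr p \<partial>edge k)) \<longlonglongrightarrow> c * 0"
      by (intro tendsto_mult_left trunc_tendsto p u)
    then have "\<forall>\<^sub>F n in sequentially. c * (\<Sum>k<E. \<integral>x. norm (u k x - trunc n u k x) powr p \<partial>edge k) < \<epsilon> / 2"
      using \<epsilon> by (intro order_tendstoD(2)) auto
    then obtain n where n: "c * (\<Sum>k<E. \<integral>x. norm (u k x - trunc n u k x) powr p \<partial>edge k) < \<epsilon> / 2"
      using eventually_happens'[OF sequentially_bot] by blast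
    define b where "b = trunc n u"
    define w where "w = (\<lambda>k x. u k x - b k x)"
    have bm: "b k \<in> borel_measurable (edge k)" if "k < E" for k
      using L1 that unfolding b_def by (intro trunc_measurable) (simp add: L1_def)
    have bb: "AE x in edge k. norm (b k x) \<le> real n" for k by (simp add: b_def trunc_def)
    have binf: "inLp E l \<infinity> b" using bm bb by (auto simp: inLp_def)
    have bp: "inLp E l (ereal p) b" by (rule bounded_imp_inLp[OF p bm bb])
    have wp: "inLp E l (ereal p) w" unfolding w_def by (rule inLp_diff[OF p u bp])
    have wn: "c * (\<Sum>k<E. \<integral>x. norm (w k x) powr p \<partial>edge k) < \<epsilon> / 2" using n by (simp add: w_def b_def)
    have L1': "L1 b" "L1 w" using inLp_imp_L1[OF _ bp] inLp_imp_L1[OF _ wp] p by auto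
    have "\<forall>\<^sub>F s in at t within {0..}. (\<Sum>k<E. \<integral>x. norm (S s b k x - S t b k x) powr p \<partial>edge k) < \<epsilon> / 2 / 2 powr p"
      by (rule S_bounded_increment[OF p t binf]) (use \<epsilon> in simp)
    moreover have "\<forall>\<^sub>F s in at t within {0..}. 0 \<le> s" by (simp add: eventually_at_filter)
    ultimately show ?thesis
    proof eventually_elim
      case (elim s)
      then have s: "0 \<le> s" by simp
      have dec: "S q u \<simeq> (\<lambda>k x. S q w k x + S q b k x)" if "0 \<le> q" for q
        using S_add[OF that L1'(2,1)] by (simp add: w_def)
      have "D s = (\<Sum>k<E. \<integral>x. norm ((S s w k x - S t w k x) + (S s b k x - S t b k x)) powr p \<partial>edge k)"
        unfolding D_def
      proof (intro sum.cong refl integral_cong_AE)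
        fix k assume "k \<in> {..<E}"
        then have k: "k < E" by simp
        note ms = S_measurable[OF s L1 k] S_measurable[OF t L1 k] S_measurable[OF s L1'(1) k] S_measurable[OF t L1'(1) k]
          S_measurable[OF s L1'(2) k] S_measurable[OF t L1'(2) k]
        show "(\<lambda>x. norm (S s u k x - S t u k x) powr p) \<in> borel_measurable (edge k)"
          "(\<lambda>x. norm ((S s w k x - S t w k x) + (S s b k x - S t b k x)) powr p) \<in> borel_measurable (edge k)"
          using ms by measurable
        have "AE x in edge k. S s u k x = S s w k x + S s b k x" "AE x in edge k. S t u k x = S t w k x + S t b k x"
          using dec[OF s] dec[OF t] k by (auto simp: aeq_def)
        then show "AE x in edge k. norm (S s u k x - S t u k x) powr p
           = norm ((S s w k x - S t w k x) + (S s b k x - S t b k x)) powr p"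
          by eventually_elim (simp add: algebra_simps)
      qed
      also have "\<dots> \<le> 2 powr p * (\<Sum>k<E. \<integral>x. norm (S s w k x - S t w k x) powr p \<partial>edge k)
         + 2 powr p * (\<Sum>k<E. \<integral>x. norm (S s b k x - S t b k x) powr p \<partial>edge k)"
        by (rule inLp_add(2)[OF p]) (intro inLp_diff p S_Lp s t wp bp)+
      also have "(\<Sum>k<E. \<integral>x. norm (S s w k x - S t w k x) powr p \<partial>edge k)
         \<le> 2 powr p * (\<Sum>k<E. \<integral>x. norm (S s w k x) powr p \<partial>edge k) + 2 powr p * (\<Sum>k<E. \<integral>x. norm (S t w k x) powr p \<partial>edge k)"
        using inLp_add(2)[OF p S_Lp(1)[OF p s wp] inLp_minus[OF S_Lp(1)[OF p t wp]]] by simp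
      also have "\<dots> \<le> 2 powr p * (K powr p * (\<Sum>k<E. \<integral>x. norm (w k x) powr p \<partial>edge k))
         + 2 powr p * (K powr p * (\<Sum>k<E. \<integral>x. norm (w k x) powr p \<partial>edge k))"
        unfolding K_def by (intro add_mono mult_left_mono S_Lp_powr p s t wp) auto
      finally have "D s \<le> c * (\<Sum>k<E. \<integral>x. norm (w k x) powr p \<partial>edge k)
         + 2 powr p * (\<Sum>k<E. \<integral>x. norm (S s b k x - S t b k x) powr p \<partial>edge k)"
        by (simp add: c_def algebra_simps)
      moreover have "2 powr p * (\<Sum>k<E. \<integral>x. norm (S s b k x - S t b k x) powr p \<partial>edge k) < \<epsilon> / 2"
        using elim by (simp add: pos_less_divide_eq mult.commute)
      ultimately show ?case using wn by linarith
    qed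
  qed
  have "(D \<longlongrightarrow> 0) (at t within {0..})"
  proof (rule order_tendstoI)
    fix a :: real assume "a < 0"
    then show "\<forall>\<^sub>F s in at t within {0..}. a < D s" using D0 by (intro always_eventually) (meson less_le_trans)
  qed (rule small)
  then have "((\<lambda>s. D s powr (1 / p)) \<longlongrightarrow> 0) (at t within {0..})"
    using p D0 by (intro tendsto_zero_powrI[where b = "1 / p"] tendsto_const always_eventually) auto
  then show ?thesis by (simp add: Lpnorm_real gdiff_def D_def)
qed

lemma Lp_semigroup_S:
  assumes p: "1 \<le> p"
  shows "Lp_semigroup E l p S"
proof -
  note L1 = inLp_imp_L1[OF p]
  have bnd: "inLp E l p (S t u) \<and> Lpnorm E l p (S t u) \<le> (1 + C * kern_mass) * Lpnorm E l p u"
    if "0 \<le> t" "inLp E l p u" for t u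
    using p S_Lp[of _ t u] S_Linf[of t u] that by (cases p) auto
  show ?thesis
    unfolding Lp_semigroup_def
  proof (intro conjI allI impI)
    fix t u assume t: "0 \<le> (t::real)" and u: "inLp E l p u" and np: "p \<noteq> \<infinity>"
    obtain q where q: "p = ereal q" using p np by (cases p) auto
    show "((\<lambda>s. Lpnorm E l p (gdiff (S s u) (S t u))) \<longlongrightarrow> 0) (at t within {0..})"
      using S_continuous[of q t u] p t u by (simp add: q)
  next
    fix t :: real assume "0 \<le> t"
    then show "\<exists>M. \<forall>u. inLp E l p u \<longrightarrow> Lpnorm E l p (S t u) \<le> M * Lpnorm E l p u" using bnd by blast
  qed (use bnd L1 in \<open>auto simp: S_0 intro: S_add S_scale S_plus\<close>)
qed

end

theorem theorem5p2:
  fixes V :: "'v set" and E :: nat and src tgt :: "nat \<Rightarrow> 'v" and l :: "nat \<Rightarrow> real"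
    and Y :: "(nat \<Rightarrow> complex) set" and R :: "(nat \<Rightarrow> complex) \<Rightarrow> (nat \<Rightarrow> complex)"
    and T :: "real \<Rightarrow> gfun \<Rightarrow> gfun"
  assumes graph: "simple_connected_graph V E src tgt"
    and lengths: "\<forall>k<E. l k > 0"
    and Y: "csubspace E Y"
    and R_lin: "clinear_on Y R"
    and R_diss: "dissipative E Y R"
    and T: "generated_by_minus_A E l Y R T"
  shows "\<exists>S :: ereal \<Rightarrow> real \<Rightarrow> gfun \<Rightarrow> gfun.
     (\<forall>p\<ge>1. Lp_semigroup E l p (S p)) \<and>
     (\<forall>t\<ge>0. \<forall>u. inLp E l 2 u \<longrightarrow> aeq E l (S 2 t u) (T t u)) \<and>
     (\<forall>p\<ge>1. \<forall>q\<ge>1. \<forall>t\<ge>0. \<forall>u. inLp E l p u \<longrightarrow> inLp E l q u \<longrightarrow> aeq E l (S p t u) (S q t u)) \<and>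
     (\<exists>c \<epsilon>. c > 0 \<and> \<epsilon> > 0 \<and>
        (\<forall>p::real. 1 \<le> p \<longrightarrow> (\<forall>t>0. \<forall>u. inLp E l (ereal p) u \<longrightarrow>
            Lpnorm E l (ereal p) (S (ereal p) t u)
              \<le> c * t powr (- \<bar>2 - p\<bar> / (4 * p)) * exp (\<epsilon> * t * \<bar>2 - p\<bar> / p) * Lpnorm E l (ereal p) u)) \<and>
        (\<forall>t>0. \<forall>u. inLp E l \<infinity> u \<longrightarrow>
            Lpnorm E l \<infinity> (S \<infinity> t u) \<le> c * t powr (- 1 / 4) * exp (\<epsilon> * t) * Lpnorm E l \<infinity> u))"
proof -
  interpret network_semigroup E l Y R T
    by unfold_locales (use lengths Y R_lin R_diss T in auto)
  obtain C where C: "0 < C" and "\<And>t. 0 < t \<Longrightarrow> \<exists>r>0. \<forall>f k. L2 f \<longrightarrow> k < E \<longrightarrow>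
    (AE x in edge k. norm (T t f k x) \<le> C * potential r f k x)" using kernel_bound by blast
  then obtain scale where scale: "\<And>t. 0 < t \<Longrightarrow> 0 < scale t \<and> (\<forall>f k. L2 f \<longrightarrow> k < E \<longrightarrow>
    (AE x in edge k. norm (T t f k x) \<le> C * potential (scale t) f k x))" by metis
  interpret kernel_semigroup E l Y R T C scale
    by unfold_locales (use C scale in auto)
  define c where "c = 1 + C * kern_mass"
  have c: "0 < c" using C kern_mass_pos by (simp add: c_def add_pos_pos)
  show ?thesis
  \<comment> \<open>The same \<open>S\<close> is taken at every exponent; consistency becomes
    reflexivity of \<open>\<simeq>\<close>.\<close>
  proof (intro exI[of _ "\<lambda>p. S"] conjI allI impI)
    fix p :: ereal assume "1 \<le> p"
    then show "Lp_semigroup E l p S" by (rule Lp_semigroup_S)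
  next
    fix t :: real and u assume "0 \<le> t" "inLp E l 2 u"
    then show "S t u \<simeq> T t u" unfolding L2_def[symmetric] by (rule S_L2)
  next
    show "\<exists>c \<epsilon>. c > 0 \<and> \<epsilon> > 0 \<and>
        (\<forall>p::real. 1 \<le> p \<longrightarrow> (\<forall>t>0. \<forall>u. inLp E l (ereal p) u \<longrightarrow>
            Lpnorm E l (ereal p) (S t u)
              \<le> c * t powr (- \<bar>2 - p\<bar> / (4 * p)) * exp (\<epsilon> * t * \<bar>2 - p\<bar> / p) * Lpnorm E l (ereal p) u)) \<and>
        (\<forall>t>0. \<forall>u. inLp E l \<infinity> u \<longrightarrow>
            Lpnorm E l \<infinity> (S t u) \<le> c * t powr (- 1 / 4) * exp (\<epsilon> * t) * Lpnorm E l \<infinity> u)"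
    \<comment> \<open>The exponents of the exponential and of the power of t differ by the factor 4
      of \<open>one_le_powr_exp\<close>, so \<epsilon> = 1 serves all p, including p = \<infinity>
      with a = 1 / 4.\<close>
    proof (rule exI[of _ c], rule exI[of _ 1], intro conjI allI impI c zero_less_one)
      fix p t :: real and u assume p: "1 \<le> p" and t: "0 < t" and u: "inLp E l (ereal p) u"
      have eq: "4 * (\<bar>2 - p\<bar> / (4 * p)) * t = 1 * t * \<bar>2 - p\<bar> / p" by simp
      have "1 \<le> t powr (- (\<bar>2 - p\<bar> / (4 * p))) * exp (4 * (\<bar>2 - p\<bar> / (4 * p)) * t)"
        by (rule one_le_powr_exp[OF t]) (use p in simp)
      then have "c * 1 \<le> c * (t powr (- \<bar>2 - p\<bar> / (4 * p)) * exp (1 * t * \<bar>2 - p\<bar> / p))"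
        unfolding eq using c by (intro mult_left_mono) auto
      then have "c * Lpnorm E l (ereal p) u \<le> c * t powr (- \<bar>2 - p\<bar> / (4 * p)) * exp (1 * t * \<bar>2 - p\<bar> / p) * Lpnorm E l (ereal p) u"
        by (intro mult_right_mono Lpnorm_nonneg) (simp add: mult.assoc)
      then show "Lpnorm E l (ereal p) (S t u) \<le> c * t powr (- \<bar>2 - p\<bar> / (4 * p)) * exp (1 * t * \<bar>2 - p\<bar> / p) * Lpnorm E l (ereal p) u"
        using S_Lp(2)[OF p less_imp_le[OF t] u] unfolding c_def by linarith
    next
      fix t :: real and u assume t: "0 < t" and u: "inLp E l \<infinity> u"
      have "1 \<le> t powr (- 1 / 4) * exp (1 * t)" using one_le_powr_exp[OF t, of "1 / 4"] by simp
      then have "c * 1 \<le> c * (t powr (- 1 / 4) * exp (1 * t))" using c by (intro mult_left_mono) auto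
      then have "c * Lpnorm E l \<infinity> u \<le> c * t powr (- 1 / 4) * exp (1 * t) * Lpnorm E l \<infinity> u"
        by (intro mult_right_mono Linf_norm_nonneg u) (simp add: mult.assoc)
      then show "Lpnorm E l \<infinity> (S t u) \<le> c * t powr (- 1 / 4) * exp (1 * t) * Lpnorm E l \<infinity> u"
        using S_Linf(2)[OF less_imp_le[OF t] u] unfolding c_def by linarith
    qed
  qed simp
qed

end
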